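(* Suppose that $V\in P_0(\mathcal T)$ is piecewise constant. For every $k\in\mathbb{N}$, the $k$-th exact eigenvalue $\lambda=\lambda_k$ of the Schrödinger eigenvalue problem and the $k$-th modified (enriched) Crouzeix–Raviart eigenvalue $\lambda_{\mathrm{mCR}}=\lambda_{\mathrm{mCR}(k)}$ satisfy $$\mathrm{GLB}_{\mathrm{mCR}}:=\frac{\lambda_{\mathrm{mCR}}}{1+\dfrac{\varepsilon'\varepsilon''\lambda_{\mathrm{mCR}}^2}{1+\varepsilon''\lambda_{\mathrm{mCR}}}}\le\lambda .$$
   Context: Let $\Omega\subset\mathbb{R}^n$, $n\ge2$, be a polyhedral bounded Lipschitz domain and $V\in L^\infty(\Omega)$ with $\operatorname{ess\,inf}_\Omega V=0$. Write $(v,w)_V:=\int_\Omega V v w\,dx$. The exact eigenvalues $0<\lambda_1\le\lambda_2\le\dots$ (counted with multiplicity) are those of: find $(\lambda,u)\in\mathbb{R}_+\times H_0^1(\Omega)$, $u\ne0$, with $\int_\Omega\nabla u\cdot\nabla v\,dx+(u,v)_V=\lambda\int_\Omega uv\,dx$ for all $v\in H^1_0(\Omega)$. $\mathcal{T}$ is a regular (face-to-face) triangulation of $\Omega$ into non-degenerate compact $n$-simplices, $h_T:=\operatorname{diam}(T)$, $h_{\mathcal T}|_T:=h_T$, $\mathcal F$ is the set of all faces, $\mathcal F(\Omega)$ the set of interior faces, $\mathcal V(T)$ the set of vertices of $T$, $\operatorname{mid}(\cdot)$ denotes the barycenter. The jump $[v]_F$ of a piecewise continuous function is the difference of the traces from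 the two adjacent simplices if $F$ is interior and the trace $v|_F$ if $F\subset\partial\Omega$. $P_m(\mathcal T)$ is the space of piecewise polynomials of total degree at most $m$ and $\Pi_0$ the $L^2$ projection onto $P_0(\mathcal T)$. Set $\mathrm{CR}_0^1(\mathcal T):=\{v\in P_1(\mathcal T): [v]_F(\operatorname{mid}(F))=0\ \forall F\in\mathcal F\}$. For $T\in\mathcal T$ the bubble is $$\flat_T(x):=\frac{n+2}{2}-\frac{n(n+1)^2(n+2)}{\sum_{P\ne Q\in\mathcal V(T)}|P-Q|^2}\,|x-\operatorname{mid}(T)|^2\quad(x\in T),$$ extended by zero outside $T$ (sum over ordered pairs, so that $\int_F\flat_T\,ds=0$ for each face $F$ of $T$ and $|T|^{-1}\int_T\flat_T\,dx=1$). Let $B(\mathcal T)$ be the span of all $\flat_T$ and $\mathrm{eCR}_0^1(\mathcal T):=\mathrm{CR}_0^1(\mathcal T)\oplus B(\mathcal T)$. Let $a_{\mathrm{pw}}(v,w):=\sum_{T\in\mathcal T}\int_T\nabla v\cdot\nabla w\,dx$. The mCR eigenvalues $0<\lambda_{\mathrm{mCR}(1)}\le\dots\le\lambda_{\mathrm{mCR}(N)}$, $N=\dim\mathrm{eCR}_0^1(\mathcal T)$, are those of: find $(\lambda_h,u_h)\in\mathbb{R}_+\times\mathrm{eCR}_0^1(\mathcal T)$, $u_h\ne0$, with $a_{\mathrm{pw}}(u_h,v_h)+(\Pi_0u_h,\Pi_0v_h)_V=\lambda_h\int_\Omega u_hv_h\,dx$ for all $v_h\in\mathrm{eCR}_0^1(\mathcal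 T)$. Convention: $\lambda_{\mathrm{mCR}(k)}=+\infty$ for $k>N$, and the bound is then read as its limit for $\lambda_{\mathrm{mCR}}\to\infty$. Interpolation: for $F\in\mathcal F(\Omega)$ let $\psi_F\in\mathrm{CR}^1_0(\mathcal T)$ be equal to $1$ at $\operatorname{mid}(F)$ and $0$ at the midpoints of all other faces, $I_{\mathrm{CR}}v:=\sum_{F\in\mathcal F(\Omega)}\big(|F|^{-1}\int_Fv\,ds\big)\psi_F$, and $I_{\mathrm{eCR}}v:=I_{\mathrm{CR}}v+\sum_{T\in\mathcal T}\big(|T|^{-1}\int_T(v-I_{\mathrm{CR}}v)\,dx\big)\flat_T$. The constant $\kappa_{\mathrm{eCR}}>0$ is such that $\|v-I_{\mathrm{eCR}}v\|_{L^2(T)}\le\kappa_{\mathrm{eCR}}h_T\|\nabla(v-I_{\mathrm{eCR}}v)\|_{L^2(T)}$ for all $v\in H_0^1(\Omega)$, $T\in\mathcal T$. $C_P>0$ is a Poincaré constant, i.e. $\|f-|T|^{-1}\int_Tf\,dx\|_{L^2(T)}\le C_Ph_T\|\nabla f\|_{L^2(T)}$ for all $f\in H^1(T)$, $T\in\mathcal T$ (e.g. $C_P=1/\pi$). Set $\varepsilon':=\|C_P^2h_{\mathcal T}^2\|_{L^\infty(\Omega)}$ and $\varepsilon'':=\|\kappa_{\mathrm{eCR}}^2h_{\mathcal T}^2\|_{L^\infty(\Omega)}$. *)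

theory Defs
  imports "HOL-Analysis.Analysis" "HOL-Probability.Essential_Supremum"
begin

section \<open>Domains and triangulations\<close>

text \<open>A bounded domain whose boundary is, near each of its points, the graph of a Lipschitz
  function in a rotated coordinate system, with the domain on one side: \<open>(y - x) \<bullet> e\<close> is the
  height of \<open>y\<close>, and \<open>g\<close> is evaluated at the component of \<open>y - x\<close> orthogonal to \<open>e\<close>.\<close>

definition bounded_Lipschitz_domain :: "'a::euclidean_space set \<Rightarrow> bool" where
  "bounded_Lipschitz_domain \<Omega> \<longleftrightarrow>
     open \<Omega> \<and> connected \<Omega> \<and> bounded \<Omega> \<and> \<Omega> \<noteq> {} \<and>
     (\<forall>x \<in> frontier \<Omega>. \<exists>e r L g. norm e = 1 \<and> r > 0 \<and> L-lipschitz_on UNIV g \<and>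
        \<Omega> \<inter> ball x r =
          {y \<in> ball x r. g ((y - x) - ((y - x) \<bullet> e) *\<^sub>R e) < (y - x) \<bullet> e})"

definition polyhedral_Lipschitz_domain :: "'a::euclidean_space set \<Rightarrow> bool" where
  "polyhedral_Lipschitz_domain \<Omega> \<longleftrightarrow>
     bounded_Lipschitz_domain \<Omega> \<and>
     (\<exists>\<P>. finite \<P> \<and> (\<forall>P \<in> \<P>. polytope P) \<and> closure \<Omega> = \<Union>\<P>)"

definition regular_triangulation :: "'a::euclidean_space set \<Rightarrow> 'a set set \<Rightarrow> bool" where
  "regular_triangulation \<Omega> \<T> \<longleftrightarrow>
     triangulation \<T> \<and> (\<forall>T \<in> \<T>. int DIM('a) simplex T) \<and> \<Union>\<T> = closure \<Omega>"

definition faces :: "'a::euclidean_space set set \<Rightarrow> 'a set set" where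
  "faces \<T> = {F. \<exists>T \<in> \<T>. F facet_of T}"

definition interior_faces :: "'a::euclidean_space set \<Rightarrow> 'a set set \<Rightarrow> 'a set set" where
  "interior_faces \<Omega> \<T> = {F \<in> faces \<T>. \<not> F \<subseteq> frontier \<Omega>}"

definition vertices :: "'a::euclidean_space set \<Rightarrow> 'a set" where
  "vertices S = {P. P extreme_point_of S}"

definition barycenter :: "'a::euclidean_space set \<Rightarrow> 'a" where
  "barycenter S = (\<Sum>P \<in> vertices S. P) /\<^sub>R real (card (vertices S))"

definition mesh_size :: "'a::euclidean_space set set \<Rightarrow> 'a \<Rightarrow> real" where
  "mesh_size \<T> x = (\<Sum>T \<in> \<T>. indicator (interior T) x * diameter T)"

section \<open>Lebesgue and Sobolev spaces\<close>

text \<open>Elements of function spaces are represented by functions on the whole space;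
  only their restriction to the relevant set, up to null sets, matters.\<close>

definition L2 :: "'a::euclidean_space set \<Rightarrow> ('a \<Rightarrow> 'b::euclidean_space) \<Rightarrow> bool" where
  "L2 U f \<longleftrightarrow> f \<in> borel_measurable (lebesgue_on U) \<and>
     integrable (lebesgue_on U) (\<lambda>x. (norm (f x))\<^sup>2)"

definition L2_norm :: "'a::euclidean_space set \<Rightarrow> ('a \<Rightarrow> 'b::euclidean_space) \<Rightarrow> real" where
  "L2_norm U f = sqrt (LINT x|lebesgue_on U. (norm (f x))\<^sup>2)"

definition mean :: "'a::euclidean_space set \<Rightarrow> ('a \<Rightarrow> real) \<Rightarrow> real" where
  "mean T f = (LINT x|lebesgue_on T. f x) / measure lebesgue T"

definition L_infinity :: "'a::euclidean_space set \<Rightarrow> ('a \<Rightarrow> real) \<Rightarrow> bool" where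
  "L_infinity U f \<longleftrightarrow> f \<in> borel_measurable (lebesgue_on U) \<and>
     esssup (lebesgue_on U) (\<lambda>x. ereal \<bar>f x\<bar>) < \<infinity>"

definition L_infinity_norm :: "'a::euclidean_space set \<Rightarrow> ('a \<Rightarrow> real) \<Rightarrow> real" where
  "L_infinity_norm U f = real_of_ereal (esssup (lebesgue_on U) (\<lambda>x. ereal \<bar>f x\<bar>))"

definition essinf :: "'a::euclidean_space set \<Rightarrow> ('a \<Rightarrow> real) \<Rightarrow> ereal" where
  "essinf U f = - esssup (lebesgue_on U) (\<lambda>x. ereal (- f x))"

primrec C_k :: "nat \<Rightarrow> ('a::euclidean_space \<Rightarrow> real) \<Rightarrow> bool" where
  "C_k 0 f \<longleftrightarrow> continuous_on UNIV f"
| "C_k (Suc k) f \<longleftrightarrow> (\<forall>x. f differentiable (at x)) \<and>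
     (\<forall>b \<in> Basis. C_k k (\<lambda>x. frechet_derivative f (at x) b))"

definition test_function :: "'a::euclidean_space set \<Rightarrow> ('a \<Rightarrow> real) \<Rightarrow> bool" where
  "test_function U \<phi> \<longleftrightarrow> (\<forall>k. C_k k \<phi>) \<and>
     compact (closure {x. \<phi> x \<noteq> 0}) \<and> closure {x. \<phi> x \<noteq> 0} \<subseteq> U"

definition is_weak_gradient ::
  "'a::euclidean_space set \<Rightarrow> ('a \<Rightarrow> real) \<Rightarrow> ('a \<Rightarrow> 'a) \<Rightarrow> bool" where
  "is_weak_gradient U u G \<longleftrightarrow> L2 U u \<and> L2 U G \<and>
     (\<forall>\<phi>. test_function U \<phi> \<longrightarrow> (\<forall>b \<in> Basis.
        (LINT x|lebesgue_on U. u x * frechet_derivative \<phi> (at x) b) =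
        - (LINT x|lebesgue_on U. (G x \<bullet> b) * \<phi> x)))"

definition H1 :: "'a::euclidean_space set \<Rightarrow> ('a \<Rightarrow> real) set" where
  "H1 U = {u. \<exists>G. is_weak_gradient U u G}"

text \<open>The weak gradient of \<open>u \<in> H1 U\<close> is unique almost everywhere in the open set \<open>U\<close>.\<close>

definition weak_grad :: "'a::euclidean_space set \<Rightarrow> ('a \<Rightarrow> real) \<Rightarrow> 'a \<Rightarrow> 'a" where
  "weak_grad U u = (SOME G. is_weak_gradient U u G)"

definition H1_norm :: "'a::euclidean_space set \<Rightarrow> ('a \<Rightarrow> real) \<Rightarrow> real" where
  "H1_norm U u = sqrt ((L2_norm U u)\<^sup>2 + (L2_norm U (weak_grad U u))\<^sup>2)"

definition test_approximation ::
  "'a::euclidean_space set \<Rightarrow> (nat \<Rightarrow> 'a \<Rightarrow> real) \<Rightarrow> ('a \<Rightarrow> real) \<Rightarrow> bool" where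
  "test_approximation U \<phi> u \<longleftrightarrow> (\<forall>j. test_function U (\<phi> j)) \<and>
     (\<lambda>j. H1_norm U (\<lambda>x. \<phi> j x - u x)) \<longlonglongrightarrow> 0"

definition H10 :: "'a::euclidean_space set \<Rightarrow> ('a \<Rightarrow> real) set" where
  "H10 U = {u \<in> H1 U. \<exists>\<phi>. test_approximation U \<phi> u}"

section \<open>Surface integrals and traces on faces\<close>

text \<open>The \<open>(n - 1)\<close>-dimensional surface measure on a face \<open>F\<close> that lies in a hyperplane. The prism
  over \<open>F\<close> of height \<open>1\<close>, centred at the hyperplane, is the product of \<open>F\<close> and the interval
  \<open>[-1/2, 1/2]\<close> in normal direction. By Fubini, the image of Lebesgue measure on the prism under
  the orthogonal projection onto the hyperplane is the surface measure on \<open>F\<close>.\<close>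

definition prism :: "'a::euclidean_space set \<Rightarrow> 'a set" where
  "prism F = {x. closest_point (affine hull F) x \<in> F \<and>
                 dist x (closest_point (affine hull F) x) \<le> 1 / 2}"

definition surface_measure :: "'a::euclidean_space set \<Rightarrow> 'a measure" where
  "surface_measure F = distr (lebesgue_on (prism F)) borel (closest_point (affine hull F))"

text \<open>The trace on \<open>F\<close> is the continuous extension to \<open>H10\<close> of the restriction of test functions
  to \<open>F\<close>, with values in \<open>L2\<close> of the surface measure.\<close>

definition is_trace ::
  "'a::euclidean_space set \<Rightarrow> 'a set \<Rightarrow> ('a \<Rightarrow> real) \<Rightarrow> ('a \<Rightarrow> real) \<Rightarrow> bool" where
  "is_trace \<Omega> F v g \<longleftrightarrow> g \<in> borel_measurable borel \<and>
     integrable (surface_measure F) (\<lambda>x. (g x)\<^sup>2) \<and>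
     (\<exists>\<phi>. test_approximation \<Omega> \<phi> v \<and>
        (\<lambda>j. LINT x|surface_measure F. (\<phi> j x - g x)\<^sup>2) \<longlonglongrightarrow> 0)"

definition face_mean :: "'a::euclidean_space set \<Rightarrow> 'a set \<Rightarrow> ('a \<Rightarrow> real) \<Rightarrow> real" where
  "face_mean \<Omega> F v =
     (LINT x|surface_measure F. (SOME g. is_trace \<Omega> F v g) x) / measure (surface_measure F) UNIV"

section \<open>Piecewise polynomials and the enriched Crouzeix--Raviart space\<close>

text \<open>A piecewise polynomial is prescribed on the interiors of the simplices only, its values on
  the skeleton being irrelevant. Its trace from \<open>T\<close> is the limit from the interior of \<open>T\<close>.\<close>

definition P0 :: "'a::euclidean_space set set \<Rightarrow> ('a \<Rightarrow> real) set" where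
  "P0 \<T> = {v. \<forall>T \<in> \<T>. \<exists>c. \<forall>x \<in> interior T. v x = c}"

definition P1 :: "'a::euclidean_space set set \<Rightarrow> ('a \<Rightarrow> real) set" where
  "P1 \<T> = {v. \<forall>T \<in> \<T>. \<exists>a c. \<forall>x \<in> interior T. v x = a \<bullet> x + c}"

definition L2_projection_P0 ::
  "'a::euclidean_space set \<Rightarrow> 'a set set \<Rightarrow> ('a \<Rightarrow> real) \<Rightarrow> 'a \<Rightarrow> real" where
  "L2_projection_P0 \<Omega> \<T> v =
     (SOME p. p \<in> P0 \<T> \<and> (\<forall>q \<in> P0 \<T>. (LINT x|lebesgue_on \<Omega>. (v x - p x) * q x) = 0))"

definition trace_from :: "'a::euclidean_space set \<Rightarrow> ('a \<Rightarrow> real) \<Rightarrow> 'a \<Rightarrow> real" where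
  "trace_from T v x = Lim (at x within interior T) v"

text \<open>\<open>[v]\<^sub>F(x) = 0\<close>. The sign of the jump across an interior face is immaterial here.\<close>

definition zero_jump ::
  "'a::euclidean_space set \<Rightarrow> 'a set set \<Rightarrow> 'a set \<Rightarrow> ('a \<Rightarrow> real) \<Rightarrow> 'a \<Rightarrow> bool" where
  "zero_jump \<Omega> \<T> F v x \<longleftrightarrow>
     (if F \<in> interior_faces \<Omega> \<T>
      then \<forall>T \<in> \<T>. \<forall>T' \<in> \<T>. F facet_of T \<and> F facet_of T' \<longrightarrow>
             trace_from T v x - trace_from T' v x = 0
      else \<forall>T \<in> \<T>. F facet_of T \<longrightarrow> trace_from T v x = 0)"

definition CR :: "'a::euclidean_space set \<Rightarrow> 'a set set \<Rightarrow> ('a \<Rightarrow> real) set" where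
  "CR \<Omega> \<T> = {v \<in> P1 \<T>. \<forall>F \<in> faces \<T>. zero_jump \<Omega> \<T> F v (barycenter F)}"

definition bubble :: "'a::euclidean_space set \<Rightarrow> 'a \<Rightarrow> real" where
  "bubble T x =
     (if x \<in> T then
        (real DIM('a) + 2) / 2 -
        real DIM('a) * (real DIM('a) + 1)\<^sup>2 * (real DIM('a) + 2) /
          (\<Sum>(P, Q) \<in> {(P, Q). P \<in> vertices T \<and> Q \<in> vertices T \<and> P \<noteq> Q}. (norm (P - Q))\<^sup>2)
        * (norm (x - barycenter T))\<^sup>2
      else 0)"

definition eCR :: "'a::euclidean_space set \<Rightarrow> 'a set set \<Rightarrow> ('a \<Rightarrow> real) set" where
  "eCR \<Omega> \<T> = {(\<lambda>x. v x + (\<Sum>T \<in> \<T>. c T * bubble T x)) | v c. v \<in> CR \<Omega> \<T>}"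

definition CR_basis :: "'a::euclidean_space set \<Rightarrow> 'a set set \<Rightarrow> 'a set \<Rightarrow> 'a \<Rightarrow> real" where
  "CR_basis \<Omega> \<T> F =
     (SOME \<psi>. \<psi> \<in> CR \<Omega> \<T> \<and>
        (\<forall>T \<in> \<T>. \<forall>G. G facet_of T \<longrightarrow> trace_from T \<psi> (barycenter G) = (if G = F then 1 else 0)))"

definition I_CR ::
  "'a::euclidean_space set \<Rightarrow> 'a set set \<Rightarrow> ('a \<Rightarrow> real) \<Rightarrow> 'a \<Rightarrow> real" where
  "I_CR \<Omega> \<T> v x = (\<Sum>F \<in> interior_faces \<Omega> \<T>. face_mean \<Omega> F v * CR_basis \<Omega> \<T> F x)"

definition I_eCR ::
  "'a::euclidean_space set \<Rightarrow> 'a set set \<Rightarrow> ('a \<Rightarrow> real) \<Rightarrow> 'a \<Rightarrow> real" where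
  "I_eCR \<Omega> \<T> v x =
     I_CR \<Omega> \<T> v x + (\<Sum>T \<in> \<T>. mean T (\<lambda>y. v y - I_CR \<Omega> \<T> v y) * bubble T x)"

section \<open>The constants\<close>

definition Poincare_constant :: "'a::euclidean_space set set \<Rightarrow> real \<Rightarrow> bool" where
  "Poincare_constant \<T> C \<longleftrightarrow> C > 0 \<and>
     (\<forall>T \<in> \<T>. \<forall>f \<in> H1 (interior T).
        L2_norm (interior T) (\<lambda>x. f x - mean (interior T) f)
          \<le> C * diameter T * L2_norm (interior T) (weak_grad (interior T) f))"

definition eCR_interpolation_constant ::
  "'a::euclidean_space set \<Rightarrow> 'a set set \<Rightarrow> real \<Rightarrow> bool" where
  "eCR_interpolation_constant \<Omega> \<T> \<kappa> \<longleftrightarrow> \<kappa> > 0 \<and>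
     (\<forall>v \<in> H10 \<Omega>. \<forall>T \<in> \<T>.
        L2_norm (interior T) (\<lambda>x. v x - I_eCR \<Omega> \<T> v x)
          \<le> \<kappa> * diameter T *
              L2_norm (interior T) (weak_grad (interior T) (\<lambda>x. v x - I_eCR \<Omega> \<T> v x)))"

section \<open>The eigenvalue problems\<close>

definition L2_inner :: "'a::euclidean_space set \<Rightarrow> ('a \<Rightarrow> real) \<Rightarrow> ('a \<Rightarrow> real) \<Rightarrow> real" where
  "L2_inner \<Omega> v w = (LINT x|lebesgue_on \<Omega>. v x * w x)"

definition V_inner ::
  "'a::euclidean_space set \<Rightarrow> ('a \<Rightarrow> real) \<Rightarrow> ('a \<Rightarrow> real) \<Rightarrow> ('a \<Rightarrow> real) \<Rightarrow> real" where
  "V_inner \<Omega> V v w = (LINT x|lebesgue_on \<Omega>. V x * v x * w x)"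

definition grad_inner :: "'a::euclidean_space set \<Rightarrow> ('a \<Rightarrow> real) \<Rightarrow> ('a \<Rightarrow> real) \<Rightarrow> real" where
  "grad_inner U v w = (LINT x|lebesgue_on U. weak_grad U v x \<bullet> weak_grad U w x)"

definition a_pw :: "'a::euclidean_space set set \<Rightarrow> ('a \<Rightarrow> real) \<Rightarrow> ('a \<Rightarrow> real) \<Rightarrow> real" where
  "a_pw \<T> v w = (\<Sum>T \<in> \<T>. grad_inner (interior T) v w)"

definition exact_eigenspace ::
  "'a::euclidean_space set \<Rightarrow> ('a \<Rightarrow> real) \<Rightarrow> real \<Rightarrow> ('a \<Rightarrow> real) set" where
  "exact_eigenspace \<Omega> V \<mu> =
     {u \<in> H10 \<Omega>. \<forall>v \<in> H10 \<Omega>. grad_inner \<Omega> u v + V_inner \<Omega> V u v = \<mu> * L2_inner \<Omega> u v}"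

definition mCR_eigenspace ::
  "'a::euclidean_space set \<Rightarrow> 'a set set \<Rightarrow> ('a \<Rightarrow> real) \<Rightarrow> real \<Rightarrow> ('a \<Rightarrow> real) set" where
  "mCR_eigenspace \<Omega> \<T> V \<mu> =
     {u \<in> eCR \<Omega> \<T>. \<forall>v \<in> eCR \<Omega> \<T>.
        a_pw \<T> u v + V_inner \<Omega> V (L2_projection_P0 \<Omega> \<T> u) (L2_projection_P0 \<Omega> \<T> v)
          = \<mu> * L2_inner \<Omega> u v}"

text \<open>The dimension of a space of functions that are identified when they agree almost everywhere
  in \<open>\<Omega>\<close>.\<close>

definition ae_independent ::
  "'a::euclidean_space set \<Rightarrow> nat \<Rightarrow> (nat \<Rightarrow> 'a \<Rightarrow> real) \<Rightarrow> bool" where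
  "ae_independent \<Omega> d u \<longleftrightarrow>
     (\<forall>c :: nat \<Rightarrow> real. (AE x in lebesgue_on \<Omega>. (\<Sum>i<d. c i * u i x) = 0) \<longrightarrow> (\<forall>i<d. c i = 0))"

definition ae_dim :: "'a::euclidean_space set \<Rightarrow> ('a \<Rightarrow> real) set \<Rightarrow> enat" where
  "ae_dim \<Omega> E = Sup {enat d | d. \<exists>u. (\<forall>i<d. u i \<in> E) \<and> ae_independent \<Omega> d u}"

text \<open>The numbers \<open>l k\<close>, \<open>k \<in> J\<close>, are the positive eigenvalues in nondecreasing order: every
  \<open>\<mu> > 0\<close> occurs as often as the dimension of its eigenspace \<open>E \<mu>\<close>, hence not at all if it is
  not an eigenvalue.\<close>

definition eigenvalue_enumeration ::
  "'a::euclidean_space set \<Rightarrow> (real \<Rightarrow> ('a \<Rightarrow> real) set) \<Rightarrow> nat set \<Rightarrow> (nat \<Rightarrow> real) \<Rightarrow> bool" where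
  "eigenvalue_enumeration \<Omega> E J l \<longleftrightarrow>
     mono_on J l \<and> (\<forall>k \<in> J. l k > 0) \<and>
     (\<forall>\<mu> > 0. finite {k \<in> J. l k = \<mu>} \<and> ae_dim \<Omega> (E \<mu>) = enat (card {k \<in> J. l k = \<mu>}))"

definition exact_eigenvalues ::
  "'a::euclidean_space set \<Rightarrow> ('a \<Rightarrow> real) \<Rightarrow> (nat \<Rightarrow> real) \<Rightarrow> bool" where
  "exact_eigenvalues \<Omega> V l \<longleftrightarrow> eigenvalue_enumeration \<Omega> (exact_eigenspace \<Omega> V) {1..} l"

text \<open>The mCR eigenvalues, extended by \<open>\<infinity>\<close> beyond the dimension of the discrete space.\<close>

definition mCR_eigenvalues ::
  "'a::euclidean_space set \<Rightarrow> 'a set set \<Rightarrow> ('a \<Rightarrow> real) \<Rightarrow> (nat \<Rightarrow> ereal) \<Rightarrow> bool" where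
  "mCR_eigenvalues \<Omega> \<T> V l \<longleftrightarrow>
     (\<exists>m. eigenvalue_enumeration \<Omega> (mCR_eigenspace \<Omega> \<T> V)
            {k. 1 \<le> k \<and> enat k \<le> ae_dim \<Omega> (eCR \<Omega> \<T>)} m \<and>
          (\<forall>k \<ge> 1. l k = (if enat k \<le> ae_dim \<Omega> (eCR \<Omega> \<T>) then ereal (m k) else \<infinity>)))"

definition GLB_real :: "real \<Rightarrow> real \<Rightarrow> real \<Rightarrow> real" where
  "GLB_real \<epsilon>' \<epsilon>'' l = l / (1 + (\<epsilon>' * \<epsilon>'' * l\<^sup>2) / (1 + \<epsilon>'' * l))"

text \<open>For \<open>l = \<infinity>\<close> the bound is the limit of the formula; it equals \<open>1 / \<epsilon>'\<close> for positive
  \<open>\<epsilon>'\<close> and \<open>\<epsilon>''\<close>.\<close>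

definition GLB :: "real \<Rightarrow> real \<Rightarrow> ereal \<Rightarrow> real" where
  "GLB \<epsilon>' \<epsilon>'' l =
     (if l = \<infinity> then Lim at_top (GLB_real \<epsilon>' \<epsilon>'') else GLB_real \<epsilon>' \<epsilon>'' (real_of_ereal l))"

end

theory Submission
  imports Defs
begin

text \<open>Let \<open>v\<close> be a combination of the first \<open>k\<close> exact eigenfunctions, \<open>w = I_eCR v\<close> and \<open>l\<close> the discrete
  eigenvalue. On every simplex, \<open>v - w\<close> has mean zero, and \<open>\<nabla>(v - w)\<close> is orthogonal to the gradients
  of enriched Crouzeix-Raviart functions: these are combinations of the fields \<open>x - P\<close>, \<open>P\<close> a vertex,
  whose flux is supported on the facet opposite to \<open>P\<close>, where the means of \<open>v\<close> and \<open>w\<close> agree. Since \<open>V\<close>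
  is piecewise constant, the exact energy of \<open>v\<close> exceeds the discrete energy of \<open>w\<close> at least by
  \<open>\<parallel>\<nabla>(v - w)\<parallel>\<^sup>2 \<ge> \<parallel>v - w\<parallel>\<^sup>2 / \<epsilon>''\<close>. The number of coefficients of \<open>v\<close> allows for \<open>w\<close> to be orthogonal to the
  first \<open>k - 1\<close> discrete eigenfunctions, so that the discrete energy is at least \<open>l \<parallel>w\<parallel>\<^sup>2\<close>. With
  \<open>\<Pi>\<^sub>0 v = \<Pi>\<^sub>0 w\<close> and the pointwise inequality \<open>l p\<^sup>2 + q\<^sup>2 / \<epsilon>'' \<ge> (p + q)\<^sup>2 l / (1 + \<epsilon>'' l)\<close> for
  \<open>p = w - \<Pi>\<^sub>0 w\<close> and \<open>q = v - w\<close>, the energy is at least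
  \<open>l \<parallel>v\<parallel>\<^sup>2 - \<parallel>v - \<Pi>\<^sub>0 v\<parallel>\<^sup>2 \<epsilon>'' l\<^sup>2 / (1 + \<epsilon>'' l)\<close>, and the Poincare inequality bounds \<open>\<parallel>v - \<Pi>\<^sub>0 v\<parallel>\<^sup>2\<close> by
  \<open>\<epsilon>'\<close> times the energy.\<close>

section \<open>Smooth functions of compact support\<close>

text \<open>The interpolant depends on \<open>v\<close> only through means over simplices and faces,
  and the latter are means of a trace picked by choice among L2 limits of test functions. So traces
  must first be shown to exist, and their means must be expressed by data in the volume: on a
  simplex, n |T| times the mean over the facet opposite to \<open>P\<close> is the integral of
  \<nabla>v . (x - P) + n v. As the surface measure is an image of Lebesgue measure on a prism, this
  Green formula is drawn from Fubini and the fundamental theorem of calculus on the rays from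
  \<open>P\<close>. Eigenvalues are given as enumerations counted by dimensions. The discrete
  eigenfunctions span their space because their number is its dimension, which has to be proved
  finite; of the exact ones, k independent functions are used. The constant of the bound comes from
  l = l / (1 + \<epsilon>'' l) + \<epsilon>'' l^2 / (1 + \<epsilon>'' l): the energies absorb the
  first share, the Poincare inequality the second. For k beyond the discrete dimension, the
  interpolant vanishes almost everywhere, so \<open>v\<close> has mean zero on every simplex and the
  Poincare inequality alone gives the limit 1 / \<epsilon>'.\<close>

lemma homogeneous_system_nontrivial:
  fixes A :: "'i \<Rightarrow> 'j \<Rightarrow> real"
  assumes "finite J" "finite I" "card J < card I"
  shows "\<exists>c. (\<exists>i\<in>I. c i \<noteq> 0) \<and> (\<forall>j\<in>J. (\<Sum>i\<in>I. c i * A i j) = 0)"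
  using assms
proof (induction J arbitrary: I A rule: finite_induct)
  case empty
  then show ?case by (intro exI[of _ "\<lambda>_. 1"]) (auto simp: card_gt_0_iff)
next
  case (insert j J)
  show ?case
  proof (cases "\<forall>i\<in>I. A i j = 0")
    case True
    have "card J < card I" using insert by simp
    from insert.IH[OF insert.prems(1) this, of A] True show ?thesis by auto
  next
    case False
    then obtain p where p: "p \<in> I" "A p j \<noteq> 0" by auto
    \<comment> \<open>Gaussian elimination: equation \<open>j\<close> is solved for the unknown
      \<open>p\<close>, and the other equations are rewritten without it.\<close>
    define A' where "A' i k = A i k - A i j / A p j * A p k" for i k
    have "finite (I - {p})" "card J < card (I - {p})" using insert p by auto
    from insert.IH[OF this, of A'] obtain c where
      c: "\<exists>i\<in>I-{p}. c i \<noteq> 0" "\<And>k. k \<in> J \<Longrightarrow> (\<Sum>i\<in>I-{p}. c i * A' i k) = 0" by auto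
    define d where "d i = (if i = p then - (\<Sum>i\<in>I-{p}. c i * A i j) / A p j else c i)" for i
    have split: "(\<Sum>i\<in>I. d i * A i k) = d p * A p k + (\<Sum>i\<in>I-{p}. c i * A i k)" for k
    proof -
      have "(\<Sum>i\<in>I-{p}. d i * A i k) = (\<Sum>i\<in>I-{p}. c i * A i k)"
        by (intro sum.cong) (auto simp: d_def)
      then show ?thesis using insert.prems(1) p(1) by (simp add: sum.remove[of I p])
    qed
    have "(\<Sum>i\<in>I. d i * A i j) = 0" unfolding split using p by (simp add: d_def)
    moreover have "(\<Sum>i\<in>I. d i * A i k) = 0" if "k \<in> J" for k
    proof -
      have "(\<Sum>i\<in>I-{p}. c i * A' i k)
          = (\<Sum>i\<in>I-{p}. c i * A i k) - (\<Sum>i\<in>I-{p}. c i * A i j) / A p j * A p k"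
        by (simp add: A'_def right_diff_distrib sum_subtractf sum_distrib_right sum_divide_distrib mult.assoc)
      with c(2)[OF that] show ?thesis unfolding split by (simp add: d_def)
    qed
    moreover have "\<exists>i\<in>I. d i \<noteq> 0" using c(1) by (auto simp: d_def)
    ultimately show ?thesis by (intro exI[of _ d]) auto
  qed
qed

section \<open>The classes \<open>C_k\<close> and smooth cut-off functions\<close>

lemma C_k_Suc_imp: "C_k (Suc k) f \<Longrightarrow> C_k k f"
proof (induction k arbitrary: f)
  case 0
  then show ?case
    by (auto simp: continuous_on_eq_continuous_at differentiable_imp_continuous_within)
next
  case (Suc k)
  then show ?case by (metis C_k.simps(2))
qed

lemma C_k_const: "C_k k (\<lambda>x. c)"
  by (induction k arbitrary: c) auto

lemma C_k_add: "C_k k f \<Longrightarrow> C_k k g \<Longrightarrow> C_k k (\<lambda>x. f x + g x)"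
proof (induction k arbitrary: f g)
  case (Suc k)
  have "frechet_derivative (\<lambda>x. f x + g x) (at x)
      = (\<lambda>h. frechet_derivative f (at x) h + frechet_derivative g (at x) h)" for x
    using Suc.prems
    by (intro frechet_derivative_at[symmetric] has_derivative_add) (auto simp: frechet_derivative_works)
  then show ?case using Suc by auto
qed (auto intro: continuous_intros)

lemma C_k_mult: "C_k k f \<Longrightarrow> C_k k g \<Longrightarrow> C_k k (\<lambda>x. f x * g x)"
proof (induction k arbitrary: f g)
  case (Suc k)
  have "frechet_derivative (\<lambda>x. f x * g x) (at x)
      = (\<lambda>h. f x * frechet_derivative g (at x) h + frechet_derivative f (at x) h * g x)" for x
    using Suc.prems
    by (intro frechet_derivative_at[symmetric] has_derivative_mult) (auto simp: frechet_derivative_works)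
  then show ?case using Suc C_k_Suc_imp[of k f] C_k_Suc_imp[of k g] by (auto intro!: C_k_add)
qed (auto intro: continuous_intros)

lemma C_k_prod:
  assumes "finite I" "\<And>i. i \<in> I \<Longrightarrow> C_k k (f i)"
  shows "C_k k (\<lambda>x. \<Prod>i\<in>I. f i x)"
  using assms by (induction I rule: finite_induct) (auto intro!: C_k_const C_k_mult)

text \<open>The derivatives of \<open>t \<mapsto> exp (-1 / t)\<close>, extended by zero, are combinations of these
  functions.\<close>

definition flat_exp :: "nat \<Rightarrow> real \<Rightarrow> real" where
  "flat_exp k t = (if t > 0 then inverse t ^ k * exp (- inverse t) else 0)"

lemma flat_exp_tendsto_0: "(flat_exp k \<longlongrightarrow> 0) (at 0)"
proof -
  have "((\<lambda>t. (inverse t) ^ k / exp (inverse t)) \<longlongrightarrow> (0::real)) (at_right 0)"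
    by (rule filterlim_compose[OF tendsto_power_div_exp_0 filterlim_inverse_at_top_right])
  then have "(flat_exp k \<longlongrightarrow> 0) (at_right 0)"
    by (rule Lim_transform_eventually)
      (auto simp: flat_exp_def exp_minus divide_inverse eventually_at_right_less intro!: eventually_mono[OF eventually_at_right_less])
  moreover have "(flat_exp k \<longlongrightarrow> 0) (at_left 0)"
    by (rule Lim_transform_eventually[of "\<lambda>_. 0"])
      (auto simp: flat_exp_def eventually_at_filter)
  ultimately show ?thesis by (simp add: filterlim_split_at)
qed

text \<open>The family is closed under differentiation, so an induction with arbitrary
  \<open>m\<close> yields all orders of smoothness at once.\<close>

lemma DERIV_flat_exp:
  "(flat_exp k has_real_derivative (flat_exp (k + 2) t - real k * flat_exp (k + 1) t)) (at t)"
proof -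
  consider "t > 0" | "t < 0" | "t = 0" by linarith
  then show ?thesis
  proof cases
    case 1
    have *: "((\<lambda>t. inverse t ^ k * exp (- inverse t)) has_real_derivative
          (flat_exp (k + 2) t - real k * flat_exp (k + 1) t)) (at t)"
    proof (cases k)
      case (Suc m)
      have "t * t ^ (i - Suc 0) = t ^ i" if "i \<noteq> 0" for i
        using that by (cases i) auto
      then show ?thesis
        using 1 Suc by (cases "m = 0") (auto intro!: derivative_eq_intros simp: flat_exp_def field_simps power2_eq_square)
    qed (use 1 in \<open>auto intro!: derivative_eq_intros simp: flat_exp_def field_simps power2_eq_square\<close>)
    show ?thesis
      by (rule has_field_derivative_transform_within_open[OF *, of "{0<..}"]) (use 1 in \<open>auto simp: flat_exp_def\<close>)
  next
    case 2
    then have "((\<lambda>_. 0) has_real_derivative (flat_exp (k + 2) t - real k * flat_exp (k + 1) t)) (at t)"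
      by (simp add: flat_exp_def)
    then show ?thesis
      by (rule has_field_derivative_transform_within_open[of _ _ _ "{..<0}"]) (use 2 in \<open>auto simp: flat_exp_def\<close>)
  next
    case 3
    \<comment> \<open>The difference quotient at 0 is \<open>flat_exp (Suc k)\<close>, whose limit
      is known.\<close>
    have "((\<lambda>h. (flat_exp k (0 + h) - flat_exp k 0) / h) \<longlongrightarrow> 0) (at 0)"
      by (rule Lim_transform_eventually[OF flat_exp_tendsto_0[of "Suc k"]])
        (auto simp: flat_exp_def eventually_at_filter divide_inverse)
    then show ?thesis using 3 by (simp add: DERIV_def flat_exp_def)
  qed
qed

lemma C_k_flat_exp: "C_k k (\<lambda>x. flat_exp m (x \<bullet> a + \<beta>))"
proof (induction k arbitrary: m)
  case 0
  have "continuous_on UNIV (flat_exp m)"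
    by (intro continuous_at_imp_continuous_on ballI DERIV_isCont[OF DERIV_flat_exp])
  have "continuous_on UNIV (\<lambda>x. x \<bullet> a + \<beta>)" by (intro continuous_intros)
  with \<open>continuous_on UNIV (flat_exp m)\<close> show ?case
    using continuous_on_compose2[of UNIV "flat_exp m" UNIV "\<lambda>x. x \<bullet> a + \<beta>"] by simp
next
  case (Suc k)
  have der: "((\<lambda>x. flat_exp m (x \<bullet> a + \<beta>)) has_derivative
     (\<lambda>h. (flat_exp (m + 2) (x \<bullet> a + \<beta>) - real m * flat_exp (m + 1) (x \<bullet> a + \<beta>)) * (h \<bullet> a))) (at x)" for x
  proof -
    have "((\<lambda>x. x \<bullet> a + \<beta>) has_derivative (\<lambda>h. h \<bullet> a)) (at x)"
      by (auto intro!: derivative_eq_intros)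
    from has_derivative_compose[OF this DERIV_flat_exp[of m, unfolded has_field_derivative_def]]
    show ?thesis .
  qed
  have fd: "frechet_derivative (\<lambda>x. flat_exp m (x \<bullet> a + \<beta>)) (at x) b
      = flat_exp (m + 2) (x \<bullet> a + \<beta>) * (b \<bullet> a) + flat_exp (m + 1) (x \<bullet> a + \<beta>) * (- real m * (b \<bullet> a))" for x b
    unfolding frechet_derivative_at[OF der, symmetric] by (simp add: algebra_simps)
  have "C_k k (\<lambda>x. flat_exp (m + 2) (x \<bullet> a + \<beta>) * (b \<bullet> a) + flat_exp (m + 1) (x \<bullet> a + \<beta>) * (- real m * (b \<bullet> a)))" for b
    by (intro C_k_add C_k_mult C_k_const Suc.IH)
  then show ?case using der unfolding C_k.simps fd by (auto simp: differentiable_def)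
qed

text \<open>Every factor of the product is exp (-1 / t), where t is j + 1 times the signed distance
  of a coordinate from an endpoint of its interval. It vanishes to all orders at the endpoint and
  tends to 1 inside as j grows. The support is contained in the closed box, whence the hypothesis on
  \<open>cbox\<close>.\<close>

lemma test_functions_approximate_box:
  fixes a c :: "'a::euclidean_space"
  assumes sub: "cbox a c \<subseteq> U"
  obtains \<phi> where "\<And>j. test_function U (\<phi> j)" "\<And>j x. \<bar>\<phi> j x\<bar> \<le> 1"
    "\<And>x. (\<lambda>j. \<phi> j x) \<longlonglongrightarrow> indicator (box a c) x"
proof
  \<comment> \<open>The arguments are put into the form \<open>x \<bullet> a + \<beta>\<close> of
    \<open>C_k_flat_exp\<close>; \<open>Suc j\<close> keeps the scaling positive.\<close>
  define \<phi> where "\<phi> j x = (\<Prod>b\<in>Basis. flat_exp 0 (x \<bullet> (real (Suc j) *\<^sub>R b) + (- real (Suc j) * (a \<bullet> b))) *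
      flat_exp 0 (x \<bullet> (- real (Suc j) *\<^sub>R b) + real (Suc j) * (c \<bullet> b)))" for j and x :: 'a
  have 01: "0 \<le> flat_exp 0 t" "flat_exp 0 t \<le> 1" for t by (auto simp: flat_exp_def)
  have supp: "\<phi> j x = 0" if "x \<notin> box a c" for j x
  proof -
    from that obtain b where "b \<in> Basis" and b: "x \<bullet> b \<le> a \<bullet> b \<or> c \<bullet> b \<le> x \<bullet> b"
      by (force simp: mem_box)
    moreover have "x \<bullet> (real (Suc j) *\<^sub>R b) + (- real (Suc j) * (a \<bullet> b)) = real (Suc j) * (x \<bullet> b - a \<bullet> b)"
      "x \<bullet> (- real (Suc j) *\<^sub>R b) + real (Suc j) * (c \<bullet> b) = real (Suc j) * (c \<bullet> b - x \<bullet> b)"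
      by (simp_all only: inner_scaleR_right) (simp_all add: algebra_simps)
    ultimately show ?thesis unfolding \<phi>_def
      by (intro prod_zero bexI[of _ b]) (auto simp: flat_exp_def zero_less_mult_iff)
  qed
  have cl: "closure {x. \<phi> j x \<noteq> 0} \<subseteq> cbox a c" for j
  proof (rule closure_minimal)
    show "{x. \<phi> j x \<noteq> 0} \<subseteq> cbox a c" using supp[of _ j] box_subset_cbox[of a c] by blast
  qed (rule closed_cbox)
  show "test_function U (\<phi> j)" for j
    unfolding test_function_def
  proof (intro conjI allI)
    show "C_k k (\<phi> j)" for k
      unfolding \<phi>_def by (intro C_k_prod C_k_mult C_k_flat_exp) auto
    show "compact (closure {x. \<phi> j x \<noteq> 0})"
      using cl by (meson bounded_cbox bounded_subset closed_closure compact_eq_bounded_closed)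
    show "closure {x. \<phi> j x \<noteq> 0} \<subseteq> U" using cl sub by blast
  qed
  show "\<bar>\<phi> j x\<bar> \<le> 1" for j x
    unfolding \<phi>_def abs_prod using 01
    by (intro prod_le_1) (auto simp: abs_mult intro!: mult_le_one)
  have lim1: "(\<lambda>j. flat_exp 0 (real (Suc j) * t)) \<longlonglongrightarrow> 1" if "t > 0" for t
  proof -
    have "(\<lambda>j. exp (- (inverse (real (Suc j)) * inverse t))) \<longlonglongrightarrow> exp (- (0 * inverse t))"
      by (intro tendsto_intros LIMSEQ_inverse_real_of_nat)
    then show ?thesis using that by (simp add: flat_exp_def zero_less_mult_iff)
  qed
  show "(\<lambda>j. \<phi> j x) \<longlonglongrightarrow> indicator (box a c) x" for x
  proof (cases "x \<in> box a c")
    case False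
    then show ?thesis by (simp add: supp)
  next
    case True
    have eq: "x \<bullet> (real (Suc j) *\<^sub>R b) + (- real (Suc j) * (a \<bullet> b)) = real (Suc j) * (x \<bullet> b - a \<bullet> b)"
      "x \<bullet> (- real (Suc j) *\<^sub>R b) + real (Suc j) * (c \<bullet> b) = real (Suc j) * (c \<bullet> b - x \<bullet> b)" for j b
      by (simp_all only: inner_scaleR_right) (simp_all add: algebra_simps)
    have "(\<lambda>j. \<phi> j x) \<longlonglongrightarrow> (\<Prod>b\<in>(Basis::'a set). 1 * 1)"
      unfolding \<phi>_def eq using True
      by (intro tendsto_prod tendsto_mult lim1) (auto simp: mem_box)
    then show ?thesis using True by simp
  qed
qed

text \<open>Open boxes form an intersection-stable generator of the Borel sets, so the vanishing of
  the integral passes to all Borel sets by a Dynkin argument. Uniqueness of densities then gives the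
  claim.\<close>

lemma AE_zero_if_box_integrals_zero:
  fixes f :: "'a::euclidean_space \<Rightarrow> real"
  assumes f: "integrable lborel f"
    and box0: "\<And>a c. (LINT x|lborel. indicator (box a c) x * f x) = 0"
  shows "AE x in lborel. f x = 0"
proof -
  have I0: "(LINT x|lborel. indicator A x * f x) = 0" if "A \<in> sets borel" for A
  proof -
    define G where "G = range (\<lambda>(a, b). box a b :: 'a set)"
    have ind: "integrable lborel (\<lambda>x. indicator A x * f x)" if "A \<in> sets borel" for A
      using integrable_mult_indicator[of A lborel f] that f by simp
    have "Int_stable G"
      unfolding G_def Int_stable_def
      by (metis (mono_tags, lifting) box_Int_box case_prod_conv rangeE rangeI surj_pair)
    moreover have "G \<subseteq> Pow UNIV" by simp
    moreover have "A \<in> sigma_sets UNIV G" using that by (simp add: G_def borel_eq_box)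
    ultimately show ?thesis
    proof (induction rule: sigma_sets_induct_disjoint)
      case (basic A)
      then show ?case using box0 by (auto simp: G_def)
    next
      case empty
      then show ?case by simp
    next
      case (compl A)
      have A: "A \<in> sets borel" using compl by (simp add: G_def borel_eq_box)
      \<comment> \<open>Complements require the integral over the whole space, which is the limit of
        the integrals over growing boxes.\<close>
      have "(\<lambda>n. LINT x|lborel. indicator (box (- real n *\<^sub>R One) (real n *\<^sub>R One)) x * f x)
          \<longlonglongrightarrow> (LINT x|lborel. f x)"
      proof (rule integral_dominated_convergence[where w = "\<lambda>x. norm (f x)"])
        show "AE x in lborel. (\<lambda>n. indicator (box (- real n *\<^sub>R One) (real n *\<^sub>R One)) x * f x) \<longlonglongrightarrow> f x"
        proof (rule AE_I2)
          fix x :: 'a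
          obtain N where N: "norm x < real N" using reals_Archimedean2 by blast
          have "x \<in> box (- real n *\<^sub>R One) (real n *\<^sub>R One)" if "n \<ge> N" for n
          proof -
            have "\<bar>x \<bullet> b\<bar> < real n" if "b \<in> Basis" for b
              using Basis_le_norm[OF that, of x] N \<open>n \<ge> N\<close> by linarith
            then show ?thesis by (force simp: mem_box)
          qed
          then show "(\<lambda>n. indicator (box (- real n *\<^sub>R One) (real n *\<^sub>R One)) x * f x) \<longlonglongrightarrow> f x"
            by (intro tendsto_eventually eventually_sequentiallyI[of N]) auto
        qed
      qed (use f in \<open>auto simp: indicator_def\<close>)
      then have tot: "(LINT x|lborel. f x) = 0" by (simp add: box0 LIMSEQ_const_iff)
      have "(LINT x|lborel. indicator (UNIV - A) x * f x) = (LINT x|lborel. f x - indicator A x * f x)"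
        by (intro Bochner_Integration.integral_cong) (auto simp: indicator_def)
      then show ?case using compl.IH tot f ind[OF A] by simp
    next
      case (union A)
      have A: "A i \<in> sets borel" for i using union(2) by (auto simp: G_def borel_eq_box)
      have "(\<lambda>n. LINT x|lborel. indicator (\<Union>i<n. A i) x * f x) \<longlonglongrightarrow> (LINT x|lborel. indicator (\<Union>i. A i) x * f x)"
      proof (rule integral_dominated_convergence[where w = "\<lambda>x. norm (f x)"])
        show "AE x in lborel. (\<lambda>n. indicator (\<Union>i<n. A i) x * f x) \<longlonglongrightarrow> indicator (\<Union>i. A i) x * f x"
          by (intro AE_I2 tendsto_mult tendsto_const LIMSEQ_indicator_UN)
      qed (use f A in \<open>auto simp: indicator_def\<close>)
      moreover have "(LINT x|lborel. indicator (\<Union>i<n. A i) x * f x) = 0" for n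
      proof -
        have "indicator (\<Union>i<n. A i) x = (\<Sum>i<n. indicator (A i) x :: real)" for x
          using union(1) by (intro indicator_UN_disjoint) (auto simp: disjoint_family_on_def)
        then have "(LINT x|lborel. indicator (\<Union>i<n. A i) x * f x) = (LINT x|lborel. (\<Sum>i<n. indicator (A i) x * f x))"
          by (simp add: sum_distrib_right)
        also have "\<dots> = (\<Sum>i<n. (LINT x|lborel. indicator (A i) x * f x))"
          by (intro Bochner_Integration.integral_sum ind A)
        finally show ?thesis using union(3) by simp
      qed
      ultimately show ?case by (simp add: LIMSEQ_const_iff)
    qed
  qed
  show ?thesis
    by (rule density_unique_real[of _ f "\<lambda>_. 0"]) (use f I0 in \<open>auto simp: set_lebesgue_integral_def\<close>)
qed

section \<open>Weak gradients\<close>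

text \<open>Lebesgue measure is complete. The function spaces consist of representatives, so
  measurability has to survive changes on null sets.\<close>

lemma borel_measurable_lebesgue_on_AE_cong:
  fixes f g :: "'a::euclidean_space \<Rightarrow> 'b::euclidean_space"
  assumes U: "U \<in> sets lebesgue" and f: "f \<in> borel_measurable (lebesgue_on U)"
    and eq: "AE x in lebesgue_on U. f x = g x"
  shows "g \<in> borel_measurable (lebesgue_on U)"
proof (rule measurableI)
  fix A :: "'b set" assume A: "A \<in> sets borel"
  have eq': "AE x in lebesgue. x \<in> U \<longrightarrow> f x = g x"
    using eq U by (simp add: AE_restrict_space_iff)
  have "f -` A \<inter> space (lebesgue_on U) \<in> sets (lebesgue_on U)"
    using f A by (rule measurable_sets)
  then have fA: "f -` A \<inter> U \<in> sets lebesgue"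
    using U by (simp add: sets_restrict_space_iff)
  have "g -` A \<inter> U \<in> sets lebesgue"
  proof (rule completion.in_sets_AE[OF _ fA])
    show "AE x in lebesgue. (x \<in> f -` A \<inter> U) = (x \<in> g -` A \<inter> U)"
      using eq' by eventually_elim auto
  qed simp
  then show "g -` A \<inter> space (lebesgue_on U) \<in> sets (lebesgue_on U)"
    using U by (simp add: sets_restrict_space_iff)
qed simp

section \<open>Square integrable functions: linear operations, products, Cauchy-Schwarz
  inequality\<close>

lemma L2_AE_cong:
  assumes U: "U \<in> sets lebesgue" and f: "L2 U f" and eq: "AE x in lebesgue_on U. f x = g x"
  shows "L2 U g"
proof -
  have "g \<in> borel_measurable (lebesgue_on U)"
    using borel_measurable_lebesgue_on_AE_cong[OF U _ eq] f by (auto simp: L2_def)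
  moreover have "integrable (lebesgue_on U) (\<lambda>x. (norm (g x))\<^sup>2)"
    by (subst integrable_cong_AE[of _ _ "\<lambda>x. (norm (f x))\<^sup>2"]) (use f eq calculation in \<open>auto simp: L2_def\<close>)
  ultimately show ?thesis by (simp add: L2_def)
qed

lemma integrable_if_abs_le:
  fixes f g :: "'a \<Rightarrow> real"
  assumes "integrable M f" "g \<in> borel_measurable M" "\<And>x. \<bar>g x\<bar> \<le> f x"
  shows "integrable M g"
proof (rule Bochner_Integration.integrable_bound[OF assms(1,2)])
  show "AE x in M. norm (g x) \<le> norm (f x)"
    using assms(3) by (intro AE_I2) (metis abs_ge_self order_trans real_norm_def)
qed

lemma L2_add: assumes "L2 U f" "L2 U g" shows "L2 U (\<lambda>x. f x + g x)"
proof -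
  have [measurable]: "f \<in> borel_measurable (lebesgue_on U)" "g \<in> borel_measurable (lebesgue_on U)"
    using assms by (auto simp: L2_def)
  have "(norm (f x + g x))\<^sup>2 \<le> 2 * (norm (f x))\<^sup>2 + 2 * (norm (g x))\<^sup>2" for x
  proof -
    have "(norm (f x + g x))\<^sup>2 \<le> (norm (f x) + norm (g x))\<^sup>2"
      by (intro power_mono norm_triangle_ineq) auto
    also have "\<dots> \<le> 2 * (norm (f x))\<^sup>2 + 2 * (norm (g x))\<^sup>2"
      using sum_squares_bound[of "norm (f x)" "norm (g x)"] by (simp add: power2_sum)
    finally show ?thesis .
  qed
  note le = this
  have "integrable (lebesgue_on U) (\<lambda>x. 2 * (norm (f x))\<^sup>2 + 2 * (norm (g x))\<^sup>2)"
    using assms by (auto simp: L2_def)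
  then have "integrable (lebesgue_on U) (\<lambda>x. (norm (f x + g x))\<^sup>2)"
    by (rule integrable_if_abs_le) (measurable, simp only: abs_power2 le)
  then show ?thesis by (simp add: L2_def)
qed

lemma L2_scaleR: assumes "L2 U f" shows "L2 U (\<lambda>x. c *\<^sub>R f x)"
  using assms by (auto simp: L2_def power_mult_distrib)

lemma L2_zero: "L2 U (\<lambda>x. 0)"
  by (auto simp: L2_def)

lemma L2_sum: "finite I \<Longrightarrow> (\<And>i. i \<in> I \<Longrightarrow> L2 U (f i)) \<Longrightarrow> L2 U (\<lambda>x. \<Sum>i\<in>I. f i x)"
  by (induction I rule: finite_induct) (auto intro: L2_zero L2_add)

lemma L2_diff: assumes "L2 U f" "L2 U g" shows "L2 U (\<lambda>x. f x - g x)"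
  using L2_add[OF assms(1) L2_scaleR[OF assms(2), of "-1"]] by simp

lemma L2_mult: assumes "L2 U (f :: 'a::euclidean_space \<Rightarrow> real)" shows "L2 U (\<lambda>x. c * f x)"
  using L2_scaleR[OF assms, of c] by simp

lemma L2_integrable_inner: assumes "L2 U f" "L2 U g" shows "integrable (lebesgue_on U) (\<lambda>x. f x \<bullet> g x)"
proof -
  have [measurable]: "f \<in> borel_measurable (lebesgue_on U)" "g \<in> borel_measurable (lebesgue_on U)"
    using assms by (auto simp: L2_def)
  have "\<bar>f x \<bullet> g x\<bar> \<le> (norm (f x))\<^sup>2 + (norm (g x))\<^sup>2" for x
  proof -
    have "\<bar>f x \<bullet> g x\<bar> \<le> norm (f x) * norm (g x)" by (rule Cauchy_Schwarz_ineq2)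
    also have "\<dots> \<le> (norm (f x))\<^sup>2 + (norm (g x))\<^sup>2"
    proof -
      have "0 \<le> norm (f x) * norm (g x)" by simp
      then show ?thesis using sum_squares_bound[of "norm (f x)" "norm (g x)"] by linarith
    qed
    finally show ?thesis .
  qed
  note le = this
  have "integrable (lebesgue_on U) (\<lambda>x. (norm (f x))\<^sup>2 + (norm (g x))\<^sup>2)"
    using assms by (auto simp: L2_def)
  then show ?thesis
    by (rule integrable_if_abs_le) (measurable, rule le)
qed

lemma L2_integrable_mult:
  "L2 U (f :: 'a::euclidean_space \<Rightarrow> real) \<Longrightarrow> L2 U g \<Longrightarrow> integrable (lebesgue_on U) (\<lambda>x. f x * g x)"
  using L2_integrable_inner[of U f g] by simp

lemma L2_bounded:
  fixes f :: "'a::euclidean_space \<Rightarrow> 'b::euclidean_space"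
  assumes U: "U \<in> lmeasurable" and f: "f \<in> borel_measurable (lebesgue_on U)"
    and B: "\<And>x. x \<in> U \<Longrightarrow> norm (f x) \<le> B"
  shows "L2 U f"
proof -
  have "finite_measure (lebesgue_on U)" using U by (simp add: finite_measure_lebesgue_on)
  then have "integrable (lebesgue_on U) (\<lambda>x. (norm (f x))\<^sup>2)"
    by (rule finite_measure.integrable_const_bound[where B = "B\<^sup>2"])
      (use f B in \<open>auto intro!: AE_I2 power_mono\<close>)
  with f show ?thesis by (simp add: L2_def)
qed

lemma L2_continuous:
  fixes f :: "'a::euclidean_space \<Rightarrow> 'b::euclidean_space"
  assumes U: "U \<in> lmeasurable" "bounded U" and f: "continuous_on UNIV f"
  shows "L2 U f"
proof -
  have "compact (f ` closure U)"
    using U f by (intro compact_continuous_image continuous_on_subset[OF f]) auto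
  then obtain B where "\<forall>x\<in>closure U. norm (f x) \<le> B"
    by (auto dest!: compact_imp_bounded simp: bounded_iff)
  moreover have "f \<in> borel_measurable (lebesgue_on U)"
    using U f by (intro continuous_imp_measurable_on_sets_lebesgue continuous_on_subset[OF f])
      (auto simp: fmeasurableD)
  ultimately show ?thesis using U closure_subset by (intro L2_bounded) auto
qed

lemma L2_const: "U \<in> lmeasurable \<Longrightarrow> L2 U (\<lambda>x. c)"
  by (rule L2_bounded[where B = "norm c"]) auto

lemma L2_integrable:
  fixes f :: "'a::euclidean_space \<Rightarrow> real"
  assumes "U \<in> lmeasurable" "L2 U f" shows "integrable (lebesgue_on U) f"
  using L2_integrable_mult[OF assms(2) L2_const[OF assms(1), of 1]] by simp

lemma L2_inner_const:
  fixes f :: "'a::euclidean_space \<Rightarrow> 'b::euclidean_space"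
  assumes "L2 U f" shows "L2 U (\<lambda>x. f x \<bullet> b)"
proof -
  have [measurable]: "f \<in> borel_measurable (lebesgue_on U)" using assms by (auto simp: L2_def)
  have "(f x \<bullet> b)\<^sup>2 \<le> (norm b)\<^sup>2 * (norm (f x))\<^sup>2" for x
    using power_mono[OF Cauchy_Schwarz_ineq2[of "f x" b], of 2] by (simp add: power_mult_distrib mult.commute)
  note le = this
  have "integrable (lebesgue_on U) (\<lambda>x. (norm b)\<^sup>2 * (norm (f x))\<^sup>2)"
    using assms by (auto simp: L2_def)
  then have "integrable (lebesgue_on U) (\<lambda>x. (f x \<bullet> b)\<^sup>2)"
    by (rule integrable_if_abs_le) (measurable, simp only: abs_power2 le)
  then show ?thesis by (simp add: L2_def)
qed

lemma L2_subset:
  assumes f: "L2 U f" and S: "S \<subseteq> U" "S \<in> sets lebesgue" "U \<in> sets lebesgue"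
  shows "L2 S f"
proof -
  have m: "f \<in> borel_measurable (lebesgue_on S)"
    using f S by (auto simp: L2_def intro: measurable_restrict_mono)
  have "integrable lebesgue (\<lambda>x. indicator U x *\<^sub>R (norm (f x))\<^sup>2)"
    using f S by (simp add: L2_def integrable_restrict_space)
  note integrable_mult_indicator[OF S(2) this]
  moreover have "(\<lambda>x. indicator S x *\<^sub>R indicator U x *\<^sub>R (norm (f x))\<^sup>2) = (\<lambda>x. indicator S x *\<^sub>R (norm (f x))\<^sup>2 :: real)"
    using S by (auto simp: fun_eq_iff indicator_def)
  ultimately have "integrable lebesgue (\<lambda>x. indicator S x *\<^sub>R (norm (f x))\<^sup>2)"
    by simp
  then show ?thesis using m S by (simp add: L2_def integrable_restrict_space)
qed

text \<open>The polynomial a + 2 t b + t^2 c in t is nonnegative. Its minimiser t = - b / c gives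
  the inequality; if c = 0, a linear function bounded below is constant, hence b = 0.\<close>

lemma Cauchy_Schwarz_integral:
  assumes f: "L2 U f" and g: "L2 U g"
  shows "(LINT x|lebesgue_on U. f x \<bullet> g x)\<^sup>2
    \<le> (LINT x|lebesgue_on U. (norm (f x))\<^sup>2) * (LINT x|lebesgue_on U. (norm (g x))\<^sup>2)"
proof -
  define a b c where "a = (LINT x|lebesgue_on U. (norm (f x))\<^sup>2)"
    and "b = (LINT x|lebesgue_on U. f x \<bullet> g x)" and "c = (LINT x|lebesgue_on U. (norm (g x))\<^sup>2)"
  have nn: "0 \<le> a + 2 * t * b + t\<^sup>2 * c" for t
  proof -
    have "0 \<le> (LINT x|lebesgue_on U. (norm (f x + t *\<^sub>R g x))\<^sup>2)" by simp
    also have "\<dots> = (LINT x|lebesgue_on U. (norm (f x))\<^sup>2 + 2 * t * (f x \<bullet> g x) + t\<^sup>2 * (norm (g x))\<^sup>2)"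
      unfolding power2_norm_eq_inner
      by (simp add: inner_add_left inner_add_right inner_commute power2_eq_square algebra_simps)
    also have "\<dots> = a + 2 * t * b + t\<^sup>2 * c"
      using f g L2_integrable_inner[OF f g] by (simp add: a_def b_def c_def L2_def)
    finally show ?thesis .
  qed
  have "c \<ge> 0" by (simp add: c_def)
  have "b\<^sup>2 \<le> a * c"
  proof (cases "c = 0")
    case True
    have "b = 0"
    proof (rule ccontr)
      assume "b \<noteq> 0"
      then show False using nn[of "- (a + 1) / (2 * b)"] True by (simp add: field_simps)
    qed
    then show ?thesis using True by simp
  next
    case False
    then show ?thesis using nn[of "- b / c"] \<open>c \<ge> 0\<close>
      by (simp add: field_simps power2_eq_square)
  qed
  then show ?thesis by (simp add: a_def b_def c_def)
qed

lemma L2_norm_power2: "(L2_norm U f)\<^sup>2 = (LINT x|lebesgue_on U. (norm (f x))\<^sup>2)"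
  by (simp add: L2_norm_def)

lemma tendsto_integral_L2_inner:
  assumes f: "L2 U f" and g: "\<And>j. L2 U (g j)" and h: "L2 U h"
    and lim: "(\<lambda>j. L2_norm U (\<lambda>x. g j x - f x)) \<longlonglongrightarrow> 0"
  shows "(\<lambda>j. LINT x|lebesgue_on U. g j x \<bullet> h x) \<longlonglongrightarrow> (LINT x|lebesgue_on U. f x \<bullet> h x)"
proof -
  have "(\<lambda>j. (LINT x|lebesgue_on U. g j x \<bullet> h x) - (LINT x|lebesgue_on U. f x \<bullet> h x)) \<longlonglongrightarrow> 0"
  proof (rule Lim_null_comparison)
    show "\<forall>\<^sub>F j in sequentially. norm ((LINT x|lebesgue_on U. g j x \<bullet> h x) - (LINT x|lebesgue_on U. f x \<bullet> h x))
        \<le> L2_norm U (\<lambda>x. g j x - f x) * L2_norm U h"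
    proof (intro always_eventually allI)
      fix j
      have "(LINT x|lebesgue_on U. g j x \<bullet> h x) - (LINT x|lebesgue_on U. f x \<bullet> h x)
          = (LINT x|lebesgue_on U. (g j x - f x) \<bullet> h x)"
        using L2_integrable_inner[OF g h] L2_integrable_inner[OF f h] by (simp add: inner_diff_left)
      moreover have "\<bar>LINT x|lebesgue_on U. (g j x - f x) \<bullet> h x\<bar> \<le> L2_norm U (\<lambda>x. g j x - f x) * L2_norm U h"
      proof (rule power2_le_iff_abs_le[THEN iffD1])
        show "0 \<le> L2_norm U (\<lambda>x. g j x - f x) * L2_norm U h" by (simp add: L2_norm_def)
        show "(LINT x|lebesgue_on U. (g j x - f x) \<bullet> h x)\<^sup>2 \<le> (L2_norm U (\<lambda>x. g j x - f x) * L2_norm U h)\<^sup>2"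
          unfolding power_mult_distrib L2_norm_power2 by (rule Cauchy_Schwarz_integral[OF L2_diff[OF g f] h])
      qed
      ultimately show "norm ((LINT x|lebesgue_on U. g j x \<bullet> h x) - (LINT x|lebesgue_on U. f x \<bullet> h x))
        \<le> L2_norm U (\<lambda>x. g j x - f x) * L2_norm U h" by simp
    qed
    show "(\<lambda>j. L2_norm U (\<lambda>x. g j x - f x) * L2_norm U h) \<longlonglongrightarrow> 0"
      using tendsto_mult[OF lim tendsto_const, of "L2_norm U h"] by simp
  qed
  then show ?thesis by (simp add: LIM_zero_iff)
qed

section \<open>Classical gradients and integration by parts\<close>

definition gradient :: "('a::euclidean_space \<Rightarrow> real) \<Rightarrow> 'a \<Rightarrow> 'a" where
  "gradient f x = (\<Sum>b\<in>Basis. frechet_derivative f (at x) b *\<^sub>R b)"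

lemma gradient_inner_Basis: "b \<in> Basis \<Longrightarrow> gradient f x \<bullet> b = frechet_derivative f (at x) b"
  by (simp add: gradient_def inner_sum_left inner_Basis if_distrib cong: if_cong)

lemma gradient_eqI: "(f has_derivative (\<lambda>h. g \<bullet> h)) (at x) \<Longrightarrow> gradient f x = g"
  by (rule euclidean_eqI) (simp add: gradient_inner_Basis frechet_derivative_at[symmetric])

lemma has_derivative_gradient:
  assumes "f differentiable (at x)" shows "(f has_derivative (\<lambda>h. gradient f x \<bullet> h)) (at x)"
proof -
  have d: "(f has_derivative frechet_derivative f (at x)) (at x)"
    using assms by (simp add: frechet_derivative_works)
  interpret linear "frechet_derivative f (at x)" using d by (rule has_derivative_linear)
  have "frechet_derivative f (at x) h = gradient f x \<bullet> h" for h
  proof -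
    have "frechet_derivative f (at x) h = frechet_derivative f (at x) (\<Sum>b\<in>Basis. (h \<bullet> b) *\<^sub>R b)"
      by (simp add: euclidean_representation)
    also have "\<dots> = (\<Sum>b\<in>Basis. (h \<bullet> b) * frechet_derivative f (at x) b)" by (simp add: sum scale)
    also have "\<dots> = gradient f x \<bullet> h"
      by (simp add: gradient_def inner_sum_left inner_commute[of h] mult.commute)
    finally show ?thesis .
  qed
  then have "frechet_derivative f (at x) = (\<lambda>h. gradient f x \<bullet> h)" by auto
  with d show ?thesis by simp
qed

lemma C1_has_derivative: "C_k 1 f \<Longrightarrow> (f has_derivative (\<lambda>h. gradient f x \<bullet> h)) (at x)"
  by (rule has_derivative_gradient) simp

lemma C1_continuous_gradient: "C_k 1 f \<Longrightarrow> continuous_on UNIV (gradient f)"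
  unfolding gradient_def by (intro continuous_on_sum continuous_on_scaleR) auto

lemma C1_continuous: "C_k 1 f \<Longrightarrow> continuous_on UNIV f"
  using C_k_Suc_imp[of 0 f] by simp

lemma C1_I:
  assumes "\<And>x. (f has_derivative (\<lambda>h. g x \<bullet> h)) (at x)" "continuous_on UNIV g"
  shows "C_k 1 f" "gradient f = g"
proof -
  show "gradient f = g" using gradient_eqI[OF assms(1)] by auto
  have "frechet_derivative f (at x) b = g x \<bullet> b" for x b
    using frechet_derivative_at[OF assms(1), of x, symmetric] by simp
  then show "C_k 1 f" using assms by (auto simp: differentiable_def intro!: continuous_intros)
qed

lemma gradient_mult:
  assumes "C_k 1 f" "C_k 1 g"
  shows "gradient (\<lambda>x. f x * g x) x = f x *\<^sub>R gradient g x + g x *\<^sub>R gradient f x"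
  using has_derivative_mult[OF assms[THEN C1_has_derivative], of x]
  by (intro gradient_eqI) (simp add: inner_add_left algebra_simps)

lemma gradient_zero_outside:
  assumes "\<And>y. y \<notin> K \<Longrightarrow> f y = 0" "closed K" "x \<notin> K"
  shows "gradient f x = 0"
proof (rule gradient_eqI)
  have "((\<lambda>_. 0) has_derivative (\<lambda>h. 0 \<bullet> h)) (at x)" by simp
  then show "(f has_derivative (\<lambda>h. 0 \<bullet> h)) (at x)"
    by (rule has_derivative_transform_within_open[of _ _ _ _ "- K"]) (use assms in auto)
qed

text \<open>By translation invariance, the integral of every difference quotient of
  \<open>\<psi>\<close> is 0. The quotients converge to the directional derivative and are dominated
  by the Lipschitz constant on a ball.\<close>

lemma integral_gradient_zero:
  fixes \<psi> :: "'a::euclidean_space \<Rightarrow> real"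
  assumes \<psi>: "C_k 1 \<psi>" and supp: "\<And>x. norm x > R \<Longrightarrow> \<psi> x = 0" and b: "b \<in> Basis"
  shows "(LINT x|lborel. gradient \<psi> x \<bullet> b) = 0"
proof -
  have g0: "gradient \<psi> x = 0" if "norm x > R" for x
    by (rule gradient_zero_outside[of "cball 0 R"]) (use supp that in auto)
  have "compact (gradient \<psi> ` cball 0 R)"
    by (intro compact_continuous_image continuous_on_subset[OF C1_continuous_gradient[OF \<psi>]]) auto
  then obtain K where K: "\<forall>x\<in>cball 0 R. norm (gradient \<psi> x) \<le> K"
    by (auto dest!: compact_imp_bounded simp: bounded_iff)
  \<comment> \<open>If \<open>R\<close> is negative, the ball is empty and \<open>K\<close> is
    arbitrary; the maximum with 0 covers this case.\<close>
  have K': "norm (gradient \<psi> x) \<le> max K 0" for x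
    using bspec[OF K, of x] g0[of x] by (cases "norm x \<le> R") auto
  have lip: "\<bar>\<psi> x - \<psi> y\<bar> \<le> max K 0 * norm (x - y)" for x y
  proof -
    have "norm (\<psi> x - \<psi> y) \<le> max K 0 * norm (x - y)"
    proof (rule differentiable_bound[of UNIV])
      show "onorm (\<lambda>h. gradient \<psi> x \<bullet> h) \<le> max K 0" for x
        by (rule onorm_le) (metis K' Cauchy_Schwarz_ineq2 order.trans mult_right_mono norm_ge_zero real_norm_def)
    qed (use C1_has_derivative[OF \<psi>] in auto)
    then show ?thesis by simp
  qed
  have [measurable]: "\<psi> \<in> borel_measurable borel" "gradient \<psi> \<in> borel_measurable borel"
    by (intro borel_measurable_continuous_onI C1_continuous C1_continuous_gradient \<psi>)+
  have int\<psi>: "integrable lborel \<psi>"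
  proof -
    have "integrable lborel (\<lambda>x. if x \<in> cball 0 R then \<psi> x else 0)"
      using borel_integrable_compact[OF compact_cball continuous_on_subset[OF C1_continuous[OF \<psi>] subset_UNIV], of 0 R]
      by (simp add: indicator_def of_bool_def if_distrib[of "\<lambda>c. c * _"] cong: if_cong)
    moreover have "(\<lambda>x. if x \<in> cball 0 R then \<psi> x else 0) = \<psi>" using supp by force
    ultimately show ?thesis by simp
  qed
  have shift: "integrable lborel (\<lambda>x. \<psi> (h + x))" "(LINT x|lborel. \<psi> (h + x)) = (LINT x|lborel. \<psi> x)" for h
    using int\<psi> by (subst (asm) lborel_distr_plus[symmetric, of h], simp add: integrable_distr_eq)
      (subst (2) lborel_distr_plus[symmetric, of h], simp add: integral_distr)
  define s where "s n x = real (Suc n) * (\<psi> (inverse (real (Suc n)) *\<^sub>R b + x) - \<psi> x)" for n x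
  have "(\<lambda>n. LINT x|lborel. s n x) \<longlonglongrightarrow> (LINT x|lborel. gradient \<psi> x \<bullet> b)"
  \<comment> \<open>Translations have length at most 1, so all quotients vanish outside the ball of
    radius \<open>R + 1\<close>.\<close>
  proof (rule integral_dominated_convergence[where w = "\<lambda>x. max K 0 * indicator (cball 0 (R + 1)) x"])
    show "integrable lborel (\<lambda>x. max K 0 * indicator (cball (0::'a) (R + 1)) x)"
      using emeasure_bounded_finite[OF bounded_cball, of "0::'a" "R + 1"]
      by (intro integrable_mult_right integrable_real_indicator) (auto simp: less_top)
    show "AE x in lborel. (\<lambda>n. s n x) \<longlonglongrightarrow> gradient \<psi> x \<bullet> b"
    proof (rule AE_I2)
      fix x
      have "((\<lambda>t. \<psi> (x + t *\<^sub>R b)) has_derivative (\<lambda>t. gradient \<psi> x \<bullet> (t *\<^sub>R b))) (at 0)"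
        by (rule has_derivative_compose[of "\<lambda>t. x + t *\<^sub>R b" "\<lambda>t. t *\<^sub>R b" 0 UNIV \<psi> "\<lambda>h. gradient \<psi> x \<bullet> h"])
          (use C1_has_derivative[OF \<psi>, of x] in \<open>auto intro!: derivative_eq_intros\<close>)
      then have "((\<lambda>t. \<psi> (x + t *\<^sub>R b)) has_real_derivative (gradient \<psi> x \<bullet> b)) (at 0)"
        by (simp add: has_field_derivative_def mult.commute[of _ "gradient \<psi> x \<bullet> b"] cong: if_cong)
      then have "((\<lambda>h. (\<psi> (x + h *\<^sub>R b) - \<psi> x) / h) \<longlongrightarrow> gradient \<psi> x \<bullet> b) (at 0)"
        by (simp add: DERIV_def)
      moreover have "filterlim (\<lambda>n. inverse (real (Suc n))) (at 0) sequentially"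
        using LIMSEQ_inverse_real_of_nat by (auto simp: filterlim_at)
      ultimately have "(\<lambda>n. (\<psi> (x + inverse (real (Suc n)) *\<^sub>R b) - \<psi> x) / inverse (real (Suc n))) \<longlonglongrightarrow> gradient \<psi> x \<bullet> b"
        by (rule filterlim_compose)
      then show "(\<lambda>n. s n x) \<longlonglongrightarrow> gradient \<psi> x \<bullet> b"
        by (simp add: s_def field_simps add.commute)
    qed
    show "AE x in lborel. norm (s n x) \<le> max K 0 * indicator (cball 0 (R + 1)) x" for n
    proof (rule AE_I2)
      fix x :: 'a
      have n1: "norm (inverse (real (Suc n)) *\<^sub>R b) = inverse (real (Suc n))" "inverse (real (Suc n)) \<le> 1"
        using b by (auto simp: field_simps)
      show "norm (s n x) \<le> max K 0 * indicator (cball 0 (R + 1)) x"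
      proof (cases "x \<in> cball 0 (R + 1)")
        case True
        have "norm (s n x) = real (Suc n) * \<bar>\<psi> (inverse (real (Suc n)) *\<^sub>R b + x) - \<psi> x\<bar>"
          by (simp add: s_def abs_mult)
        also have "\<dots> \<le> real (Suc n) * (max K 0 * inverse (real (Suc n)))"
          using lip[of "inverse (real (Suc n)) *\<^sub>R b + x" x] n1 by (intro mult_left_mono) auto
        also have "\<dots> = max K 0" by (simp del: of_nat_Suc)
        finally show ?thesis using True by simp
      next
        case False
        then have "norm x > R + 1" by simp
        moreover have "norm (inverse (real (Suc n)) *\<^sub>R b + x) \<ge> norm x - inverse (real (Suc n))"
          using norm_diff_ineq[of x "inverse (real (Suc n)) *\<^sub>R b"] n1 by (simp add: add.commute)
        ultimately have "norm x > R" "norm (inverse (real (Suc n)) *\<^sub>R b + x) > R" using n1 by linarith+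
        then show ?thesis using False by (simp add: s_def supp)
      qed
    qed
  qed (auto simp: s_def)
  moreover have "(LINT x|lborel. s n x) = 0" for n
    unfolding s_def using shift int\<psi> by simp
  ultimately show ?thesis by (simp add: LIMSEQ_const_iff)
qed

lemma lebesgue_on_integral_eq_lborel:
  fixes g :: "'a::euclidean_space \<Rightarrow> real"
  assumes "U \<in> sets lebesgue" "g \<in> borel_measurable borel" "\<And>x. x \<notin> U \<Longrightarrow> g x = 0"
  shows "(LINT x|lebesgue_on U. g x) = (LINT x|lborel. g x)"
proof -
  have "(LINT x|lebesgue_on U. g x) = (LINT x|lebesgue. indicator U x *\<^sub>R g x)"
    using assms by (simp add: integral_restrict_space)
  also have "\<dots> = (LINT x|lebesgue. g x)"
    by (rule Bochner_Integration.integral_cong) (use assms in \<open>auto simp: indicator_def\<close>)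
  also have "\<dots> = (LINT x|lborel. g x)" using assms by (simp add: integral_completion)
  finally show ?thesis .
qed

lemma test_function_C1: "test_function U \<phi> \<Longrightarrow> C_k 1 \<phi>"
  by (simp add: test_function_def del: C_k.simps)

lemma test_function_support:
  assumes "test_function U \<phi>"
  obtains K where "compact K" "K \<subseteq> U" "\<And>x. x \<notin> K \<Longrightarrow> \<phi> x = 0" "\<And>x. x \<notin> K \<Longrightarrow> gradient \<phi> x = 0"
proof
  let ?K = "closure {x. \<phi> x \<noteq> 0}"
  show "compact ?K" "?K \<subseteq> U" using assms by (auto simp: test_function_def)
  show *: "\<phi> x = 0" if "x \<notin> ?K" for x using that closure_subset[of "{x. \<phi> x \<noteq> 0}"] by auto
  show "gradient \<phi> x = 0" if "x \<notin> ?K" for x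
    by (rule gradient_zero_outside[OF * closed_closure that])
qed

lemma test_function_mono: "test_function U \<phi> \<Longrightarrow> U \<subseteq> U' \<Longrightarrow> test_function U' \<phi>"
  by (auto simp: test_function_def)

text \<open>The product \<open>f x * \<phi> x\<close> has compact support in \<open>U\<close>, so
  the integral of its gradient over \<open>U\<close> is one over the whole space and
  vanishes.\<close>

lemma is_weak_gradient_C1:
  fixes U :: "'a::euclidean_space set"
  assumes U: "open U" "bounded U" and f: "C_k 1 f"
  shows "is_weak_gradient U f (gradient f)"
proof -
  have lm: "U \<in> lmeasurable" using U by (simp add: lmeasurable_open)
  have L: "L2 U f" "L2 U (gradient f)"
    using L2_continuous[OF lm U(2)] C1_continuous[OF f] C1_continuous_gradient[OF f] by auto
  have "(LINT x|lebesgue_on U. f x * frechet_derivative \<phi> (at x) b)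
      = - (LINT x|lebesgue_on U. (gradient f x \<bullet> b) * \<phi> x)"
    if \<phi>: "test_function U \<phi>" and b: "b \<in> Basis" for \<phi> b
  proof -
    have C: "C_k 1 \<phi>" using \<phi> by (rule test_function_C1)
    obtain K where K: "compact K" "K \<subseteq> U" "\<And>x. x \<notin> K \<Longrightarrow> \<phi> x = 0" "\<And>x. x \<notin> K \<Longrightarrow> gradient \<phi> x = 0"
      using test_function_support[OF \<phi>] by metis
    obtain R where R: "\<And>x. x \<in> K \<Longrightarrow> norm x \<le> R"
      using compact_imp_bounded[OF K(1)] by (auto simp: bounded_iff)
    have fd: "frechet_derivative \<phi> (at x) b = gradient \<phi> x \<bullet> b" for x
      using b by (simp add: gradient_inner_Basis)
    have L': "L2 U \<phi>" "L2 U (\<lambda>x. gradient \<phi> x \<bullet> b)"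
      using L2_continuous[OF lm U(2)] C1_continuous[OF C] L2_inner_const[OF L2_continuous[OF lm U(2) C1_continuous_gradient[OF C]]]
      by auto
    have "(LINT x|lebesgue_on U. f x * (gradient \<phi> x \<bullet> b)) + (LINT x|lebesgue_on U. (gradient f x \<bullet> b) * \<phi> x)
        = (LINT x|lebesgue_on U. f x * (gradient \<phi> x \<bullet> b) + (gradient f x \<bullet> b) * \<phi> x)"
      using L2_integrable_mult[OF L(1) L'(2)] L2_integrable_mult[OF L2_inner_const[OF L(2), of b] L'(1)] by simp
    also have "\<dots> = (LINT x|lebesgue_on U. gradient (\<lambda>x. f x * \<phi> x) x \<bullet> b)"
      by (intro Bochner_Integration.integral_cong refl) (simp add: gradient_mult[OF f C] inner_add_left)
    also have "\<dots> = (LINT x|lborel. gradient (\<lambda>x. f x * \<phi> x) x \<bullet> b)"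
    proof (rule lebesgue_on_integral_eq_lborel)
      have "continuous_on UNIV (gradient (\<lambda>x. f x * \<phi> x))"
        by (rule C1_continuous_gradient[OF C_k_mult[OF f C]])
      then show "(\<lambda>x. gradient (\<lambda>x. f x * \<phi> x) x \<bullet> b) \<in> borel_measurable borel"
        by (intro borel_measurable_continuous_onI continuous_intros)
      show "gradient (\<lambda>x. f x * \<phi> x) x \<bullet> b = 0" if "x \<notin> U" for x
      proof -
        have "x \<notin> K" using K(2) that by blast
        then show ?thesis using K(3,4) by (simp add: gradient_mult[OF f C])
      qed
    qed (use lm in auto)
    also have "\<dots> = 0"
    proof (rule integral_gradient_zero[OF C_k_mult[OF f C] _ b])
      show "f x * \<phi> x = 0" if "R < norm x" for x
        using R[of x] K(3)[of x] that by fastforce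
    qed
    finally show ?thesis unfolding fd by simp
  qed
  with L show ?thesis by (simp add: is_weak_gradient_def)
qed

text \<open>The fundamental lemma of the calculus of variations. Dominated convergence along
  \<open>test_functions_approximate_box\<close> gives vanishing integrals over the boxes whose
  closure lies in \<open>U\<close>; they determine \<open>f\<close> locally, and countably many of
  them cover \<open>U\<close>.\<close>

lemma AE_zero_if_test_integrals_zero:
  fixes f :: "'a::euclidean_space \<Rightarrow> real"
  assumes U: "open U" and f: "integrable (lebesgue_on U) f"
    and 0: "\<And>\<phi>. test_function U \<phi> \<Longrightarrow> (LINT x|lebesgue_on U. f x * \<phi> x) = 0"
  shows "AE x in lebesgue_on U. f x = 0"
proof -
  have Us: "U \<in> sets lebesgue" using U by simp
  have fU: "integrable lebesgue (\<lambda>x. indicator U x * f x)"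
    using f Us by (simp add: integrable_restrict_space)
  \<comment> \<open>A Borel representative, because the criterion on box integrals is formulated for
    \<open>lborel\<close>.\<close>
  then obtain f' where f'[measurable]: "f' \<in> borel_measurable lborel"
    and eq: "AE x in lborel. indicator U x * f x = f' x"
    using completion_ex_borel_measurable_real[of "\<lambda>x. indicator U x * f x" lborel] by auto
  have eq': "AE x in lebesgue. indicator U x * f x = f' x" using eq by (rule AE_completion)
  have "integrable lebesgue f'"
    by (rule integrable_cong_AE_imp[OF fU]) (use eq' in \<open>auto intro: measurable_completion\<close>)
  then have f'i: "integrable lborel f'" by (simp add: integrable_completion)
  have box: "(LINT x|lborel. indicator (box a c) x * f' x) = 0" if sub: "cbox a c \<subseteq> U" for a c
  proof -
    obtain \<phi> where \<phi>: "\<And>j. test_function U (\<phi> j)" "\<And>j x. \<bar>\<phi> j x\<bar> \<le> 1"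
      "\<And>x. (\<lambda>j. \<phi> j x) \<longlonglongrightarrow> indicator (box a c) x"
      using test_functions_approximate_box[OF sub] by metis
    have [measurable]: "\<phi> j \<in> borel_measurable borel" for j
      by (intro borel_measurable_continuous_onI C1_continuous test_function_C1[OF \<phi>(1)])
    have "(\<lambda>j. LINT x|lborel. \<phi> j x * f' x) \<longlonglongrightarrow> (LINT x|lborel. indicator (box a c) x * f' x)"
    proof (rule integral_dominated_convergence[where w = "\<lambda>x. norm (f' x)"])
      show "AE x in lborel. (\<lambda>j. \<phi> j x * f' x) \<longlonglongrightarrow> indicator (box a c) x * f' x"
        by (intro AE_I2 tendsto_mult tendsto_const \<phi>)
      show "AE x in lborel. norm (\<phi> j x * f' x) \<le> norm (f' x)" for j
        using \<phi>(2) by (intro AE_I2) (auto simp: abs_mult intro: mult_left_le_one_le)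
    qed (use f'i in auto)
    moreover have "(LINT x|lborel. \<phi> j x * f' x) = 0" for j
    proof -
      obtain K where K: "K \<subseteq> U" "\<And>x. x \<notin> K \<Longrightarrow> \<phi> j x = 0"
        using test_function_support[OF \<phi>(1)[of j]] by metis
      have "(LINT x|lborel. \<phi> j x * f' x) = (LINT x|lebesgue. \<phi> j x * f' x)"
        by (simp add: integral_completion)
      also have "\<dots> = (LINT x|lebesgue. indicator U x *\<^sub>R (f x * \<phi> j x))"
      proof (rule integral_cong_AE)
        have "(\<lambda>x. (indicator U x * f x) * \<phi> j x) \<in> borel_measurable lebesgue"
          by (intro borel_measurable_times borel_measurable_integrable[OF fU] measurable_completion) simp
        then show "(\<lambda>x. indicator U x *\<^sub>R (f x * \<phi> j x)) \<in> borel_measurable lebesgue"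
          by (simp add: mult.assoc)
        show "AE x in lebesgue. \<phi> j x * f' x = indicator U x *\<^sub>R (f x * \<phi> j x)"
          using eq' by eventually_elim (simp add: mult_ac)
      qed (auto intro: measurable_completion)
      also have "\<dots> = (LINT x|lebesgue_on U. f x * \<phi> j x)" using Us by (simp add: integral_restrict_space)
      finally show ?thesis using 0[OF \<phi>(1)] by simp
    qed
    ultimately show ?thesis by (simp add: LIMSEQ_const_iff)
  qed
  have boxAE: "AE x in lborel. x \<in> box a c \<longrightarrow> f' x = 0" if sub: "cbox a c \<subseteq> U" for a c
  proof -
    have "AE x in lborel. indicator (box a c) x * f' x = 0"
    proof (rule AE_zero_if_box_integrals_zero)
      show "integrable lborel (\<lambda>x. indicator (box a c) x * f' x)"
        using integrable_mult_indicator[of "box a c" lborel f'] f'i by simp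
      fix a' c' :: 'a
      obtain p q where pq: "box a' c' \<inter> box a c = box p q" using box_Int_box[of a' c' a c] by blast
      have "(LINT x|lborel. indicator (box p q) x * f' x) = 0"
      proof (cases "box p q = {}")
        case False
        have "box p q \<subseteq> box a c" using pq by auto
        \<comment> \<open>A closed box is the closure of its open box only if the latter is
          nonempty; an empty \<open>box p q\<close> may come with a nonempty \<open>cbox p q\<close>
          outside of \<open>U\<close>.\<close>
        then have "cbox p q \<subseteq> cbox a c" using False
          by (metis closure_box closure_mono box_eq_empty(1) subset_empty)
        then show ?thesis using sub by (intro box) auto
      qed simp
      moreover have "indicator (box a' c') x * (indicator (box a c) x * f' x) = indicator (box p q) x * f' x" for x
        unfolding pq[symmetric] by (auto simp: indicator_def)
      ultimately show "(LINT x|lborel. indicator (box a' c') x * (indicator (box a c) x * f' x)) = 0" by (simp only:)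
    qed
    then show ?thesis by eventually_elim (auto simp: indicator_def)
  qed
  have cboxAE: "AE x in lebesgue. x \<in> cbox a c \<longrightarrow> f' x = 0" if sub: "cbox a c \<subseteq> U" for a c
  proof -
    have "AE x in lebesgue. x \<notin> cbox a c - box a c"
      using negligible_frontier_interval[of a c] by (intro AE_not_in) (simp add: negligible_iff_null_sets)
    with AE_completion[OF boxAE[OF sub]] show ?thesis by eventually_elim auto
  qed
  obtain D where D: "countable D" "\<And>X. X \<in> D \<Longrightarrow> X \<subseteq> U" "\<And>X. X \<in> D \<Longrightarrow> \<exists>a b. X = cbox a b" "\<Union>D = U"
    using open_countable_Union_open_cbox[OF U] by (metis Pow_iff subsetD)
  have "AE x in lebesgue. \<forall>X\<in>D. x \<in> X \<longrightarrow> f' x = 0"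
    using D(1) by (subst AE_ball_countable) (use D cboxAE in metis)+
  with eq' have "AE x in lebesgue. x \<in> U \<longrightarrow> f x = 0"
    by eventually_elim (use D(4) in \<open>auto simp: indicator_def\<close>)
  then show ?thesis using Us by (simp add: AE_restrict_space_iff)
qed

text \<open>The two functions need only agree almost everywhere, because expansions into
  eigenfunctions hold in this sense.\<close>

lemma is_weak_gradient_unique:
  fixes U :: "'a::euclidean_space set"
  assumes U: "open U" "bounded U" and G: "is_weak_gradient U u G" and G': "is_weak_gradient U w G'"
    and eq: "AE x in lebesgue_on U. u x = w x"
  shows "AE x in lebesgue_on U. G x = G' x"
proof -
  have lm: "U \<in> lmeasurable" using U by (simp add: lmeasurable_open)
  have L: "L2 U u" "L2 U w" "L2 U G" "L2 U G'" using G G' by (auto simp: is_weak_gradient_def)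
  have "AE x in lebesgue_on U. (G x - G' x) \<bullet> b = 0" if b: "b \<in> Basis" for b
  proof (rule AE_zero_if_test_integrals_zero[OF U(1)])
    show "integrable (lebesgue_on U) (\<lambda>x. (G x - G' x) \<bullet> b)"
      by (intro L2_integrable lm L2_inner_const L2_diff L)
    fix \<phi> :: "'a \<Rightarrow> real" assume \<phi>: "test_function U \<phi>"
    have L\<phi>: "L2 U \<phi>" by (rule L2_continuous[OF lm U(2) C1_continuous[OF test_function_C1[OF \<phi>]]])
    have m: "(\<lambda>x. frechet_derivative \<phi> (at x) b) \<in> borel_measurable (lebesgue_on U)"
      using L2_inner_const[OF L2_continuous[OF lm U(2) C1_continuous_gradient[OF test_function_C1[OF \<phi>]]], of b] b
      by (simp add: L2_def gradient_inner_Basis)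
    have "(LINT x|lebesgue_on U. (G x - G' x) \<bullet> b * \<phi> x)
        = (LINT x|lebesgue_on U. (G x \<bullet> b) * \<phi> x) - (LINT x|lebesgue_on U. (G' x \<bullet> b) * \<phi> x)"
      using L2_integrable_mult[OF L2_inner_const[OF L(3), of b] L\<phi>] L2_integrable_mult[OF L2_inner_const[OF L(4), of b] L\<phi>]
      by (simp add: inner_diff_left left_diff_distrib)
    also have "\<dots> = (LINT x|lebesgue_on U. w x * frechet_derivative \<phi> (at x) b) - (LINT x|lebesgue_on U. u x * frechet_derivative \<phi> (at x) b)"
      using G G' \<phi> b by (simp add: is_weak_gradient_def)
    also have "(LINT x|lebesgue_on U. w x * frechet_derivative \<phi> (at x) b) = (LINT x|lebesgue_on U. u x * frechet_derivative \<phi> (at x) b)"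
      by (rule integral_cong_AE) (use L m eq in \<open>auto simp: L2_def\<close>)
    finally show "(LINT x|lebesgue_on U. (G x - G' x) \<bullet> b * \<phi> x) = 0" by simp
  qed
  then have "AE x in lebesgue_on U. \<forall>b\<in>Basis. (G x - G' x) \<bullet> b = 0"
    by (simp only: AE_ball_countable[OF countable_finite[OF finite_Basis]] ball_simps) simp
  then show ?thesis
  proof eventually_elim
    case (elim x)
    show "G x = G' x" by (rule euclidean_eqI) (use elim in \<open>simp add: inner_diff_left\<close>)
  qed
qed

lemma weak_grad_AE_eq:
  assumes "open U" "bounded U" "is_weak_gradient U u G"
  shows "AE x in lebesgue_on U. weak_grad U u x = G x"
proof -
  have "is_weak_gradient U u (weak_grad U u)"
    unfolding weak_grad_def by (rule someI[of "is_weak_gradient U u", OF assms(3)])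
  from is_weak_gradient_unique[OF assms(1,2) this assms(3)] show ?thesis by simp
qed

lemma is_weak_gradient_weak_grad: "u \<in> H1 U \<Longrightarrow> is_weak_gradient U u (weak_grad U u)"
  unfolding weak_grad_def H1_def by (auto intro: someI[of "is_weak_gradient U u"])

lemma is_weak_gradient_AE_cong:
  assumes U: "U \<in> sets lebesgue" and G: "is_weak_gradient U u G"
    and u: "AE x in lebesgue_on U. u x = u' x" and GG: "AE x in lebesgue_on U. G x = G' x"
  shows "is_weak_gradient U u' G'"
proof -
  have L: "L2 U u" "L2 U G" using G by (auto simp: is_weak_gradient_def)
  have L': "L2 U u'" "L2 U G'" using L2_AE_cong[OF U] L u GG by blast+
  have "(LINT x|lebesgue_on U. u' x * frechet_derivative \<phi> (at x) b) = - (LINT x|lebesgue_on U. (G' x \<bullet> b) * \<phi> x)"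
    if \<phi>: "test_function U \<phi>" and b: "b \<in> Basis" for \<phi> b
  proof -
    have m: "\<phi> \<in> borel_measurable (lebesgue_on U)"
      by (intro continuous_imp_measurable_on_sets_lebesgue U continuous_on_subset[OF C1_continuous[OF test_function_C1[OF \<phi>]]]) auto
    have "gradient \<phi> \<in> borel_measurable (lebesgue_on U)"
      by (intro continuous_imp_measurable_on_sets_lebesgue U continuous_on_subset[OF C1_continuous_gradient[OF test_function_C1[OF \<phi>]]]) auto
    then have "(\<lambda>x. gradient \<phi> x \<bullet> b) \<in> borel_measurable (lebesgue_on U)" by simp
    then have m': "(\<lambda>x. frechet_derivative \<phi> (at x) b) \<in> borel_measurable (lebesgue_on U)"
      using b by (simp add: gradient_inner_Basis)
    have "(LINT x|lebesgue_on U. u' x * frechet_derivative \<phi> (at x) b) = (LINT x|lebesgue_on U. u x * frechet_derivative \<phi> (at x) b)"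
      by (rule integral_cong_AE) (use L L' m' u in \<open>auto simp: L2_def\<close>)
    moreover have "(LINT x|lebesgue_on U. (G' x \<bullet> b) * \<phi> x) = (LINT x|lebesgue_on U. (G x \<bullet> b) * \<phi> x)"
      by (rule integral_cong_AE) (use L L' m GG in \<open>auto simp: L2_def\<close>)
    ultimately show ?thesis using G \<phi> b by (simp add: is_weak_gradient_def)
  qed
  with L' show ?thesis by (simp add: is_weak_gradient_def)
qed

lemma is_weak_gradient_lincomb:
  fixes U :: "'a::euclidean_space set"
  assumes U: "open U" "bounded U" and u: "is_weak_gradient U u G" and w: "is_weak_gradient U w H"
  shows "is_weak_gradient U (\<lambda>x. \<alpha> * u x + \<beta> * w x) (\<lambda>x. \<alpha> *\<^sub>R G x + \<beta> *\<^sub>R H x)"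
proof -
  have lm: "U \<in> lmeasurable" using U by (simp add: lmeasurable_open)
  have L: "L2 U u" "L2 U w" "L2 U G" "L2 U H" using u w by (auto simp: is_weak_gradient_def)
  have "(LINT x|lebesgue_on U. (\<alpha> * u x + \<beta> * w x) * frechet_derivative \<phi> (at x) b)
      = - (LINT x|lebesgue_on U. ((\<alpha> *\<^sub>R G x + \<beta> *\<^sub>R H x) \<bullet> b) * \<phi> x)"
    if \<phi>: "test_function U \<phi>" and b: "b \<in> Basis" for \<phi> b
  proof -
    have L\<phi>: "L2 U \<phi>" by (rule L2_continuous[OF lm U(2) C1_continuous[OF test_function_C1[OF \<phi>]]])
    have L\<phi>': "L2 U (\<lambda>x. frechet_derivative \<phi> (at x) b)"
      using L2_inner_const[OF L2_continuous[OF lm U(2) C1_continuous_gradient[OF test_function_C1[OF \<phi>]]], of b] b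
      by (simp add: gradient_inner_Basis)
    have "(LINT x|lebesgue_on U. (\<alpha> * u x + \<beta> * w x) * frechet_derivative \<phi> (at x) b)
      = (LINT x|lebesgue_on U. \<alpha> * (u x * frechet_derivative \<phi> (at x) b) + \<beta> * (w x * frechet_derivative \<phi> (at x) b))"
      by (simp add: algebra_simps)
    also have "\<dots> = \<alpha> * (LINT x|lebesgue_on U. u x * frechet_derivative \<phi> (at x) b) + \<beta> * (LINT x|lebesgue_on U. w x * frechet_derivative \<phi> (at x) b)"
      using L2_integrable_mult[OF L(1) L\<phi>'] L2_integrable_mult[OF L(2) L\<phi>'] by simp
    also have "\<dots> = - (\<alpha> * (LINT x|lebesgue_on U. (G x \<bullet> b) * \<phi> x) + \<beta> * (LINT x|lebesgue_on U. (H x \<bullet> b) * \<phi> x))"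
      using u w \<phi> b by (simp add: is_weak_gradient_def)
    also have "\<alpha> * (LINT x|lebesgue_on U. (G x \<bullet> b) * \<phi> x) + \<beta> * (LINT x|lebesgue_on U. (H x \<bullet> b) * \<phi> x)
      = (LINT x|lebesgue_on U. \<alpha> * ((G x \<bullet> b) * \<phi> x) + \<beta> * ((H x \<bullet> b) * \<phi> x))"
      using L2_integrable_mult[OF L2_inner_const[OF L(3), of b] L\<phi>] L2_integrable_mult[OF L2_inner_const[OF L(4), of b] L\<phi>]
      by simp
    also have "\<dots> = (LINT x|lebesgue_on U. ((\<alpha> *\<^sub>R G x + \<beta> *\<^sub>R H x) \<bullet> b) * \<phi> x)"
      by (simp add: inner_add_left algebra_simps)
    finally show ?thesis .
  qed
  moreover have "L2 U (\<lambda>x. \<alpha> * u x + \<beta> * w x)" "L2 U (\<lambda>x. \<alpha> *\<^sub>R G x + \<beta> *\<^sub>R H x)"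
    using L by (auto intro!: L2_add L2_mult L2_scaleR)
  ultimately show ?thesis by (simp add: is_weak_gradient_def)
qed

text \<open>A test function of \<open>S\<close> is one of \<open>U\<close>, and the integrals over
  \<open>S\<close> and \<open>U\<close> coincide because the integrands vanish outside
  \<open>S\<close>.\<close>

lemma is_weak_gradient_subset:
  fixes U :: "'a::euclidean_space set"
  assumes S: "open S" "S \<subseteq> U" and U: "open U" and u: "is_weak_gradient U u G"
  shows "is_weak_gradient S u G"
proof -
  have "(LINT x|lebesgue_on S. u x * frechet_derivative \<phi> (at x) b) = - (LINT x|lebesgue_on S. (G x \<bullet> b) * \<phi> x)"
    if \<phi>: "test_function S \<phi>" and b: "b \<in> Basis" for \<phi> b
  proof -
    obtain K where K: "K \<subseteq> S" "\<And>x. x \<notin> K \<Longrightarrow> \<phi> x = 0" "\<And>x. x \<notin> K \<Longrightarrow> gradient \<phi> x = 0"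
      using test_function_support[OF \<phi>] by metis
    have z: "frechet_derivative \<phi> (at x) b = 0" if "x \<notin> S" for x
    proof -
      have "x \<notin> K" using K(1) that by blast
      from K(3)[OF this] show ?thesis using gradient_inner_Basis[OF b, of \<phi> x] by simp
    qed
    have "(LINT x|lebesgue_on S. h x) = (LINT x|lebesgue_on U. h x)" if "\<And>x. x \<notin> S \<Longrightarrow> h x = 0" for h :: "'a \<Rightarrow> real"
    proof -
      have "indicator S x *\<^sub>R h x = indicator U x *\<^sub>R h x" for x
        using that S by (auto simp: indicator_def)
      then have "(\<lambda>x. indicator S x *\<^sub>R h x) = (\<lambda>x. indicator U x *\<^sub>R h x)" by (rule ext)
      moreover have "(LINT x|lebesgue_on A. h x) = (LINT x|lebesgue. indicator A x *\<^sub>R h x)" if "open A" for A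
        by (rule integral_restrict_space) (use that in simp)
      ultimately show ?thesis using S U by simp
    qed
    note * = this
    have "\<phi> x = 0" if "x \<notin> S" for x using K(1) K(2)[of x] that by blast
    then have "(LINT x|lebesgue_on S. (G x \<bullet> b) * \<phi> x) = (LINT x|lebesgue_on U. (G x \<bullet> b) * \<phi> x)"
      by (intro *) simp
    moreover have "(LINT x|lebesgue_on S. u x * frechet_derivative \<phi> (at x) b)
        = (LINT x|lebesgue_on U. u x * frechet_derivative \<phi> (at x) b)"
      by (intro *) (simp add: z)
    ultimately show ?thesis using u test_function_mono[OF \<phi> S(2)] b by (auto simp: is_weak_gradient_def)
  qed
  moreover have "L2 S u" "L2 S G" using u S U by (auto simp: is_weak_gradient_def intro: L2_subset)
  ultimately show ?thesis by (simp add: is_weak_gradient_def)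
qed

section \<open>Integration over cones\<close>

lemma nn_integral_lborel_translation:
  fixes g :: "'a::euclidean_space \<Rightarrow> ennreal"
  assumes [measurable]: "g \<in> borel_measurable borel"
  shows "(\<integral>\<^sup>+x. g (x + a) \<partial>lborel) = (\<integral>\<^sup>+x. g x \<partial>lborel)"
  by (subst (2) lborel_distr_plus[symmetric, of a]) (simp add: nn_integral_distr add.commute)

lemma nn_integral_lborel_dilation:
  fixes g :: "'a::euclidean_space \<Rightarrow> ennreal"
  assumes [measurable]: "g \<in> borel_measurable borel" and s: "s > 0"
  shows "(\<integral>\<^sup>+x. g x \<partial>lborel) = ennreal (s ^ DIM('a)) * (\<integral>\<^sup>+x. g (P + s *\<^sub>R (x - P)) \<partial>lborel)"
proof -
  have "(\<integral>\<^sup>+x. g x \<partial>lborel) = (\<integral>\<^sup>+x. ennreal (\<bar>s\<bar> ^ DIM('a)) * g ((P - s *\<^sub>R P) + s *\<^sub>R x) \<partial>lborel)"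
    using s by (subst lborel_affine[of s "P - s *\<^sub>R P"]) (simp_all add: nn_integral_density nn_integral_distr)
  also have "\<dots> = ennreal (s ^ DIM('a)) * (\<integral>\<^sup>+x. g (P + s *\<^sub>R (x - P)) \<partial>lborel)"
    using s by (simp add: nn_integral_cmult algebra_simps)
  finally show ?thesis .
qed

text \<open>Cauchy-Schwarz against the constant 1. The measure is arbitrary because the lemma serves
  both for the surface measure of a face and for Lebesgue measure on a segment of a ray.\<close>

lemma Jensen_square_finite_measure:
  fixes k :: "'b \<Rightarrow> real"
  assumes M: "finite_measure M" and k[measurable]: "k \<in> borel_measurable M"
    and k2: "integrable M (\<lambda>x. (k x)\<^sup>2)"
  shows "integrable M k" "(LINT x|M. k x)\<^sup>2 \<le> measure M (space M) * (LINT x|M. (k x)\<^sup>2)"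
proof -
  interpret finite_measure M by (rule M)
  have "\<bar>k x\<bar> \<le> 1 + (k x)\<^sup>2" for x
    using sum_squares_bound[of "\<bar>k x\<bar>" 1] by simp
  note le = this
  have "integrable M (\<lambda>x. 1 + (k x)\<^sup>2)" using k2 by simp
  then show int: "integrable M k"
    by (rule integrable_if_abs_le[OF _ k le])
  define m where "m = measure M (space M)"
  define I where "I = (LINT x|M. k x)"
  have *: "0 \<le> m * t\<^sup>2 - 2 * t * I + (LINT x|M. (k x)\<^sup>2)" for t
  proof -
    have "0 \<le> (LINT x|M. (t - k x)\<^sup>2)" by simp
    also have "(LINT x|M. (t - k x)\<^sup>2) = (LINT x|M. t\<^sup>2 - 2 * t * k x + (k x)\<^sup>2)"
      by (simp add: power2_diff algebra_simps)
    also have "\<dots> = m * t\<^sup>2 - 2 * t * I + (LINT x|M. (k x)\<^sup>2)"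
      using int k2 by (simp add: m_def I_def)
    finally show ?thesis .
  qed
  have "I\<^sup>2 \<le> m * (LINT x|M. (k x)\<^sup>2)"
  proof (cases "m = 0")
    case True
    have "I = 0"
    proof (rule ccontr)
      assume "I \<noteq> 0"
      then show False using *[of "((LINT x|M. (k x)\<^sup>2) + 1) / (2 * I)"] True by simp
    qed
    then show ?thesis using True by simp
  next
    case False
    then have "m > 0" by (simp add: m_def zero_less_measure_iff)
    then show ?thesis using *[of "I / m"] by (simp add: power2_eq_square field_simps)
  qed
  then show "(LINT x|M. k x)\<^sup>2 \<le> measure M (space M) * (LINT x|M. (k x)\<^sup>2)"
    by (simp add: I_def m_def)
qed

text \<open>\<open>N\<close> is the unit normal of the plane of \<open>F\<close> that points away
  from the apex \<open>P\<close>, and \<open>h\<close> is the height of the cone.\<close>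

locale cone_over_face =
  fixes F :: "'a::euclidean_space set" and P N :: 'a and c h :: real
  assumes compact_F: "compact F"
    and affine_hull_F: "affine hull F = {x. N \<bullet> x = c}"
    and norm_N: "norm N = 1"
    and h_pos: "h > 0"
    and apex: "N \<bullet> P = c - h"
begin

definition foot :: "'a \<Rightarrow> 'a" where "foot x = x - (N \<bullet> x - c) *\<^sub>R N"
text \<open>The ray parameter: it is 0 at the apex and 1 on the plane of the face, so that P + s (y
  - P) with y in \<open>F\<close> has level s.\<close>

definition level :: "'a \<Rightarrow> real" where "level x = N \<bullet> (x - P) / h"
definition infinite_cone :: "'a set" where
  "infinite_cone = {x. level x > 0 \<and> P + (x - P) /\<^sub>R level x \<in> F}"
text \<open>Jacobian of the map (y, s) \<mapsto> P + s (y - P) from \<open>F\<close> times the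
  positive half-line to the cone.\<close>

definition weight :: "real \<Rightarrow> real" where
  "weight s = indicator {0<..} s * (h * s ^ (DIM('a) - 1))"

lemma N_N: "N \<bullet> N = 1"
  using norm_N by (simp add: norm_eq_1)

lemma N_F: "y \<in> F \<Longrightarrow> N \<bullet> y = c"
  using affine_hull_F hull_subset[of F affine] by auto

lemma closest_point_eq_foot: "closest_point (affine hull F) x = foot x"
proof (rule closest_point_unique[symmetric])
  show "foot x \<in> affine hull F"
    by (simp add: affine_hull_F foot_def inner_diff_right N_N)
  show "\<forall>z\<in>affine hull F. dist x (foot x) \<le> dist x z"
  proof
    fix z assume "z \<in> affine hull F"
    then have "N \<bullet> x - c = N \<bullet> (x - z)" by (simp add: affine_hull_F inner_diff_right)
    then have "\<bar>N \<bullet> x - c\<bar> \<le> norm (x - z)" using Cauchy_Schwarz_ineq2[of N "x - z"] norm_N by simp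
    then show "dist x (foot x) \<le> dist x z" using norm_N by (simp add: dist_norm foot_def)
  qed
qed (auto simp: affine_imp_convex closed_affine_hull)

lemma continuous_foot: "continuous_on A foot"
  unfolding foot_def by (intro continuous_intros)

lemma foot_measurable[measurable]: "foot \<in> borel_measurable borel"
  by (intro borel_measurable_continuous_onI continuous_foot)

lemma level_measurable[measurable]: "level \<in> borel_measurable borel"
  unfolding level_def by measurable

lemma F_borel[measurable]: "F \<in> sets borel"
  using compact_F by (simp add: borel_compact)

lemma prism_eq: "prism F = {x. foot x \<in> F \<and> \<bar>N \<bullet> x - c\<bar> \<le> 1 / 2}"
proof -
  have "dist x (foot x) = \<bar>N \<bullet> x - c\<bar>" for x using norm_N by (simp add: dist_norm foot_def)
  then show ?thesis by (simp add: prism_def closest_point_eq_foot)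
qed

lemma prism_borel[measurable]: "prism F \<in> sets borel"
  unfolding prism_eq by measurable

lemma bounded_prism: "bounded (prism F)"
proof -
  obtain B where B: "\<And>x. x \<in> F \<Longrightarrow> norm x \<le> B"
    using compact_imp_bounded[OF compact_F] by (auto simp: bounded_iff)
  have "norm x \<le> B + 1 / 2" if "x \<in> prism F" for x
  proof -
    have "norm x \<le> norm (foot x) + norm ((N \<bullet> x - c) *\<^sub>R N)"
      using norm_triangle_ineq[of "foot x" "(N \<bullet> x - c) *\<^sub>R N"] by (simp add: foot_def)
    then show ?thesis using that B[of "foot x"] norm_N by (simp add: prism_eq)
  qed
  then show ?thesis by (auto simp: bounded_iff)
qed

lemma sets_surface_measure[simp, measurable_cong]: "sets (surface_measure F) = sets borel"
  by (simp add: surface_measure_def)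

lemma space_surface_measure[simp]: "space (surface_measure F) = UNIV"
  by (simp add: surface_measure_def)

lemma closest_point_measurable: "closest_point (affine hull F) \<in> lebesgue_on (prism F) \<rightarrow>\<^sub>M borel"
proof -
  have "closest_point (affine hull F) = foot" by (auto simp: closest_point_eq_foot)
  moreover have "foot \<in> lebesgue_on (prism F) \<rightarrow>\<^sub>M borel"
    by (intro measurable_restrict_space1 measurable_completion) simp
  ultimately show ?thesis by simp
qed

lemma nn_integral_surface_measure:
  assumes [measurable]: "f \<in> borel_measurable borel"
  shows "(\<integral>\<^sup>+y. f y \<partial>surface_measure F) = (\<integral>\<^sup>+x. indicator (prism F) x * f (foot x) \<partial>lborel)"
proof -
  have "(\<integral>\<^sup>+y. f y \<partial>surface_measure F) = (\<integral>\<^sup>+x. f (foot x) \<partial>lebesgue_on (prism F))"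
    unfolding surface_measure_def
    by (subst nn_integral_distr[OF closest_point_measurable]) (simp_all add: closest_point_eq_foot)
  also have "\<dots> = (\<integral>\<^sup>+x. f (foot x) * indicator (prism F) x \<partial>lebesgue)"
    by (subst nn_integral_restrict_space) auto
  also have "\<dots> = (\<integral>\<^sup>+x. f (foot x) * indicator (prism F) x \<partial>lborel)"
    by (simp add: nn_integral_completion)
  finally show ?thesis by (simp add: mult.commute)
qed

lemma finite_surface_measure: "finite_measure (surface_measure F)"
proof
  have "emeasure (surface_measure F) (space (surface_measure F)) = (\<integral>\<^sup>+y. 1 \<partial>surface_measure F)"
    by simp
  also have "\<dots> = emeasure lborel (prism F)" by (subst nn_integral_surface_measure) simp_all
  also have "\<dots> < \<infinity>" by (rule emeasure_bounded_finite[OF bounded_prism])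
  finally show "emeasure (surface_measure F) (space (surface_measure F)) \<noteq> \<infinity>" by simp
qed

sublocale surface: finite_measure "surface_measure F"
  by (rule finite_surface_measure)

sublocale surface_line: pair_sigma_finite "surface_measure F" "lborel :: real measure"
  by (simp add: pair_sigma_finite_def surface.sigma_finite_measure_axioms sigma_finite_lborel)

lemma AE_surface_measure: "AE y in surface_measure F. y \<in> F"
proof (rule AE_I[of _ _ "- F"])
  have "emeasure (surface_measure F) (- F) = (\<integral>\<^sup>+y. indicator (- F) y \<partial>surface_measure F)"
    by (subst nn_integral_indicator) auto
  also have "\<dots> = (\<integral>\<^sup>+x. indicator (prism F) x * indicator (- F) (foot x) \<partial>lborel)"
    by (rule nn_integral_surface_measure) simp
  also have "\<dots> = (\<integral>\<^sup>+(x::'a). 0 \<partial>lborel)"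
    by (intro nn_integral_cong) (auto simp: indicator_def prism_eq)
  finally show "emeasure (surface_measure F) (- F) = 0" by simp
qed auto

lemma infinite_cone_borel[measurable]: "infinite_cone \<in> sets borel"
  unfolding infinite_cone_def by measurable

lemma weight_measurable[measurable]: "weight \<in> borel_measurable borel"
  unfolding weight_def by measurable

lemma weight_nonneg: "weight s \<ge> 0"
  using h_pos by (auto simp: weight_def indicator_def)

text \<open>The slices of the cone parallel to the face are disintegrated by translating in normal
  direction, which only uses the translation and dilation behaviour of Lebesgue measure.\<close>

lemma nn_integral_cone:
  fixes f :: "'a \<Rightarrow> ennreal"
  assumes [measurable]: "f \<in> borel_measurable borel"
  shows "(\<integral>\<^sup>+y. \<integral>\<^sup>+s. ennreal (weight s) * f (P + s *\<^sub>R (y - P)) \<partial>lborel \<partial>surface_measure F)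
      = (\<integral>\<^sup>+x. indicator infinite_cone x * f x \<partial>lborel)"
proof -
  \<comment> \<open>The integrand after the dilation by \<open>s\<close> about the apex:
    \<open>x\<close> ranges over the stretched prism of thickness \<open>s\<close> around the plane
    of level \<open>s\<close>, and \<open>f\<close> is evaluated at the projection of
    \<open>x\<close> to this plane.\<close>
  define H where "H x s = indicator {0<..} s * ennreal (h / s) * indicator (prism F) (P + (1 / s) *\<^sub>R (x - P))
      * f (x - (N \<bullet> (x - P) - s * h) *\<^sub>R N)" for x :: 'a and s :: real
  have H_meas[measurable]: "case_prod H \<in> borel_measurable (lborel \<Otimes>\<^sub>M lborel)"
    unfolding H_def by measurable
  have "(\<integral>\<^sup>+y. \<integral>\<^sup>+s. ennreal (weight s) * f (P + s *\<^sub>R (y - P)) \<partial>lborel \<partial>surface_measure F)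
      = (\<integral>\<^sup>+x. indicator (prism F) x * (\<integral>\<^sup>+s. ennreal (weight s) * f (P + s *\<^sub>R (foot x - P)) \<partial>lborel) \<partial>lborel)"
    by (rule nn_integral_surface_measure) measurable
  also have "\<dots> = (\<integral>\<^sup>+x. \<integral>\<^sup>+s. indicator (prism F) x * (ennreal (weight s) * f (P + s *\<^sub>R (foot x - P))) \<partial>lborel \<partial>lborel)"
    by (simp add: nn_integral_cmult)
  also have "\<dots> = (\<integral>\<^sup>+s. \<integral>\<^sup>+x. indicator (prism F) x * (ennreal (weight s) * f (P + s *\<^sub>R (foot x - P))) \<partial>lborel \<partial>lborel)"
    by (rule lborel_pair.Fubini'[symmetric]) measurable
  also have "\<dots> = (\<integral>\<^sup>+s. \<integral>\<^sup>+x. H x s \<partial>lborel \<partial>lborel)"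
  proof (rule nn_integral_cong)
    fix s :: real
    show "(\<integral>\<^sup>+x. indicator (prism F) x * (ennreal (weight s) * f (P + s *\<^sub>R (foot x - P))) \<partial>lborel) = (\<integral>\<^sup>+x. H x s \<partial>lborel)"
    proof (cases "s > 0")
      case False
      then show ?thesis by (simp add: weight_def H_def)
    next
      case True
      have foot_eq: "P + s *\<^sub>R (foot (P + (1 / s) *\<^sub>R (x - P)) - P) = x - (N \<bullet> (x - P) - s * h) *\<^sub>R N" for x
      proof -
        have 1: "N \<bullet> (P + (1 / s) *\<^sub>R (x - P)) - c = N \<bullet> (x - P) / s - h"
          using apex by (simp add: inner_add_right)
        have "P + s *\<^sub>R ((P + b - a) - P) = P + s *\<^sub>R b - s *\<^sub>R a" for a b :: 'a
          by (simp add: algebra_simps)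
        then show ?thesis
          unfolding foot_def 1 using True by (simp add: right_diff_distrib scaleR_left_diff_distrib)
      qed
      have w: "ennreal ((1 / s) ^ DIM('a)) * ennreal (weight s) = ennreal (h / s)"
      proof -
        have "s ^ DIM('a) = s * s ^ (DIM('a) - 1)"
          by (simp add: power_eq_if)
        then have "(1 / s) ^ DIM('a) * weight s = h / s"
          using True by (simp add: weight_def power_divide)
        then show ?thesis using True by (simp add: ennreal_mult[symmetric] weight_nonneg)
      qed
      have "(\<integral>\<^sup>+x. indicator (prism F) x * (ennreal (weight s) * f (P + s *\<^sub>R (foot x - P))) \<partial>lborel)
         = ennreal ((1 / s) ^ DIM('a)) * (\<integral>\<^sup>+x. indicator (prism F) (P + (1 / s) *\<^sub>R (x - P)) *
            (ennreal (weight s) * f (P + s *\<^sub>R (foot (P + (1 / s) *\<^sub>R (x - P)) - P))) \<partial>lborel)"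
        by (rule nn_integral_lborel_dilation) (use True in \<open>measurable, simp\<close>)
      also have "\<dots> = (\<integral>\<^sup>+x. (ennreal ((1 / s) ^ DIM('a)) * ennreal (weight s)) * (indicator (prism F) (P + (1 / s) *\<^sub>R (x - P)) *
            f (P + s *\<^sub>R (foot (P + (1 / s) *\<^sub>R (x - P)) - P))) \<partial>lborel)"
        by (subst nn_integral_cmult[symmetric]) (auto simp: mult_ac)
      also have "\<dots> = (\<integral>\<^sup>+x. H x s \<partial>lborel)"
        unfolding w foot_eq using True by (intro nn_integral_cong) (simp add: H_def mult.assoc)
      finally show ?thesis .
    qed
  qed
  also have "\<dots> = (\<integral>\<^sup>+x. \<integral>\<^sup>+s. H x s \<partial>lborel \<partial>lborel)"
    by (rule lborel_pair.Fubini') measurable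
  \<comment> \<open>Here \<open>s\<close> is replaced by the offset t = N . (x - P) - s h of
    \<open>x\<close> from the plane of level \<open>s\<close>.\<close>
  also have "\<dots> = (\<integral>\<^sup>+x. \<integral>\<^sup>+t. ennreal (1 / h) * H x ((N \<bullet> (x - P) - t) / h) \<partial>lborel \<partial>lborel)"
  proof (rule nn_integral_cong)
    fix x
    have "(\<integral>\<^sup>+s. H x s \<partial>lborel) = ennreal \<bar>- 1 / h\<bar> * (\<integral>\<^sup>+t. H x (N \<bullet> (x - P) / h + - 1 / h * t) \<partial>lborel)"
      by (rule nn_integral_real_affine) (use h_pos in auto)
    also have "\<dots> = (\<integral>\<^sup>+t. ennreal (1 / h) * H x ((N \<bullet> (x - P) - t) / h) \<partial>lborel)"
      using h_pos by (subst nn_integral_cmult[symmetric]) (auto simp: diff_divide_distrib)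
    finally show "(\<integral>\<^sup>+s. H x s \<partial>lborel) = (\<integral>\<^sup>+t. ennreal (1 / h) * H x ((N \<bullet> (x - P) - t) / h) \<partial>lborel)" .
  qed
  also have "\<dots> = (\<integral>\<^sup>+t. \<integral>\<^sup>+x. ennreal (1 / h) * H x ((N \<bullet> (x - P) - t) / h) \<partial>lborel \<partial>lborel)"
    by (rule lborel_pair.Fubini'[symmetric]) measurable
  \<comment> \<open>After the translation by \<open>t *\<^sub>R N\<close>, \<open>x\<close> itself
    is the point where \<open>f\<close> is evaluated, and the former \<open>s\<close> is its
    level.\<close>
  also have "\<dots> = (\<integral>\<^sup>+t. \<integral>\<^sup>+x. ennreal (1 / h) * H (x + t *\<^sub>R N) ((N \<bullet> (x + t *\<^sub>R N - P) - t) / h) \<partial>lborel \<partial>lborel)"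
    by (intro nn_integral_cong nn_integral_lborel_translation[symmetric]) measurable
  \<comment> \<open>The offset now ranges over an interval of length \<open>level x\<close>, which
    will cancel the factor \<open>1 / level x\<close>.\<close>
  also have "\<dots> = (\<integral>\<^sup>+t. \<integral>\<^sup>+x. (indicator infinite_cone x * f x * ennreal (1 / level x)) *
        indicator {- (level x / 2) .. level x / 2} t \<partial>lborel \<partial>lborel)"
  proof (intro nn_integral_cong)
    fix t :: real and x :: 'a
    have lev: "(N \<bullet> (x + t *\<^sub>R N - P) - t) / h = level x"
      by (simp add: level_def inner_add_right inner_diff_right N_N)
    show "ennreal (1 / h) * H (x + t *\<^sub>R N) ((N \<bullet> (x + t *\<^sub>R N - P) - t) / h)
        = (indicator infinite_cone x * f x * ennreal (1 / level x)) * indicator {- (level x / 2) .. level x / 2} t"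
    proof (cases "level x > 0")
      case False
      then show ?thesis unfolding lev by (simp add: H_def infinite_cone_def)
    next
      case True
      have pos: "x + t *\<^sub>R N - (N \<bullet> (x + t *\<^sub>R N - P) - level x * h) *\<^sub>R N = x"
        using h_pos by (simp add: level_def inner_add_right inner_diff_right N_N)
      let ?z = "P + (1 / level x) *\<^sub>R (x + t *\<^sub>R N - P)"
      have Nz: "N \<bullet> ?z - c = t / level x"
      proof -
        have "N \<bullet> ?z = N \<bullet> P + (N \<bullet> (x - P) + t) / level x"
          by (simp add: inner_add_right inner_diff_right N_N add_divide_distrib diff_divide_distrib)
        also have "N \<bullet> (x - P) = h * level x" using h_pos by (simp add: level_def)
        finally show ?thesis using True apex by (simp add: add_divide_distrib)
      qed
      have fz: "foot ?z = P + (x - P) /\<^sub>R level x"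
        unfolding foot_def Nz by (simp add: algebra_simps divide_inverse)
      have "\<bar>t / level x\<bar> \<le> 1 / 2 \<longleftrightarrow> t \<in> {- (level x / 2) .. level x / 2}"
        using True by (auto simp: abs_le_iff field_simps)
      then have "?z \<in> prism F \<longleftrightarrow> P + (x - P) /\<^sub>R level x \<in> F \<and> t \<in> {- (level x / 2) .. level x / 2}"
        unfolding prism_eq mem_Collect_eq Nz fz by blast
      then have ind: "indicator (prism F) ?z = (indicator infinite_cone x * indicator {- (level x / 2) .. level x / 2} t :: ennreal)"
        using True by (auto simp: indicator_def infinite_cone_def)
      have hh: "ennreal (1 / h) * ennreal (h / level x) = ennreal (1 / level x)"
        using h_pos True by (simp add: ennreal_mult[symmetric])
      have "ennreal (1 / h) * H (x + t *\<^sub>R N) (level x) = ennreal (1 / h) * ennreal (h / level x) * indicator (prism F) ?z * f x"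
        using True unfolding H_def pos by (simp add: mult.assoc)
      then show ?thesis unfolding lev ind hh by (simp add: mult_ac)
    qed
  qed
  also have "\<dots> = (\<integral>\<^sup>+x. \<integral>\<^sup>+t. (indicator infinite_cone x * f x * ennreal (1 / level x)) *
        indicator {- (level x / 2) .. level x / 2} t \<partial>lborel \<partial>lborel)"
    by (rule lborel_pair.Fubini') (measurable, simp only: atLeastAtMost_iff, measurable)
  also have "\<dots> = (\<integral>\<^sup>+x. indicator infinite_cone x * f x \<partial>lborel)"
  proof (intro nn_integral_cong)
    fix x
    have "(\<integral>\<^sup>+t. (indicator infinite_cone x * f x * ennreal (1 / level x)) * indicator {- (level x / 2) .. level x / 2} t \<partial>lborel)
        = (indicator infinite_cone x * f x * ennreal (1 / level x)) * emeasure lborel {- (level x / 2) .. level x / 2}"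
      by (subst nn_integral_cmult) auto
    also have "\<dots> = indicator infinite_cone x * f x"
    proof (cases "x \<in> infinite_cone")
      case True
      then have "level x > 0" by (simp add: infinite_cone_def)
      then have "ennreal (1 / level x) * emeasure lborel {- (level x / 2) .. level x / 2} = 1"
        by (simp add: ennreal_mult[symmetric])
      then show ?thesis by (simp add: mult.assoc)
    qed simp
    finally show "(\<integral>\<^sup>+t. (indicator infinite_cone x * f x * ennreal (1 / level x)) * indicator {- (level x / 2) .. level x / 2} t \<partial>lborel)
        = indicator infinite_cone x * f x" .
  qed
  finally show ?thesis .
qed

text \<open>By the formula for nonnegative functions, the weighted product measure is mapped by (y,
  s) \<mapsto> P + s (y - P) to Lebesgue measure on the cone. As an identity of measures, this also
  covers integrands of variable sign.\<close>

lemma integral_cone: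
  fixes f :: "'a \<Rightarrow> real"
  assumes [measurable]: "f \<in> borel_measurable borel"
    and f: "integrable lborel (\<lambda>x. indicator infinite_cone x * f x)"
  shows "(LINT x|lborel. indicator infinite_cone x * f x)
      = (LINT y|surface_measure F. (LINT s|lborel. weight s * f (P + s *\<^sub>R (y - P))))"
proof -
  define M where "M = density (surface_measure F \<Otimes>\<^sub>M lborel) (\<lambda>z. ennreal (weight (snd z)))"
  define q where "q z = P + snd z *\<^sub>R (fst z - P)" for z :: "'a \<times> real"
  have q[measurable]: "q \<in> borel_measurable (surface_measure F \<Otimes>\<^sub>M lborel)" unfolding q_def by measurable
  have eq: "distr M borel q = density lborel (indicator infinite_cone)"
  proof (rule measure_eqI)
    fix A assume "A \<in> sets (distr M borel q)"
    then have A[measurable]: "A \<in> sets borel" by simp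
    have "emeasure (distr M borel q) A = (\<integral>\<^sup>+x. indicator A x \<partial>distr M borel q)" by simp
    also have "\<dots> = (\<integral>\<^sup>+z. indicator A (q z) \<partial>M)"
      by (subst nn_integral_distr) (auto simp: M_def)
    also have "\<dots> = (\<integral>\<^sup>+z. ennreal (weight (snd z)) * indicator A (q z) \<partial>(surface_measure F \<Otimes>\<^sub>M lborel))"
      unfolding M_def by (subst nn_integral_density) auto
    also have "\<dots> = (\<integral>\<^sup>+y. \<integral>\<^sup>+s. ennreal (weight s) * indicator A (P + s *\<^sub>R (y - P)) \<partial>lborel \<partial>surface_measure F)"
      by (subst sigma_finite_measure.nn_integral_fst[OF sigma_finite_lborel, symmetric]) (auto simp: q_def)
    also have "\<dots> = (\<integral>\<^sup>+x. indicator infinite_cone x * indicator A x \<partial>lborel)"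
      by (rule nn_integral_cone) simp
    also have "\<dots> = emeasure (density lborel (indicator infinite_cone)) A"
      by (subst emeasure_density) auto
    finally show "emeasure (distr M borel q) A = emeasure (density lborel (indicator infinite_cone)) A" .
  qed simp
  have dens: "density lborel (indicator infinite_cone) = density lborel (\<lambda>x. ennreal (indicator infinite_cone x))"
    by (simp add: ennreal_indicator)
  have "integrable (distr M borel q) f"
    unfolding eq dens using f by (subst integrable_density) auto
  then have "integrable M (\<lambda>z. f (q z))" by (subst (asm) integrable_distr_eq) (auto simp: M_def)
  then have int: "integrable (surface_measure F \<Otimes>\<^sub>M lborel) (\<lambda>z. weight (snd z) * f (q z))"
    unfolding M_def by (subst (asm) integrable_density) (auto simp: weight_nonneg)
  have "(LINT x|lborel. indicator infinite_cone x * f x) = (LINT x|distr M borel q. f x)"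
    unfolding eq dens by (subst integral_density) auto
  also have "\<dots> = (LINT z|M. f (q z))" by (subst integral_distr) (auto simp: M_def)
  also have "\<dots> = (LINT z|(surface_measure F \<Otimes>\<^sub>M lborel). weight (snd z) * f (q z))"
    unfolding M_def by (subst integral_density) (auto simp: weight_nonneg)
  also have "\<dots> = (LINT y|surface_measure F. (LINT s|lborel. weight s * f (P + s *\<^sub>R (y - P))))"
    using surface_line.integral_fst'[OF int] by (simp add: q_def)
  finally show ?thesis .
qed

definition truncated_cone :: "'a set" where "truncated_cone = {x \<in> infinite_cone. level x \<le> 1}"

lemma truncated_cone_borel[measurable]: "truncated_cone \<in> sets borel"
  unfolding truncated_cone_def by measurable

lemma level_ray: "y \<in> F \<Longrightarrow> level (P + s *\<^sub>R (y - P)) = s"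
  using h_pos apex by (simp add: level_def inner_diff_right N_F)

lemma bounded_truncated_cone: "bounded truncated_cone"
proof -
  obtain B where B: "\<And>x. x \<in> F \<Longrightarrow> norm x \<le> B"
    using compact_imp_bounded[OF compact_F] by (auto simp: bounded_iff)
  have "norm x \<le> norm P + (B + norm P)" if x: "x \<in> truncated_cone" for x
  proof -
    define y where "y = P + (x - P) /\<^sub>R level x"
    have y: "y \<in> F" and l: "0 < level x" "level x \<le> 1"
      using x by (auto simp: truncated_cone_def infinite_cone_def y_def)
    have "x = P + level x *\<^sub>R (y - P)" using l by (simp add: y_def)
    then have "norm x \<le> norm P + level x * norm (y - P)"
      using norm_triangle_ineq[of P "level x *\<^sub>R (y - P)"] l by simp
    also have "level x * norm (y - P) \<le> 1 * (B + norm P)"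
      using l B[OF y] norm_triangle_ineq4[of y P] by (intro mult_mono) auto
    finally show ?thesis by simp
  qed
  then show ?thesis by (auto simp: bounded_iff)
qed

text \<open>The flux of the field \<open>\<phi>(x) (x - P)\<close> through the lateral surface of the cone vanishes.\<close>

lemma divergence_theorem_cone:
  assumes \<phi>: "C_k 1 \<phi>"
  shows "(LINT x|lborel. indicator truncated_cone x * (gradient \<phi> x \<bullet> (x - P) + real DIM('a) * \<phi> x))
     = h * (LINT y|surface_measure F. \<phi> y)"
proof -
  define f where "f x = indicator {x. level x \<le> 1} x * (gradient \<phi> x \<bullet> (x - P) + real DIM('a) * \<phi> x)" for x
  have cont: "continuous_on UNIV (\<lambda>x. gradient \<phi> x \<bullet> (x - P) + real DIM('a) * \<phi> x)"
    by (intro continuous_intros C1_continuous[OF \<phi>] C1_continuous_gradient[OF \<phi>])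
  then have [measurable]: "(\<lambda>x. gradient \<phi> x \<bullet> (x - P) + real DIM('a) * \<phi> x) \<in> borel_measurable borel"
    by (rule borel_measurable_continuous_onI)
  have f_meas[measurable]: "f \<in> borel_measurable borel" unfolding f_def by measurable
  have ind: "indicator infinite_cone x * f x = indicator truncated_cone x * (gradient \<phi> x \<bullet> (x - P) + real DIM('a) * \<phi> x)" for x
    by (auto simp: f_def truncated_cone_def indicator_def)
  have "integrable lborel (\<lambda>x. indicator infinite_cone x * f x)"
    unfolding ind
  proof -
    obtain B where B: "\<forall>x\<in>closure truncated_cone. norm (gradient \<phi> x \<bullet> (x - P) + real DIM('a) * \<phi> x) \<le> B"
      using compact_continuous_image[OF continuous_on_subset[OF cont subset_UNIV], of "closure truncated_cone"] bounded_truncated_cone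
      by (auto dest!: compact_imp_bounded simp: bounded_iff compact_closure)
    show "integrable lborel (\<lambda>x. indicator truncated_cone x * (gradient \<phi> x \<bullet> (x - P) + real DIM('a) * \<phi> x))"
    proof (rule integrable_if_abs_le)
      show "integrable lborel (\<lambda>x. B * indicator truncated_cone x)"
        using emeasure_bounded_finite[OF bounded_truncated_cone]
        by (intro integrable_mult_right integrable_real_indicator) (auto simp: less_top)
      show "\<bar>indicator truncated_cone x * (gradient \<phi> x \<bullet> (x - P) + real DIM('a) * \<phi> x)\<bar> \<le> B * indicator truncated_cone x" for x
        using B closure_subset[of truncated_cone] by (auto simp: indicator_def)
    qed measurable
  qed
  from integral_cone[OF f_meas this]
  have "(LINT x|lborel. indicator truncated_cone x * (gradient \<phi> x \<bullet> (x - P) + real DIM('a) * \<phi> x))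
      = (LINT y|surface_measure F. (LINT s|lborel. weight s * f (P + s *\<^sub>R (y - P))))"
    by (simp only: ind)
  also have "\<dots> = (LINT y|surface_measure F. h * \<phi> y)"
  proof (rule integral_cong_AE)
    show "(\<lambda>y. LINT s|lborel. weight s * f (P + s *\<^sub>R (y - P))) \<in> borel_measurable (surface_measure F)"
      by measurable
    show "(\<lambda>y. h * \<phi> y) \<in> borel_measurable (surface_measure F)"
      using borel_measurable_continuous_onI[OF C1_continuous[OF \<phi>]] by measurable
    show "AE y in surface_measure F. (LINT s|lborel. weight s * f (P + s *\<^sub>R (y - P))) = h * \<phi> y"
      using AE_surface_measure
    proof eventually_elim
      case (elim y)
      define q where "q s = P + s *\<^sub>R (y - P)" for s
      \<comment> \<open>This is the derivative of s \<mapsto> h s^n \<phi>(q(s)): the divergence of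
        \<phi>(x) (x - P), multiplied by the Jacobian, is an exact derivative on every ray.\<close>
      define g where "g s = h * (real DIM('a) * s ^ (DIM('a) - 1) * \<phi> (q s) + s ^ DIM('a) * (gradient \<phi> (q s) \<bullet> (y - P)))" for s
      have sD: "s ^ DIM('a) = s * s ^ (DIM('a) - 1)" for s :: real
        by (simp add: power_eq_if)
      have "(LINT s|lborel. weight s * f (q s)) = (LINT s|lborel. g s * indicator {0..1} s)"
      proof (rule integral_cong_AE)
        have cg: "continuous_on UNIV (\<lambda>s. gradient \<phi> (q s))" "continuous_on UNIV (\<lambda>s. \<phi> (q s))"
          unfolding q_def
          by (intro continuous_on_compose2[OF C1_continuous_gradient[OF \<phi>]] continuous_on_compose2[OF C1_continuous[OF \<phi>]] continuous_intros; simp)+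
        have "continuous_on UNIV g" unfolding g_def by (intro continuous_intros cg)
        then have "g \<in> borel_measurable borel" by (rule borel_measurable_continuous_onI)
        then show "(\<lambda>s. g s * indicator {0..1} s) \<in> borel_measurable lborel" by measurable
        show "(\<lambda>s. weight s * f (q s)) \<in> borel_measurable lborel" unfolding q_def by measurable
        \<comment> \<open>At s = 0 the weight is 0, whereas \<open>g\<close> has the value h
          \<phi>(P) in dimension one.\<close>
        have "AE s in lborel. s \<noteq> (0::real)" by (rule AE_lborel_singleton)
        then show "AE s in lborel. weight s * f (q s) = g s * indicator {0..1} s"
        proof eventually_elim
          case (elim s)
          have gq: "gradient \<phi> (q s) \<bullet> (q s - P) = s * (gradient \<phi> (q s) \<bullet> (y - P))" by (simp add: q_def)
          have "level (q s) = s" using level_ray[OF \<open>y \<in> F\<close>] by (simp add: q_def)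
          then show ?case using elim
            by (auto simp: weight_def f_def g_def indicator_def sD gq distrib_left mult_ac)
        qed
      qed
      also have "\<dots> = (h * (1 ^ DIM('a) * \<phi> (q 1))) - (h * (0 ^ DIM('a) * \<phi> (q 0)))"
      proof (rule integral_FTC_Icc_real)
        fix s :: real
        have "((\<lambda>s. \<phi> (q s)) has_derivative (\<lambda>t. gradient \<phi> (q s) \<bullet> (t *\<^sub>R (y - P)))) (at s)"
        proof (rule has_derivative_compose[of q "\<lambda>t. t *\<^sub>R (y - P)" s UNIV \<phi> "\<lambda>h. gradient \<phi> (q s) \<bullet> h"])
          show "(q has_derivative (\<lambda>t. t *\<^sub>R (y - P))) (at s)"
            unfolding q_def by (auto intro!: derivative_eq_intros)
        qed (rule C1_has_derivative[OF \<phi>])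
        then have "((\<lambda>s. \<phi> (q s)) has_real_derivative (gradient \<phi> (q s) \<bullet> (y - P))) (at s)"
          by (rule has_derivative_imp_has_field_derivative) (simp add: mult.commute)
        then show "((\<lambda>s. h * (s ^ DIM('a) * \<phi> (q s))) has_real_derivative g s) (at s)"
          unfolding g_def by (auto intro!: derivative_eq_intros simp: algebra_simps)
        have "continuous_on UNIV (\<lambda>s. gradient \<phi> (q s))" "continuous_on UNIV (\<lambda>s. \<phi> (q s))"
          unfolding q_def
          by (intro continuous_on_compose2[OF C1_continuous_gradient[OF \<phi>]] continuous_on_compose2[OF C1_continuous[OF \<phi>]] continuous_intros; simp)+
        then have "continuous_on UNIV g" unfolding g_def by (intro continuous_intros)
        then show "isCont g s" by (simp add: continuous_on_eq_continuous_at)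
      qed simp
      also have "\<dots> = h * \<phi> y" by (simp add: q_def)
      finally show ?case by (simp add: q_def)
    qed
  qed
  also have "\<dots> = h * (LINT y|surface_measure F. \<phi> y)" by simp
  finally show ?thesis .
qed

end

section \<open>Traces on faces\<close>

lemma L2_norm_cong_AE:
  assumes "L2 U f" "L2 U g" "AE x in lebesgue_on U. f x = g x"
  shows "L2_norm U f = L2_norm U g"
proof -
  have "(LINT x|lebesgue_on U. (norm (f x))\<^sup>2) = (LINT x|lebesgue_on U. (norm (g x))\<^sup>2)"
    by (rule integral_cong_AE) (use assms in \<open>auto simp: L2_def\<close>)
  then show ?thesis by (simp add: L2_norm_def)
qed

lemma L2_norm_nonneg: "0 \<le> L2_norm U f"
  by (simp add: L2_norm_def)

lemma L2_norm_le_H1_norm: "L2_norm U u \<le> H1_norm U u" "L2_norm U (weak_grad U u) \<le> H1_norm U u"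
  by (simp_all add: H1_norm_def L2_norm_nonneg real_le_rsqrt)

text \<open>\<open>H1_norm\<close> contains a chosen weak gradient of the difference. By uniqueness
  it may be replaced by the classical gradient minus the weak one.\<close>

lemma test_approximation_tendsto:
  fixes U :: "'a::euclidean_space set"
  assumes U: "open U" "bounded U" and v: "v \<in> H1 U" and \<phi>: "test_approximation U \<phi> v"
  shows "(\<lambda>j. L2_norm U (\<lambda>x. \<phi> j x - v x)) \<longlonglongrightarrow> 0"
    and "(\<lambda>j. L2_norm U (\<lambda>x. gradient (\<phi> j) x - weak_grad U v x)) \<longlonglongrightarrow> 0"
proof -
  have lim: "(\<lambda>j. H1_norm U (\<lambda>x. \<phi> j x - v x)) \<longlonglongrightarrow> 0"
    using \<phi> by (simp add: test_approximation_def)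
  show "(\<lambda>j. L2_norm U (\<lambda>x. \<phi> j x - v x)) \<longlonglongrightarrow> 0"
    by (rule Lim_null_comparison[OF _ lim]) (simp add: L2_norm_nonneg L2_norm_le_H1_norm)
  have wv: "is_weak_gradient U v (weak_grad U v)" using v by (rule is_weak_gradient_weak_grad)
  have w\<phi>: "is_weak_gradient U (\<phi> j) (gradient (\<phi> j))" for j
    using \<phi> by (intro is_weak_gradient_C1 U test_function_C1[of U]) (simp add: test_approximation_def)
  have "L2_norm U (weak_grad U (\<lambda>x. \<phi> j x - v x)) = L2_norm U (\<lambda>x. gradient (\<phi> j) x - weak_grad U v x)" for j
  proof (rule L2_norm_cong_AE)
    have w: "is_weak_gradient U (\<lambda>x. \<phi> j x - v x) (\<lambda>x. gradient (\<phi> j) x - weak_grad U v x)"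
      using is_weak_gradient_lincomb[OF U w\<phi> wv, of 1 j "-1"] by simp
    then show "L2 U (\<lambda>x. gradient (\<phi> j) x - weak_grad U v x)" by (simp add: is_weak_gradient_def)
    have "(\<lambda>x. \<phi> j x - v x) \<in> H1 U" using w by (auto simp: H1_def)
    from is_weak_gradient_weak_grad[OF this]
    show "L2 U (weak_grad U (\<lambda>x. \<phi> j x - v x))" by (simp add: is_weak_gradient_def)
    show "AE x in lebesgue_on U. weak_grad U (\<lambda>x. \<phi> j x - v x) x = gradient (\<phi> j) x - weak_grad U v x"
      by (rule weak_grad_AE_eq[OF U w])
  qed
  moreover have "(\<lambda>j. L2_norm U (weak_grad U (\<lambda>x. \<phi> j x - v x))) \<longlonglongrightarrow> 0"
    by (rule Lim_null_comparison[OF _ lim]) (simp add: L2_norm_nonneg L2_norm_le_H1_norm)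
  ultimately show "(\<lambda>j. L2_norm U (\<lambda>x. gradient (\<phi> j) x - weak_grad U v x)) \<longlonglongrightarrow> 0" by simp
qed

lemma L2_norm_mono_set:
  assumes f: "L2 U f" and S: "S \<subseteq> U" "S \<in> sets lebesgue" "U \<in> sets lebesgue"
  shows "L2_norm S f \<le> L2_norm U f"
proof -
  have "(LINT x|lebesgue_on S. (norm (f x))\<^sup>2) \<le> (LINT x|lebesgue_on U. (norm (f x))\<^sup>2)"
    by (rule integral_mono_lebesgue_on_AE) (use f S in \<open>auto simp: L2_def\<close>)
  then show ?thesis by (simp add: L2_norm_def)
qed

context cone_over_face
begin

text \<open>The trace is obtained by integrating the weak gradient along the rays from the apex, from the
  face to the outside of the domain.\<close>

lemma trace_exists:
  fixes \<Omega> :: "'a set"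
  assumes \<Omega>: "open \<Omega>" "bounded \<Omega>" and v: "v \<in> H1 \<Omega>" and \<phi>: "test_approximation \<Omega> \<phi> v"
  shows "\<exists>g. is_trace \<Omega> F v g"
proof -
  obtain \<rho> where \<rho>: "\<rho> > 0" "\<And>x. x \<in> \<Omega> \<Longrightarrow> norm (x - P) < \<rho>"
    using bounded_subset_ballD[OF \<Omega>(2), of P] by (auto simp: dist_norm norm_minus_commute subset_iff)
  \<comment> \<open>Every point of \<open>F\<close> has distance at least \<open>h\<close> from the
    apex, so all rays are outside \<open>\<Omega>\<close> at the parameter \<open>R\<close>.\<close>
  define R where "R = \<rho> / h + 1"
  have R: "R > 1" using \<rho> h_pos by (simp add: R_def)
  have out: "P + R *\<^sub>R (y - P) \<notin> \<Omega>" if y: "y \<in> F" for y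
  proof
    assume "P + R *\<^sub>R (y - P) \<in> \<Omega>"
    from \<rho>(2)[OF this] have "R * norm (y - P) < \<rho>" using R by simp
    moreover have "h \<le> norm (y - P)"
      using Cauchy_Schwarz_ineq2[of N "y - P"] N_F[OF y] apex norm_N h_pos by (simp add: inner_diff_right)
    then have "R * h \<le> R * norm (y - P)" using R by simp
    moreover have "R * h = \<rho> + h" using h_pos by (simp add: R_def field_simps)
    ultimately show False using h_pos by simp
  qed
  have \<Omega>s: "\<Omega> \<in> sets lebesgue" using \<Omega> by simp
  define G where "G = weak_grad \<Omega> v"
  have G: "L2 \<Omega> G"
    using is_weak_gradient_weak_grad[OF v] by (simp add: G_def is_weak_gradient_def)
  have [measurable]: "G \<in> borel_measurable (lebesgue_on \<Omega>)" using G by (simp add: L2_def)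
  have "(\<lambda>x. G x \<bullet> (x - P)) \<in> borel_measurable (lebesgue_on \<Omega>)"
  proof -
    have "(\<lambda>x. x) \<in> borel_measurable (lebesgue_on \<Omega>)"
      by (intro measurable_restrict_space1 measurable_completion) simp
    then show ?thesis by measurable
  qed
  then have "(\<lambda>x. indicator \<Omega> x * (G x \<bullet> (x - P))) \<in> borel_measurable lebesgue"
    using \<Omega>s by (subst (asm) borel_measurable_restrict_space_iff) (auto simp: mult.commute)
  \<comment> \<open>A Borel representative of the radial component of the weak gradient, extended by
    zero, since it will be integrated along single rays.\<close>
  then obtain f where f[measurable]: "f \<in> borel_measurable lborel"
    and f_eq: "AE x in lborel. indicator \<Omega> x * (G x \<bullet> (x - P)) = f x"
    using completion_ex_borel_measurable_real by blast
  have tf: "test_function \<Omega> (\<phi> j)" for j using \<phi> by (simp add: test_approximation_def)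
  have C1: "C_k 1 (\<phi> j)" for j by (rule test_function_C1[OF tf])
  define e where "e j x = gradient (\<phi> j) x \<bullet> (x - P)" for j x
  have ce: "continuous_on UNIV (e j)" for j
    unfolding e_def by (intro continuous_intros C1_continuous_gradient C1)
  have e[measurable]: "e j \<in> borel_measurable borel" for j
    by (rule borel_measurable_continuous_onI[OF ce])
  have \<phi>_meas[measurable]: "\<phi> j \<in> borel_measurable borel" for j
    by (rule borel_measurable_continuous_onI[OF C1_continuous[OF C1]])
  define D where "D j x = e j x - f x" for j x
  have D[measurable]: "D j \<in> borel_measurable borel" for j unfolding D_def using f by measurable
  \<comment> \<open>The derivative along the ray through \<open>y\<close> is the gradient times y -
    P, that is, the radial component divided by \<open>s\<close>. A test function vanishes at the
    parameter \<open>R\<close>, so its value on the face is minus such an integral; \<open>g\<close>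
    is the same expression for \<open>v\<close>.\<close>
  define g where "g y = - (LINT s|lborel. indicator {1..R} s * (f (P + s *\<^sub>R (y - P)) / s))" for y
  have g[measurable]: "g \<in> borel_measurable borel"
    unfolding g_def using f by measurable
  \<comment> \<open>Outside \<open>\<Omega>\<close>, the gradient of the test function is 0, and so
    is \<open>f\<close> almost everywhere; hence the integral over the whole space is controlled by
    the error in \<open>\<Omega>\<close>.\<close>
  have D_bound: "(\<integral>\<^sup>+x. ennreal ((D j x)\<^sup>2) \<partial>lborel) \<le> ennreal (\<rho>\<^sup>2 * (L2_norm \<Omega> (\<lambda>x. gradient (\<phi> j) x - G x))\<^sup>2)" for j
  proof -
    have L: "L2 \<Omega> (\<lambda>x. gradient (\<phi> j) x - G x)"
      using G is_weak_gradient_C1[OF \<Omega> C1, of j] by (intro L2_diff) (auto simp: is_weak_gradient_def)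
    obtain K where K: "K \<subseteq> \<Omega>" "\<And>x. x \<notin> K \<Longrightarrow> gradient (\<phi> j) x = 0"
      using test_function_support[OF tf[of j]] by metis
    have "(\<integral>\<^sup>+x. ennreal ((D j x)\<^sup>2) \<partial>lborel) = (\<integral>\<^sup>+x. ennreal ((D j x)\<^sup>2) \<partial>lebesgue)"
      by (simp add: nn_integral_completion)
    also have "\<dots> \<le> (\<integral>\<^sup>+x. ennreal (\<rho>\<^sup>2 * (norm (gradient (\<phi> j) x - G x))\<^sup>2) * indicator \<Omega> x \<partial>lebesgue)"
    proof (rule nn_integral_mono_AE)
      show "AE x in lebesgue. ennreal ((D j x)\<^sup>2) \<le> ennreal (\<rho>\<^sup>2 * (norm (gradient (\<phi> j) x - G x))\<^sup>2) * indicator \<Omega> x"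
        using AE_completion[OF f_eq]
      proof eventually_elim
        case (elim x)
        show ?case
        proof (cases "x \<in> \<Omega>")
          case True
          then have "D j x = (gradient (\<phi> j) x - G x) \<bullet> (x - P)"
            using elim by (simp add: D_def e_def inner_diff_left)
          also have "(\<dots>)\<^sup>2 \<le> (norm (gradient (\<phi> j) x - G x) * norm (x - P))\<^sup>2"
            using Cauchy_Schwarz_ineq2 by (rule abs_le_square_iff[THEN iffD1, OF order.trans]) simp
          also have "\<dots> \<le> (norm (gradient (\<phi> j) x - G x) * \<rho>)\<^sup>2"
            using \<rho>(2)[OF True] by (intro power_mono mult_left_mono) auto
          finally show ?thesis using True by (simp add: power_mult_distrib mult.commute)
        next
          case False
          then have "x \<notin> K" using K(1) by blast
          then show ?thesis using K(2) elim False by (simp add: D_def e_def)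
        qed
      qed
    qed
    also have "\<dots> = (\<integral>\<^sup>+x. ennreal (\<rho>\<^sup>2 * (norm (gradient (\<phi> j) x - G x))\<^sup>2) \<partial>lebesgue_on \<Omega>)"
      using \<Omega>s by (subst nn_integral_restrict_space) auto
    also have "\<dots> = ennreal (LINT x|lebesgue_on \<Omega>. \<rho>\<^sup>2 * (norm (gradient (\<phi> j) x - G x))\<^sup>2)"
      using L by (intro nn_integral_eq_integral) (auto simp: L2_def)
    also have "\<dots> = ennreal (\<rho>\<^sup>2 * (L2_norm \<Omega> (\<lambda>x. gradient (\<phi> j) x - G x))\<^sup>2)"
      by (simp add: L2_norm_power2)
    finally show ?thesis .
  qed
  \<comment> \<open>The fundamental theorem on the ray for \<open>\<phi> j\<close>, followed by
    Cauchy-Schwarz and s \<ge> 1. An infinite right-hand side leaves nothing to prove; a finite one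
    provides the integrability that makes the integral in \<open>g y\<close> meaningful.\<close>
  have pointwise: "ennreal ((\<phi> j y - g y)\<^sup>2)
      \<le> ennreal (R - 1) * (\<integral>\<^sup>+s. indicator {1..R} s * ennreal ((D j (P + s *\<^sub>R (y - P)))\<^sup>2) \<partial>lborel)"
    if y: "y \<in> F" for j y
  proof (cases "(\<integral>\<^sup>+s. indicator {1..R} s * ennreal ((D j (P + s *\<^sub>R (y - P)))\<^sup>2) \<partial>lborel) = \<infinity>")
    case True
    then show ?thesis using R by (simp add: ennreal_mult_top)
  next
    case False
    define q where "q s = P + s *\<^sub>R (y - P)" for s
    have q[measurable]: "q \<in> borel_measurable borel" unfolding q_def by measurable
    define M where "M = restrict_space lborel {1..R}"
    have M: "finite_measure M"
      unfolding M_def by (rule finite_measureI) (use emeasure_bounded_finite[of "{1..R}"] in \<open>simp add: emeasure_restrict_space less_top\<close>)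
    have Mm: "measure M (space M) = R - 1"
      using R by (simp add: M_def measure_restrict_space space_restrict_space)
    have Mc: "u \<in> borel_measurable M" if "u \<in> borel_measurable borel" for u :: "real \<Rightarrow> real"
      unfolding M_def using that by (intro measurable_restrict_space1) simp
    have fin: "(\<integral>\<^sup>+s. ennreal ((D j (q s))\<^sup>2) \<partial>M) < \<infinity>"
      unfolding M_def using False
      by (subst nn_integral_restrict_space) (auto simp: q_def mult.commute less_top)
    have D2: "integrable M (\<lambda>s. (D j (q s))\<^sup>2)"
      by (rule integrableI_bounded) (use fin in \<open>auto intro!: Mc\<close>)
    have k2: "integrable M (\<lambda>s. (D j (q s) / s)\<^sup>2)"
    proof (rule Bochner_Integration.integrable_bound[OF D2])
      show "AE s in M. norm ((D j (q s) / s)\<^sup>2) \<le> norm ((D j (q s))\<^sup>2)"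
      proof (rule AE_I2)
        fix s assume "s \<in> space M"
        then have "s \<ge> 1" by (simp add: M_def space_restrict_space)
        then have "s\<^sup>2 \<ge> 1" by simp
        then have "(D j (q s))\<^sup>2 * 1 \<le> (D j (q s))\<^sup>2 * s\<^sup>2" by (intro mult_left_mono) auto
        then show "norm ((D j (q s) / s)\<^sup>2) \<le> norm ((D j (q s))\<^sup>2)"
          using \<open>s \<ge> 1\<close> by (simp add: power_divide field_simps)
      qed
    qed (auto intro!: Mc)
    note J = Jensen_square_finite_measure[OF M _ k2]
    have intk: "integrable M (\<lambda>s. D j (q s) / s)" by (intro J Mc) measurable
    have Mint: "(LINT s|M. u s) = (LINT s|lborel. indicator {1..R} s * u s)" for u :: "real \<Rightarrow> real"
      by (simp add: M_def integral_restrict_space)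
    have ci: "isCont (\<lambda>s. gradient (\<phi> j) (q s) \<bullet> (y - P)) s" for s
    proof -
      have "continuous_on UNIV (\<lambda>s. gradient (\<phi> j) (q s) \<bullet> (y - P))"
        unfolding q_def
        by (intro continuous_intros continuous_on_compose2[OF C1_continuous_gradient[OF C1]]) simp
      then show ?thesis by (simp add: continuous_on_eq_continuous_at)
    qed
    have dq: "((\<lambda>s. \<phi> j (q s)) has_real_derivative (gradient (\<phi> j) (q s) \<bullet> (y - P))) (at s)" for s
    proof -
      have "((\<lambda>s. \<phi> j (q s)) has_derivative (\<lambda>t. gradient (\<phi> j) (q s) \<bullet> (t *\<^sub>R (y - P)))) (at s)"
      proof (rule has_derivative_compose[of q "\<lambda>t. t *\<^sub>R (y - P)" s UNIV "\<phi> j" "\<lambda>h. gradient (\<phi> j) (q s) \<bullet> h"])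
        show "(q has_derivative (\<lambda>t. t *\<^sub>R (y - P))) (at s)"
          unfolding q_def by (auto intro!: derivative_eq_intros)
      qed (rule C1_has_derivative[OF C1])
      then show ?thesis
        by (rule has_derivative_imp_has_field_derivative) (simp add: mult.commute)
    qed
    have q1: "q 1 = y" by (simp add: q_def)
    have qR: "\<phi> j (q R) = 0"
    proof -
      obtain K where "K \<subseteq> \<Omega>" "\<And>x. x \<notin> K \<Longrightarrow> \<phi> j x = 0" using test_function_support[OF tf[of j]] by metis
      then show ?thesis using out[OF y] by (auto simp: q_def)
    qed
    have bi: "has_bochner_integral lborel (\<lambda>s. gradient (\<phi> j) (q s) \<bullet> (y - P) * indicator {1..R} s) (\<phi> j (q R) - \<phi> j (q 1))"
      by (rule has_bochner_integral_FTC_Icc_real) (use R dq ci in auto)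
    have ee: "e j (q s) / s = gradient (\<phi> j) (q s) \<bullet> (y - P)" if "s \<noteq> 0" for s
      using that by (simp add: e_def q_def)
    have cong: "gradient (\<phi> j) (q s) \<bullet> (y - P) * indicator {1..R} s = indicator {1..R} s * (e j (q s) / s)" for s
      using ee[of s] by (auto simp: indicator_def)
    have ibe: "integrable M (\<lambda>s. e j (q s) / s)" "(LINT s|M. e j (q s) / s) = - \<phi> j y"
      using bi unfolding cong q1 qR Mint
      by (auto simp: has_bochner_integral_iff M_def integrable_restrict_space)
    have "integrable M (\<lambda>s. e j (q s) / s - D j (q s) / s)" using ibe(1) intk by simp
    then have ibf: "integrable M (\<lambda>s. f (q s) / s)" by (simp add: D_def diff_divide_distrib)
    have "(LINT s|M. D j (q s) / s) = (LINT s|M. e j (q s) / s) - (LINT s|M. f (q s) / s)"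
      using ibe(1) ibf by (simp add: D_def diff_divide_distrib)
    also have "\<dots> = - (\<phi> j y - g y)"
      unfolding ibe(2) unfolding Mint by (simp add: g_def q_def)
    finally have "(\<phi> j y - g y)\<^sup>2 = (LINT s|M. D j (q s) / s)\<^sup>2" by (simp only: power2_minus)
    also have "\<dots> \<le> (R - 1) * (LINT s|M. (D j (q s) / s)\<^sup>2)"
      using J(2) unfolding Mm by (simp add: Mc)
    also have "\<dots> \<le> (R - 1) * (LINT s|M. (D j (q s))\<^sup>2)"
    proof (intro mult_left_mono integral_mono k2 D2)
      fix s assume "s \<in> space M"
      then have "s \<ge> 1" by (simp add: M_def space_restrict_space)
      then have "s\<^sup>2 \<ge> 1" by simp
      then have "(D j (q s))\<^sup>2 * 1 \<le> (D j (q s))\<^sup>2 * s\<^sup>2" by (intro mult_left_mono) auto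
      then show "(D j (q s) / s)\<^sup>2 \<le> (D j (q s))\<^sup>2"
        using \<open>s \<ge> 1\<close> by (simp add: power_divide field_simps)
    qed (use R in simp)
    finally have "ennreal ((\<phi> j y - g y)\<^sup>2) \<le> ennreal ((R - 1) * (LINT s|M. (D j (q s))\<^sup>2))"
      by (rule ennreal_leI)
    also have "\<dots> = ennreal (R - 1) * (\<integral>\<^sup>+s. ennreal ((D j (q s))\<^sup>2) \<partial>M)"
      using R D2 by (subst nn_integral_eq_integral) (auto simp: ennreal_mult)
    also have "(\<integral>\<^sup>+s. ennreal ((D j (q s))\<^sup>2) \<partial>M) = (\<integral>\<^sup>+s. indicator {1..R} s * ennreal ((D j (P + s *\<^sub>R (y - P)))\<^sup>2) \<partial>lborel)"
      unfolding M_def by (subst nn_integral_restrict_space) (auto simp: q_def mult.commute)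
    finally show ?thesis .
  qed
  \<comment> \<open>\<open>R - 1\<close> stems from Cauchy-Schwarz, 1 / h from comparing 1 with the
    weight for s \<ge> 1, and the square of \<open>\<rho>\<close> from |x - P| < \<rho>.\<close>
  define C where "C = (R - 1) / h * \<rho>\<^sup>2"
  have C: "C \<ge> 0" using R h_pos by (simp add: C_def)
  have bound: "(\<integral>\<^sup>+y. ennreal ((\<phi> j y - g y)\<^sup>2) \<partial>surface_measure F)
      \<le> ennreal (C * (L2_norm \<Omega> (\<lambda>x. gradient (\<phi> j) x - G x))\<^sup>2)" for j
  proof -
    have "(\<integral>\<^sup>+y. ennreal ((\<phi> j y - g y)\<^sup>2) \<partial>surface_measure F)
       \<le> (\<integral>\<^sup>+y. ennreal (R - 1) * (\<integral>\<^sup>+s. indicator {1..R} s * ennreal ((D j (P + s *\<^sub>R (y - P)))\<^sup>2) \<partial>lborel) \<partial>surface_measure F)"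
      using AE_surface_measure by (intro nn_integral_mono_AE) (auto elim!: eventually_mono intro: pointwise)
    also have "\<dots> \<le> (\<integral>\<^sup>+y. ennreal (R - 1) * (\<integral>\<^sup>+s. ennreal (1 / h) * (ennreal (weight s) * ennreal ((D j (P + s *\<^sub>R (y - P)))\<^sup>2)) \<partial>lborel) \<partial>surface_measure F)"
    proof (intro nn_integral_mono mult_left_mono)
      fix y :: 'a and s :: real
      show "indicator {1..R} s * ennreal ((D j (P + s *\<^sub>R (y - P)))\<^sup>2)
          \<le> ennreal (1 / h) * (ennreal (weight s) * ennreal ((D j (P + s *\<^sub>R (y - P)))\<^sup>2))"
      proof (cases "s \<in> {1..R}")
        case True
        then have "1 \<le> s ^ (DIM('a) - 1)" by (simp add: one_le_power)
        then have "1 \<le> 1 / h * weight s" using True h_pos by (simp add: weight_def)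
        then have "ennreal 1 \<le> ennreal (1 / h) * ennreal (weight s)"
          using h_pos weight_nonneg[of s] by (subst ennreal_mult[symmetric]) (auto intro: ennreal_leI)
        then have "1 * ennreal ((D j (P + s *\<^sub>R (y - P)))\<^sup>2) \<le> ennreal (1 / h) * ennreal (weight s) * ennreal ((D j (P + s *\<^sub>R (y - P)))\<^sup>2)"
          by (intro mult_right_mono) auto
        then show ?thesis using True by (simp add: mult.assoc)
      qed simp
    qed simp
    also have "\<dots> = ennreal (R - 1) * (ennreal (1 / h) * (\<integral>\<^sup>+y. \<integral>\<^sup>+s. ennreal (weight s) * ennreal ((D j (P + s *\<^sub>R (y - P)))\<^sup>2) \<partial>lborel \<partial>surface_measure F))"
      by (simp add: nn_integral_cmult)
    also have "\<dots> = ennreal (R - 1) * (ennreal (1 / h) * (\<integral>\<^sup>+x. indicator infinite_cone x * ennreal ((D j x)\<^sup>2) \<partial>lborel))"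
      by (subst nn_integral_cone) auto
    also have "\<dots> \<le> ennreal (R - 1) * (ennreal (1 / h) * ennreal (\<rho>\<^sup>2 * (L2_norm \<Omega> (\<lambda>x. gradient (\<phi> j) x - G x))\<^sup>2))"
      by (intro mult_left_mono order.trans[OF nn_integral_mono D_bound]) (auto simp: indicator_def)
    also have "\<dots> = ennreal (C * (L2_norm \<Omega> (\<lambda>x. gradient (\<phi> j) x - G x))\<^sup>2)"
      using R h_pos by (simp add: C_def ennreal_mult[symmetric] mult.assoc)
    finally show ?thesis .
  qed
  have diff2: "integrable (surface_measure F) (\<lambda>y. (\<phi> j y - g y)\<^sup>2)" for j
    by (rule integrableI_bounded) (use bound[of j] in \<open>auto simp: le_less_trans\<close>)
  have lim: "(\<lambda>j. LINT y|surface_measure F. (\<phi> j y - g y)\<^sup>2) \<longlonglongrightarrow> 0"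
  proof (rule Lim_null_comparison)
    show "\<forall>\<^sub>F j in sequentially. norm (LINT y|surface_measure F. (\<phi> j y - g y)\<^sup>2) \<le> C * (L2_norm \<Omega> (\<lambda>x. gradient (\<phi> j) x - G x))\<^sup>2"
    proof (intro always_eventually allI)
      fix j
      have "ennreal (LINT y|surface_measure F. (\<phi> j y - g y)\<^sup>2) \<le> ennreal (C * (L2_norm \<Omega> (\<lambda>x. gradient (\<phi> j) x - G x))\<^sup>2)"
        using bound[of j] diff2[of j] by (subst nn_integral_eq_integral[symmetric]) auto
      then show "norm (LINT y|surface_measure F. (\<phi> j y - g y)\<^sup>2) \<le> C * (L2_norm \<Omega> (\<lambda>x. gradient (\<phi> j) x - G x))\<^sup>2"
        using C by (simp add: ennreal_le_iff)
    qed
    have "(\<lambda>j. L2_norm \<Omega> (\<lambda>x. gradient (\<phi> j) x - G x)) \<longlonglongrightarrow> 0"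
      unfolding G_def by (rule test_approximation_tendsto[OF \<Omega> v \<phi>])
    then have "(\<lambda>j. C * (L2_norm \<Omega> (\<lambda>x. gradient (\<phi> j) x - G x))\<^sup>2) \<longlonglongrightarrow> C * 0\<^sup>2"
      by (intro tendsto_intros)
    then show "(\<lambda>j. C * (L2_norm \<Omega> (\<lambda>x. gradient (\<phi> j) x - G x))\<^sup>2) \<longlonglongrightarrow> 0" by simp
  qed
  \<comment> \<open>A single test function suffices: it is bounded on the face and differs from
    \<open>g\<close> by a square integrable function.\<close>
  have \<phi>2: "integrable (surface_measure F) (\<lambda>y. (\<phi> 0 y)\<^sup>2)"
  proof -
    have "compact (\<phi> 0 ` F)"
      by (intro compact_continuous_image compact_F continuous_on_subset[OF C1_continuous[OF C1]]) auto
    then obtain B where B: "\<forall>y\<in>F. \<bar>\<phi> 0 y\<bar> \<le> B" by (auto dest!: compact_imp_bounded simp: bounded_iff)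
    show ?thesis
    proof (rule surface.integrable_const_bound[where B = "B\<^sup>2"])
      show "AE y in surface_measure F. norm ((\<phi> 0 y)\<^sup>2) \<le> B\<^sup>2"
        using AE_surface_measure by eventually_elim (use B in \<open>auto simp: abs_le_square_iff[symmetric] intro: order.trans[OF _ abs_ge_self]\<close>)
    qed measurable
  qed
  have "integrable (surface_measure F) (\<lambda>y. (g y)\<^sup>2)"
  proof (rule integrable_if_abs_le)
    show "integrable (surface_measure F) (\<lambda>y. 2 * (\<phi> 0 y - g y)\<^sup>2 + 2 * (\<phi> 0 y)\<^sup>2)"
      using diff2 \<phi>2 by simp
    show "\<bar>(g y)\<^sup>2\<bar> \<le> 2 * (\<phi> 0 y - g y)\<^sup>2 + 2 * (\<phi> 0 y)\<^sup>2" for y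
    proof -
      have "0 \<le> (2 * \<phi> 0 y - g y)\<^sup>2" by simp
      then show ?thesis by (simp add: power2_eq_square algebra_simps)
    qed
  qed measurable
  then show ?thesis
    unfolding is_trace_def using g lim \<phi> by blast
qed

section \<open>Green formula for traces\<close>

lemma divergence_theorem_cone_on:
  assumes sets: "U \<in> sets lebesgue" and eq: "AE x in lebesgue. x \<in> U \<longleftrightarrow> x \<in> truncated_cone"
    and C1: "C_k 1 \<phi>"
  shows "(LINT x|lebesgue_on U. gradient \<phi> x \<bullet> (x - P) + real DIM('a) * \<phi> x)
    = h * (LINT y|surface_measure F. \<phi> y)"
proof -
    have cont: "continuous_on UNIV (\<lambda>x. gradient \<phi> x \<bullet> (x - P) + real DIM('a) * \<phi> x)"
      by (intro continuous_intros C1_continuous C1_continuous_gradient C1)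
    then have m: "(\<lambda>x. gradient \<phi> x \<bullet> (x - P) + real DIM('a) * \<phi> x) \<in> borel_measurable borel"
      by (rule borel_measurable_continuous_onI)
    have "(LINT x|lebesgue_on U. gradient \<phi> x \<bullet> (x - P) + real DIM('a) * \<phi> x) = (LINT x|lebesgue. indicator U x *\<^sub>R (gradient \<phi> x \<bullet> (x - P) + real DIM('a) * \<phi> x))"
      by (rule integral_restrict_space) (use sets in simp)
    also have "\<dots> = (LINT x|lebesgue. indicator truncated_cone x * (gradient \<phi> x \<bullet> (x - P) + real DIM('a) * \<phi> x))"
    proof (rule integral_cong_AE)
      have m': "(\<lambda>x. gradient \<phi> x \<bullet> (x - P) + real DIM('a) * \<phi> x) \<in> borel_measurable lebesgue"
        using m by (intro measurable_completion) simp
      show "(\<lambda>x. indicator U x *\<^sub>R (gradient \<phi> x \<bullet> (x - P) + real DIM('a) * \<phi> x)) \<in> borel_measurable lebesgue"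
        using m' sets by (intro borel_measurable_scaleR borel_measurable_indicator) auto
      show "(\<lambda>x. indicator truncated_cone x * (gradient \<phi> x \<bullet> (x - P) + real DIM('a) * \<phi> x)) \<in> borel_measurable lebesgue"
        using m' by (intro borel_measurable_times borel_measurable_indicator) auto
      show "AE x in lebesgue. indicator U x *\<^sub>R (gradient \<phi> x \<bullet> (x - P) + real DIM('a) * \<phi> x)
          = indicator truncated_cone x * (gradient \<phi> x \<bullet> (x - P) + real DIM('a) * \<phi> x)"
        using eq by eventually_elim (auto simp: indicator_def)
    qed
    also have "\<dots> = (LINT x|lborel. indicator truncated_cone x * (gradient \<phi> x \<bullet> (x - P) + real DIM('a) * \<phi> x))"
      using borel_measurable_times[OF borel_measurable_indicator[of truncated_cone borel] m] by (intro integral_completion) simp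
    also have "\<dots> = h * (LINT y|surface_measure F. \<phi> y)" by (rule divergence_theorem_cone[OF C1])
    finally show ?thesis .
qed

text \<open>The divergence theorem passes to the limit along the test functions that accompany
  \<open>g\<close>, as both sides are continuous in the respective L2 norms. It thus holds for every
  trace, in particular for the chosen one in \<open>face_mean\<close>.\<close>

lemma green_formula_trace:
  fixes \<Omega> U :: "'a set"
  assumes \<Omega>: "open \<Omega>" "bounded \<Omega>" and U: "open U" "U \<subseteq> \<Omega>"
    and eq: "AE x in lebesgue. x \<in> U \<longleftrightarrow> x \<in> truncated_cone"
    and v: "v \<in> H1 \<Omega>" and g: "is_trace \<Omega> F v g"
  shows "(LINT x|lebesgue_on U. weak_grad \<Omega> v x \<bullet> (x - P) + real DIM('a) * v x) = h * (LINT y|surface_measure F. g y)"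
proof -
  obtain \<phi> where \<phi>: "test_approximation \<Omega> \<phi> v"
    and lim: "(\<lambda>j. LINT y|surface_measure F. (\<phi> j y - g y)\<^sup>2) \<longlonglongrightarrow> 0"
    and g_meas[measurable]: "g \<in> borel_measurable borel"
    and g2: "integrable (surface_measure F) (\<lambda>y. (g y)\<^sup>2)"
    using g by (auto simp: is_trace_def)
  have tf: "test_function \<Omega> (\<phi> j)" for j using \<phi> by (simp add: test_approximation_def)
  have C1: "C_k 1 (\<phi> j)" for j by (rule test_function_C1[OF tf])
  have \<phi>_meas[measurable]: "\<phi> j \<in> borel_measurable borel" for j
    by (rule borel_measurable_continuous_onI[OF C1_continuous[OF C1]])
  have bU: "bounded U" using \<Omega> U bounded_subset by blast
  have lm: "U \<in> lmeasurable" "\<Omega> \<in> lmeasurable" using U \<Omega> bU by (auto simp: lmeasurable_open)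
  have sets: "U \<in> sets lebesgue" "\<Omega> \<in> sets lebesgue" using lm by (auto simp: fmeasurableD)
  have L: "L2 \<Omega> v" "L2 \<Omega> (weak_grad \<Omega> v)"
    using is_weak_gradient_weak_grad[OF v] by (auto simp: is_weak_gradient_def)
  have LU: "L2 U v" "L2 U (weak_grad \<Omega> v)" by (rule L2_subset[OF L(1) U(2) sets], rule L2_subset[OF L(2) U(2) sets])
  have L\<phi>: "L2 W (\<phi> j)" "L2 W (gradient (\<phi> j))" if "W \<in> lmeasurable" "bounded W" for j W
    by (intro L2_continuous that C1_continuous C1_continuous_gradient C1)+
  have Lx: "L2 U (\<lambda>x. x - P)" by (intro L2_continuous lm bU continuous_intros)
  have L1: "L2 U (\<lambda>x. real DIM('a))" by (intro L2_const lm)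
  note lims = test_approximation_tendsto[OF \<Omega> v \<phi>]
  have "(\<lambda>j. L2_norm U (\<lambda>x. \<phi> j x - v x)) \<longlonglongrightarrow> 0"
  proof (rule Lim_null_comparison[OF always_eventually lims(1)], rule allI)
    show "norm (L2_norm U (\<lambda>x. \<phi> j x - v x)) \<le> L2_norm \<Omega> (\<lambda>x. \<phi> j x - v x)" for j
      using L2_norm_mono_set[OF L2_diff[OF L\<phi>(1)[OF lm(2) \<Omega>(2)] L(1)] U(2) sets] by (simp add: L2_norm_nonneg)
  qed
  from tendsto_integral_L2_inner[OF LU(1) L\<phi>(1)[OF lm(1) bU] L1 this]
  have A: "(\<lambda>j. LINT x|lebesgue_on U. real DIM('a) * \<phi> j x) \<longlonglongrightarrow> (LINT x|lebesgue_on U. real DIM('a) * v x)"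
    by (simp add: mult.commute)
  have "(\<lambda>j. L2_norm U (\<lambda>x. gradient (\<phi> j) x - weak_grad \<Omega> v x)) \<longlonglongrightarrow> 0"
  proof (rule Lim_null_comparison[OF always_eventually lims(2)], rule allI)
    show "norm (L2_norm U (\<lambda>x. gradient (\<phi> j) x - weak_grad \<Omega> v x)) \<le> L2_norm \<Omega> (\<lambda>x. gradient (\<phi> j) x - weak_grad \<Omega> v x)" for j
      using L2_norm_mono_set[OF L2_diff[OF L\<phi>(2)[OF lm(2) \<Omega>(2)] L(2)] U(2) sets] by (simp add: L2_norm_nonneg)
  qed
  from tendsto_integral_L2_inner[OF LU(2) L\<phi>(2)[OF lm(1) bU] Lx this]
  have B: "(\<lambda>j. LINT x|lebesgue_on U. gradient (\<phi> j) x \<bullet> (x - P)) \<longlonglongrightarrow> (LINT x|lebesgue_on U. weak_grad \<Omega> v x \<bullet> (x - P))" .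
  have "(LINT x|lebesgue_on U. gradient (\<phi> j) x \<bullet> (x - P)) + (LINT x|lebesgue_on U. real DIM('a) * \<phi> j x)
      = h * (LINT y|surface_measure F. \<phi> j y)" for j
    using divergence_theorem_cone_on[OF sets(1) eq C1, of j]
      L2_integrable_inner[OF L\<phi>(2)[OF lm(1) bU] Lx, of j] L2_integrable_mult[OF L1 L\<phi>(1)[OF lm(1) bU], of j] by simp
  with tendsto_add[OF B A] have "(\<lambda>j. h * (LINT y|surface_measure F. \<phi> j y)) \<longlonglongrightarrow>
      (LINT x|lebesgue_on U. weak_grad \<Omega> v x \<bullet> (x - P)) + (LINT x|lebesgue_on U. real DIM('a) * v x)" by simp
  also have "(LINT x|lebesgue_on U. weak_grad \<Omega> v x \<bullet> (x - P)) + (LINT x|lebesgue_on U. real DIM('a) * v x)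
     = (LINT x|lebesgue_on U. weak_grad \<Omega> v x \<bullet> (x - P) + real DIM('a) * v x)"
    using L2_integrable_inner[OF LU(2) Lx] L2_integrable_mult[OF L1 LU(1)] by simp
  finally have lim1: "(\<lambda>j. h * (LINT y|surface_measure F. \<phi> j y)) \<longlonglongrightarrow>
      (LINT x|lebesgue_on U. weak_grad \<Omega> v x \<bullet> (x - P) + real DIM('a) * v x)" .
  have ig: "integrable (surface_measure F) g"
    by (rule Jensen_square_finite_measure[OF finite_surface_measure _ g2]) measurable
  have "(\<lambda>j. (LINT y|surface_measure F. \<phi> j y) - (LINT y|surface_measure F. g y)) \<longlonglongrightarrow> 0"
  proof (rule Lim_null_comparison)
    have fin: "integrable (surface_measure F) (\<lambda>y. (\<phi> j y)\<^sup>2)" for j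
    proof -
      have "compact (\<phi> j ` F)"
        by (intro compact_continuous_image compact_F continuous_on_subset[OF C1_continuous[OF C1]]) auto
      then obtain B where B: "\<forall>y\<in>F. \<bar>\<phi> j y\<bar> \<le> B" by (auto dest!: compact_imp_bounded simp: bounded_iff)
      show ?thesis
      proof (rule surface.integrable_const_bound[where B = "B\<^sup>2"])
        show "AE y in surface_measure F. norm ((\<phi> j y)\<^sup>2) \<le> B\<^sup>2"
          using AE_surface_measure by eventually_elim (use B in \<open>auto simp: abs_le_square_iff[symmetric] intro: order.trans[OF _ abs_ge_self]\<close>)
      qed measurable
    qed
    have i\<phi>: "integrable (surface_measure F) (\<phi> j)" for j
      by (rule Jensen_square_finite_measure[OF finite_surface_measure _ fin]) measurable
    have d2: "integrable (surface_measure F) (\<lambda>y. (\<phi> j y - g y)\<^sup>2)" for j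
    proof (rule integrable_if_abs_le)
      show "integrable (surface_measure F) (\<lambda>y. 2 * (\<phi> j y)\<^sup>2 + 2 * (g y)\<^sup>2)" using fin g2 by simp
      show "\<bar>(\<phi> j y - g y)\<^sup>2\<bar> \<le> 2 * (\<phi> j y)\<^sup>2 + 2 * (g y)\<^sup>2" for y
      proof -
        have "0 \<le> (\<phi> j y + g y)\<^sup>2" by simp
        then show ?thesis unfolding abs_power2 by (simp add: power2_eq_square algebra_simps)
      qed
    qed measurable
    show "\<forall>\<^sub>F j in sequentially. norm ((LINT y|surface_measure F. \<phi> j y) - (LINT y|surface_measure F. g y))
        \<le> sqrt (measure (surface_measure F) UNIV * (LINT y|surface_measure F. (\<phi> j y - g y)\<^sup>2))"
    proof (intro always_eventually allI)
      fix j
      have "(LINT y|surface_measure F. \<phi> j y - g y)\<^sup>2 \<le> measure (surface_measure F) UNIV * (LINT y|surface_measure F. (\<phi> j y - g y)\<^sup>2)"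
        using Jensen_square_finite_measure(2)[OF finite_surface_measure _ d2, of j] by simp
      then show "norm ((LINT y|surface_measure F. \<phi> j y) - (LINT y|surface_measure F. g y))
        \<le> sqrt (measure (surface_measure F) UNIV * (LINT y|surface_measure F. (\<phi> j y - g y)\<^sup>2))"
        using i\<phi> ig by (simp add: real_le_rsqrt)
    qed
    have "(\<lambda>j. sqrt (measure (surface_measure F) UNIV * (LINT y|surface_measure F. (\<phi> j y - g y)\<^sup>2)))
       \<longlonglongrightarrow> sqrt (measure (surface_measure F) UNIV * 0)"
      by (intro tendsto_intros lim)
    then show "(\<lambda>j. sqrt (measure (surface_measure F) UNIV * (LINT y|surface_measure F. (\<phi> j y - g y)\<^sup>2))) \<longlonglongrightarrow> 0" by simp
  qed
  then have "(\<lambda>j. LINT y|surface_measure F. \<phi> j y) \<longlonglongrightarrow> (LINT y|surface_measure F. g y)"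
    by (simp add: LIM_zero_iff)
  then have "(\<lambda>j. h * (LINT y|surface_measure F. \<phi> j y)) \<longlonglongrightarrow> h * (LINT y|surface_measure F. g y)"
    by (intro tendsto_intros)
  with lim1 show ?thesis by (rule LIMSEQ_unique)
qed

end

section \<open>Simplices\<close>

lemma has_derivative_affine: "((\<lambda>x. a \<bullet> x + d) has_derivative (\<lambda>h. a \<bullet> h)) (at x)"
  by (auto intro!: derivative_eq_intros)

lemma affine_C1: "C_k 1 (\<lambda>x. a \<bullet> x + d)" "gradient (\<lambda>x. a \<bullet> x + d) = (\<lambda>x. a)"
  by (rule C1_I[of _ "\<lambda>x. a"]; auto simp: has_derivative_affine)+

locale full_simplex =
  fixes C :: "'a::euclidean_space set"
  assumes independent_C: "\<not> affine_dependent C"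
    and card_C: "card C = DIM('a) + 1"
begin

abbreviation S :: "'a set" where "S \<equiv> convex hull C"
abbreviation face :: "'a \<Rightarrow> 'a set" where "face P \<equiv> convex hull (C - {P})"

lemma finite_C: "finite C"
  by (rule aff_independent_finite[OF independent_C])

lemma affine_hull_C: "affine hull C = UNIV"
  using aff_dim_affine_independent[OF independent_C] card_C by (simp add: aff_dim_eq_full[symmetric])

lemma vertices_S: "vertices S = C"
  by (simp add: vertices_def extreme_point_of_convex_hull_affine_independent[OF independent_C])

lemma vertices_face: "vertices (face P) = C - {P}"
  using affine_independent_subset[OF independent_C, of "C - {P}"]
  by (auto simp: vertices_def extreme_point_of_convex_hull_affine_independent)

lemma card_C_minus: "P \<in> C \<Longrightarrow> card (C - {P}) = DIM('a)"
  using card_C finite_C by simp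

lemma facet_of_S: "F facet_of S \<longleftrightarrow> (\<exists>P\<in>C. F = face P)"
proof -
  have "2 \<le> card C" using card_C by (simp add: Suc_le_eq)
  then show ?thesis using facet_of_convex_hull_affine_independent_alt[OF independent_C] by auto
qed

lemma compact_S: "compact S"
  by (simp add: finite_C finite_imp_compact_convex_hull)

lemma interior_S_nonempty: "interior S \<noteq> {}"
  using interior_convex_hull_eq_empty[of C] card_C independent_C by simp

lemma closure_interior_S: "closure (interior S) = S"
  using convex_closure_interior[OF convex_convex_hull interior_S_nonempty] compact_S
  by (simp add: closure_closed compact_imp_closed)

lemma bounded_interior_S: "bounded (interior S)"
  using compact_S by (meson bounded_subset compact_imp_bounded interior_subset)

lemma interior_S_lmeasurable: "interior S \<in> lmeasurable"
  by (simp add: lmeasurable_open bounded_interior_S)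

lemma interior_S_sets: "interior S \<in> sets lebesgue"
  by simp

lemma negligible_S_diff: "negligible (S - interior S)"
  using negligible_convex_frontier[OF convex_convex_hull, of C] compact_S
  by (simp add: frontier_def closure_closed compact_imp_closed)

lemma AE_interior_S: "AE x in lebesgue. x \<in> S \<longleftrightarrow> x \<in> interior S"
proof -
  have "AE x in lebesgue. x \<notin> S - interior S"
    using negligible_S_diff by (intro AE_not_in) (simp add: negligible_iff_null_sets)
  then show ?thesis by eventually_elim (use interior_subset in auto)
qed

definition vol :: real where "vol = measure lebesgue (interior S)"

lemma vol_pos: "vol > 0"
proof -
  have "\<not> negligible (interior S)"
    using open_not_negligible[OF open_interior interior_S_nonempty] .
  then show ?thesis
    using interior_S_lmeasurable unfolding vol_def
    by (metis measure_nonneg negligible_iff_measure0 order_less_le)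
qed

lemma cone_over_facet_exists:
  assumes P: "P \<in> C" shows "\<exists>N c h. cone_over_face (face P) P N c h"
proof -
  have "aff_dim (C - {P}) = int DIM('a) - 1"
    using aff_dim_affine_independent[OF affine_independent_subset[OF independent_C, of "C - {P}"]] card_C_minus[OF P] by simp
  then obtain a b where ab: "a \<noteq> 0" "affine hull (C - {P}) = {x. a \<bullet> x = b}"
    using aff_dim_eq_hyperplane[of "C - {P}"] by auto
  have nP: "a \<bullet> P \<noteq> b" using independent_C P ab unfolding affine_dependent_def by auto
  \<comment> \<open>The sign orients the normal so that it points from \<open>P\<close> towards the
    facet, which makes the height positive.\<close>
  define \<sigma> where "\<sigma> = (if a \<bullet> P < b then 1 else - 1 :: real)"
  define N where "N = (\<sigma> / norm a) *\<^sub>R a"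
  define c where "c = \<sigma> * b / norm a"
  define h where "h = c - N \<bullet> P"
  have s: "\<sigma> = 1 \<or> \<sigma> = - 1" by (simp add: \<sigma>_def)
  have "cone_over_face (face P) P N c h"
  proof
    show "compact (face P)" using finite_C by (intro finite_imp_compact_convex_hull) simp
    have "N \<bullet> x = c \<longleftrightarrow> a \<bullet> x = b" for x
      using ab(1) s by (auto simp: N_def c_def field_simps)
    then show "affine hull face P = {x. N \<bullet> x = c}" by (simp add: ab)
    show "norm N = 1" using ab(1) s by (auto simp: N_def)
    have "h = \<sigma> * (b - a \<bullet> P) / norm a" by (simp add: h_def c_def N_def algebra_simps diff_divide_distrib)
    then show "h > 0" using ab(1) nP by (auto simp: \<sigma>_def intro!: divide_neg_pos mult_neg_neg divide_pos_pos split: if_splits)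
    show "N \<bullet> P = c - h" by (simp add: h_def)
  qed
  then show ?thesis by blast
qed

text \<open>The coordinate belonging to \<open>P\<close> is (c - N . x) / h, which is one minus the
  level in the cone with apex \<open>P\<close> over the opposite facet.\<close>

lemma barycentric_exists:
  assumes P: "P \<in> C" shows "\<exists>a d. \<forall>Q\<in>C. a \<bullet> Q + d = (if Q = P then 1 else 0)"
proof -
  obtain N c h where "cone_over_face (face P) P N c h" using cone_over_facet_exists[OF P] by blast
  then interpret cone_over_face "face P" P N c h .
  have "(- (1 / h) *\<^sub>R N) \<bullet> Q + c / h = (if Q = P then 1 else 0)" if "Q \<in> C" for Q
  proof (cases "Q = P")
    case True
    then show ?thesis using apex h_pos by (simp add: diff_divide_distrib[symmetric] divide_inverse[symmetric] field_simps)
  next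
    case False
    then have "Q \<in> face P" using that by (intro hull_inc) simp
    then show ?thesis using N_F[of Q] h_pos False by simp
  qed
  then show ?thesis by blast
qed

section \<open>Barycentric coordinates\<close>

definition bc_grad :: "'a \<Rightarrow> 'a" where
  "bc_grad P = fst (SOME (a, d). \<forall>Q\<in>C. a \<bullet> Q + d = (if Q = P then 1 else 0))"
definition bc_const :: "'a \<Rightarrow> real" where
  "bc_const P = snd (SOME (a, d). \<forall>Q\<in>C. a \<bullet> Q + d = (if Q = P then 1 else 0))"
definition bc :: "'a \<Rightarrow> 'a \<Rightarrow> real" where "bc P x = bc_grad P \<bullet> x + bc_const P"

lemma bc_vertex: assumes "P \<in> C" "Q \<in> C" shows "bc P Q = (if Q = P then 1 else 0)"
proof -
  have "\<exists>z. case z of (a, d) \<Rightarrow> \<forall>Q\<in>C. a \<bullet> Q + d = (if Q = P then 1 else 0)"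
    using barycentric_exists[OF assms(1)] by simp
  from someI_ex[OF this] show ?thesis using assms(2)
    by (simp add: bc_def bc_grad_def bc_const_def case_prod_unfold)
qed

lemma affine_combination:
  assumes "sum u C = 1" shows "a \<bullet> (\<Sum>Q\<in>C. u Q *\<^sub>R Q) + d = (\<Sum>Q\<in>C. u Q * (a \<bullet> Q + d))"
  using assms by (simp add: inner_sum_right distrib_left sum.distrib sum_distrib_right[symmetric])

lemma bc_coefficients:
  assumes "sum u C = 1" "P \<in> C" shows "bc P (\<Sum>Q\<in>C. u Q *\<^sub>R Q) = u P"
proof -
  have "bc P (\<Sum>Q\<in>C. u Q *\<^sub>R Q) = (\<Sum>Q\<in>C. u Q * bc P Q)"
    unfolding bc_def by (rule affine_combination[OF assms(1)])
  also have "\<dots> = (\<Sum>Q\<in>C. if Q = P then u P else 0)"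
    by (intro sum.cong) (auto simp: bc_vertex assms)
  finally show ?thesis using finite_C assms(2) by simp
qed

lemma bc_sum: "(\<Sum>P\<in>C. bc P x) = 1" and bc_repr: "(\<Sum>P\<in>C. bc P x *\<^sub>R P) = x"
proof -
  have "x \<in> affine hull C" by (simp add: affine_hull_C)
  then obtain u where u: "sum u C = 1" "(\<Sum>Q\<in>C. u Q *\<^sub>R Q) = x"
    using affine_hull_finite[OF finite_C] by auto
  have "bc P x = u P" if "P \<in> C" for P using bc_coefficients[OF u(1) that] u(2) by simp
  then show "(\<Sum>P\<in>C. bc P x) = 1" "(\<Sum>P\<in>C. bc P x *\<^sub>R P) = x" using u by simp_all
qed

lemma affine_eq_bc_sum: "a \<bullet> x + d = (\<Sum>P\<in>C. bc P x * (a \<bullet> P + d))"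
  using affine_combination[OF bc_sum, of a x d] by (simp add: bc_repr)

lemma affine_eqI:
  assumes "\<And>P. P \<in> C \<Longrightarrow> a \<bullet> P + d = a' \<bullet> P + d'" shows "a \<bullet> x + d = a' \<bullet> x + d'"
  by (subst (1 2) affine_eq_bc_sum) (use assms in simp)

lemma S_iff_bc: "x \<in> S \<longleftrightarrow> (\<forall>P\<in>C. bc P x \<ge> 0)"
proof
  assume "x \<in> S"
  then obtain u where u: "\<forall>P\<in>C. 0 \<le> u P" "sum u C = 1" "(\<Sum>Q\<in>C. u Q *\<^sub>R Q) = x"
    using convex_hull_finite[OF finite_C] by auto
  then show "\<forall>P\<in>C. bc P x \<ge> 0" using bc_coefficients[OF u(2)] by auto
next
  assume "\<forall>P\<in>C. bc P x \<ge> 0"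
  then show "x \<in> S"
    unfolding convex_hull_finite[OF finite_C] using bc_sum[of x] bc_repr[of x]
    by (intro CollectI exI[of _ "\<lambda>P. bc P x"]) auto
qed

lemma face_iff_bc:
  assumes P: "P \<in> C" shows "x \<in> face P \<longleftrightarrow> x \<in> S \<and> bc P x = 0"
proof
  assume x: "x \<in> face P"
  obtain u where u: "\<forall>Q\<in>C-{P}. 0 \<le> u Q" "sum u (C-{P}) = 1" "(\<Sum>Q\<in>C-{P}. u Q *\<^sub>R Q) = x"
    using x convex_hull_finite[of "C - {P}"] finite_C by auto
  define w where "w Q = (if Q = P then 0 else u Q)" for Q
  have w: "sum w C = 1" "(\<Sum>Q\<in>C. w Q *\<^sub>R Q) = x"
    using u P finite_C by (auto simp: sum.remove[of C P] w_def intro!: sum.cong)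
  have "bc P x = w P" using bc_coefficients[OF w(1) P] w(2) by simp
  moreover have "x \<in> S" using x hull_mono[of "C - {P}" C convex] by auto
  ultimately show "x \<in> S \<and> bc P x = 0" by (simp add: w_def)
next
  assume x: "x \<in> S \<and> bc P x = 0"
  have "(\<Sum>Q\<in>C-{P}. bc Q x) = 1" "(\<Sum>Q\<in>C-{P}. bc Q x *\<^sub>R Q) = x"
    using bc_sum[of x] bc_repr[of x] x P finite_C by (simp_all add: sum.remove[of C P])
  moreover have "\<forall>Q\<in>C-{P}. bc Q x \<ge> 0" using x S_iff_bc by auto
  ultimately show "x \<in> face P"
    unfolding convex_hull_finite[OF finite_Diff[OF finite_C]]
    by (intro CollectI exI[of _ "\<lambda>P. bc P x"]) auto
qed

lemma face_inject: assumes "P \<in> C" "Q \<in> C" "face P = face Q" shows "P = Q"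
proof (rule ccontr)
  assume "P \<noteq> Q"
  then have "Q \<in> face P" using assms by (intro hull_inc) simp
  then have "bc Q Q = 0" using assms face_iff_bc by auto
  then show False using assms bc_vertex by simp
qed

text \<open>Since the level is 1 - \<open>bc P\<close>, the radial projection of a point of the
  simplex other than \<open>P\<close> has coordinate 0 at \<open>P\<close> and nonnegative ones
  elsewhere, so it lies in the facet. The exceptions are the apex, whose level is 0, and the
  boundary.\<close>

lemma AE_truncated_cone:
  assumes P: "P \<in> C" and cone: "cone_over_face (face P) P N c h"
  shows "AE x in lebesgue. x \<in> interior S \<longleftrightarrow> x \<in> cone_over_face.truncated_cone (face P) P N h"
proof -
  interpret cone_over_face "face P" P N c h by (rule cone)
  have lev: "level x = 1 - bc P x" for x
  proof -
    have "((1 / h) *\<^sub>R N) \<bullet> x + (- (N \<bullet> P) / h) = (- bc_grad P) \<bullet> x + (1 - bc_const P)"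
    proof (rule affine_eqI)
      fix Q assume Q: "Q \<in> C"
      have b: "(- bc_grad P) \<bullet> Q + (1 - bc_const P) = 1 - bc P Q" by (simp add: bc_def)
      show "((1 / h) *\<^sub>R N) \<bullet> Q + (- (N \<bullet> P) / h) = (- bc_grad P) \<bullet> Q + (1 - bc_const P)"
      proof (cases "Q = P")
        case True
        then show ?thesis unfolding b using P by (simp add: bc_vertex)
      next
        case False
        then have "Q \<in> face P" using Q by (intro hull_inc) simp
        then show ?thesis unfolding b using P Q False N_F[of Q] apex h_pos
          by (simp add: bc_vertex field_simps)
      qed
    qed
    then show ?thesis by (simp add: level_def bc_def inner_diff_right diff_divide_distrib)
  qed
  have sub: "x \<in> S" if x: "x \<in> truncated_cone" for x
  proof -
    define y where "y = P + (x - P) /\<^sub>R level x"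
    have y: "y \<in> face P" and l: "0 < level x" "level x \<le> 1"
      using x by (auto simp: truncated_cone_def infinite_cone_def y_def)
    have "x = (1 - level x) *\<^sub>R P + level x *\<^sub>R y" using l by (simp add: y_def algebra_simps)
    moreover have "P \<in> S" "y \<in> S" using P y face_iff_bc by (auto intro: hull_inc)
    ultimately show ?thesis
      using l convexD[OF convex_convex_hull, of P C y "1 - level x" "level x"] by simp
  qed
  have sup: "x \<in> truncated_cone" if x: "x \<in> S" "x \<noteq> P" for x
  proof -
    have nn: "bc Q x \<ge> 0" if "Q \<in> C" for Q using x that S_iff_bc by auto
    have s1: "bc P x + (\<Sum>Q\<in>C-{P}. bc Q x) = 1" using bc_sum[of x] P finite_C by (simp add: sum.remove)
    have "bc P x \<noteq> 1"
    proof
      assume b: "bc P x = 1"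
      then have "\<forall>Q\<in>C-{P}. bc Q x = 0"
        using s1 sum_nonneg_eq_0_iff[of "C-{P}" "\<lambda>Q. bc Q x"] finite_C nn by simp
      then have "x = P" using bc_repr[of x] b P finite_C by (simp add: sum.remove[of C P])
      then show False using x by simp
    qed
    moreover have "bc P x \<le> 1" using s1 sum_nonneg[of "C-{P}" "\<lambda>Q. bc Q x"] nn by force
    ultimately have l: "level x > 0" "level x \<le> 1" using lev nn[OF P] by auto
    define y where "y = P + (x - P) /\<^sub>R level x"
    have bcy: "bc Q y = bc Q P + (bc Q x - bc Q P) / level x" for Q
      using l by (simp add: bc_def y_def inner_add_right inner_diff_right divide_inverse algebra_simps)
    have "bc P y = 0" using l by (simp add: bcy bc_vertex P lev[symmetric] divide_inverse)
      (use lev[of x] l in \<open>simp add: field_simps\<close>)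
    moreover have "bc Q y \<ge> 0" if "Q \<in> C" for Q
    proof (cases "Q = P")
      case False
      then show ?thesis using nn[OF that] l that P by (simp add: bcy bc_vertex)
    qed (use \<open>bc P y = 0\<close> in simp)
    ultimately have "y \<in> face P" using P face_iff_bc S_iff_bc by auto
    then show ?thesis using l by (simp add: truncated_cone_def infinite_cone_def y_def)
  qed
  have "AE x in lebesgue. x \<noteq> P" by (intro AE_completion AE_lborel_singleton)
  with AE_interior_S show ?thesis by eventually_elim (use sub sup in blast)
qed

text \<open>The field \<phi>(x) (x - P) has flux only through the facet opposite to
  \<open>P\<close>, where \<open>\<phi>\<close> is now assumed to vanish. With products of
  barycentric coordinates for \<open>\<phi>\<close> this becomes a recursion for their
  integrals.\<close>

lemma divergence_theorem_simplex:
  assumes P: "P \<in> C" and \<phi>: "C_k 1 \<phi>" and zero: "\<And>y. y \<in> face P \<Longrightarrow> \<phi> y = 0"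
  shows "(LINT x|lebesgue_on (interior S). gradient \<phi> x \<bullet> (x - P) + real DIM('a) * \<phi> x) = 0"
proof -
  obtain N c h where cone: "cone_over_face (face P) P N c h" using cone_over_facet_exists[OF P] by blast
  interpret cone_over_face "face P" P N c h by (rule cone)
  have "(LINT y|surface_measure (face P). \<phi> y) = (LINT y|surface_measure (face P). 0)"
    using borel_measurable_continuous_onI[OF C1_continuous[OF \<phi>]]
    by (intro integral_cong_AE) (auto intro: eventually_mono[OF AE_surface_measure] simp: zero)
  then show ?thesis
    using divergence_theorem_cone_on[OF interior_S_sets AE_truncated_cone[OF P cone] \<phi>] by simp
qed

lemma lebesgue_on_const: "(LINT x|lebesgue_on (interior S). a) = vol * a"
  using interior_S_lmeasurable by (simp add: vol_def measure_restrict_space fmeasurableD)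

text \<open>The formula for the constant 1 identifies \<open>h\<close> times the area of the facet
  with n times the volume, so the surface integral of the trace turns into its mean.\<close>

lemma green_formula_simplex:
  assumes P: "P \<in> C" and \<Omega>: "open \<Omega>" "bounded \<Omega>" "interior S \<subseteq> \<Omega>" and v: "v \<in> H10 \<Omega>"
  shows "(LINT x|lebesgue_on (interior S). weak_grad \<Omega> v x \<bullet> (x - P) + real DIM('a) * v x) = real DIM('a) * vol * face_mean \<Omega> (face P) v"
proof -
  obtain N c h where cone: "cone_over_face (face P) P N c h" using cone_over_facet_exists[OF P] by blast
  interpret cone_over_face "face P" P N c h by (rule cone)
  obtain \<phi> where \<phi>: "test_approximation \<Omega> \<phi> v" and v1: "v \<in> H1 \<Omega>" using v by (auto simp: H10_def)
  have "is_trace \<Omega> (face P) v (SOME g. is_trace \<Omega> (face P) v g)"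
    by (rule someI_ex[OF trace_exists[OF \<Omega>(1,2) v1 \<phi>]])
  from green_formula_trace[OF \<Omega>(1,2) open_interior \<Omega>(3) AE_truncated_cone[OF P cone] v1 this]
  have 1: "(LINT x|lebesgue_on (interior S). weak_grad \<Omega> v x \<bullet> (x - P) + real DIM('a) * v x)
      = h * (LINT y|surface_measure (face P). (SOME g. is_trace \<Omega> (face P) v g) y)" .
  have g1: "gradient (\<lambda>x. 1) = (\<lambda>x::'a. 0)" using affine_C1(2)[of 0 1] by simp
  have "(LINT x|lebesgue_on (interior S). gradient (\<lambda>x. 1) x \<bullet> (x - P) + real DIM('a) * 1) = h * (LINT y|surface_measure (face P). 1)"
    by (rule divergence_theorem_cone_on[OF interior_S_sets AE_truncated_cone[OF P cone] C_k_const])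
  then have 2: "real DIM('a) * vol = h * measure (surface_measure (face P)) UNIV"
    using lebesgue_on_const[of "real DIM('a)"] by (simp add: g1 mult.commute)
  then have "measure (surface_measure (face P)) UNIV \<noteq> 0" using vol_pos by auto
  then show ?thesis unfolding 1 2 by (simp add: face_mean_def)
qed

text \<open>Test functions of \<open>\<Omega>\<close> vanish on its frontier, so the zero function
  is a trace. This matches \<open>I_CR\<close>, which assigns the value 0 to boundary
  facets.\<close>

lemma green_formula_simplex_boundary:
  assumes P: "P \<in> C" and \<Omega>: "open \<Omega>" "bounded \<Omega>" "interior S \<subseteq> \<Omega>" and v: "v \<in> H10 \<Omega>"
    and bd: "face P \<subseteq> frontier \<Omega>"
  shows "(LINT x|lebesgue_on (interior S). weak_grad \<Omega> v x \<bullet> (x - P) + real DIM('a) * v x) = 0"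
proof -
  obtain N c h where cone: "cone_over_face (face P) P N c h" using cone_over_facet_exists[OF P] by blast
  interpret cone_over_face "face P" P N c h by (rule cone)
  obtain \<phi> where \<phi>: "test_approximation \<Omega> \<phi> v" and v1: "v \<in> H1 \<Omega>" using v by (auto simp: H10_def)
  have z: "\<phi> j y = 0" if "y \<in> face P" for j y
  proof -
    have "test_function \<Omega> (\<phi> j)" using \<phi> by (simp add: test_approximation_def)
    then obtain K where "K \<subseteq> \<Omega>" "\<And>x. x \<notin> K \<Longrightarrow> \<phi> j x = 0" using test_function_support by metis
    moreover have "y \<notin> \<Omega>" using that bd \<Omega>(1) by (auto simp: frontier_def interior_open)
    ultimately show ?thesis by blast
  qed
  have "(LINT y|surface_measure (face P). (\<phi> j y - 0)\<^sup>2) = (LINT y|surface_measure (face P). 0)" for j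
  proof (rule integral_cong_AE)
    have "test_function \<Omega> (\<phi> j)" using \<phi> by (simp add: test_approximation_def)
    from borel_measurable_continuous_onI[OF C1_continuous[OF test_function_C1[OF this]]]
    show "(\<lambda>y. (\<phi> j y - 0)\<^sup>2) \<in> borel_measurable (surface_measure (face P))" by simp
    show "AE y in surface_measure (face P). (\<phi> j y - 0)\<^sup>2 = 0"
      using AE_surface_measure by eventually_elim (simp add: z)
  qed simp
  then have "is_trace \<Omega> (face P) v (\<lambda>_. 0)"
    unfolding is_trace_def using \<phi> by (auto intro!: exI[of _ \<phi>])
  from green_formula_trace[OF \<Omega>(1,2) open_interior \<Omega>(3) AE_truncated_cone[OF P cone] v1 this]
  show ?thesis by simp
qed

section \<open>Moments of a simplex and of its bubble function\<close>

lemma continuous_integrable: "continuous_on UNIV f \<Longrightarrow> integrable (lebesgue_on (interior S)) (f :: 'a \<Rightarrow> real)"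
  by (intro L2_integrable interior_S_lmeasurable L2_continuous bounded_interior_S)

lemma continuous_bc: "continuous_on A (bc P)"
  unfolding bc_def by (intro continuous_intros)

lemma bc_C1: "C_k 1 (bc P)" "gradient (bc P) = (\<lambda>x. bc_grad P)"
  unfolding bc_def by (rule affine_C1)+

lemma bc_grad_inner: "P \<in> C \<Longrightarrow> bc_grad Q \<bullet> (x - P) = bc Q x - bc Q P"
  by (simp add: bc_def inner_diff_right)

text \<open>With \<phi> = \<open>bc P\<close>, the derivative along x - P is
  \<open>bc P x - 1\<close>, so the integral of (n + 1) \<open>bc P\<close> - 1 vanishes.\<close>

lemma integral_bc: assumes P: "P \<in> C"
  shows "(real DIM('a) + 1) * (LINT x|lebesgue_on (interior S). bc P x) = vol"
proof -
  have i: "integrable (lebesgue_on (interior S)) (bc P)" by (rule continuous_integrable[OF continuous_bc])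
  have "0 = (LINT x|lebesgue_on (interior S). gradient (bc P) x \<bullet> (x - P) + real DIM('a) * bc P x)"
    by (rule divergence_theorem_simplex[OF P bc_C1(1), symmetric]) (use face_iff_bc[OF P] in auto)
  also have "\<dots> = (LINT x|lebesgue_on (interior S). (real DIM('a) + 1) * bc P x - 1)"
  proof (rule Bochner_Integration.integral_cong[OF refl])
    fix x
    have "gradient (bc P) x \<bullet> (x - P) = bc P x - 1"
      by (simp add: bc_C1 bc_grad_inner P bc_vertex)
    then show "gradient (bc P) x \<bullet> (x - P) + real DIM('a) * bc P x = (real DIM('a) + 1) * bc P x - 1"
      by (simp add: algebra_simps)
  qed
  also have "\<dots> = (real DIM('a) + 1) * (LINT x|lebesgue_on (interior S). bc P x) - (LINT x|lebesgue_on (interior S). 1)"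
    using i by (subst Bochner_Integration.integral_diff) (auto intro!: continuous_integrable)
  finally show ?thesis using lebesgue_on_const[of 1] by simp
qed

text \<open>The product vanishes on the facet opposite to \<open>P\<close>, and the divergence is (n
  + 2) times the product minus \<open>bc Q\<close>; for P = Q the term \<open>bc Q\<close> occurs
  twice because then \<open>bc Q P\<close> is 1.\<close>

lemma integral_bc_bc: assumes P: "P \<in> C" and Q: "Q \<in> C"
  shows "(real DIM('a) + 1) * (real DIM('a) + 2) * (LINT x|lebesgue_on (interior S). bc P x * bc Q x) = vol * (if P = Q then 2 else 1)"
proof -
  have i: "integrable (lebesgue_on (interior S)) (bc R)" for R by (rule continuous_integrable[OF continuous_bc])
  have ii: "integrable (lebesgue_on (interior S)) (\<lambda>x. bc P x * bc Q x)"
    by (intro continuous_integrable continuous_intros continuous_bc)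
  have "0 = (LINT x|lebesgue_on (interior S). gradient (\<lambda>x. bc P x * bc Q x) x \<bullet> (x - P) + real DIM('a) * (bc P x * bc Q x))"
    by (rule divergence_theorem_simplex[OF P C_k_mult[OF bc_C1(1) bc_C1(1)], symmetric]) (use face_iff_bc[OF P] in auto)
  also have "\<dots> = (LINT x|lebesgue_on (interior S). (real DIM('a) + 2) * (bc P x * bc Q x) - (if P = Q then 2 else 1) * bc Q x)"
  proof (rule Bochner_Integration.integral_cong[OF refl])
    fix x
    have "gradient (\<lambda>x. bc P x * bc Q x) x \<bullet> (x - P) = bc P x * (bc Q x - bc Q P) + bc Q x * (bc P x - 1)"
      by (simp add: gradient_mult[OF bc_C1(1) bc_C1(1)] bc_C1(2) inner_add_left bc_grad_inner P bc_vertex)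
    then show "gradient (\<lambda>x. bc P x * bc Q x) x \<bullet> (x - P) + real DIM('a) * (bc P x * bc Q x)
       = (real DIM('a) + 2) * (bc P x * bc Q x) - (if P = Q then 2 else 1) * bc Q x"
      using P Q by (auto simp: bc_vertex algebra_simps)
  qed
  also have "\<dots> = (real DIM('a) + 2) * (LINT x|lebesgue_on (interior S). bc P x * bc Q x) - (if P = Q then 2 else 1) * (LINT x|lebesgue_on (interior S). bc Q x)"
    using i ii by simp
  finally have "(real DIM('a) + 2) * (LINT x|lebesgue_on (interior S). bc P x * bc Q x) = (if P = Q then 2 else 1) * (LINT x|lebesgue_on (interior S). bc Q x)"
    by simp
  then have "(real DIM('a) + 1) * (real DIM('a) + 2) * (LINT x|lebesgue_on (interior S). bc P x * bc Q x) = (if P = Q then 2 else 1) * ((real DIM('a) + 1) * (LINT x|lebesgue_on (interior S). bc Q x))"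
    by (simp add: mult_ac)
  then show ?thesis unfolding integral_bc[OF Q] by simp
qed

abbreviation b :: 'a where "b \<equiv> barycenter S"

lemma b_eq: "(real DIM('a) + 1) *\<^sub>R b = (\<Sum>P\<in>C. P)"
  using card_C by (simp add: barycenter_def vertices_S add.commute)

lemma b_face_eq: assumes P: "P \<in> C" shows "real DIM('a) *\<^sub>R barycenter (face P) = (real DIM('a) + 1) *\<^sub>R b - P"
  using card_C_minus[OF P] P finite_C unfolding b_eq by (simp add: barycenter_def vertices_face sum_diff1)

lemma sum_vertices_minus_b: "(\<Sum>P\<in>C. P - b) = 0"
  using card_C b_eq by (simp add: sum_subtractf sum_constant_scaleR add.commute)

lemma integral_affine: "(LINT x|lebesgue_on (interior S). a \<bullet> x + d) = vol * (a \<bullet> b + d)"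
proof -
  have i: "integrable (lebesgue_on (interior S)) (bc R)" for R by (rule continuous_integrable[OF continuous_bc])
  have "(LINT x|lebesgue_on (interior S). a \<bullet> x + d) = (LINT x|lebesgue_on (interior S). (\<Sum>P\<in>C. bc P x * (a \<bullet> P + d)))"
    by (rule Bochner_Integration.integral_cong[OF refl affine_eq_bc_sum])
  also have "\<dots> = (\<Sum>P\<in>C. (LINT x|lebesgue_on (interior S). bc P x) * (a \<bullet> P + d))"
    using i by (subst Bochner_Integration.integral_sum) auto
  also have "\<dots> = (\<Sum>P\<in>C. vol / (real DIM('a) + 1) * (a \<bullet> P + d))"
    using integral_bc by (intro sum.cong) (auto simp: field_simps)
  also have "\<dots> = vol / (real DIM('a) + 1) * (a \<bullet> (\<Sum>P\<in>C. P) + real (card C) * d)"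
    by (simp only: sum_distrib_left[symmetric] sum.distrib inner_sum_right sum_constant)
  also have "\<dots> = vol * (a \<bullet> b + d)" unfolding b_eq[symmetric] card_C
    by (simp add: field_simps inner_add_right)
  finally show ?thesis .
qed

definition sqs :: real where
  "sqs = (\<Sum>(P, Q) \<in> {(P, Q). P \<in> vertices S \<and> Q \<in> vertices S \<and> P \<noteq> Q}. (norm (P - Q))\<^sup>2)"

text \<open>Expanding |P - Q|^2 about the barycenter, the mixed terms cancel because the vectors P -
  b sum to 0, and every vertex is counted n + 1 times in each of the two positions.\<close>

lemma sqs_eq: "sqs = 2 * (real DIM('a) + 1) * (\<Sum>P\<in>C. (norm (P - b))\<^sup>2)"
proof -
  have "sqs = (\<Sum>(P, Q) \<in> C \<times> C. (norm (P - Q))\<^sup>2)"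
    unfolding sqs_def vertices_S using finite_C by (intro sum.mono_neutral_left) auto
  also have "\<dots> = (\<Sum>P\<in>C. \<Sum>Q\<in>C. (norm (P - Q))\<^sup>2)" by (simp add: sum.cartesian_product)
  also have "\<dots> = (\<Sum>P\<in>C. \<Sum>Q\<in>C. (norm (P - b))\<^sup>2 + (norm (Q - b))\<^sup>2 - 2 * ((P - b) \<bullet> (Q - b)))"
  proof (intro sum.cong refl)
    fix P Q
    have "P - Q = (P - b) - (Q - b)" by simp
    then show "(norm (P - Q))\<^sup>2 = (norm (P - b))\<^sup>2 + (norm (Q - b))\<^sup>2 - 2 * ((P - b) \<bullet> (Q - b))"
      by (simp only: power2_norm_eq_inner) (simp add: inner_diff_left inner_diff_right inner_commute algebra_simps)
  qed
  also have "\<dots> = 2 * real (card C) * (\<Sum>P\<in>C. (norm (P - b))\<^sup>2) - 2 * (\<Sum>P\<in>C. (P - b) \<bullet> (\<Sum>Q\<in>C. Q - b))"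
  proof -
    have "(\<Sum>P\<in>C. \<Sum>Q\<in>C. f P + f Q - 2 * (g P \<bullet> g Q)) = 2 * real (card C) * sum f C - 2 * (\<Sum>P\<in>C. g P \<bullet> (\<Sum>Q\<in>C. g Q))"
      for f :: "'a \<Rightarrow> real" and g :: "'a \<Rightarrow> 'a"
      by (simp add: sum.distrib sum_subtractf sum_distrib_left inner_sum_right mult.assoc)
    then show ?thesis .
  qed
  also have "\<dots> = 2 * (real DIM('a) + 1) * (\<Sum>P\<in>C. (norm (P - b))\<^sup>2)"
    unfolding sum_vertices_minus_b card_C by simp
  finally show ?thesis .
qed

lemma sqs_pos: "sqs > 0"
proof -
  have "\<exists>P\<in>C. P \<noteq> b"
  proof (rule ccontr)
    assume "\<not> ?thesis"
    then have "C \<subseteq> {b}" by auto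
    then have "card C \<le> 1" using card_mono[of "{b}" C] by simp
    then show False using card_C DIM_positive[where 'a='a] by simp
  qed
  then have "0 < (\<Sum>P\<in>C. (norm (P - b))\<^sup>2)"
    using finite_C by (metis (mono_tags, lifting) norm_eq_zero right_minus_eq sum_pos2 zero_le_power2 zero_less_power2)
  then show ?thesis by (simp add: sqs_eq)
qed

text \<open>x - b is the combination of the vectors P - b with barycentric coefficients. Their
  second moments are vol / ((n + 1) (n + 2)), doubled on the diagonal; the constant part drops out
  because the vectors sum to 0, and only the diagonal remains.\<close>

lemma integral_norm_b: "(LINT x|lebesgue_on (interior S). (norm (x - b))\<^sup>2) = vol * sqs / (2 * (real DIM('a) + 1)\<^sup>2 * (real DIM('a) + 2))"
proof -
  have ii: "integrable (lebesgue_on (interior S)) (\<lambda>x. bc P x * bc Q x)" for P Q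
    by (intro continuous_integrable continuous_intros continuous_bc)
  have xb: "(norm (x - b))\<^sup>2 = (\<Sum>P\<in>C. \<Sum>Q\<in>C. (bc P x * bc Q x) * ((P - b) \<bullet> (Q - b)))" for x
  proof -
    have "x - b = (\<Sum>P\<in>C. bc P x *\<^sub>R (P - b))"
      using bc_repr[of x] bc_sum[of x] by (simp add: scaleR_diff_right sum_subtractf scaleR_sum_left[symmetric])
    moreover have "(\<Sum>P\<in>C. bc P x *\<^sub>R g P) \<bullet> (\<Sum>P\<in>C. bc P x *\<^sub>R g P) = (\<Sum>P\<in>C. \<Sum>Q\<in>C. (bc P x * bc Q x) * (g P \<bullet> g Q))"
      for g :: "'a \<Rightarrow> 'a"
      by (simp only: inner_sum_left) (simp add: inner_sum_right mult.assoc mult.left_commute)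
    ultimately show ?thesis by (simp add: power2_norm_eq_inner)
  qed
  have e: "(LINT x|lebesgue_on (interior S). bc P x * bc Q x) = vol / ((real DIM('a) + 1) * (real DIM('a) + 2)) * (1 + (if P = Q then 1 else 0))"
    if "P \<in> C" "Q \<in> C" for P Q
  proof -
    have "(real DIM('a) + 1) * (real DIM('a) + 2) \<noteq> 0"
      using add_pos_pos[of "real DIM('a)" 1] add_pos_pos[of "real DIM('a)" 2] by simp
    then have "(LINT x|lebesgue_on (interior S). bc P x * bc Q x)
       = ((real DIM('a) + 1) * (real DIM('a) + 2) * (LINT x|lebesgue_on (interior S). bc P x * bc Q x)) / ((real DIM('a) + 1) * (real DIM('a) + 2))"
      by simp
    then show ?thesis unfolding integral_bc_bc[OF that] by simp
  qed
  have "(LINT x|lebesgue_on (interior S). (norm (x - b))\<^sup>2)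
     = (\<Sum>P\<in>C. \<Sum>Q\<in>C. (LINT x|lebesgue_on (interior S). bc P x * bc Q x) * ((P - b) \<bullet> (Q - b)))"
    unfolding xb using ii by (simp add: Bochner_Integration.integral_sum)
  also have "\<dots> = (\<Sum>P\<in>C. \<Sum>Q\<in>C. vol / ((real DIM('a) + 1) * (real DIM('a) + 2)) * (1 + (if P = Q then 1 else 0)) * ((P - b) \<bullet> (Q - b)))"
    by (intro sum.cong refl) (simp add: e)
  also have "\<dots> = vol / ((real DIM('a) + 1) * (real DIM('a) + 2)) * (\<Sum>P\<in>C. \<Sum>Q\<in>C. (P - b) \<bullet> (Q - b) + (if P = Q then (norm (P - b))\<^sup>2 else 0))"
    unfolding sum_distrib_left
  proof (intro sum.cong refl)
    fix P Q
    have "k * (1 + (if p then 1 else 0)) * y = k * (y + (if p then y else 0))" for k y :: real and p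
      by (simp add: algebra_simps)
    from this[of "vol / ((real DIM('a) + 1) * (real DIM('a) + 2))" "P = Q" "(P - b) \<bullet> (Q - b)"]
    show "vol / ((real DIM('a) + 1) * (real DIM('a) + 2)) * (1 + (if P = Q then 1 else 0)) * ((P - b) \<bullet> (Q - b))
        = vol / ((real DIM('a) + 1) * (real DIM('a) + 2)) * ((P - b) \<bullet> (Q - b) + (if P = Q then (norm (P - b))\<^sup>2 else 0))"
      by (cases "P = Q") (simp_all only: power2_norm_eq_inner if_True if_False simp_thms)
  qed
  also have "(\<Sum>P\<in>C. \<Sum>Q\<in>C. (P - b) \<bullet> (Q - b) + (if P = Q then (norm (P - b))\<^sup>2 else 0))
     = (\<Sum>P\<in>C. (P - b) \<bullet> (\<Sum>Q\<in>C. Q - b)) + (\<Sum>P\<in>C. (norm (P - b))\<^sup>2)"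
    using finite_C by (simp add: sum.distrib inner_sum_right)
  also have "\<dots> = sqs / (2 * (real DIM('a) + 1))" unfolding sum_vertices_minus_b by (simp add: sqs_eq)
  finally show ?thesis by (simp add: power2_eq_square field_simps)
qed

text \<open>The polynomial of the bubble without the cut-off at the boundary, to which the calculus
  of C1 functions on the whole space applies. \<open>bub_rate\<close> is the factor of x - b in its
  gradient.\<close>

definition bub :: "'a \<Rightarrow> real" where
  "bub x = (real DIM('a) + 2) / 2 - real DIM('a) * (real DIM('a) + 1)\<^sup>2 * (real DIM('a) + 2) / sqs * (norm (x - b))\<^sup>2"
definition bub_rate :: real where "bub_rate = - 2 * (real DIM('a) * (real DIM('a) + 1)\<^sup>2 * (real DIM('a) + 2) / sqs)"

lemma bubble_eq: "x \<in> S \<Longrightarrow> bubble S x = bub x"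
  by (simp add: bubble_def bub_def sqs_def)

lemma bub_C1: "C_k 1 bub" and bub_gradient: "gradient bub = (\<lambda>x. bub_rate *\<^sub>R (x - b))"
proof -
  have eq: "bub = (\<lambda>x. (real DIM('a) + 2) / 2 - real DIM('a) * (real DIM('a) + 1)\<^sup>2 * (real DIM('a) + 2) / sqs * ((x - b) \<bullet> (x - b)))"
    by (simp add: bub_def[abs_def] power2_norm_eq_inner)
  have "(bub has_derivative (\<lambda>h. (bub_rate *\<^sub>R (x - b)) \<bullet> h)) (at x)" for x
    unfolding eq bub_rate_def
    using sqs_pos by (auto intro!: derivative_eq_intros simp: inner_commute)
  then show "C_k 1 bub" "gradient bub = (\<lambda>x. bub_rate *\<^sub>R (x - b))"
    by (rule C1_I; intro continuous_intros)+
qed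

text \<open>By \<open>integral_norm_b\<close> the quadratic term has mean n / 2, and (n + 2) / 2 - n
  / 2 = 1.\<close>

lemma integral_bub: "(LINT x|lebesgue_on (interior S). bub x) = vol"
proof -
  have i: "integrable (lebesgue_on (interior S)) (\<lambda>x. (norm (x - b))\<^sup>2)"
    by (intro continuous_integrable continuous_intros)
  have "(LINT x|lebesgue_on (interior S). bub x)
     = (LINT x|lebesgue_on (interior S). (real DIM('a) + 2) / 2) - real DIM('a) * (real DIM('a) + 1)\<^sup>2 * (real DIM('a) + 2) / sqs * (LINT x|lebesgue_on (interior S). (norm (x - b))\<^sup>2)"
    unfolding bub_def using i by (subst Bochner_Integration.integral_diff) (auto intro!: continuous_integrable)
  also have "\<dots> = vol"
  proof -
    have "k * X * m / sqs * (vol * sqs / (2 * X * m)) = k * vol / 2" if "X > 0" "m > 0" for k X m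
      using sqs_pos that by (simp add: field_simps)
    from this[of "(real DIM('a) + 1)\<^sup>2" "real DIM('a) + 2" "real DIM('a)"]
    show ?thesis unfolding lebesgue_on_const integral_norm_b by (simp add: algebra_simps add_divide_distrib)
  qed
  finally show ?thesis .
qed

text \<open>The volume form of the fact that an affine function attains its mean over a facet at the
  barycenter; n times the latter is (n + 1) b - P.\<close>

lemma flux_affine:
  assumes P: "P \<in> C"
  shows "(LINT x|lebesgue_on (interior S). a \<bullet> (x - P) + real DIM('a) * (a \<bullet> x + d)) = real DIM('a) * vol * (a \<bullet> barycenter (face P) + d)"
proof -
  have "(LINT x|lebesgue_on (interior S). a \<bullet> (x - P) + real DIM('a) * (a \<bullet> x + d))
      = (LINT x|lebesgue_on (interior S). ((real DIM('a) + 1) *\<^sub>R a) \<bullet> x + (real DIM('a) * d - a \<bullet> P))"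
    by (simp add: inner_diff_right algebra_simps)
  also have "\<dots> = vol * (a \<bullet> ((real DIM('a) + 1) *\<^sub>R b - P) + real DIM('a) * d)"
    unfolding integral_affine by (simp add: inner_diff_right algebra_simps)
  also have "\<dots> = real DIM('a) * vol * (a \<bullet> barycenter (face P) + d)"
    unfolding b_face_eq[OF P, symmetric] by (simp add: algebra_simps)
  finally show ?thesis .
qed

text \<open>The volume form of the vanishing mean of the bubble over each facet: the gradient term
  contributes - n vol and the bubble itself n vol.\<close>

lemma flux_bub:
  assumes P: "P \<in> C"
  shows "(LINT x|lebesgue_on (interior S). (bub_rate *\<^sub>R (x - b)) \<bullet> (x - P) + real DIM('a) * bub x) = 0"
proof -
  have i: "integrable (lebesgue_on (interior S)) (\<lambda>x. (norm (x - b))\<^sup>2)"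
    "integrable (lebesgue_on (interior S)) (\<lambda>x. (b - P) \<bullet> x + (- ((b - P) \<bullet> b)))"
    "integrable (lebesgue_on (interior S)) bub"
    by (intro continuous_integrable continuous_intros C1_continuous bub_C1)+
  have "(LINT x|lebesgue_on (interior S). (bub_rate *\<^sub>R (x - b)) \<bullet> (x - P) + real DIM('a) * bub x)
     = (LINT x|lebesgue_on (interior S). bub_rate * ((norm (x - b))\<^sup>2 + ((b - P) \<bullet> x + (- ((b - P) \<bullet> b)))) + real DIM('a) * bub x)"
    by (intro Bochner_Integration.integral_cong refl)
      (simp add: power2_norm_eq_inner inner_diff_left inner_diff_right inner_commute algebra_simps)
  also have "\<dots> = bub_rate * ((LINT x|lebesgue_on (interior S). (norm (x - b))\<^sup>2)
      + (LINT x|lebesgue_on (interior S). (b - P) \<bullet> x + (- ((b - P) \<bullet> b)))) + real DIM('a) * (LINT x|lebesgue_on (interior S). bub x)"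
    using i by simp
  also have "\<dots> = bub_rate * (vol * sqs / (2 * (real DIM('a) + 1)\<^sup>2 * (real DIM('a) + 2))) + real DIM('a) * vol"
    unfolding integral_affine integral_bub integral_norm_b by simp
  also have "\<dots> = 0"
  proof -
    have "- 2 * (k * X * m / sqs) * (vol * sqs / (2 * X * m)) = - k * vol" if "X > 0" "m > 0" for k X m
      using sqs_pos that by (simp add: field_simps)
    from this[of "(real DIM('a) + 1)\<^sup>2" "real DIM('a) + 2" "real DIM('a)"]
    show ?thesis unfolding bub_rate_def by simp
  qed
  finally show ?thesis .
qed

text \<open>The gradients of enriched Crouzeix-Raviart functions are combinations of the Raviart-Thomas
  fields \<open>x - P\<close>.\<close>

lemma Raviart_Thomas_span: "\<exists>\<alpha>. \<forall>x. a + \<gamma> *\<^sub>R (x - b) = (\<Sum>P\<in>C. \<alpha> P *\<^sub>R (x - P))"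
proof -
  \<comment> \<open>The coefficients sum to 0 and give the point - a, so they represent the constant
    field \<open>a\<close>; adding the same \<open>t\<close> to all of them produces the multiple of
    x - b.\<close>
  define \<beta> where "\<beta> P = bc P (b - a) - 1 / (real DIM('a) + 1)" for P
  have s0: "(\<Sum>P\<in>C. \<beta> P) = 0" using bc_sum[of "b - a"] card_C by (simp add: \<beta>_def sum_subtractf)
  have "(\<Sum>P\<in>C. \<beta> P *\<^sub>R P) = (b - a) - (1 / (real DIM('a) + 1)) *\<^sub>R (\<Sum>P\<in>C. P)"
    using bc_repr[of "b - a"] by (simp add: \<beta>_def scaleR_diff_left sum_subtractf scaleR_sum_right)
  also have "\<dots> = - a" unfolding b_eq[symmetric] by simp
  finally have s1: "(\<Sum>P\<in>C. \<beta> P *\<^sub>R P) = - a" .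
  define t where "t = \<gamma> / (real DIM('a) + 1)"
  have t: "\<gamma> = t * (real DIM('a) + 1)" by (simp add: t_def)
  have "a + \<gamma> *\<^sub>R (x - b) = (\<Sum>P\<in>C. (\<beta> P + t) *\<^sub>R (x - P))" for x
  proof -
    have "(\<Sum>P\<in>C. (\<beta> P + t) *\<^sub>R (x - P))
        = (\<Sum>P\<in>C. \<beta> P *\<^sub>R x) - (\<Sum>P\<in>C. \<beta> P *\<^sub>R P) + ((\<Sum>P\<in>C. t *\<^sub>R x) - (\<Sum>P\<in>C. t *\<^sub>R P))"
      by (simp add: scaleR_diff_right scaleR_add_left sum.distrib sum_subtractf algebra_simps)
    also have "\<dots> = a + (t * (real DIM('a) + 1)) *\<^sub>R x - t *\<^sub>R ((real DIM('a) + 1) *\<^sub>R b)"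
      unfolding s1 scaleR_sum_left[symmetric] s0 b_eq scaleR_sum_right using card_C
      by (simp add: sum_constant_scaleR mult.commute)
    also have "\<dots> = a + \<gamma> *\<^sub>R (x - b)"
      unfolding t by (simp add: scaleR_diff_right)
    finally show ?thesis by simp
  qed
  then show ?thesis by (intro exI[of _ "\<lambda>P. \<beta> P + t"]) simp
qed

lemma trace_from_affine:
  assumes v: "\<And>y. y \<in> interior S \<Longrightarrow> v y = a \<bullet> y + d" and x: "x \<in> S"
  shows "trace_from S v x = a \<bullet> x + d"
proof -
  have nt: "\<not> trivial_limit (at x within interior S)"
    unfolding trivial_limit_within
    using x closure_interior_S interior_limit_point[of x "interior S"] by (auto simp: closure_def)
  have "((\<lambda>y. a \<bullet> y + d) \<longlongrightarrow> a \<bullet> x + d) (at x within interior S)" by (intro tendsto_intros)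
  then have "(v \<longlongrightarrow> a \<bullet> x + d) (at x within interior S)"
    by (rule Lim_transform_eventually) (simp add: v eventually_at_filter)
  then show ?thesis unfolding trace_from_def by (rule tendsto_Lim[OF nt])
qed

lemma barycenter_face_in_S: assumes P: "P \<in> C" shows "barycenter (face P) \<in> S"
proof -
  have "barycenter (face P) = (\<Sum>Q\<in>C-{P}. (1 / real DIM('a)) *\<^sub>R Q)"
    using card_C_minus[OF P] by (simp add: barycenter_def vertices_face scaleR_sum_right divide_inverse)
  also have "\<dots> \<in> convex hull (C - {P})"
    using card_C_minus[OF P] finite_C by (intro convex_sum) (auto intro: hull_inc)
  also have "\<dots> \<subseteq> S" by (intro hull_mono) auto
  finally show ?thesis .
qed

text \<open>The function is 1 - n \<open>bc P\<close>: the coordinate vanishes on the facet opposite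
  to \<open>P\<close> and is 1 / n at the barycenters of the other facets.\<close>

lemma nodal_affine_function:
  assumes P: "P \<in> C"
  shows "\<exists>a d. \<forall>Q\<in>C. a \<bullet> barycenter (face Q) + d = (if Q = P then 1 else 0)"
proof (intro exI ballI)
  fix Q assume Q: "Q \<in> C"
  have "real DIM('a) * (bc_grad P \<bullet> barycenter (face Q)) = bc_grad P \<bullet> ((real DIM('a) + 1) *\<^sub>R b - Q)"
    unfolding b_face_eq[OF Q, symmetric] by simp
  also have "\<dots> = (\<Sum>R\<in>C. bc P R) - bc P Q - real DIM('a) * bc_const P"
    unfolding b_eq using card_C by (simp add: bc_def inner_diff_right inner_sum_right sum.distrib algebra_simps)
  also have "(\<Sum>R\<in>C. bc P R) = 1" using P finite_C by (simp add: bc_vertex)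
  finally show "(- real DIM('a) *\<^sub>R bc_grad P) \<bullet> barycenter (face Q) + (1 - real DIM('a) * bc_const P) = (if Q = P then 1 else 0)"
    using P Q by (simp add: bc_vertex)
qed

end

section \<open>The interpolation operator\<close>

text \<open>The domain lies on one side of its boundary, so it has no slits: moving from a frontier
  point against the direction \<open>e\<close>, one leaves the closure. As the simplices cover the
  closure, this is what puts their interiors into \<open>\<Omega>\<close>.\<close>

lemma interior_closure_Lipschitz:
  fixes \<Omega> :: "'a::euclidean_space set"
  assumes "bounded_Lipschitz_domain \<Omega>" shows "interior (closure \<Omega>) \<subseteq> \<Omega>"
proof
  fix x assume x: "x \<in> interior (closure \<Omega>)"
  have \<Omega>: "open \<Omega>" using assms by (simp add: bounded_Lipschitz_domain_def)
  show "x \<in> \<Omega>"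
  proof (rule ccontr)
    assume nx: "x \<notin> \<Omega>"
    then have "x \<in> frontier \<Omega>" using x \<Omega> interior_subset by (auto simp: frontier_def interior_open)
    then have "\<exists>e r L g. norm e = 1 \<and> r > 0 \<and> L-lipschitz_on UNIV g \<and>
        \<Omega> \<inter> ball x r = {y \<in> ball x r. g ((y - x) - ((y - x) \<bullet> e) *\<^sub>R e) < (y - x) \<bullet> e}"
      using assms[unfolded bounded_Lipschitz_domain_def, THEN conjunct2, THEN conjunct2, THEN conjunct2, THEN conjunct2]
      by (rule bspec[rotated])
    then obtain e r L g where e: "norm e = 1" and r: "r > 0" and g: "L-lipschitz_on UNIV g"
      and eq: "\<Omega> \<inter> ball x r = {y \<in> ball x r. g ((y - x) - ((y - x) \<bullet> e) *\<^sub>R e) < (y - x) \<bullet> e}"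
      by blast
    define H where "H y = (y - x) \<bullet> e - g ((y - x) - ((y - x) \<bullet> e) *\<^sub>R e)" for y
    have cg: "continuous_on UNIV g" using g by (rule lipschitz_on_continuous_on)
    have cH: "continuous_on UNIV H"
      unfolding H_def by (intro continuous_intros continuous_on_compose2[OF cg]) auto
    have inH: "y \<in> \<Omega> \<longleftrightarrow> H y > 0" if "y \<in> ball x r" for y
    proof -
      have "y \<in> \<Omega> \<longleftrightarrow> y \<in> \<Omega> \<inter> ball x r" using that by simp
      also have "\<dots> \<longleftrightarrow> H y > 0" unfolding eq using that by (simp add: H_def)
      finally show ?thesis .
    qed
    have g0: "g 0 \<ge> 0" using inH[of x] nx r by (simp add: H_def not_less)
    obtain \<delta> where \<delta>: "\<delta> > 0" "ball x \<delta> \<subseteq> closure \<Omega>"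
      using x by (metis mem_interior)
    define t where "t = min \<delta> r / 2"
    have t: "t > 0" "t < \<delta>" "t < r" using \<delta>(1) r by (auto simp: t_def)
    define y where "y = x - t *\<^sub>R e"
    have ee: "e \<bullet> e = 1" using e by (simp add: norm_eq_1)
    have "H y = - t - g 0" by (simp add: H_def y_def ee)
    then have "H y < 0" using g0 t by simp
    \<comment> \<open>The points strictly below the graph form an open set without points of
      \<open>\<Omega>\<close>, hence without points of its closure.\<close>
    define W where "W = {y. H y < 0} \<inter> ball x r"
    have "open {y. H y < 0}" by (rule open_Collect_less) (use cH in auto)
    then have "open W" by (simp add: W_def open_Int)
    moreover have "W \<inter> \<Omega> = {}" using inH by (force simp: W_def)
    ultimately have "W \<inter> closure \<Omega> = {}" by (simp add: open_Int_closure_eq_empty)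
    moreover have "y \<in> W" using \<open>H y < 0\<close> t e by (simp add: W_def y_def dist_norm)
    moreover have "y \<in> closure \<Omega>" using \<delta>(2) t e by (auto simp: y_def dist_norm)
    ultimately show False by blast
  qed
qed

context full_simplex
begin

lemma local_gradient:
  assumes "\<And>x. x \<in> interior S \<Longrightarrow> z x = a \<bullet> x + d + \<gamma> * bub x"
  shows "is_weak_gradient (interior S) z (\<lambda>x. a + (\<gamma> * bub_rate) *\<^sub>R (x - b))"
proof -
  have "is_weak_gradient (interior S) (\<lambda>x. 1 * (a \<bullet> x + d) + \<gamma> * bub x)
     (\<lambda>x. 1 *\<^sub>R gradient (\<lambda>x. a \<bullet> x + d) x + \<gamma> *\<^sub>R gradient bub x)"
    by (intro is_weak_gradient_lincomb is_weak_gradient_C1 open_interior bounded_interior_S affine_C1 bub_C1)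
  then have "is_weak_gradient (interior S) (\<lambda>x. a \<bullet> x + d + \<gamma> * bub x) (\<lambda>x. a + (\<gamma> * bub_rate) *\<^sub>R (x - b))"
    by (simp add: affine_C1 bub_gradient)
  then show ?thesis
    by (rule is_weak_gradient_AE_cong[OF interior_S_sets]) (use assms in \<open>auto intro!: AE_I2\<close>)
qed

text \<open>It suffices to test with the fields x - P. Against such a field, the integral of a
  gradient is the facet term minus n times the integral of the function; facet terms and integrals
  of \<open>v\<close> and the local function agree, the bubble having no facet term.\<close>

lemma interpolation_orthogonality:
  assumes v: "L2 (interior S) v" and G: "L2 (interior S) G"
    and flux: "\<And>P. P \<in> C \<Longrightarrow> (LINT x|lebesgue_on (interior S). G x \<bullet> (x - P) + real DIM('a) * v x)
        = real DIM('a) * vol * (a \<bullet> barycenter (face P) + d)"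
    and mean: "(LINT x|lebesgue_on (interior S). v x - (a \<bullet> x + d + \<gamma> * bub x)) = 0"
  shows "(LINT x|lebesgue_on (interior S). (G x - (a + (\<gamma> * bub_rate) *\<^sub>R (x - b))) \<bullet> (a0 + \<gamma>0 *\<^sub>R (x - b))) = 0"
proof -
  let ?H = "\<lambda>x. a + (\<gamma> * bub_rate) *\<^sub>R (x - b)"
  let ?W = "\<lambda>x. a \<bullet> x + d + \<gamma> * bub x"
  have Lx: "L2 (interior S) (\<lambda>x. x - P)" for P
    by (intro L2_continuous interior_S_lmeasurable bounded_interior_S continuous_intros)
  have LH: "L2 (interior S) ?H"
    by (intro L2_continuous interior_S_lmeasurable bounded_interior_S continuous_intros)
  have cW: "continuous_on UNIV ?W" by (intro continuous_intros C1_continuous bub_C1)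
  have iv: "integrable (lebesgue_on (interior S)) v" by (rule L2_integrable[OF interior_S_lmeasurable v])
  have iW: "integrable (lebesgue_on (interior S)) ?W" by (rule continuous_integrable[OF cW])
  have RT: "(LINT x|lebesgue_on (interior S). (G x - ?H x) \<bullet> (x - P)) = 0" if P: "P \<in> C" for P
  proof -
    have iG: "integrable (lebesgue_on (interior S)) (\<lambda>x. G x \<bullet> (x - P))" by (rule L2_integrable_inner[OF G Lx])
    have iH: "integrable (lebesgue_on (interior S)) (\<lambda>x. ?H x \<bullet> (x - P))" by (rule L2_integrable_inner[OF LH Lx])
    have i1: "integrable (lebesgue_on (interior S)) (\<lambda>x. a \<bullet> (x - P) + real DIM('a) * (a \<bullet> x + d))"
      by (intro continuous_integrable continuous_intros)
    have i2: "integrable (lebesgue_on (interior S)) (\<lambda>x. (bub_rate *\<^sub>R (x - b)) \<bullet> (x - P) + real DIM('a) * bub x)"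
      by (intro continuous_integrable continuous_intros C1_continuous bub_C1)
    have "(LINT x|lebesgue_on (interior S). (G x - ?H x) \<bullet> (x - P))
        = (LINT x|lebesgue_on (interior S). G x \<bullet> (x - P)) - (LINT x|lebesgue_on (interior S). ?H x \<bullet> (x - P))"
      using iG iH by (simp only: inner_diff_left Bochner_Integration.integral_diff)
    also have "(LINT x|lebesgue_on (interior S). G x \<bullet> (x - P))
        = real DIM('a) * vol * (a \<bullet> barycenter (face P) + d) - real DIM('a) * (LINT x|lebesgue_on (interior S). v x)"
      using flux[OF P] iG iv by simp
    also have "(LINT x|lebesgue_on (interior S). ?H x \<bullet> (x - P))
        = (LINT x|lebesgue_on (interior S). (a \<bullet> (x - P) + real DIM('a) * (a \<bullet> x + d))
            + \<gamma> * ((bub_rate *\<^sub>R (x - b)) \<bullet> (x - P) + real DIM('a) * bub x) - real DIM('a) * ?W x)"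
      by (intro Bochner_Integration.integral_cong refl) (simp add: inner_add_left algebra_simps)
    also have "\<dots> = real DIM('a) * vol * (a \<bullet> barycenter (face P) + d) - real DIM('a) * (LINT x|lebesgue_on (interior S). ?W x)"
      using i1 i2 iW by (simp only: Bochner_Integration.integral_diff Bochner_Integration.integral_add
          integrable_mult_right Bochner_Integration.integrable_add integral_mult_right_zero flux_affine[OF P] flux_bub[OF P] mult_zero_right add_0_right)
    also have "(LINT x|lebesgue_on (interior S). v x) = (LINT x|lebesgue_on (interior S). ?W x)"
      using mean iv iW by simp
    finally show ?thesis by simp
  qed
  obtain \<alpha> where \<alpha>: "\<And>x. a0 + \<gamma>0 *\<^sub>R (x - b) = (\<Sum>P\<in>C. \<alpha> P *\<^sub>R (x - P))"
    using Raviart_Thomas_span[of a0 \<gamma>0] by blast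
  have "(LINT x|lebesgue_on (interior S). (G x - ?H x) \<bullet> (a0 + \<gamma>0 *\<^sub>R (x - b)))
      = (LINT x|lebesgue_on (interior S). (\<Sum>P\<in>C. \<alpha> P * ((G x - ?H x) \<bullet> (x - P))))"
    unfolding \<alpha> by (simp add: inner_sum_right)
  also have "\<dots> = (\<Sum>P\<in>C. \<alpha> P * (LINT x|lebesgue_on (interior S). (G x - ?H x) \<bullet> (x - P)))"
    using L2_integrable_inner[OF L2_diff[OF G LH] Lx] by (subst Bochner_Integration.integral_sum) auto
  also have "\<dots> = 0" by (simp add: RT)
  finally show ?thesis .
qed

text \<open>Links the mean over the closed simplex in \<open>I_eCR\<close> with the integrals over
  the open one used elsewhere. Only measurability on the interior is assumed; the boundary is a null
  set of a complete measure.\<close>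

lemma lebesgue_on_S_eq_interior:
  fixes f :: "'a \<Rightarrow> real"
  assumes f: "f \<in> borel_measurable (lebesgue_on (interior S))"
  shows "(LINT x|lebesgue_on S. f x) = (LINT x|lebesgue_on (interior S). f x)"
proof -
  have Ss: "S \<in> sets lebesgue" using compact_S by (simp add: borel_compact)
  let ?g = "\<lambda>x. indicator (interior S) x *\<^sub>R f x"
  have g: "?g \<in> borel_measurable lebesgue"
    using f by (subst (asm) borel_measurable_restrict_space_iff) auto
  have gS: "?g \<in> borel_measurable (lebesgue_on S)" using g by (rule measurable_restrict_space1)
  have ae: "AE x in lebesgue_on S. ?g x = f x"
    using AE_interior_S Ss by (subst AE_restrict_space_iff) (auto simp: indicator_def elim!: eventually_mono)
  have fS: "f \<in> borel_measurable (lebesgue_on S)" by (rule borel_measurable_lebesgue_on_AE_cong[OF Ss gS ae])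
  have "(LINT x|lebesgue_on S. f x) = (LINT x|lebesgue_on S. ?g x)"
    by (rule integral_cong_AE[OF fS gS]) (use ae in \<open>auto elim!: eventually_mono\<close>)
  also have "\<dots> = (LINT x|lebesgue. indicator S x *\<^sub>R ?g x)" by (rule integral_restrict_space) (use Ss in simp)
  also have "\<dots> = (LINT x|lebesgue. ?g x)"
    using interior_subset[of S] by (intro Bochner_Integration.integral_cong refl) (auto simp: indicator_def)
  also have "\<dots> = (LINT x|lebesgue_on (interior S). f x)" by (rule integral_restrict_space[symmetric]) simp
  finally show ?thesis .
qed

lemma vol_eq: "vol = measure lebesgue S"
  unfolding vol_def
  by (rule measure_interior) (auto simp: compact_S compact_imp_bounded negligible_convex_frontier)

end

section \<open>Triangulated domains and the local form of discrete functions\<close>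

locale triangulated_domain =
  fixes \<Omega> :: "'a::euclidean_space set" and \<T> :: "'a set set"
  assumes domain: "polyhedral_Lipschitz_domain \<Omega>" and triangulation: "regular_triangulation \<Omega> \<T>"
begin

lemma Lipschitz: "bounded_Lipschitz_domain \<Omega>"
  using domain by (simp add: polyhedral_Lipschitz_domain_def)

lemma open_\<Omega>: "open \<Omega>" and bounded_\<Omega>: "bounded \<Omega>" and \<Omega>_nonempty: "\<Omega> \<noteq> {}"
  using Lipschitz by (auto simp: bounded_Lipschitz_domain_def)

lemma \<Omega>_sets: "\<Omega> \<in> sets lebesgue"
  using open_\<Omega> by simp

lemma finite_\<T>: "finite \<T>"
  using triangulation by (simp add: regular_triangulation_def triangulation_def)

lemma Union_\<T>: "\<Union>\<T> = closure \<Omega>"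
  using triangulation by (simp add: regular_triangulation_def)

lemma simplex_hull:
  assumes "T \<in> \<T>" shows "full_simplex (vertices T)" "convex hull (vertices T) = T"
proof -
  have "int DIM('a) simplex T" using assms triangulation by (simp add: regular_triangulation_def)
  then obtain C where C: "\<not> affine_dependent C" "int (card C) = int DIM('a) + 1" "T = convex hull C"
    by (auto simp: simplex_def)
  then interpret full_simplex C by unfold_locales auto
  have "vertices T = C" using vertices_S C by simp
  then show "full_simplex (vertices T)" "convex hull (vertices T) = T"
    using C full_simplex_axioms by simp_all
qed

lemma interior_subset_\<Omega>: assumes "T \<in> \<T>" shows "interior T \<subseteq> \<Omega>"
proof -
  have "T \<subseteq> closure \<Omega>" using Union_\<T> assms by auto
  then show ?thesis using interior_mono interior_closure_Lipschitz[OF Lipschitz] by blast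
qed

text \<open>The intersection is a face of both simplices and proper in at least one of them, and a
  proper face misses the interior. Since an open set that misses the interior of \<open>T'\<close>
  also misses its closure, \<open>T'\<close> itself is avoided; this is the form used for bubbles,
  which are supported on closed simplices.\<close>

lemma disjoint_interior:
  assumes "T \<in> \<T>" "T' \<in> \<T>" "T \<noteq> T'" shows "interior T \<inter> T' = {}"
proof -
  have f: "(T \<inter> T') face_of T" "(T' \<inter> T) face_of T'"
    using triangulation assms by (auto simp: regular_triangulation_def triangulation_def)
  have "interior T \<inter> interior T' = {}"
  proof (cases "T \<inter> T' = T")
    case False
    then show ?thesis using face_of_disjoint_interior[OF f(1)] interior_subset by blast
  next
    case True
    then have "T' \<inter> T \<noteq> T'" using assms by auto
    then show ?thesis using face_of_disjoint_interior[OF f(2)] interior_subset by blast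
  qed
  then have "interior T \<inter> closure (interior T') = {}" by (simp add: open_Int_closure_eq_empty)
  moreover have "closure (interior T') = T'"
    using full_simplex.closure_interior_S[OF simplex_hull(1)[OF assms(2)]] simplex_hull(2)[OF assms(2)] by simp
  ultimately show ?thesis by simp
qed

lemma interior_unique:
  assumes "T \<in> \<T>" "T' \<in> \<T>" "x \<in> interior T" "x \<in> T'" shows "T = T'"
  using disjoint_interior[OF assms(1,2)] assms by blast

lemma sum_indicator_interior:
  assumes "T \<in> \<T>" "x \<in> interior T"
  shows "(\<Sum>T'\<in>\<T>. indicator (interior T') x * f T') = (f T :: real)"
proof -
  have "(\<Sum>T'\<in>\<T>. indicator (interior T') x * f T') = (\<Sum>T'\<in>\<T>. if T' = T then f T else 0)"
  proof (rule sum.cong[OF refl])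
    fix T' assume T': "T' \<in> \<T>"
    have "x \<in> interior T' \<longleftrightarrow> T' = T"
      using interior_unique[OF assms(1) T' assms(2)] interior_subset[of T'] assms(2) by blast
    then show "indicator (interior T') x * f T' = (if T' = T then f T else 0)" using assms(2) by simp
  qed
  then show ?thesis using assms finite_\<T> by simp
qed

lemma AE_\<Omega>: "AE x in lebesgue. x \<in> \<Omega> \<longleftrightarrow> (\<exists>T\<in>\<T>. x \<in> interior T)"
proof -
  have "AE x in lebesgue. \<forall>T\<in>\<T>. x \<in> T \<longleftrightarrow> x \<in> interior T"
  proof (rule AE_ball_countable[OF countable_finite[OF finite_\<T>], THEN iffD2], rule ballI)
    fix T assume T: "T \<in> \<T>"
    show "AE x in lebesgue. x \<in> T \<longleftrightarrow> x \<in> interior T"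
      using full_simplex.AE_interior_S[OF simplex_hull(1)[OF T]] unfolding simplex_hull(2)[OF T] .
  qed
  then show ?thesis
  proof eventually_elim
    case (elim x)
    show ?case
    proof
      assume "x \<in> \<Omega>"
      then have "x \<in> \<Union>\<T>" using Union_\<T> closure_subset by auto
      then show "\<exists>T\<in>\<T>. x \<in> interior T" using elim by auto
    next
      assume "\<exists>T\<in>\<T>. x \<in> interior T"
      then show "x \<in> \<Omega>" using interior_subset_\<Omega> by auto
    qed
  qed
qed

lemma AE_\<Omega>_interior: "AE x in lebesgue_on \<Omega>. \<exists>T\<in>\<T>. x \<in> interior T"
  using AE_\<Omega> \<Omega>_sets by (subst AE_restrict_space_iff) (auto elim: eventually_mono)

lemma integral_\<Omega>_split:
  fixes f :: "'a \<Rightarrow> real"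
  assumes f: "integrable (lebesgue_on \<Omega>) f"
  shows "(LINT x|lebesgue_on \<Omega>. f x) = (\<Sum>T\<in>\<T>. (LINT x|lebesgue_on (interior T). f x))"
proof -
  have fO: "integrable lebesgue (\<lambda>x. indicator \<Omega> x *\<^sub>R f x)"
    using f \<Omega>_sets by (simp add: integrable_restrict_space)
  have ind: "indicator (interior T) x *\<^sub>R (indicator \<Omega> x *\<^sub>R f x) = indicator (interior T) x *\<^sub>R f x" if "T \<in> \<T>" for T x
    using interior_subset_\<Omega>[OF that] by (auto simp: indicator_def)
  have i: "integrable lebesgue (\<lambda>x. indicator (interior T) x *\<^sub>R f x)" if "T \<in> \<T>" for T
    using integrable_mult_indicator[of "interior T" lebesgue, OF _ fO] unfolding ind[OF that] by simp
  have "(LINT x|lebesgue_on \<Omega>. f x) = (LINT x|lebesgue. indicator \<Omega> x *\<^sub>R f x)"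
    by (rule integral_restrict_space) (use \<Omega>_sets in simp)
  also have "\<dots> = (LINT x|lebesgue. (\<Sum>T\<in>\<T>. indicator (interior T) x *\<^sub>R f x))"
  proof (rule integral_cong_AE)
    show "(\<lambda>x. \<Sum>T\<in>\<T>. indicator (interior T) x *\<^sub>R f x) \<in> borel_measurable lebesgue"
      using i by (intro borel_measurable_sum) auto
    show "AE x in lebesgue. indicator \<Omega> x *\<^sub>R f x = (\<Sum>T\<in>\<T>. indicator (interior T) x *\<^sub>R f x)"
      using AE_\<Omega>
    proof eventually_elim
      case (elim x)
      show ?case
      proof (cases "x \<in> \<Omega>")
        case True
        then obtain T where "T \<in> \<T>" "x \<in> interior T" using elim by auto
        then show ?thesis using sum_indicator_interior[of T x "\<lambda>_. f x"] True by simp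
      next
        case False
        then have "(\<Sum>T\<in>\<T>. indicator (interior T) x *\<^sub>R f x) = 0"
          using elim by (intro sum.neutral) (auto simp: indicator_def)
        then show ?thesis using False by simp
      qed
    qed
  qed (use fO in auto)
  also have "\<dots> = (\<Sum>T\<in>\<T>. (LINT x|lebesgue. indicator (interior T) x *\<^sub>R f x))"
    using i by (intro Bochner_Integration.integral_sum)
  also have "\<dots> = (\<Sum>T\<in>\<T>. (LINT x|lebesgue_on (interior T). f x))"
    by (intro sum.cong refl integral_restrict_space[symmetric]) simp
  finally show ?thesis .
qed

lemma L2_\<Omega>_I:
  fixes f :: "'a \<Rightarrow> real"
  assumes f: "\<And>T. T \<in> \<T> \<Longrightarrow> L2 (interior T) f" shows "L2 \<Omega> f"
proof -
  have L: "L2 \<Omega> (\<lambda>x. indicator (interior T) x * f x)" if T: "T \<in> \<T>" for T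
  proof -
    have "(\<lambda>x. indicator (interior T) x * f x) \<in> borel_measurable lebesgue"
      using f[OF T] unfolding L2_def by (subst (asm) borel_measurable_restrict_space_iff) auto
    then have m: "(\<lambda>x. indicator (interior T) x * f x) \<in> borel_measurable (lebesgue_on \<Omega>)"
      by (rule measurable_restrict_space1)
    have "integrable lebesgue (\<lambda>x. indicator (interior T) x *\<^sub>R (f x)\<^sup>2)"
      using f[OF T] by (simp add: L2_def integrable_restrict_space)
    moreover have "(\<lambda>x. indicator (interior T) x *\<^sub>R (f x)\<^sup>2) = (\<lambda>x. indicator \<Omega> x *\<^sub>R (indicator (interior T) x * f x)\<^sup>2)"
      using interior_subset_\<Omega>[OF T] by (auto simp: fun_eq_iff indicator_def)
    ultimately have "integrable (lebesgue_on \<Omega>) (\<lambda>x. (indicator (interior T) x * f x)\<^sup>2)"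
      using \<Omega>_sets by (simp add: integrable_restrict_space)
    with m show ?thesis by (simp add: L2_def)
  qed
  have "L2 \<Omega> (\<lambda>x. \<Sum>T\<in>\<T>. indicator (interior T) x * f x)" by (intro L2_sum finite_\<T> L)
  then show ?thesis
  proof (rule L2_AE_cong[OF \<Omega>_sets])
    show "AE x in lebesgue_on \<Omega>. (\<Sum>T\<in>\<T>. indicator (interior T) x * f x) = f x"
      using AE_\<Omega>_interior by eventually_elim (use sum_indicator_interior in auto)
  qed
qed

lemma L2_interior: "L2 \<Omega> f \<Longrightarrow> T \<in> \<T> \<Longrightarrow> L2 (interior T) f"
  by (rule L2_subset[OF _ interior_subset_\<Omega>]) (auto simp: \<Omega>_sets)

lemma eCR_local:
  assumes z: "z \<in> eCR \<Omega> \<T>" and T: "T \<in> \<T>"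
  obtains a d \<gamma> where "\<And>x. x \<in> interior T \<Longrightarrow> z x = a \<bullet> x + d + \<gamma> * full_simplex.bub (vertices T) x"
proof -
  interpret full_simplex "vertices T" rewrites "convex hull (vertices T) = T"
    using simplex_hull[OF T] by simp_all
  obtain v c where v: "v \<in> CR \<Omega> \<T>" and zv: "z = (\<lambda>x. v x + (\<Sum>T\<in>\<T>. c T * bubble T x))"
    using z by (auto simp: eCR_def)
  obtain a d where ad: "\<And>x. x \<in> interior T \<Longrightarrow> v x = a \<bullet> x + d"
    using v T by (auto simp: CR_def P1_def)
  have "z x = a \<bullet> x + d + c T * bub x" if x: "x \<in> interior T" for x
  proof -
    have xT: "x \<in> T" using x interior_subset by auto
    have "(\<Sum>T'\<in>\<T>. c T' * bubble T' x) = (\<Sum>T'\<in>\<T>. if T' = T then c T * bub x else 0)"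
    proof (intro sum.cong refl)
      fix T' assume T': "T' \<in> \<T>"
      show "c T' * bubble T' x = (if T' = T then c T * bub x else 0)"
      proof (cases "T' = T")
        case True
        then show ?thesis using bubble_eq[OF xT] by simp
      next
        case False
        then have "x \<notin> T'" using interior_unique[OF T T' x] by auto
        then show ?thesis using False by (simp add: bubble_def)
      qed
    qed
    then show ?thesis using T finite_\<T> by (simp add: zv ad[OF x])
  qed
  then show ?thesis by (rule that)
qed

lemma eCR_H1_interior:
  assumes z: "z \<in> eCR \<Omega> \<T>" and T: "T \<in> \<T>" shows "z \<in> H1 (interior T)"
proof -
  obtain a d \<gamma> where "\<And>x. x \<in> interior T \<Longrightarrow> z x = a \<bullet> x + d + \<gamma> * full_simplex.bub (vertices T) x"
    using eCR_local[OF z T] by blast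
  from full_simplex.local_gradient[OF simplex_hull(1)[OF T], unfolded simplex_hull(2)[OF T], OF this]
  show ?thesis by (auto simp: H1_def)
qed

lemma bounded_interior: "T \<in> \<T> \<Longrightarrow> bounded (interior T)"
  using bounded_\<Omega> interior_subset_\<Omega> bounded_subset by blast

lemma finite_faces: "finite (faces \<T>)"
proof -
  have "faces \<T> = (\<Union>T\<in>\<T>. {F. F facet_of T})" by (auto simp: faces_def)
  moreover have "finite {F. F facet_of T}" if "T \<in> \<T>" for T
    using triangulation that
    by (intro finite_polytope_facets) (auto simp: regular_triangulation_def intro: simplex_imp_polytope)
  ultimately show ?thesis using finite_\<T> by simp
qed

lemma finite_interior_faces: "finite (interior_faces \<Omega> \<T>)"
  using finite_faces by (simp add: interior_faces_def)

lemma facet_barycenter_in: assumes "T \<in> \<T>" "G facet_of T" shows "barycenter G \<in> T"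
proof -
  interpret full_simplex "vertices T" rewrites "convex hull (vertices T) = T"
    using simplex_hull[OF assms(1)] by simp_all
  show ?thesis using assms(2) facet_of_S barycenter_face_in_S by auto
qed

lemma trace_from_affine_T:
  assumes T: "T \<in> \<T>" and v: "\<And>y. y \<in> interior T \<Longrightarrow> v y = a \<bullet> y + d" and x: "x \<in> T"
  shows "trace_from T v x = a \<bullet> x + d"
  using full_simplex.trace_from_affine[OF simplex_hull(1)[OF T], unfolded simplex_hull(2)[OF T], OF v x] by simp

text \<open>Existence makes the choice in \<open>CR_basis\<close> meaningful. The nodal affine
  functions of the simplices at \<open>F\<close>, and zero elsewhere, are glued; there are no jumps
  at barycenters because both sides have the same nodal value, and boundary values are 0 because
  \<open>F\<close> is interior.\<close>

lemma CR_basis_props: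
  assumes F: "F \<in> interior_faces \<Omega> \<T>"
  shows "CR_basis \<Omega> \<T> F \<in> CR \<Omega> \<T>"
    and "\<And>T G. T \<in> \<T> \<Longrightarrow> G facet_of T \<Longrightarrow> trace_from T (CR_basis \<Omega> \<T> F) (barycenter G) = (if G = F then 1 else 0)"
proof -
  have "\<forall>T\<in>\<T>. \<exists>a d. \<forall>G. G facet_of T \<longrightarrow> a \<bullet> barycenter G + d = (if G = F then 1 else 0)"
  proof
    fix T assume T: "T \<in> \<T>"
    interpret full_simplex "vertices T" rewrites "convex hull (vertices T) = T"
      using simplex_hull[OF T] by simp_all
    show "\<exists>a d. \<forall>G. G facet_of T \<longrightarrow> a \<bullet> barycenter G + d = (if G = F then 1 else 0)"
    proof (cases "F facet_of T")
      case True
      then obtain P where P: "P \<in> vertices T" "F = convex hull (vertices T - {P})" using facet_of_S by auto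
      obtain a d where ad: "\<forall>Q\<in>vertices T. a \<bullet> barycenter (convex hull (vertices T - {Q})) + d = (if Q = P then 1 else 0)"
        using nodal_affine_function[OF P(1)] by blast
      have "a \<bullet> barycenter G + d = (if G = F then 1 else 0)" if Gf: "G facet_of T" for G
      proof -
        obtain Q where Q: "Q \<in> vertices T" "G = convex hull (vertices T - {Q})" using Gf facet_of_S by auto
        then have "G = F \<longleftrightarrow> Q = P" using P face_inject by auto
        then show ?thesis using ad Q by auto
      qed
      then show ?thesis by blast
    next
      case False
      then show ?thesis by (intro exI[of _ 0]) auto
    qed
  qed
  then obtain a d where ad: "\<And>T G. T \<in> \<T> \<Longrightarrow> G facet_of T \<Longrightarrow> a T \<bullet> barycenter G + d T = (if G = F then 1 else 0)"
    by metis
  define \<psi> where "\<psi> x = (\<Sum>T\<in>\<T>. indicator (interior T) x * (a T \<bullet> x + d T))" for x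
  have \<psi>: "\<psi> x = a T \<bullet> x + d T" if "T \<in> \<T>" "x \<in> interior T" for T x
    using sum_indicator_interior[OF that, of "\<lambda>T. a T \<bullet> x + d T"] by (simp add: \<psi>_def)
  have tr: "trace_from T \<psi> (barycenter G) = (if G = F then 1 else 0)" if "T \<in> \<T>" "G facet_of T" for T G
    using trace_from_affine_T[of T \<psi> "a T" "d T", OF that(1) \<psi> facet_barycenter_in] that ad by simp
  have "\<psi> \<in> P1 \<T>" unfolding P1_def using \<psi> by blast
  moreover have "zero_jump \<Omega> \<T> G \<psi> (barycenter G)" for G
    using F by (auto simp: zero_jump_def tr)
  ultimately have "\<psi> \<in> CR \<Omega> \<T>" by (simp add: CR_def)
  with tr have "\<exists>\<psi>. \<psi> \<in> CR \<Omega> \<T> \<and>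
        (\<forall>T \<in> \<T>. \<forall>G. G facet_of T \<longrightarrow> trace_from T \<psi> (barycenter G) = (if G = F then 1 else 0))"
    by blast
  from someI_ex[OF this] show "CR_basis \<Omega> \<T> F \<in> CR \<Omega> \<T>"
    and "\<And>T G. T \<in> \<T> \<Longrightarrow> G facet_of T \<Longrightarrow> trace_from T (CR_basis \<Omega> \<T> F) (barycenter G) = (if G = F then 1 else 0)"
    unfolding CR_basis_def by blast+
qed

section \<open>The interpolant on a single simplex\<close>

lemma I_CR_local:
  assumes T: "T \<in> \<T>"
  obtains a d where "\<And>x. x \<in> interior T \<Longrightarrow> I_CR \<Omega> \<T> v x = a \<bullet> x + d"
    "\<And>G. G facet_of T \<Longrightarrow> a \<bullet> barycenter G + d = (if G \<in> interior_faces \<Omega> \<T> then face_mean \<Omega> G v else 0)"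
proof -
  have "\<forall>F\<in>interior_faces \<Omega> \<T>. \<exists>a d. \<forall>x\<in>interior T. CR_basis \<Omega> \<T> F x = a \<bullet> x + d"
    using CR_basis_props(1) T by (auto simp: CR_def P1_def)
  then obtain a d where ad: "\<And>F x. F \<in> interior_faces \<Omega> \<T> \<Longrightarrow> x \<in> interior T \<Longrightarrow> CR_basis \<Omega> \<T> F x = a F \<bullet> x + d F"
    by metis
  have val: "a F \<bullet> barycenter G + d F = (if G = F then 1 else 0)" if "F \<in> interior_faces \<Omega> \<T>" "G facet_of T" for F G
    using CR_basis_props(2)[OF that(1) T that(2)]
      trace_from_affine_T[of T "CR_basis \<Omega> \<T> F" "a F" "d F", OF T ad[OF that(1)] facet_barycenter_in[OF T that(2)]] by simp
  let ?a = "\<Sum>F\<in>interior_faces \<Omega> \<T>. face_mean \<Omega> F v *\<^sub>R a F"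
  let ?d = "\<Sum>F\<in>interior_faces \<Omega> \<T>. face_mean \<Omega> F v * d F"
  have lin: "?a \<bullet> x + ?d = (\<Sum>F\<in>interior_faces \<Omega> \<T>. face_mean \<Omega> F v * (a F \<bullet> x + d F))" for x
    by (simp add: inner_sum_left distrib_left sum.distrib)
  show ?thesis
  proof
    show "I_CR \<Omega> \<T> v x = ?a \<bullet> x + ?d" if "x \<in> interior T" for x
      unfolding lin I_CR_def using ad that by simp
    show "?a \<bullet> barycenter G + ?d = (if G \<in> interior_faces \<Omega> \<T> then face_mean \<Omega> G v else 0)" if G: "G facet_of T" for G
    proof -
      have "?a \<bullet> barycenter G + ?d = (\<Sum>F\<in>interior_faces \<Omega> \<T>. if G = F then face_mean \<Omega> G v else 0)"
        unfolding lin using val[OF _ G] by (intro sum.cong) auto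
      then show ?thesis using finite_interior_faces by simp
    qed
  qed
qed

lemma I_eCR_in_eCR: "I_eCR \<Omega> \<T> v \<in> eCR \<Omega> \<T>"
proof -
  have "I_CR \<Omega> \<T> v \<in> P1 \<T>" unfolding P1_def
  proof (intro CollectI ballI)
    fix T assume T: "T \<in> \<T>"
    obtain a d where "\<And>x. x \<in> interior T \<Longrightarrow> I_CR \<Omega> \<T> v x = a \<bullet> x + d" using I_CR_local[OF T, of v] by metis
    then show "\<exists>a c. \<forall>x\<in>interior T. I_CR \<Omega> \<T> v x = a \<bullet> x + c" by blast
  qed
  moreover have "zero_jump \<Omega> \<T> G (I_CR \<Omega> \<T> v) (barycenter G)" if "G \<in> faces \<T>" for G
  proof -
    have "trace_from T (I_CR \<Omega> \<T> v) (barycenter G) = (if G \<in> interior_faces \<Omega> \<T> then face_mean \<Omega> G v else 0)"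
      if T: "T \<in> \<T>" and G: "G facet_of T" for T
    proof -
      obtain a d where ad: "\<And>x. x \<in> interior T \<Longrightarrow> I_CR \<Omega> \<T> v x = a \<bullet> x + d"
        "\<And>G. G facet_of T \<Longrightarrow> a \<bullet> barycenter G + d = (if G \<in> interior_faces \<Omega> \<T> then face_mean \<Omega> G v else 0)"
        using I_CR_local[OF T] by blast
      show ?thesis
        using trace_from_affine_T[of T "I_CR \<Omega> \<T> v" a d, OF T ad(1) facet_barycenter_in[OF T G]] ad(2)[OF G] by simp
    qed
    then show ?thesis by (auto simp: zero_jump_def)
  qed
  ultimately have "I_CR \<Omega> \<T> v \<in> CR \<Omega> \<T>" by (simp add: CR_def)
  then show ?thesis unfolding eCR_def I_eCR_def[abs_def]
    by (intro CollectI exI[of _ "I_CR \<Omega> \<T> v"] exI[of _ "\<lambda>T. mean T (\<lambda>y. v y - I_CR \<Omega> \<T> v y)"] conjI refl)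
qed

text \<open>The bubble has mean 1 and its coefficient is the mean missing after the Crouzeix-Raviart
  interpolation, so the total mean is corrected. The facet terms agree because the interpolant takes
  the face mean at the barycenter of an interior facet and 0 on a boundary facet.\<close>

lemma interpolation_local:
  assumes v: "v \<in> H10 \<Omega>" and T: "T \<in> \<T>"
  shows "(LINT x|lebesgue_on (interior T). v x - I_eCR \<Omega> \<T> v x) = 0"
    and "is_weak_gradient (interior T) (\<lambda>x. v x - I_eCR \<Omega> \<T> v x) (\<lambda>x. weak_grad \<Omega> v x - weak_grad (interior T) (I_eCR \<Omega> \<T> v) x)"
    and "z \<in> eCR \<Omega> \<T> \<Longrightarrow> (LINT x|lebesgue_on (interior T).
        (weak_grad \<Omega> v x - weak_grad (interior T) (I_eCR \<Omega> \<T> v) x) \<bullet> weak_grad (interior T) z x) = 0"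
proof -
  interpret full_simplex "vertices T" rewrites "convex hull (vertices T) = T"
    using simplex_hull[OF T] by simp_all
  have v1: "v \<in> H1 \<Omega>" using v by (simp add: H10_def)
  define G where "G = weak_grad \<Omega> v"
  have wG: "is_weak_gradient (interior T) v G"
    unfolding G_def by (rule is_weak_gradient_subset[OF open_interior interior_subset_\<Omega>[OF T] open_\<Omega> is_weak_gradient_weak_grad[OF v1]])
  have L: "L2 (interior T) v" "L2 (interior T) G" using wG by (auto simp: is_weak_gradient_def)
  obtain a d where ad: "\<And>x. x \<in> interior T \<Longrightarrow> I_CR \<Omega> \<T> v x = a \<bullet> x + d"
    "\<And>G. G facet_of T \<Longrightarrow> a \<bullet> barycenter G + d = (if G \<in> interior_faces \<Omega> \<T> then face_mean \<Omega> G v else 0)"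
    using I_CR_local[OF T] by blast
  define \<gamma> where "\<gamma> = mean T (\<lambda>y. v y - I_CR \<Omega> \<T> v y)"
  have w: "I_eCR \<Omega> \<T> v x = a \<bullet> x + d + \<gamma> * bub x" if x: "x \<in> interior T" for x
  proof -
    have xT: "x \<in> T" using x interior_subset by auto
    have "(\<Sum>T'\<in>\<T>. mean T' (\<lambda>y. v y - I_CR \<Omega> \<T> v y) * bubble T' x) = (\<Sum>T'\<in>\<T>. if T' = T then \<gamma> * bub x else 0)"
    proof (intro sum.cong refl)
      fix T' assume T': "T' \<in> \<T>"
      show "mean T' (\<lambda>y. v y - I_CR \<Omega> \<T> v y) * bubble T' x = (if T' = T then \<gamma> * bub x else 0)"
      proof (cases "T' = T")
        case True
        then show ?thesis using bubble_eq[OF xT] by (simp add: \<gamma>_def)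
      next
        case False
        then have "x \<notin> T'" using interior_unique[OF T T' x] by auto
        then show ?thesis using False by (simp add: bubble_def)
      qed
    qed
    then show ?thesis using T finite_\<T> by (simp add: I_eCR_def ad(1)[OF x])
  qed
  have iv: "integrable (lebesgue_on (interior T)) v" by (rule L2_integrable[OF interior_S_lmeasurable L(1)])
  have ia: "integrable (lebesgue_on (interior T)) (\<lambda>x. a \<bullet> x + d)" "integrable (lebesgue_on (interior T)) bub"
    by (intro continuous_integrable continuous_intros C1_continuous bub_C1)+
  have mean0: "(LINT x|lebesgue_on (interior T). v x - (a \<bullet> x + d + \<gamma> * bub x)) = 0"
  proof -
    have eq: "(LINT x|lebesgue_on (interior T). v x - I_CR \<Omega> \<T> v x) = (LINT x|lebesgue_on (interior T). v x - (a \<bullet> x + d))"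
      by (intro Bochner_Integration.integral_cong refl) (simp add: ad(1))
    have "(\<lambda>x. v x - (a \<bullet> x + d)) \<in> borel_measurable (lebesgue_on (interior T))" using iv ia by auto
    then have "(\<lambda>x. v x - I_CR \<Omega> \<T> v x) \<in> borel_measurable (lebesgue_on (interior T))"
      by (subst measurable_cong[of _ _ "\<lambda>x. v x - (a \<bullet> x + d)"]) (auto simp: ad(1))
    from lebesgue_on_S_eq_interior[OF this]
    have "\<gamma> * vol = (LINT x|lebesgue_on (interior T). v x - (a \<bullet> x + d))"
      using vol_pos by (simp add: \<gamma>_def mean_def eq vol_eq)
    moreover have "(LINT x|lebesgue_on (interior T). v x - (a \<bullet> x + d + \<gamma> * bub x))
       = (LINT x|lebesgue_on (interior T). (v x - (a \<bullet> x + d)) - \<gamma> * bub x)" by (simp add: algebra_simps)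
    moreover have "\<dots> = (LINT x|lebesgue_on (interior T). v x - (a \<bullet> x + d)) - \<gamma> * (LINT x|lebesgue_on (interior T). bub x)"
      by (subst Bochner_Integration.integral_diff) (use iv ia in auto)
    ultimately show ?thesis by (simp add: integral_bub)
  qed
  then show "(LINT x|lebesgue_on (interior T). v x - I_eCR \<Omega> \<T> v x) = 0"
    by (subst Bochner_Integration.integral_cong[of _ _ _ "\<lambda>x. v x - (a \<bullet> x + d + \<gamma> * bub x)", OF refl]) (auto simp: w)
  have wI: "is_weak_gradient (interior T) (I_eCR \<Omega> \<T> v) (weak_grad (interior T) (I_eCR \<Omega> \<T> v))"
    by (rule is_weak_gradient_weak_grad[OF eCR_H1_interior[OF I_eCR_in_eCR T]])
  show "is_weak_gradient (interior T) (\<lambda>x. v x - I_eCR \<Omega> \<T> v x) (\<lambda>x. weak_grad \<Omega> v x - weak_grad (interior T) (I_eCR \<Omega> \<T> v) x)"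
    using is_weak_gradient_lincomb[OF open_interior bounded_interior_S wG wI, of 1 "-1"] by (simp add: G_def)
  have flux: "(LINT x|lebesgue_on (interior T). G x \<bullet> (x - P) + real DIM('a) * v x)
        = real DIM('a) * vol * (a \<bullet> barycenter (convex hull (vertices T - {P})) + d)" if P: "P \<in> vertices T" for P
  proof -
    let ?F = "convex hull (vertices T - {P})"
    have F: "?F facet_of T" using facet_of_S P by blast
    show ?thesis
    proof (cases "?F \<in> interior_faces \<Omega> \<T>")
      case True
      then show ?thesis using ad(2)[OF F]
        green_formula_simplex[OF P open_\<Omega> bounded_\<Omega> interior_subset_\<Omega>[OF T] v] by (simp add: G_def)
    next
      case False
      moreover have "?F \<in> faces \<T>" using F T by (auto simp: faces_def)
      ultimately have "?F \<subseteq> frontier \<Omega>" by (simp add: interior_faces_def)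
      then show ?thesis using ad(2)[OF F] False
        green_formula_simplex_boundary[OF P open_\<Omega> bounded_\<Omega> interior_subset_\<Omega>[OF T] v] by (simp add: G_def)
    qed
  qed
  assume z: "z \<in> eCR \<Omega> \<T>"
  obtain a0 d0 \<gamma>0 where z0: "\<And>x. x \<in> interior T \<Longrightarrow> z x = a0 \<bullet> x + d0 + \<gamma>0 * bub x"
    using eCR_local[OF z T] by blast
  note gz = local_gradient[OF z0] and gw = local_gradient[OF w]
  have ez: "AE x in lebesgue_on (interior T). weak_grad (interior T) z x = a0 + (\<gamma>0 * bub_rate) *\<^sub>R (x - barycenter T)"
    by (rule weak_grad_AE_eq[OF open_interior bounded_interior_S gz])
  have ew: "AE x in lebesgue_on (interior T). weak_grad (interior T) (I_eCR \<Omega> \<T> v) x = a + (\<gamma> * bub_rate) *\<^sub>R (x - barycenter T)"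
    by (rule weak_grad_AE_eq[OF open_interior bounded_interior_S gw])
  have wz: "is_weak_gradient (interior T) z (weak_grad (interior T) z)"
    by (rule is_weak_gradient_weak_grad[OF eCR_H1_interior[OF z T]])
  have "(LINT x|lebesgue_on (interior T). (G x - weak_grad (interior T) (I_eCR \<Omega> \<T> v) x) \<bullet> weak_grad (interior T) z x)
     = (LINT x|lebesgue_on (interior T). (G x - (a + (\<gamma> * bub_rate) *\<^sub>R (x - barycenter T))) \<bullet> (a0 + (\<gamma>0 * bub_rate) *\<^sub>R (x - barycenter T)))"
  proof (rule integral_cong_AE)
    show "(\<lambda>x. (G x - weak_grad (interior T) (I_eCR \<Omega> \<T> v) x) \<bullet> weak_grad (interior T) z x) \<in> borel_measurable (lebesgue_on (interior T))"
      using wz wI L by (intro borel_measurable_inner borel_measurable_diff) (auto simp: is_weak_gradient_def L2_def)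
    show "(\<lambda>x. (G x - (a + (\<gamma> * bub_rate) *\<^sub>R (x - barycenter T))) \<bullet> (a0 + (\<gamma>0 * bub_rate) *\<^sub>R (x - barycenter T))) \<in> borel_measurable (lebesgue_on (interior T))"
      using gz gw L by (intro borel_measurable_inner borel_measurable_diff[of G]) (auto simp: is_weak_gradient_def L2_def)
    show "AE x in lebesgue_on (interior T). (G x - weak_grad (interior T) (I_eCR \<Omega> \<T> v) x) \<bullet> weak_grad (interior T) z x
        = (G x - (a + (\<gamma> * bub_rate) *\<^sub>R (x - barycenter T))) \<bullet> (a0 + (\<gamma>0 * bub_rate) *\<^sub>R (x - barycenter T))"
      using ez ew by eventually_elim simp
  qed
  also have "\<dots> = 0" by (rule interpolation_orthogonality[OF L flux mean0])
  finally show "(LINT x|lebesgue_on (interior T).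
        (weak_grad \<Omega> v x - weak_grad (interior T) (I_eCR \<Omega> \<T> v) x) \<bullet> weak_grad (interior T) z x) = 0" by (simp add: G_def)
qed

text \<open>The piecewise mean shows that a projection exists; testing the chosen one with the
  indicator of the interior of \<open>T\<close> then determines its constant there.\<close>

lemma mean_L2_projection:
  fixes v :: "'a \<Rightarrow> real"
  assumes v: "L2 \<Omega> v" and T: "T \<in> \<T>" and x: "x \<in> interior T"
  shows "L2_projection_P0 \<Omega> \<T> v x = mean (interior T) v"
proof -
  have mT: "measure lebesgue (interior T') > 0" if "T' \<in> \<T>" for T'
    using full_simplex.vol_pos[OF simplex_hull(1)[OF that]] full_simplex.vol_def[OF simplex_hull(1)[OF that]]
      simplex_hull(2)[OF that] by simp
  have lm: "interior T' \<in> lmeasurable" if "T' \<in> \<T>" for T'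
    using bounded_interior[OF that] by (simp add: lmeasurable_open)
  have ci: "(LINT x|lebesgue_on (interior T'). c) = measure lebesgue (interior T') * c" if "T' \<in> \<T>" for T' and c :: real
    using lm[OF that] by (simp add: measure_restrict_space)
  have LP0: "L2 (interior T') q" if q: "q \<in> P0 \<T>" and T': "T' \<in> \<T>" for q T'
  proof -
    obtain c where c: "\<forall>x\<in>interior T'. q x = c" using q T' by (auto simp: P0_def)
    have "AE x in lebesgue_on (interior T'). c = q x" by (rule AE_I2) (use c in simp)
    then show ?thesis by (rule L2_AE_cong[OF _ L2_const[OF lm[OF T']], rotated]) simp
  qed
  have local: "(LINT x|lebesgue_on (interior T'). (v x - p x) * q x) = (LINT x|lebesgue_on (interior T'). v x - p x) * q y"
    if q: "q \<in> P0 \<T>" and T': "T' \<in> \<T>" and y: "y \<in> interior T'" for p q T' y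
  proof -
    obtain c where c: "\<forall>x\<in>interior T'. q x = c" using q T' by (auto simp: P0_def)
    have "(LINT x|lebesgue_on (interior T'). (v x - p x) * q x) = (LINT x|lebesgue_on (interior T'). (v x - p x) * c)"
      by (intro Bochner_Integration.integral_cong refl) (simp add: c)
    then show ?thesis using c y by simp
  qed
  have int: "integrable (lebesgue_on \<Omega>) (\<lambda>x. (v x - p x) * q x)" if "p \<in> P0 \<T>" "q \<in> P0 \<T>" for p q
    by (intro L2_integrable_mult L2_diff v L2_\<Omega>_I LP0 that)
  define p where "p x = (\<Sum>T\<in>\<T>. indicator (interior T) x * mean (interior T) v)" for x
  have p: "p x = mean (interior T') v" if "T' \<in> \<T>" "x \<in> interior T'" for T' x
    using sum_indicator_interior[OF that] by (simp add: p_def)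
  have pP: "p \<in> P0 \<T>" unfolding P0_def using p by blast
  have p0: "(LINT x|lebesgue_on (interior T'). v x - p x) = 0" if T': "T' \<in> \<T>" for T'
  proof -
    have "(LINT x|lebesgue_on (interior T'). v x - p x) = (LINT x|lebesgue_on (interior T'). v x - mean (interior T') v)"
      by (intro Bochner_Integration.integral_cong refl) (simp add: p[OF T'])
    also have "\<dots> = (LINT x|lebesgue_on (interior T'). v x) - measure lebesgue (interior T') * mean (interior T') v"
      using L2_integrable[OF lm[OF T'] L2_interior[OF v T']] L2_integrable[OF lm[OF T'] L2_const[OF lm[OF T']]] ci[OF T']
      by (subst Bochner_Integration.integral_diff) auto
    finally show ?thesis using mT[OF T'] by (simp add: mean_def)
  qed
  have ne: "\<exists>y. y \<in> interior T'" if "T' \<in> \<T>" for T'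
    using mT[OF that] by (metis equals0I less_irrefl measure_empty)
  have "\<exists>p. p \<in> P0 \<T> \<and> (\<forall>q \<in> P0 \<T>. (LINT x|lebesgue_on \<Omega>. (v x - p x) * q x) = 0)"
  proof (intro exI conjI ballI)
    fix q assume q: "q \<in> P0 \<T>"
    have "(LINT x|lebesgue_on (interior T'). (v x - p x) * q x) = 0" if T': "T' \<in> \<T>" for T'
      using ne[OF T'] local[OF q T', of _ p] p0[OF T'] by auto
    then show "(LINT x|lebesgue_on \<Omega>. (v x - p x) * q x) = 0"
      by (subst integral_\<Omega>_split[OF int[OF pP q]]) simp
  qed (rule pP)
  from someI_ex[OF this] have P: "L2_projection_P0 \<Omega> \<T> v \<in> P0 \<T>"
    "\<And>q. q \<in> P0 \<T> \<Longrightarrow> (LINT x|lebesgue_on \<Omega>. (v x - L2_projection_P0 \<Omega> \<T> v x) * q x) = 0"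
    unfolding L2_projection_P0_def by blast+
  define q where "q = (indicator (interior T) :: 'a \<Rightarrow> real)"
  have q1: "q y = (if T' = T then 1 else 0)" if "T' \<in> \<T>" "y \<in> interior T'" for T' y
    using that interior_unique[OF that(1) T that(2)] interior_subset[of T] by (auto simp: q_def indicator_def)
  have qP: "q \<in> P0 \<T>" unfolding P0_def using q1 by blast
  have "0 = (\<Sum>T'\<in>\<T>. (LINT x|lebesgue_on (interior T'). (v x - L2_projection_P0 \<Omega> \<T> v x) * q x))"
    using P(2)[OF qP] integral_\<Omega>_split[OF int[OF P(1) qP]] by simp
  also have "\<dots> = (\<Sum>T'\<in>\<T>. if T' = T then (LINT x|lebesgue_on (interior T). v x - L2_projection_P0 \<Omega> \<T> v x) else 0)"
  proof (intro sum.cong refl)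
    fix T' assume T': "T' \<in> \<T>"
    obtain y where "y \<in> interior T'" using ne[OF T'] by blast
    from local[OF qP T' this] q1[OF T' this]
    show "(LINT x|lebesgue_on (interior T'). (v x - L2_projection_P0 \<Omega> \<T> v x) * q x)
       = (if T' = T then (LINT x|lebesgue_on (interior T). v x - L2_projection_P0 \<Omega> \<T> v x) else 0)" by auto
  qed
  also have "\<dots> = (LINT x|lebesgue_on (interior T). v x - L2_projection_P0 \<Omega> \<T> v x)"
    using T finite_\<T> by simp
  finally have 0: "(LINT x|lebesgue_on (interior T). v x - L2_projection_P0 \<Omega> \<T> v x) = 0" by simp
  obtain c where c: "\<forall>x\<in>interior T. L2_projection_P0 \<Omega> \<T> v x = c" using P(1) T by (auto simp: P0_def)
  have "(LINT x|lebesgue_on (interior T). v x - L2_projection_P0 \<Omega> \<T> v x) = (LINT x|lebesgue_on (interior T). v x - c)"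
    by (intro Bochner_Integration.integral_cong refl) (simp add: c)
  also have "\<dots> = (LINT x|lebesgue_on (interior T). v x) - measure lebesgue (interior T) * c"
    using L2_integrable[OF lm[OF T] L2_interior[OF v T]] L2_integrable[OF lm[OF T] L2_const[OF lm[OF T]]] ci[OF T]
    by (subst Bochner_Integration.integral_diff) auto
  finally have "(LINT x|lebesgue_on (interior T). v x) = measure lebesgue (interior T) * c" using 0 by simp
  then show ?thesis using c x mT[OF T] by (simp add: mean_def)
qed

end

section \<open>The energy estimate\<close>

lemma is_weak_gradient_zero: "is_weak_gradient U (\<lambda>x. 0) (\<lambda>x. 0)"
  by (simp add: is_weak_gradient_def L2_zero)

lemma is_weak_gradient_sum:
  fixes U :: "'a::euclidean_space set"
  assumes U: "open U" "bounded U" and K: "finite K" "\<And>j. j \<in> K \<Longrightarrow> is_weak_gradient U (u j) (G j)"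
  shows "is_weak_gradient U (\<lambda>x. \<Sum>j\<in>K. c j * u j x) (\<lambda>x. \<Sum>j\<in>K. c j *\<^sub>R G j x)"
  using K
proof (induction K rule: finite_induct)
  case empty
  then show ?case by (simp add: is_weak_gradient_zero)
next
  case (insert j K)
  have "is_weak_gradient U (\<lambda>x. c j * u j x + 1 * (\<Sum>j\<in>K. c j * u j x)) (\<lambda>x. c j *\<^sub>R G j x + 1 *\<^sub>R (\<Sum>j\<in>K. c j *\<^sub>R G j x))"
    using insert by (intro is_weak_gradient_lincomb U) auto
  then show ?case using insert by simp
qed

lemma L2_norm_lincomb:
  assumes f: "L2 U f" and g: "L2 U g"
  shows "(L2_norm U (\<lambda>x. \<alpha> *\<^sub>R f x + \<beta> *\<^sub>R g x))\<^sup>2 \<le> 2 * \<alpha>\<^sup>2 * (L2_norm U f)\<^sup>2 + 2 * \<beta>\<^sup>2 * (L2_norm U g)\<^sup>2"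
proof -
  have "(L2_norm U (\<lambda>x. \<alpha> *\<^sub>R f x + \<beta> *\<^sub>R g x))\<^sup>2 = (LINT x|lebesgue_on U. (norm (\<alpha> *\<^sub>R f x + \<beta> *\<^sub>R g x))\<^sup>2)"
    by (rule L2_norm_power2)
  also have "\<dots> \<le> (LINT x|lebesgue_on U. 2 * \<alpha>\<^sup>2 * (norm (f x))\<^sup>2 + 2 * \<beta>\<^sup>2 * (norm (g x))\<^sup>2)"
  proof (rule integral_mono)
    show "integrable (lebesgue_on U) (\<lambda>x. (norm (\<alpha> *\<^sub>R f x + \<beta> *\<^sub>R g x))\<^sup>2)"
      using L2_add[OF L2_scaleR[OF f] L2_scaleR[OF g], of \<alpha> \<beta>] by (simp add: L2_def)
    show "integrable (lebesgue_on U) (\<lambda>x. 2 * \<alpha>\<^sup>2 * (norm (f x))\<^sup>2 + 2 * \<beta>\<^sup>2 * (norm (g x))\<^sup>2)"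
      using f g by (simp add: L2_def)
    show "(norm (\<alpha> *\<^sub>R f x + \<beta> *\<^sub>R g x))\<^sup>2 \<le> 2 * \<alpha>\<^sup>2 * (norm (f x))\<^sup>2 + 2 * \<beta>\<^sup>2 * (norm (g x))\<^sup>2" for x
    proof -
      have "(norm (\<alpha> *\<^sub>R f x + \<beta> *\<^sub>R g x))\<^sup>2 \<le> (norm (\<alpha> *\<^sub>R f x) + norm (\<beta> *\<^sub>R g x))\<^sup>2"
        by (intro power_mono norm_triangle_ineq) simp
      also have "\<dots> \<le> 2 * (norm (\<alpha> *\<^sub>R f x))\<^sup>2 + 2 * (norm (\<beta> *\<^sub>R g x))\<^sup>2"
        using sum_squares_bound[of "norm (\<alpha> *\<^sub>R f x)" "norm (\<beta> *\<^sub>R g x)"] by (simp add: power2_sum)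
      finally show ?thesis by (simp add: power_mult_distrib)
    qed
  qed
  also have "\<dots> = 2 * \<alpha>\<^sup>2 * (L2_norm U f)\<^sup>2 + 2 * \<beta>\<^sup>2 * (L2_norm U g)\<^sup>2"
    using f g by (simp add: L2_def L2_norm_power2)
  finally show ?thesis .
qed

section \<open>Vector space structure of \<open>H10\<close>\<close>

lemma H1_norm_power2: "(H1_norm U u)\<^sup>2 = (L2_norm U u)\<^sup>2 + (L2_norm U (weak_grad U u))\<^sup>2"
  by (simp add: H1_norm_def)

text \<open>A quadratic substitute for the triangle inequality, which passes to limits just as well
  and keeps the two parts of the norm additive.\<close>

lemma H1_norm_lincomb:
  fixes U :: "'a::euclidean_space set"
  assumes U: "open U" "bounded U" and f: "f \<in> H1 U" and g: "g \<in> H1 U"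
  shows "(H1_norm U (\<lambda>x. \<alpha> * f x + \<beta> * g x))\<^sup>2 \<le> 2 * \<alpha>\<^sup>2 * (H1_norm U f)\<^sup>2 + 2 * \<beta>\<^sup>2 * (H1_norm U g)\<^sup>2"
proof -
  note wf = is_weak_gradient_weak_grad[OF f] and wg = is_weak_gradient_weak_grad[OF g]
  have L: "L2 U f" "L2 U g" "L2 U (weak_grad U f)" "L2 U (weak_grad U g)"
    using wf wg by (auto simp: is_weak_gradient_def)
  note w = is_weak_gradient_lincomb[OF U wf wg, of \<alpha> \<beta>]
  have w': "is_weak_gradient U (\<lambda>x. \<alpha> * f x + \<beta> * g x) (weak_grad U (\<lambda>x. \<alpha> * f x + \<beta> * g x))"
    using w by (intro is_weak_gradient_weak_grad) (auto simp: H1_def)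
  have "L2_norm U (weak_grad U (\<lambda>x. \<alpha> * f x + \<beta> * g x)) = L2_norm U (\<lambda>x. \<alpha> *\<^sub>R weak_grad U f x + \<beta> *\<^sub>R weak_grad U g x)"
    by (rule L2_norm_cong_AE[OF _ _ weak_grad_AE_eq[OF U w]]) (use w w' in \<open>auto simp: is_weak_gradient_def\<close>)
  then show ?thesis
    using L2_norm_lincomb[OF L(1,2), of \<alpha> \<beta>] L2_norm_lincomb[OF L(3,4), of \<alpha> \<beta>]
    by (simp add: H1_norm_power2 algebra_simps)
qed

lemma test_function_zero: "test_function U (\<lambda>x. 0)"
  by (simp add: test_function_def C_k_const)

lemma test_function_lincomb:
  assumes \<phi>: "test_function U \<phi>" and \<psi>: "test_function U \<psi>"
  shows "test_function U (\<lambda>x. \<alpha> * \<phi> x + \<beta> * \<psi> x)"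
proof -
  have sub: "closure {x. \<alpha> * \<phi> x + \<beta> * \<psi> x \<noteq> 0} \<subseteq> closure {x. \<phi> x \<noteq> 0} \<union> closure {x. \<psi> x \<noteq> 0}"
    unfolding closure_Un[symmetric] by (rule closure_mono) auto
  have "compact (closure {x. \<phi> x \<noteq> 0} \<union> closure {x. \<psi> x \<noteq> 0})"
    using \<phi> \<psi> by (intro compact_Un) (auto simp: test_function_def)
  then have "compact (closure {x. \<alpha> * \<phi> x + \<beta> * \<psi> x \<noteq> 0})"
    using sub by (meson bounded_subset closed_closure compact_eq_bounded_closed)
  moreover have "C_k k (\<lambda>x. \<alpha> * \<phi> x + \<beta> * \<psi> x)" for k
    using \<phi> \<psi> by (intro C_k_add C_k_mult C_k_const) (auto simp: test_function_def)
  ultimately show ?thesis using sub \<phi> \<psi> by (auto simp: test_function_def)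
qed

lemma test_function_H1:
  fixes U :: "'a::euclidean_space set"
  assumes "open U" "bounded U" "test_function U \<phi>" shows "\<phi> \<in> H1 U"
  using is_weak_gradient_C1[OF assms(1,2) test_function_C1[OF assms(3)]] by (auto simp: H1_def)

lemma H1_lincomb:
  fixes U :: "'a::euclidean_space set"
  assumes "open U" "bounded U" "f \<in> H1 U" "g \<in> H1 U" shows "(\<lambda>x. \<alpha> * f x + \<beta> * g x) \<in> H1 U"
  using is_weak_gradient_lincomb[OF assms(1,2) is_weak_gradient_weak_grad[OF assms(3)] is_weak_gradient_weak_grad[OF assms(4)]]
  by (auto simp: H1_def)

lemma H10_lincomb:
  fixes U :: "'a::euclidean_space set"
  assumes U: "open U" "bounded U" and f: "f \<in> H10 U" and g: "g \<in> H10 U"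
  shows "(\<lambda>x. \<alpha> * f x + \<beta> * g x) \<in> H10 U"
proof -
  obtain \<phi> \<psi> where \<phi>: "test_approximation U \<phi> f" and \<psi>: "test_approximation U \<psi> g"
    using f g by (auto simp: H10_def)
  have fg: "f \<in> H1 U" "g \<in> H1 U" using f g by (auto simp: H10_def)
  have t: "test_function U (\<phi> j)" "test_function U (\<psi> j)" for j
    using \<phi> \<psi> by (auto simp: test_approximation_def)
  have d: "(\<lambda>x. \<phi> j x - f x) \<in> H1 U" "(\<lambda>x. \<psi> j x - g x) \<in> H1 U" for j
    using H1_lincomb[OF U test_function_H1[OF U t(1)] fg(1), of 1 j "-1"]
      H1_lincomb[OF U test_function_H1[OF U t(2)] fg(2), of 1 j "-1"] by simp_all
  let ?E = "\<lambda>j x. (\<alpha> * \<phi> j x + \<beta> * \<psi> j x) - (\<alpha> * f x + \<beta> * g x)"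
  have "(\<lambda>j. (H1_norm U (?E j))\<^sup>2) \<longlonglongrightarrow> 0"
  proof (rule Lim_null_comparison[OF always_eventually], rule allI)
    fix j
    have "?E j = (\<lambda>x. \<alpha> * (\<phi> j x - f x) + \<beta> * (\<psi> j x - g x))" by (simp add: algebra_simps)
    then show "norm ((H1_norm U (?E j))\<^sup>2) \<le> 2 * \<alpha>\<^sup>2 * (H1_norm U (\<lambda>x. \<phi> j x - f x))\<^sup>2 + 2 * \<beta>\<^sup>2 * (H1_norm U (\<lambda>x. \<psi> j x - g x))\<^sup>2"
      using H1_norm_lincomb[OF U d(1) d(2), of \<alpha> j \<beta> j] by simp
  next
    have "(\<lambda>j. 2 * \<alpha>\<^sup>2 * (H1_norm U (\<lambda>x. \<phi> j x - f x))\<^sup>2 + 2 * \<beta>\<^sup>2 * (H1_norm U (\<lambda>x. \<psi> j x - g x))\<^sup>2)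
        \<longlonglongrightarrow> 2 * \<alpha>\<^sup>2 * 0\<^sup>2 + 2 * \<beta>\<^sup>2 * 0\<^sup>2"
      using \<phi> \<psi> by (intro tendsto_intros) (auto simp: test_approximation_def)
    then show "(\<lambda>j. 2 * \<alpha>\<^sup>2 * (H1_norm U (\<lambda>x. \<phi> j x - f x))\<^sup>2 + 2 * \<beta>\<^sup>2 * (H1_norm U (\<lambda>x. \<psi> j x - g x))\<^sup>2) \<longlonglongrightarrow> 0"
      by simp
  qed
  from tendsto_real_sqrt[OF this] have "(\<lambda>j. H1_norm U (?E j)) \<longlonglongrightarrow> 0"
    by (simp add: H1_norm_def)
  then have "test_approximation U (\<lambda>j x. \<alpha> * \<phi> j x + \<beta> * \<psi> j x) (\<lambda>x. \<alpha> * f x + \<beta> * g x)"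
    using test_function_lincomb[OF t] by (simp add: test_approximation_def)
  then show ?thesis using H1_lincomb[OF U fg] by (auto simp: H10_def)
qed

lemma H10_zero:
  fixes U :: "'a::euclidean_space set"
  assumes U: "open U" "bounded U" shows "(\<lambda>x. 0) \<in> H10 U"
proof -
  have z: "(\<lambda>x. 0) \<in> H1 U" using is_weak_gradient_zero by (auto simp: H1_def)
  have "(H1_norm U (\<lambda>x. 0 * (0::real) + 0 * (0::real)))\<^sup>2 \<le> 0"
    using H1_norm_lincomb[OF U z z, of 0 0] by simp
  then have "H1_norm U (\<lambda>x. 0) = 0" by simp
  then have "test_approximation U (\<lambda>j x. 0) (\<lambda>x. 0)" by (simp add: test_approximation_def test_function_zero)
  with z show ?thesis by (auto simp: H10_def)
qed

lemma H10_sum: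
  fixes U :: "'a::euclidean_space set"
  assumes U: "open U" "bounded U" and K: "finite K" "\<And>j. j \<in> K \<Longrightarrow> u j \<in> H10 U"
  shows "(\<lambda>x. \<Sum>j\<in>K. c j * u j x) \<in> H10 U"
  using K
proof (induction K rule: finite_induct)
  case empty
  then show ?case using H10_zero[OF U] by simp
next
  case (insert j K)
  then have "(\<lambda>x. c j * u j x + 1 * (\<Sum>j\<in>K. c j * u j x)) \<in> H10 U"
    by (intro H10_lincomb U) auto
  then show ?case using insert by simp
qed

lemma mean_deviation:
  fixes v :: "'a::euclidean_space \<Rightarrow> real"
  assumes U: "U \<in> lmeasurable" "measure lebesgue U > 0" and v: "L2 U v"
  shows "(LINT x|lebesgue_on U. v x) = measure lebesgue U * mean U v"
    and "(LINT x|lebesgue_on U. (v x)\<^sup>2) = measure lebesgue U * (mean U v)\<^sup>2 + (LINT x|lebesgue_on U. (v x - mean U v)\<^sup>2)"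
proof -
  define m where "m = mean U v"
  show 1: "(LINT x|lebesgue_on U. v x) = measure lebesgue U * mean U v" using U by (simp add: mean_def)
  have c: "(LINT x|lebesgue_on U. c) = measure lebesgue U * c" for c :: real
    using U by (simp add: measure_restrict_space)
  have i: "integrable (lebesgue_on U) (\<lambda>x. (v x)\<^sup>2)" "integrable (lebesgue_on U) v" "integrable (lebesgue_on U) (\<lambda>x. m\<^sup>2)"
    using v L2_integrable[OF U(1) v] L2_integrable[OF U(1) L2_const[OF U(1)], of "m\<^sup>2"] by (simp_all add: L2_def)
  have "(LINT x|lebesgue_on U. (v x - m)\<^sup>2) = (LINT x|lebesgue_on U. (v x)\<^sup>2 - 2 * m * v x + m\<^sup>2)"
    by (simp add: power2_diff algebra_simps)
  also have "\<dots> = (LINT x|lebesgue_on U. (v x)\<^sup>2) - 2 * m * (LINT x|lebesgue_on U. v x) + (LINT x|lebesgue_on U. m\<^sup>2)"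
    using i by (simp only: Bochner_Integration.integral_diff Bochner_Integration.integral_add
        integrable_mult_right Bochner_Integration.integrable_diff integral_mult_right_zero)
  also have "\<dots> = (LINT x|lebesgue_on U. (v x)\<^sup>2) - measure lebesgue U * m\<^sup>2"
    unfolding 1 c by (simp add: m_def power2_eq_square algebra_simps)
  finally show "(LINT x|lebesgue_on U. (v x)\<^sup>2) = measure lebesgue U * (mean U v)\<^sup>2 + (LINT x|lebesgue_on U. (v x - mean U v)\<^sup>2)"
    by (simp add: m_def)
qed

text \<open>For fixed p + q, the right-hand side is minimal at q = \<epsilon> l p, where both sides
  are equal; this is the origin of the factor l / (1 + \<epsilon> l).\<close>

lemma weighted_square_sum:
  fixes l \<epsilon> p q :: real
  assumes l: "l > 0" and \<epsilon>: "\<epsilon> > 0"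
  shows "(p + q)\<^sup>2 * (l / (1 + \<epsilon> * l)) \<le> l * p\<^sup>2 + q\<^sup>2 / \<epsilon>"
proof -
  have "0 \<le> (\<epsilon> * l * p - q)\<^sup>2" by simp
  then have "(p + q)\<^sup>2 * l * \<epsilon> \<le> (l * p\<^sup>2 * \<epsilon> + q\<^sup>2) * (1 + \<epsilon> * l)"
    by (simp add: power2_eq_square algebra_simps)
  then have "(p + q)\<^sup>2 * l / (1 + \<epsilon> * l) \<le> (l * p\<^sup>2 * \<epsilon> + q\<^sup>2) / \<epsilon>"
    using l \<epsilon> by (simp add: field_simps add_pos_pos)
  then show ?thesis using \<epsilon> by (simp add: add_divide_distrib)
qed

section \<open>Potential, mesh size and the two energies\<close>

locale discretization = triangulated_domain \<Omega> \<T> for \<Omega> :: "'a::euclidean_space set" and \<T> +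
  fixes V :: "'a \<Rightarrow> real" and \<kappa> C_P \<epsilon>' \<epsilon>'' :: real
  assumes V_bounded: "L_infinity \<Omega> V" and V_essinf: "essinf \<Omega> V = 0" and V_P0: "V \<in> P0 \<T>"
    and interpolation: "eCR_interpolation_constant \<Omega> \<T> \<kappa>"
    and Poincare: "Poincare_constant \<T> C_P"
    and \<epsilon>': "\<epsilon>' = L_infinity_norm \<Omega> (\<lambda>x. C_P\<^sup>2 * (mesh_size \<T> x)\<^sup>2)"
    and \<epsilon>'': "\<epsilon>'' = L_infinity_norm \<Omega> (\<lambda>x. \<kappa>\<^sup>2 * (mesh_size \<T> x)\<^sup>2)"
begin

abbreviation volume :: "'a set \<Rightarrow> real" where "volume T \<equiv> measure lebesgue (interior T)"

lemma volume_pos: "T \<in> \<T> \<Longrightarrow> volume T > 0"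
  using full_simplex.vol_pos[OF simplex_hull(1)] full_simplex.vol_def[OF simplex_hull(1)] simplex_hull(2) by simp

lemma interior_lmeasurable: "T \<in> \<T> \<Longrightarrow> interior T \<in> lmeasurable"
  by (simp add: lmeasurable_open bounded_interior)

text \<open>Open simplices have positive measure, so a property that holds almost everywhere holds
  somewhere in each of them. For piecewise constant quantities this turns essential bounds into
  bounds on every simplex.\<close>

lemma AE_constD:
  assumes T: "T \<in> \<T>" and ae: "AE x in lebesgue_on \<Omega>. R x" and const: "\<And>x. x \<in> interior T \<Longrightarrow> R x \<Longrightarrow> Q"
  shows Q
proof (rule ccontr)
  assume "\<not> Q"
  have "AE x in lebesgue. x \<in> \<Omega> \<longrightarrow> R x" using ae \<Omega>_sets by (simp add: AE_restrict_space_iff)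
  then have "AE x in lebesgue. x \<notin> interior T"
    by eventually_elim (use const \<open>\<not> Q\<close> interior_subset_\<Omega>[OF T] in blast)
  then have "interior T \<in> null_sets lebesgue" by (simp add: AE_iff_null_sets)
  then have "volume T = 0" by (simp add: measure_def null_sets_def)
  then show False using volume_pos[OF T] by simp
qed

lemma \<T>_nonempty: "\<T> \<noteq> {}"
proof
  assume "\<T> = {}"
  then have "closure \<Omega> = {}" using Union_\<T> by simp
  then show False using \<Omega>_nonempty by (simp only: closure_eq_empty)
qed

lemma potential_nonneg: "AE x in lebesgue_on \<Omega>. 0 \<le> V x"
proof -
  have "esssup (lebesgue_on \<Omega>) (\<lambda>x. ereal (- V x)) = 0"
    using V_essinf by (simp add: essinf_def)
  then have "AE x in lebesgue_on \<Omega>. ereal (- V x) \<le> 0"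
    using esssup_AE[of "\<lambda>x. ereal (- V x)" "lebesgue_on \<Omega>"] by simp
  then show ?thesis by eventually_elim simp
qed

definition pot :: "'a set \<Rightarrow> real" where "pot T = (SOME c. \<forall>x\<in>interior T. V x = c)"

lemma pot: assumes "T \<in> \<T>" "x \<in> interior T" shows "V x = pot T"
proof -
  have "\<exists>c. \<forall>x\<in>interior T. V x = c" using V_P0 assms(1) by (auto simp: P0_def)
  from someI_ex[OF this] have "\<forall>x\<in>interior T. V x = pot T" unfolding pot_def .
  then show ?thesis using assms(2) by blast
qed

lemma pot_nonneg: assumes "T \<in> \<T>" shows "pot T \<ge> 0"
  using AE_constD[OF assms potential_nonneg] pot[OF assms] by metis

lemma diameter_pos: assumes T: "T \<in> \<T>" shows "diameter T > 0"
proof -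
  interpret full_simplex "vertices T" rewrites "convex hull (vertices T) = T"
    using simplex_hull[OF T] by simp_all
  obtain x where "x \<in> interior T" using interior_S_nonempty by blast
  then obtain e where e: "e > 0" "ball x e \<subseteq> T" by (auto simp: mem_interior)
  obtain b :: 'a where b: "b \<in> Basis" by (meson ex_in_conv nonempty_Basis)
  have "x + (e / 2) *\<^sub>R b \<in> T" "x \<in> T" using e b by (auto simp: dist_norm subset_iff)
  then have "dist (x + (e / 2) *\<^sub>R b) x \<le> diameter T"
    by (intro diameter_bounded_bound compact_imp_bounded compact_S)
  then show ?thesis using e b by (simp add: dist_norm)
qed

lemma mesh_norm_bound:
  fixes C :: real
  assumes T: "T \<in> \<T>" shows "C\<^sup>2 * (diameter T)\<^sup>2 \<le> L_infinity_norm \<Omega> (\<lambda>x. C\<^sup>2 * (mesh_size \<T> x)\<^sup>2)"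
proof -
  let ?f = "\<lambda>x. C\<^sup>2 * (mesh_size \<T> x)\<^sup>2"
  let ?e = "esssup (lebesgue_on \<Omega>) (\<lambda>x. ereal \<bar>?f x\<bar>)"
  have mesh: "mesh_size \<T> x = diameter T'" if "T' \<in> \<T>" "x \<in> interior T'" for T' x
    using sum_indicator_interior[OF that] by (simp add: mesh_size_def)
  have "mesh_size \<T> \<in> borel_measurable borel"
    unfolding mesh_size_def by (intro borel_measurable_sum borel_measurable_times borel_measurable_indicator) auto
  then have "mesh_size \<T> \<in> borel_measurable (lebesgue_on \<Omega>)"
    by (intro measurable_restrict_space1 measurable_completion) simp
  then have m: "(\<lambda>x. ereal \<bar>?f x\<bar>) \<in> borel_measurable (lebesgue_on \<Omega>)" by measurable
  \<comment> \<open>Only the finiteness of this bound matters: \<open>real_of_ereal\<close> would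
    turn an infinite essential supremum into 0.\<close>
  define M where "M = (\<Sum>T'\<in>\<T>. C\<^sup>2 * (diameter T')\<^sup>2)"
  have "?e \<le> ereal M"
  proof (rule esssup_I[OF m])
    show "AE x in lebesgue_on \<Omega>. ereal \<bar>?f x\<bar> \<le> ereal M"
      using AE_\<Omega>_interior
    proof eventually_elim
      case (elim x)
      then obtain T' where T': "T' \<in> \<T>" "x \<in> interior T'" by blast
      have "C\<^sup>2 * (diameter T')\<^sup>2 \<le> M"
        unfolding M_def by (rule member_le_sum) (use T' finite_\<T> in auto)
      then show ?case using mesh[OF T'] by simp
    qed
  qed
  moreover have "ereal (C\<^sup>2 * (diameter T)\<^sup>2) \<le> ?e"
    by (rule AE_constD[OF T esssup_AE[of "\<lambda>x. ereal \<bar>?f x\<bar>" "lebesgue_on \<Omega>"]]) (use mesh[OF T] in simp)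
  ultimately show ?thesis
    unfolding L_infinity_norm_def by (cases ?e) auto
qed

lemma C_P_pos: "C_P > 0" and \<kappa>_pos: "\<kappa> > 0"
  using Poincare interpolation by (auto simp: Poincare_constant_def eCR_interpolation_constant_def)

lemma \<epsilon>_pos: "\<epsilon>' > 0" "\<epsilon>'' > 0"
proof -
  obtain T where T: "T \<in> \<T>" using \<T>_nonempty by blast
  show "\<epsilon>' > 0" using mesh_norm_bound[OF T, of C_P] diameter_pos[OF T] C_P_pos
    by (simp add: \<epsilon>') (metis less_le_trans mult_pos_pos zero_less_power)
  show "\<epsilon>'' > 0" using mesh_norm_bound[OF T, of \<kappa>] diameter_pos[OF T] \<kappa>_pos
    by (simp add: \<epsilon>'') (metis less_le_trans mult_pos_pos zero_less_power)
qed

abbreviation wg :: "'a set \<Rightarrow> ('a \<Rightarrow> real) \<Rightarrow> 'a \<Rightarrow> 'a" where "wg T z \<equiv> weak_grad (interior T) z"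
abbreviation II :: "('a \<Rightarrow> real) \<Rightarrow> 'a \<Rightarrow> real" where "II v \<equiv> I_eCR \<Omega> \<T> v"

definition energy :: "('a \<Rightarrow> real) \<Rightarrow> ('a \<Rightarrow> real) \<Rightarrow> real" where
  "energy u w = grad_inner \<Omega> u w + V_inner \<Omega> V u w"

definition energy_h :: "('a \<Rightarrow> real) \<Rightarrow> ('a \<Rightarrow> real) \<Rightarrow> real" where
  "energy_h u w = a_pw \<T> u w + V_inner \<Omega> V (L2_projection_P0 \<Omega> \<T> u) (L2_projection_P0 \<Omega> \<T> w)"

lemma eCR_L2: assumes z: "z \<in> eCR \<Omega> \<T>" shows "L2 \<Omega> z"
proof (rule L2_\<Omega>_I)
  fix T assume "T \<in> \<T>"
  from is_weak_gradient_weak_grad[OF eCR_H1_interior[OF z this]] show "L2 (interior T) z"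
    by (simp add: is_weak_gradient_def)
qed

lemma eCR_weak_grad: "z \<in> eCR \<Omega> \<T> \<Longrightarrow> T \<in> \<T> \<Longrightarrow> is_weak_gradient (interior T) z (wg T z)"
  by (rule is_weak_gradient_weak_grad[OF eCR_H1_interior])

lemma H10_weak_grad: "v \<in> H10 \<Omega> \<Longrightarrow> is_weak_gradient \<Omega> v (weak_grad \<Omega> v)"
  by (rule is_weak_gradient_weak_grad) (simp add: H10_def)

lemma H10_L2: "v \<in> H10 \<Omega> \<Longrightarrow> L2 \<Omega> v" "v \<in> H10 \<Omega> \<Longrightarrow> L2 \<Omega> (weak_grad \<Omega> v)"
  using H10_weak_grad by (auto simp: is_weak_gradient_def)

lemma L2_potential: assumes f: "L2 \<Omega> f" shows "L2 \<Omega> (\<lambda>x. V x * f x)"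
proof (rule L2_\<Omega>_I)
  fix T assume T: "T \<in> \<T>"
  have "L2 (interior T) (\<lambda>x. pot T * f x)" by (rule L2_mult[OF L2_interior[OF f T]])
  then show "L2 (interior T) (\<lambda>x. V x * f x)"
    by (rule L2_AE_cong[rotated]) (use pot[OF T] in \<open>auto intro!: AE_I2\<close>)
qed

lemma V_inner_split:
  assumes f: "L2 \<Omega> f" and g: "L2 \<Omega> g"
  shows "V_inner \<Omega> V f g = (\<Sum>T\<in>\<T>. pot T * (LINT x|lebesgue_on (interior T). f x * g x))"
proof -
  have "V_inner \<Omega> V f g = (\<Sum>T\<in>\<T>. (LINT x|lebesgue_on (interior T). V x * f x * g x))"
    unfolding V_inner_def by (rule integral_\<Omega>_split[OF L2_integrable_mult[OF L2_potential[OF f] g]])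
  also have "\<dots> = (\<Sum>T\<in>\<T>. pot T * (LINT x|lebesgue_on (interior T). f x * g x))"
  proof (intro sum.cong refl)
    fix T assume T: "T \<in> \<T>"
    have "(LINT x|lebesgue_on (interior T). V x * f x * g x) = (LINT x|lebesgue_on (interior T). pot T * (f x * g x))"
      by (intro Bochner_Integration.integral_cong refl) (simp add: pot[OF T] mult.assoc)
    then show "(LINT x|lebesgue_on (interior T). V x * f x * g x) = pot T * (LINT x|lebesgue_on (interior T). f x * g x)"
      by simp
  qed
  finally show ?thesis .
qed

lemma energy_h_split:
  assumes u: "u \<in> eCR \<Omega> \<T>" and w: "w \<in> eCR \<Omega> \<T>"
  shows "energy_h u w = (\<Sum>T\<in>\<T>. (LINT x|lebesgue_on (interior T). wg T u x \<bullet> wg T w x)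
      + pot T * volume T * mean (interior T) u * mean (interior T) w)"
proof -
  have P: "L2_projection_P0 \<Omega> \<T> z x = mean (interior T) z" if "z \<in> eCR \<Omega> \<T>" "T \<in> \<T>" "x \<in> interior T" for z T x
    by (rule mean_L2_projection[OF eCR_L2[OF that(1)] that(2,3)])
  have L: "L2 \<Omega> (L2_projection_P0 \<Omega> \<T> z)" if z: "z \<in> eCR \<Omega> \<T>" for z
  proof (rule L2_\<Omega>_I)
    fix T assume T: "T \<in> \<T>"
    have "AE x in lebesgue_on (interior T). mean (interior T) z = L2_projection_P0 \<Omega> \<T> z x"
      by (rule AE_I2) (use P[OF z T] in simp)
    then show "L2 (interior T) (L2_projection_P0 \<Omega> \<T> z)"
      by (rule L2_AE_cong[OF _ L2_const[OF interior_lmeasurable[OF T]], rotated]) simp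
  qed
  have "(LINT x|lebesgue_on (interior T). L2_projection_P0 \<Omega> \<T> u x * L2_projection_P0 \<Omega> \<T> w x)
     = volume T * mean (interior T) u * mean (interior T) w" if T: "T \<in> \<T>" for T
  proof -
    have "(LINT x|lebesgue_on (interior T). L2_projection_P0 \<Omega> \<T> u x * L2_projection_P0 \<Omega> \<T> w x)
       = (LINT x|lebesgue_on (interior T). mean (interior T) u * mean (interior T) w)"
      by (intro Bochner_Integration.integral_cong refl) (simp add: P[OF u T] P[OF w T])
    then show ?thesis using interior_lmeasurable[OF T] by (simp add: measure_restrict_space)
  qed
  then show ?thesis
    unfolding energy_h_def V_inner_split[OF L[OF u] L[OF w]] a_pw_def grad_inner_def
    by (simp add: sum.distrib mult.assoc)
qed

lemma energy_split:
  assumes v: "v \<in> H10 \<Omega>"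
  shows "energy v v = (\<Sum>T\<in>\<T>. (LINT x|lebesgue_on (interior T). (norm (weak_grad \<Omega> v x))\<^sup>2)
      + pot T * (LINT x|lebesgue_on (interior T). (v x)\<^sup>2))"
proof -
  have "grad_inner \<Omega> v v = (\<Sum>T\<in>\<T>. (LINT x|lebesgue_on (interior T). weak_grad \<Omega> v x \<bullet> weak_grad \<Omega> v x))"
    unfolding grad_inner_def by (rule integral_\<Omega>_split[OF L2_integrable_inner[OF H10_L2(2)[OF v] H10_L2(2)[OF v]]])
  then show ?thesis
    unfolding energy_def V_inner_split[OF H10_L2(1)[OF v] H10_L2(1)[OF v]]
    by (simp add: sum.distrib power2_norm_eq_inner power2_eq_square[of "v _"])
qed

lemma L2_inner_split:
  assumes "L2 \<Omega> f" "L2 \<Omega> g"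
  shows "L2_inner \<Omega> f g = (\<Sum>T\<in>\<T>. (LINT x|lebesgue_on (interior T). f x * g x))"
  unfolding L2_inner_def by (rule integral_\<Omega>_split[OF L2_integrable_mult[OF assms]])

text \<open>\<open>D\<close> is the energy of the interpolation error and \<open>A\<close> that of
  the interpolant; orthogonality makes their sum the energy of \<open>v\<close>. The bounds are the
  squares of the two hypotheses, with the squared local mesh size estimated by its maximum.\<close>

lemma interpolation_estimates:
  assumes v: "v \<in> H10 \<Omega>" and T: "T \<in> \<T>"
  defines "D \<equiv> (LINT x|lebesgue_on (interior T). (norm (weak_grad \<Omega> v x - wg T (II v) x))\<^sup>2)"
    and "A \<equiv> (LINT x|lebesgue_on (interior T). (norm (wg T (II v) x))\<^sup>2)"
    and "m \<equiv> mean (interior T) v"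
  shows "mean (interior T) (II v) = m"
    and "(LINT x|lebesgue_on (interior T). (norm (weak_grad \<Omega> v x))\<^sup>2) = A + D"
    and "(LINT x|lebesgue_on (interior T). (v x - II v x)\<^sup>2) \<le> \<epsilon>'' * D"
    and "(LINT x|lebesgue_on (interior T). (v x - m)\<^sup>2) \<le> \<epsilon>' * (A + D)"
proof -
  have U: "open (interior T)" "bounded (interior T)" using bounded_interior[OF T] by simp_all
  note lm = interior_lmeasurable[OF T]
  have L: "L2 (interior T) v" "L2 (interior T) (weak_grad \<Omega> v)" "L2 (interior T) (II v)" "L2 (interior T) (wg T (II v))"
    using L2_interior[OF H10_L2(1)[OF v] T]
      L2_subset[OF H10_L2(2)[OF v] interior_subset_\<Omega>[OF T] _ \<Omega>_sets] eCR_weak_grad[OF I_eCR_in_eCR T]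
    by (auto simp: is_weak_gradient_def)
  show "mean (interior T) (II v) = m"
    using interpolation_local(1)[OF v T] L2_integrable[OF lm L(1)] L2_integrable[OF lm L(3)]
    by (simp add: mean_def m_def)
  have orth: "(LINT x|lebesgue_on (interior T). (weak_grad \<Omega> v x - wg T (II v) x) \<bullet> wg T (II v) x) = 0"
    by (rule interpolation_local(3)[OF v T I_eCR_in_eCR])
  note Ld = L2_diff[OF L(2) L(4)]
  have "(LINT x|lebesgue_on (interior T). (norm (weak_grad \<Omega> v x))\<^sup>2)
     = (LINT x|lebesgue_on (interior T). (norm (wg T (II v) x))\<^sup>2 + (norm (weak_grad \<Omega> v x - wg T (II v) x))\<^sup>2
          + 2 * ((weak_grad \<Omega> v x - wg T (II v) x) \<bullet> wg T (II v) x))"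
    by (intro Bochner_Integration.integral_cong refl)
      (simp add: power2_norm_eq_inner inner_diff_left inner_diff_right inner_commute algebra_simps)
  also have "\<dots> = A + D + 2 * (LINT x|lebesgue_on (interior T). (weak_grad \<Omega> v x - wg T (II v) x) \<bullet> wg T (II v) x)"
    using L Ld L2_integrable_inner[OF Ld L(4)] by (simp add: A_def D_def L2_def)
  finally show AD: "(LINT x|lebesgue_on (interior T). (norm (weak_grad \<Omega> v x))\<^sup>2) = A + D" using orth by simp
  have D: "(L2_norm (interior T) (wg T (\<lambda>x. v x - II v x)))\<^sup>2 = D"
  proof -
    note w = interpolation_local(2)[OF v T]
    have "is_weak_gradient (interior T) (\<lambda>x. v x - II v x) (wg T (\<lambda>x. v x - II v x))"
      using w by (intro is_weak_gradient_weak_grad) (auto simp: H1_def)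
    then have "L2_norm (interior T) (wg T (\<lambda>x. v x - II v x)) = L2_norm (interior T) (\<lambda>x. weak_grad \<Omega> v x - wg T (II v) x)"
      by (intro L2_norm_cong_AE weak_grad_AE_eq[OF U w] Ld) (simp add: is_weak_gradient_def)
    then show ?thesis by (simp add: L2_norm_power2 D_def)
  qed
  have Dnn: "D \<ge> 0" "A \<ge> 0" by (simp_all add: D_def A_def)
  have "L2_norm (interior T) (\<lambda>x. v x - II v x) \<le> \<kappa> * diameter T * L2_norm (interior T) (wg T (\<lambda>x. v x - II v x))"
    using interpolation v T by (simp add: eCR_interpolation_constant_def)
  from power_mono[OF this, of 2]
  have "(LINT x|lebesgue_on (interior T). (v x - II v x)\<^sup>2) \<le> \<kappa>\<^sup>2 * (diameter T)\<^sup>2 * D"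
    by (simp add: L2_norm_nonneg power_mult_distrib D) (simp add: L2_norm_power2)
  also have "\<dots> \<le> \<epsilon>'' * D" unfolding \<epsilon>'' by (intro mult_right_mono mesh_norm_bound T Dnn)
  finally show "(LINT x|lebesgue_on (interior T). (v x - II v x)\<^sup>2) \<le> \<epsilon>'' * D" .
  have w: "is_weak_gradient (interior T) v (weak_grad \<Omega> v)"
    by (rule is_weak_gradient_subset[OF U(1) interior_subset_\<Omega>[OF T] open_\<Omega> H10_weak_grad[OF v]])
  then have vH: "v \<in> H1 (interior T)" by (auto simp: H1_def)
  \<comment> \<open>The Poincare hypothesis uses a weak gradient chosen on the simplex; the
    restriction of the one on \<open>\<Omega>\<close> agrees with it almost everywhere.\<close>
  have "L2_norm (interior T) (wg T v) = L2_norm (interior T) (weak_grad \<Omega> v)"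
    using is_weak_gradient_weak_grad[OF vH] by (intro L2_norm_cong_AE weak_grad_AE_eq[OF U w] L) (simp add: is_weak_gradient_def)
  then have "L2_norm (interior T) (\<lambda>x. v x - m) \<le> C_P * diameter T * L2_norm (interior T) (weak_grad \<Omega> v)"
    using Poincare vH T unfolding Poincare_constant_def m_def by metis
  from power_mono[OF this, of 2]
  have "(LINT x|lebesgue_on (interior T). (v x - m)\<^sup>2) \<le> C_P\<^sup>2 * (diameter T)\<^sup>2 * (A + D)"
    by (simp add: L2_norm_nonneg power_mult_distrib) (simp add: L2_norm_power2 AD)
  also have "\<dots> \<le> \<epsilon>' * (A + D)" unfolding \<epsilon>' using Dnn by (intro mult_right_mono mesh_norm_bound T) simp
  finally show "(LINT x|lebesgue_on (interior T). (v x - m)\<^sup>2) \<le> \<epsilon>' * (A + D)" .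
qed

lemma L2_norm_split:
  assumes f: "L2 \<Omega> f"
  shows "L2_inner \<Omega> f f = (\<Sum>T\<in>\<T>. volume T * (mean (interior T) f)\<^sup>2
      + (LINT x|lebesgue_on (interior T). (f x - mean (interior T) f)\<^sup>2))"
  unfolding L2_inner_split[OF f f]
  by (intro sum.cong refl)
    (simp add: mean_deviation(2)[OF interior_lmeasurable volume_pos L2_interior[OF f]] power2_eq_square[symmetric])

lemma energy_lower_bound:
  assumes v: "v \<in> H10 \<Omega>" and l: "l > 0" and disc: "l * L2_inner \<Omega> (II v) (II v) \<le> energy_h (II v) (II v)"
  shows "l * L2_inner \<Omega> v v \<le> (1 + \<epsilon>' * \<epsilon>'' * l\<^sup>2 / (1 + \<epsilon>'' * l)) * energy v v"
proof -
  define D where "D T = (LINT x|lebesgue_on (interior T). (norm (weak_grad \<Omega> v x - wg T (II v) x))\<^sup>2)" for T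
  define A where "A T = (LINT x|lebesgue_on (interior T). (norm (wg T (II v) x))\<^sup>2)" for T
  define m where "m T = mean (interior T) v" for T
  define r where "r T = (LINT x|lebesgue_on (interior T). (v x - m T)\<^sup>2)" for T
  define p where "p T = (LINT x|lebesgue_on (interior T). (II v x - m T)\<^sup>2)" for T
  define q where "q T = (LINT x|lebesgue_on (interior T). (v x - II v x)\<^sup>2)" for T
  note est = interpolation_estimates[OF v, folded D_def A_def m_def]
  have Lv: "L2 \<Omega> v" and Lw: "L2 \<Omega> (II v)" using H10_L2[OF v] eCR_L2[OF I_eCR_in_eCR] by auto
  have q: "q T \<le> \<epsilon>'' * D T" and r: "r T \<le> \<epsilon>' * (A T + D T)" if "T \<in> \<T>" for T
    using est(3,4)[OF that] by (simp_all add: q_def r_def)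
  have young: "r T * (l / (1 + \<epsilon>'' * l)) \<le> l * p T + q T / \<epsilon>''" if T: "T \<in> \<T>" for T
  proof -
    have Lp: "L2 (interior T) (\<lambda>x. II v x - m T)" and Lq: "L2 (interior T) (\<lambda>x. v x - II v x)" and Lr: "L2 (interior T) (\<lambda>x. v x - m T)"
      by (intro L2_diff L2_const L2_interior[OF _ T] Lv Lw interior_lmeasurable T)+
    have "r T * (l / (1 + \<epsilon>'' * l)) = (LINT x|lebesgue_on (interior T). ((II v x - m T) + (v x - II v x))\<^sup>2 * (l / (1 + \<epsilon>'' * l)))"
      by (simp add: r_def)
    also have "\<dots> \<le> (LINT x|lebesgue_on (interior T). l * (II v x - m T)\<^sup>2 + (v x - II v x)\<^sup>2 / \<epsilon>'')"
    proof (rule integral_mono)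
      show "integrable (lebesgue_on (interior T)) (\<lambda>x. ((II v x - m T) + (v x - II v x))\<^sup>2 * (l / (1 + \<epsilon>'' * l)))"
        using Lr by (simp add: L2_def)
      show "integrable (lebesgue_on (interior T)) (\<lambda>x. l * (II v x - m T)\<^sup>2 + (v x - II v x)\<^sup>2 / \<epsilon>'')"
        using Lp Lq by (simp add: L2_def)
    qed (rule weighted_square_sum[OF l \<epsilon>_pos(2)])
    also have "\<dots> = l * p T + q T / \<epsilon>''" using Lp Lq by (simp add: L2_def p_def q_def)
    finally show ?thesis .
  qed
  \<comment> \<open>The mean part of the squared norm, common to \<open>v\<close> and its
    interpolant; the two norms differ only in the fluctuations \<open>R\<close> and
    \<open>sum p \<T>\<close>.\<close>
  define M where "M = (\<Sum>T\<in>\<T>. volume T * (m T)\<^sup>2)"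
  define R where "R = sum r \<T>"
  have vv: "L2_inner \<Omega> v v = M + R"
    unfolding L2_norm_split[OF Lv] M_def R_def r_def m_def by (simp add: sum.distrib)
  have ww: "L2_inner \<Omega> (II v) (II v) = M + sum p \<T>"
    unfolding L2_norm_split[OF Lw] M_def sum.distrib[symmetric] p_def by (intro sum.cong refl) (simp add: est(1))
  have eh: "energy_h (II v) (II v) = (\<Sum>T\<in>\<T>. A T + pot T * (volume T * (m T)\<^sup>2))"
    unfolding energy_h_split[OF I_eCR_in_eCR I_eCR_in_eCR]
    by (intro sum.cong refl) (simp add: est(1) A_def power2_norm_eq_inner power2_eq_square[of "m _"])
  have e: "energy v v = (\<Sum>T\<in>\<T>. A T + D T + pot T * (volume T * (m T)\<^sup>2 + r T))"
    unfolding energy_split[OF v]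
    by (intro sum.cong refl)
      (simp add: est(2) r_def m_def mean_deviation(2)[OF interior_lmeasurable volume_pos L2_interior[OF Lv]])
  have rnn: "r T \<ge> 0" for T by (simp add: r_def)
  \<comment> \<open>The discrete form sees the potential only through the means; what it loses is
    \<open>pot T * r T\<close>, which is nonnegative.\<close>
  have e1: "energy_h (II v) (II v) + sum D \<T> \<le> energy v v"
    unfolding eh e sum.distrib[symmetric]
    by (intro sum_mono) (simp add: distrib_left mult_nonneg_nonneg pot_nonneg rnn)
  have e2: "(\<Sum>T\<in>\<T>. A T + D T) \<le> energy v v"
    unfolding e using pot_nonneg rnn volume_pos
    by (intro sum_mono) (simp add: mult_nonneg_nonneg less_imp_le)
  have R1: "R \<le> \<epsilon>' * energy v v"
  proof -
    have "R \<le> (\<Sum>T\<in>\<T>. \<epsilon>' * (A T + D T))" unfolding R_def by (intro sum_mono r)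
    also have "\<dots> = \<epsilon>' * (\<Sum>T\<in>\<T>. A T + D T)" by (simp add: sum_distrib_left)
    also have "\<dots> \<le> \<epsilon>' * energy v v" using e2 \<epsilon>_pos by (intro mult_left_mono) auto
    finally show ?thesis .
  qed
  \<comment> \<open>The interpolation error in L2, weighted by 1 / \<epsilon>'', is at most its
    energy \<open>D\<close>, so the weighted inequality can be summed over the simplices.\<close>
  have "R * (l / (1 + \<epsilon>'' * l)) \<le> l * sum p \<T> + sum D \<T>"
  proof -
    have "R * (l / (1 + \<epsilon>'' * l)) = (\<Sum>T\<in>\<T>. r T * (l / (1 + \<epsilon>'' * l)))" unfolding R_def by (rule sum_distrib_right)
    also have "\<dots> \<le> (\<Sum>T\<in>\<T>. l * p T + D T)"
    proof (rule sum_mono)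
      fix T assume T: "T \<in> \<T>"
      have "q T / \<epsilon>'' \<le> D T" using q[OF T] \<epsilon>_pos by (simp add: field_simps)
      then show "r T * (l / (1 + \<epsilon>'' * l)) \<le> l * p T + D T" using young[OF T] by linarith
    qed
    finally show ?thesis by (simp add: sum.distrib sum_distrib_left)
  qed
  with disc e1 have "l * M + R * (l / (1 + \<epsilon>'' * l)) \<le> energy v v"
    unfolding ww by (simp add: distrib_left)
  moreover have "l * L2_inner \<Omega> v v = l * M + R * (l / (1 + \<epsilon>'' * l)) + R * (\<epsilon>'' * l\<^sup>2 / (1 + \<epsilon>'' * l))"
  proof -
    have "1 + \<epsilon>'' * l > 0" using \<epsilon>_pos l by (simp add: add_pos_pos)
    then have "l = (l + \<epsilon>'' * l\<^sup>2) / (1 + \<epsilon>'' * l)"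
      by (simp add: nonzero_eq_divide_eq power2_eq_square algebra_simps)
    then have "l = l / (1 + \<epsilon>'' * l) + \<epsilon>'' * l\<^sup>2 / (1 + \<epsilon>'' * l)"
      by (simp only: add_divide_distrib)
    then have "R * l = R * (l / (1 + \<epsilon>'' * l)) + R * (\<epsilon>'' * l\<^sup>2 / (1 + \<epsilon>'' * l))"
      by (metis distrib_left)
    then show ?thesis unfolding vv by (simp add: distrib_left mult.commute)
  qed
  \<comment> \<open>The share of \<open>R\<close> that the energies do not absorb is left to the
    Poincare bound; it produces the summand of the constant beyond 1.\<close>
  moreover have "R * (\<epsilon>'' * l\<^sup>2 / (1 + \<epsilon>'' * l)) \<le> (\<epsilon>' * energy v v) * (\<epsilon>'' * l\<^sup>2 / (1 + \<epsilon>'' * l))"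
    using R1 \<epsilon>_pos l by (intro mult_right_mono) auto
  moreover have "(1 + \<epsilon>' * \<epsilon>'' * l\<^sup>2 / (1 + \<epsilon>'' * l)) * energy v v = energy v v + (\<epsilon>' * energy v v) * (\<epsilon>'' * l\<^sup>2 / (1 + \<epsilon>'' * l))"
    by (simp add: ring_distribs mult_ac)
  ultimately show ?thesis by linarith
qed

text \<open>The counterpart of \<open>energy_lower_bound\<close> for l = \<infinity>: means are
  preserved by the interpolation, so \<open>v\<close> equals its own fluctuation on every
  simplex.\<close>

lemma energy_lower_bound_limit:
  assumes v: "v \<in> H10 \<Omega>" and w0: "AE x in lebesgue_on \<Omega>. II v x = 0"
  shows "L2_inner \<Omega> v v \<le> \<epsilon>' * energy v v"
proof -
  have Lv: "L2 \<Omega> v" and Lw: "L2 \<Omega> (II v)" using H10_L2[OF v] eCR_L2[OF I_eCR_in_eCR] by auto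
  have m0: "mean (interior T) v = 0" if T: "T \<in> \<T>" for T
  proof -
    have "AE x in lebesgue. x \<in> \<Omega> \<longrightarrow> II v x = 0" using w0 \<Omega>_sets by (simp add: AE_restrict_space_iff)
    then have "AE x in lebesgue. x \<in> interior T \<longrightarrow> II v x = 0"
      by eventually_elim (use interior_subset_\<Omega>[OF T] in blast)
    then have "AE x in lebesgue_on (interior T). II v x = 0" by (simp add: AE_restrict_space_iff)
    then have "(LINT x|lebesgue_on (interior T). II v x) = 0" by (rule integral_eq_zero_AE)
    then show ?thesis using interpolation_estimates(1)[OF v T] by (simp add: mean_def)
  qed
  have "L2_inner \<Omega> v v = (\<Sum>T\<in>\<T>. (LINT x|lebesgue_on (interior T). (v x - mean (interior T) v)\<^sup>2))"
    unfolding L2_norm_split[OF Lv] by (intro sum.cong refl) (simp add: m0)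
  also have "\<dots> \<le> (\<Sum>T\<in>\<T>. \<epsilon>' * (LINT x|lebesgue_on (interior T). (norm (weak_grad \<Omega> v x))\<^sup>2))"
    using interpolation_estimates(2,4)[OF v] by (intro sum_mono) simp
  also have "\<dots> \<le> \<epsilon>' * energy v v"
    unfolding energy_split[OF v] sum_distrib_left[symmetric] using \<epsilon>_pos pot_nonneg
    by (intro mult_left_mono sum_mono) (auto intro: mult_nonneg_nonneg)
  finally show ?thesis .
qed

end

section \<open>Eigenvalues\<close>

text \<open>The empty family shows that the set under the supremum is nonempty, and a finite
  supremum of extended naturals is a maximum.\<close>

lemma ae_dim_attained:
  assumes "ae_dim \<Omega> E = enat d"
  shows "\<exists>u. (\<forall>i<d. u i \<in> E) \<and> ae_independent \<Omega> d u"
proof -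
  let ?S = "{enat d | d. \<exists>u. (\<forall>i<d. u i \<in> E) \<and> ae_independent \<Omega> d u}"
  have "enat 0 \<in> ?S" by (auto simp: ae_independent_def)
  then have ne: "?S \<noteq> {}" by blast
  have fin: "finite ?S"
    using assms ne unfolding ae_dim_def Sup_enat_def by (auto split: if_splits)
  have "Sup ?S = Max ?S" by (subst Sup_enat_def) (simp only: fin ne if_True if_False)
  then have "enat d \<in> ?S" using Max_in[OF fin ne] assms by (simp add: ae_dim_def)
  then show ?thesis by auto
qed

lemma ae_independent_le_dim:
  assumes "\<And>i. i < d \<Longrightarrow> u i \<in> E" "ae_independent \<Omega> d u" shows "enat d \<le> ae_dim \<Omega> E"
  unfolding ae_dim_def by (rule Sup_upper) (use assms in blast)

text \<open>For each eigenvalue, its positions in the enumeration are matched bijectively with an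
  independent family in the eigenspace. The counting works eigenvalue by eigenvalue, so independence
  is at first available only for positions with a common value.\<close>

lemma eigenfunctions_exist:
  assumes en: "eigenvalue_enumeration \<Omega> E J l"
  shows "\<exists>u. (\<forall>j\<in>J. u j \<in> E (l j)) \<and>
    (\<forall>K c \<mu>. finite K \<longrightarrow> K \<subseteq> J \<longrightarrow> (\<forall>j\<in>K. l j = \<mu>) \<longrightarrow>
       (AE x in lebesgue_on \<Omega>. (\<Sum>j\<in>K. c j * u j x) = 0) \<longrightarrow> (\<forall>j\<in>K. c j = 0))"
proof -
  define grp where "grp \<mu> = {k \<in> J. l k = \<mu>}" for \<mu>
  have "\<exists>U h. (\<forall>i<card (grp \<mu>). U i \<in> E \<mu>) \<and> ae_independent \<Omega> (card (grp \<mu>)) U \<and> bij_betw h (grp \<mu>) {..<card (grp \<mu>)}"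
    if "\<mu> > 0" for \<mu>
  proof -
    have "finite (grp \<mu>)" "ae_dim \<Omega> (E \<mu>) = enat (card (grp \<mu>))"
      using en that by (auto simp: eigenvalue_enumeration_def grp_def)
    then show ?thesis
      using ae_dim_attained[of \<Omega> "E \<mu>"] ex_bij_betw_finite_nat[of "grp \<mu>"] by (auto simp: atLeast0LessThan)
  qed
  then have "\<forall>\<mu>. \<exists>p. \<mu> > 0 \<longrightarrow> (\<forall>i<card (grp \<mu>). fst p i \<in> E \<mu>) \<and> ae_independent \<Omega> (card (grp \<mu>)) (fst p) \<and> bij_betw (snd p) (grp \<mu>) {..<card (grp \<mu>)}"
    by (metis fst_conv snd_conv)
  from choice[OF this] obtain p where p: "\<And>\<mu>. \<mu> > 0 \<Longrightarrow> (\<forall>i<card (grp \<mu>). fst (p \<mu>) i \<in> E \<mu>) \<and>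
      ae_independent \<Omega> (card (grp \<mu>)) (fst (p \<mu>)) \<and> bij_betw (snd (p \<mu>)) (grp \<mu>) {..<card (grp \<mu>)}"
    by blast
  define U where "U \<mu> = fst (p \<mu>)" for \<mu>
  define h where "h \<mu> = snd (p \<mu>)" for \<mu>
  have U: "U \<mu> i \<in> E \<mu>" if "\<mu> > 0" "i < card (grp \<mu>)" for \<mu> i using p[OF that(1)] that(2) by (simp add: U_def)
  have ind: "ae_independent \<Omega> (card (grp \<mu>)) (U \<mu>)" if "\<mu> > 0" for \<mu> using p[OF that] by (simp add: U_def)
  have h: "bij_betw (h \<mu>) (grp \<mu>) {..<card (grp \<mu>)}" if "\<mu> > 0" for \<mu> using p[OF that] by (simp add: h_def)
  have pos: "l j > 0" if "j \<in> J" for j using en that by (simp add: eigenvalue_enumeration_def)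
  define u where "u j = U (l j) (h (l j) j)" for j
  show ?thesis
  proof (intro exI[of _ u] conjI ballI allI impI)
    fix j assume j: "j \<in> J"
    then have "h (l j) j < card (grp (l j))" using bij_betwE[OF h[OF pos[OF j]]] by (auto simp: grp_def)
    then show "u j \<in> E (l j)" unfolding u_def by (rule U[OF pos[OF j]])
  next
    fix K c \<mu> j
    assume K: "finite K" "K \<subseteq> J" "\<forall>j\<in>K. l j = \<mu>"
      and ae: "AE x in lebesgue_on \<Omega>. (\<Sum>j\<in>K. c j * u j x) = 0" and j: "j \<in> K"
    have "\<forall>j\<in>K. c j = 0"
    proof (cases "K = {}")
      case False
      have \<mu>: "\<mu> > 0" using K(2,3) j pos[of j] by auto
      have fin: "finite (grp \<mu>)" using en \<mu> by (simp add: eigenvalue_enumeration_def grp_def)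
      have Kg: "K \<subseteq> grp \<mu>" using K by (auto simp: grp_def)
      \<comment> \<open>The coefficients are transported to the independent family and set to 0 at
        the positions outside \<open>K\<close>.\<close>
      define c' where "c' i = (let j = inv_into (grp \<mu>) (h \<mu>) i in if j \<in> K then c j else 0)" for i
      have c': "c' (h \<mu> j) = (if j \<in> K then c j else 0)" if "j \<in> grp \<mu>" for j
        using inv_into_f_f[OF bij_betw_imp_inj_on[OF h[OF \<mu>]] that] by (simp add: c'_def Let_def)
      have "(\<Sum>i<card (grp \<mu>). c' i * U \<mu> i x) = (\<Sum>j\<in>K. c j * u j x)" for x
      proof -
        have "(\<Sum>i<card (grp \<mu>). c' i * U \<mu> i x) = (\<Sum>j\<in>grp \<mu>. c' (h \<mu> j) * U \<mu> (h \<mu> j) x)"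
          by (rule sum.reindex_bij_betw[OF h[OF \<mu>], symmetric])
        also have "\<dots> = (\<Sum>j\<in>grp \<mu>. if j \<in> K then c j * u j x else 0)"
          by (intro sum.cong refl) (auto simp: c' u_def grp_def)
        also have "\<dots> = (\<Sum>j\<in>K. c j * u j x)"
          using fin Kg by (simp add: sum.If_cases Int_absorb1)
        finally show ?thesis .
      qed
      then have "\<forall>i<card (grp \<mu>). c' i = 0"
        using ind[OF \<mu>] ae by (simp add: ae_independent_def)
      then have "c' (h \<mu> j) = 0" if "j \<in> K" for j
        using bij_betwE[OF h[OF \<mu>]] Kg that by blast
      then show ?thesis using c' Kg by fastforce
    qed simp
    then show "c j = 0" using j by blast
  qed
qed

text \<open>Eigenfunctions are only orthogonal between different eigenspaces, so that the terms are grouped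
  by eigenvalues.\<close>

lemma spectral_sum_nonneg:
  fixes d l :: "'i \<Rightarrow> real"
  assumes J: "finite J" and orth: "\<And>i j. i \<in> J \<Longrightarrow> j \<in> J \<Longrightarrow> l i \<noteq> l j \<Longrightarrow> B i j = 0"
    and Q: "\<And>K. K \<subseteq> J \<Longrightarrow> 0 \<le> (\<Sum>j\<in>K. d j * (\<Sum>i\<in>K. d i * B i j))"
    and low: "\<And>j. j \<in> J \<Longrightarrow> l j < L \<Longrightarrow> (\<Sum>i\<in>J. d i * B i j) = 0"
  shows "0 \<le> (\<Sum>j\<in>J. d j * (l j - L) * (\<Sum>i\<in>J. d i * B i j))"
proof -
  define grp where "grp \<mu> = {j \<in> J. l j = \<mu>}" for \<mu>
  have "(\<Sum>j\<in>J. d j * (l j - L) * (\<Sum>i\<in>J. d i * B i j))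
      = (\<Sum>\<mu>\<in>l ` J. \<Sum>j\<in>grp \<mu>. d j * (l j - L) * (\<Sum>i\<in>J. d i * B i j))"
    unfolding grp_def by (rule sum.image_gen[OF J])
  moreover have "0 \<le> (\<Sum>j\<in>grp \<mu>. d j * (l j - L) * (\<Sum>i\<in>J. d i * B i j))" for \<mu>
  proof (cases "\<mu> < L")
    case True
    then show ?thesis using low by (intro sum_nonneg) (auto simp: grp_def)
  next
    case False
    \<comment> \<open>Orthogonality restricts the inner sum to the group, which leaves the
      nonnegative factor \<open>\<mu> - L\<close> times the quadratic form of the group.\<close>
    have "(\<Sum>j\<in>grp \<mu>. d j * (l j - L) * (\<Sum>i\<in>J. d i * B i j)) = (\<Sum>j\<in>grp \<mu>. (\<mu> - L) * (d j * (\<Sum>i\<in>grp \<mu>. d i * B i j)))"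
    proof (intro sum.cong refl)
      fix j assume j: "j \<in> grp \<mu>"
      have "(\<Sum>i\<in>J. d i * B i j) = (\<Sum>i\<in>grp \<mu>. d i * B i j)"
        using J j orth by (intro sum.mono_neutral_right) (auto simp: grp_def)
      then show "d j * (l j - L) * (\<Sum>i\<in>J. d i * B i j) = (\<mu> - L) * (d j * (\<Sum>i\<in>grp \<mu>. d i * B i j))"
        using j by (simp add: grp_def)
    qed
    also have "\<dots> = (\<mu> - L) * (\<Sum>j\<in>grp \<mu>. d j * (\<Sum>i\<in>grp \<mu>. d i * B i j))" by (rule sum_distrib_left[symmetric])
    also have "\<dots> \<ge> 0" using False Q[of "grp \<mu>"] by (intro mult_nonneg_nonneg) (auto simp: grp_def)
    finally show ?thesis .
  qed
  ultimately show ?thesis by (simp add: sum_nonneg)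
qed

lemma L2_inner_commute: "L2_inner \<Omega> f g = L2_inner \<Omega> g f"
  by (simp add: L2_inner_def mult.commute)

lemma L2_inner_sum_left:
  assumes "finite K" "\<And>j. j \<in> K \<Longrightarrow> L2 \<Omega> (u j)" "L2 \<Omega> w"
  shows "L2_inner \<Omega> (\<lambda>x. \<Sum>j\<in>K. c j * u j x) w = (\<Sum>j\<in>K. c j * L2_inner \<Omega> (u j) w)"
proof -
  have "L2_inner \<Omega> (\<lambda>x. \<Sum>j\<in>K. c j * u j x) w = (LINT x|lebesgue_on \<Omega>. (\<Sum>j\<in>K. c j * (u j x * w x)))"
    by (simp add: L2_inner_def sum_distrib_right mult.assoc)
  also have "\<dots> = (\<Sum>j\<in>K. c j * L2_inner \<Omega> (u j) w)"
    using L2_integrable_mult[OF assms(2,3)] by (subst Bochner_Integration.integral_sum) (auto simp: L2_inner_def)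
  finally show ?thesis .
qed

lemma L2_lincomb:
  assumes "finite K" "\<And>j. j \<in> K \<Longrightarrow> L2 \<Omega> (u j)" shows "L2 \<Omega> (\<lambda>x. \<Sum>j\<in>K. c j * u j x :: real)"
  using assms by (intro L2_sum L2_mult)

lemma L2_inner_cong_AE:
  assumes "L2 \<Omega> f" "L2 \<Omega> f'" "L2 \<Omega> g" "AE x in lebesgue_on \<Omega>. f x = f' x"
  shows "L2_inner \<Omega> f g = L2_inner \<Omega> f' g"
  unfolding L2_inner_def by (rule integral_cong_AE) (use assms in \<open>auto simp: L2_def\<close>)

lemma L2_inner_nonneg: "0 \<le> L2_inner \<Omega> f f"
  by (simp add: L2_inner_def)

lemma L2_inner_eq_0_AE:
  assumes "L2 \<Omega> f" "L2_inner \<Omega> f f = 0" shows "AE x in lebesgue_on \<Omega>. f x = 0"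
proof -
  have "AE x in lebesgue_on \<Omega>. f x * f x = 0"
    using integral_nonneg_eq_0_iff_AE[OF L2_integrable_mult[OF assms(1) assms(1)]] assms(2) by (simp add: L2_inner_def)
  then show ?thesis by eventually_elim simp
qed

text \<open>The quadratic form of the Gram matrix is a squared norm; its sign is what
  \<open>spectral_sum_nonneg\<close> asks for on subsets of indices.\<close>

lemma gram_nonneg:
  assumes "finite K" "\<And>j. j \<in> K \<Longrightarrow> L2 \<Omega> (u j)"
  shows "(\<Sum>j\<in>K. d j * (\<Sum>i\<in>K. d i * L2_inner \<Omega> (u i) (u j))) = L2_inner \<Omega> (\<lambda>x. \<Sum>j\<in>K. d j * u j x) (\<lambda>x. \<Sum>j\<in>K. d j * u j x)"
proof -
  note L = L2_lincomb[of K \<Omega> u d, OF assms]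
  have "L2_inner \<Omega> (\<lambda>x. \<Sum>j\<in>K. d j * u j x) (\<lambda>x. \<Sum>j\<in>K. d j * u j x) = (\<Sum>j\<in>K. d j * L2_inner \<Omega> (u j) (\<lambda>x. \<Sum>j\<in>K. d j * u j x))"
    by (rule L2_inner_sum_left[OF assms L])
  also have "\<dots> = (\<Sum>j\<in>K. d j * (\<Sum>i\<in>K. d i * L2_inner \<Omega> (u i) (u j)))"
  proof (rule sum.cong[OF refl])
    fix j assume j: "j \<in> K"
    have "L2_inner \<Omega> (\<lambda>x. \<Sum>j\<in>K. d j * u j x) (u j) = (\<Sum>i\<in>K. d i * L2_inner \<Omega> (u i) (u j))"
      by (rule L2_inner_sum_left[OF assms assms(2)[OF j]])
    then show "d j * L2_inner \<Omega> (u j) (\<lambda>x. \<Sum>j\<in>K. d j * u j x) = d j * (\<Sum>i\<in>K. d i * L2_inner \<Omega> (u i) (u j))"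
      by (subst L2_inner_commute) simp
  qed
  finally show ?thesis by simp
qed

text \<open>The part of a vanishing combination that belongs to one eigenvalue is orthogonal to the
  rest, so its squared norm is its product with the whole combination, that is, 0. Independence
  within the group then applies.\<close>

lemma orthogonal_groups_independent:
  assumes J: "finite J" and L: "\<And>j. j \<in> J \<Longrightarrow> L2 \<Omega> (u j)"
    and orth: "\<And>i j. i \<in> J \<Longrightarrow> j \<in> J \<Longrightarrow> l i \<noteq> (l j :: real) \<Longrightarrow> L2_inner \<Omega> (u i) (u j) = 0"
    and ind: "\<And>K c \<mu>. K \<subseteq> J \<Longrightarrow> (\<And>j. j \<in> K \<Longrightarrow> l j = \<mu>) \<Longrightarrow>
       AE x in lebesgue_on \<Omega>. (\<Sum>j\<in>K. c j * u j x) = 0 \<Longrightarrow> \<forall>j\<in>K. c j = 0"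
    and ae: "AE x in lebesgue_on \<Omega>. (\<Sum>j\<in>J. c j * u j x) = 0" and j0: "j0 \<in> J"
  shows "c j0 = 0"
proof -
  define K where "K = {j \<in> J. l j = l j0}"
  have K: "K \<subseteq> J" "finite K" using J by (auto simp: K_def)
  have LK: "L2 \<Omega> (u j)" if "j \<in> K" for j using L K that by blast
  let ?z = "\<lambda>x. \<Sum>j\<in>K. c j * u j x" and ?v = "\<lambda>x. \<Sum>j\<in>J. c j * u j x"
  have Lz: "L2 \<Omega> ?z" and Lv: "L2 \<Omega> ?v" using L2_lincomb[OF K(2) LK] L2_lincomb[OF J L] by auto
  have "L2_inner \<Omega> ?z ?z = (\<Sum>j\<in>K. c j * (\<Sum>i\<in>K. c i * L2_inner \<Omega> (u i) (u j)))"
    by (rule gram_nonneg[OF K(2) LK, symmetric])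
  also have "\<dots> = (\<Sum>j\<in>K. c j * L2_inner \<Omega> (u j) ?v)"
  proof (intro sum.cong refl)
    fix j assume j: "j \<in> K"
    have "(\<Sum>i\<in>K. c i * L2_inner \<Omega> (u i) (u j)) = (\<Sum>i\<in>J. c i * L2_inner \<Omega> (u i) (u j))"
      using J K j orth by (intro sum.mono_neutral_left) (auto simp: K_def)
    also have "\<dots> = L2_inner \<Omega> ?v (u j)" by (rule L2_inner_sum_left[OF J L LK[OF j], symmetric])
    finally show "c j * (\<Sum>i\<in>K. c i * L2_inner \<Omega> (u i) (u j)) = c j * L2_inner \<Omega> (u j) ?v"
      by (simp add: L2_inner_commute)
  qed
  also have "\<dots> = (\<Sum>j\<in>K. c j * 0)"
  proof (intro sum.cong refl arg_cong2[of _ _ _ _ "(*)"])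
    fix j assume "j \<in> K"
    have "L2_inner \<Omega> ?v (u j) = L2_inner \<Omega> (\<lambda>x. 0) (u j)"
      by (rule L2_inner_cong_AE[OF Lv L2_zero LK[OF \<open>j \<in> K\<close>] ae])
    then show "L2_inner \<Omega> (u j) ?v = 0" by (simp add: L2_inner_commute) (simp add: L2_inner_def)
  qed
  finally have "AE x in lebesgue_on \<Omega>. ?z x = 0" by (intro L2_inner_eq_0_AE[OF Lz]) simp
  from ind[OF K(1) _ this] show ?thesis using j0 by (auto simp: K_def)
qed

text \<open>The bound equals l (1 + \<epsilon>'' l) / (1 + \<epsilon>'' l + \<epsilon>' \<epsilon>''
  l^2); numerator and denominator are divided by l^2.\<close>

lemma GLB_real_tendsto:
  assumes "\<epsilon>' > 0" "\<epsilon>'' > 0" shows "(GLB_real \<epsilon>' \<epsilon>'' \<longlongrightarrow> 1 / \<epsilon>') at_top"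
proof -
  have "((\<lambda>l. (inverse l + \<epsilon>'') / (inverse l * inverse l + \<epsilon>'' * inverse l + \<epsilon>' * \<epsilon>'')) \<longlongrightarrow> (0 + \<epsilon>'') / (0 * 0 + \<epsilon>'' * 0 + \<epsilon>' * \<epsilon>'')) at_top"
    using assms by (intro tendsto_intros tendsto_inverse_0_at_top filterlim_ident) auto
  then have "((\<lambda>l. (inverse l + \<epsilon>'') / (inverse l * inverse l + \<epsilon>'' * inverse l + \<epsilon>' * \<epsilon>'')) \<longlongrightarrow> 1 / \<epsilon>') at_top"
    using assms by simp
  then show ?thesis
  proof (rule Lim_transform_eventually)
    show "\<forall>\<^sub>F l in at_top. (inverse l + \<epsilon>'') / (inverse l * inverse l + \<epsilon>'' * inverse l + \<epsilon>' * \<epsilon>'') = GLB_real \<epsilon>' \<epsilon>'' l"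
      using eventually_gt_at_top[of "0::real"]
    proof eventually_elim
      case (elim l)
      have p: "1 + \<epsilon>'' * l > 0" "1 + \<epsilon>'' * l + \<epsilon>' * \<epsilon>'' * l\<^sup>2 > 0" using elim assms by (auto intro!: add_pos_pos)
      have "(inverse l + \<epsilon>'') / (inverse l * inverse l + \<epsilon>'' * inverse l + \<epsilon>' * \<epsilon>'')
         = ((inverse l + \<epsilon>'') * l\<^sup>2) / ((inverse l * inverse l + \<epsilon>'' * inverse l + \<epsilon>' * \<epsilon>'') * l\<^sup>2)"
        using elim by simp
      also have "(inverse l + \<epsilon>'') * l\<^sup>2 = l * (1 + \<epsilon>'' * l)"
        using elim by (simp add: field_simps power2_eq_square)
      also have "(inverse l * inverse l + \<epsilon>'' * inverse l + \<epsilon>' * \<epsilon>'') * l\<^sup>2 = 1 + \<epsilon>'' * l + \<epsilon>' * \<epsilon>'' * l\<^sup>2"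
        using elim by (simp add: field_simps power2_eq_square)
      also have "l * (1 + \<epsilon>'' * l) / (1 + \<epsilon>'' * l + \<epsilon>' * \<epsilon>'' * l\<^sup>2) = GLB_real \<epsilon>' \<epsilon>'' l"
      proof -
        have "1 + \<epsilon>' * \<epsilon>'' * l\<^sup>2 / (1 + \<epsilon>'' * l) = (1 + \<epsilon>'' * l + \<epsilon>' * \<epsilon>'' * l\<^sup>2) / (1 + \<epsilon>'' * l)"
          using p(1) by (simp add: add_divide_distrib)
        then show ?thesis by (simp add: GLB_real_def)
      qed
      finally show ?case .
    qed
  qed
qed

lemma weak_grad_sum_AE:
  assumes "open U" "bounded U" "finite K" "\<And>j. j \<in> K \<Longrightarrow> is_weak_gradient U (u j) (weak_grad U (u j))"
  shows "AE x in lebesgue_on U. weak_grad U (\<lambda>x. \<Sum>j\<in>K. c j * u j x) x = (\<Sum>j\<in>K. c j *\<^sub>R weak_grad U (u j) x)"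
  by (rule weak_grad_AE_eq[OF assms(1,2) is_weak_gradient_sum[OF assms]])

lemma integral_inner_sum:
  fixes g :: "'b::euclidean_space \<Rightarrow> 'c::euclidean_space"
  assumes K: "finite K" and L: "\<And>j. j \<in> K \<Longrightarrow> L2 U (G j)" "L2 U g"
    and f: "L2 U f" "AE x in lebesgue_on U. f x = (\<Sum>j\<in>K. c j *\<^sub>R G j x)"
  shows "(LINT x|lebesgue_on U. f x \<bullet> g x) = (\<Sum>j\<in>K. c j * (LINT x|lebesgue_on U. G j x \<bullet> g x))"
proof -
  have Ls: "L2 U (\<lambda>x. \<Sum>j\<in>K. c j *\<^sub>R G j x)" by (intro L2_sum K L2_scaleR L)
  have "(LINT x|lebesgue_on U. f x \<bullet> g x) = (LINT x|lebesgue_on U. (\<Sum>j\<in>K. c j *\<^sub>R G j x) \<bullet> g x)"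
    by (rule integral_cong_AE) (use f L(2) Ls in \<open>auto simp: L2_def\<close>)
  also have "\<dots> = (LINT x|lebesgue_on U. (\<Sum>j\<in>K. c j * (G j x \<bullet> g x)))"
    by (simp add: inner_sum_left)
  also have "\<dots> = (\<Sum>j\<in>K. c j * (LINT x|lebesgue_on U. G j x \<bullet> g x))"
    using L2_integrable_inner[OF L] by (subst Bochner_Integration.integral_sum) auto
  finally show ?thesis .
qed

section \<open>Finite dimension of the discrete space and linearity of the energies\<close>

context discretization
begin

text \<open>Up to a null set, a discrete function is given by n + 2 numbers per simplex: the
  components of a gradient, a constant and a bubble coefficient. More functions than such numbers
  admit a nontrivial combination with all of them 0.\<close>

lemma ae_dim_eCR_finite: "ae_dim \<Omega> (eCR \<Omega> \<T>) \<noteq> \<infinity>"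
proof -
  \<comment> \<open>For each simplex, \<open>None\<close> stands for the constant,
    \<open>Some None\<close> for the bubble coefficient and \<open>Some (Some b)\<close> for a
    component of the gradient.\<close>
  define Eq where "Eq = \<T> \<times> (insert None (insert (Some None) (Some ` Some ` (Basis :: 'a set))))"
  have fin: "finite Eq" using finite_\<T> by (simp add: Eq_def)
  have bound: "enat d \<le> enat (card Eq)" if u: "\<And>i. i < d \<Longrightarrow> u i \<in> eCR \<Omega> \<T>" and ind: "ae_independent \<Omega> d u" for d u
  proof (rule ccontr)
    assume "\<not> enat d \<le> enat (card Eq)"
    then have card: "card Eq < card {..<d}" by simp
    have "\<forall>i\<in>{..<d}. \<forall>T\<in>\<T>. \<exists>a e \<gamma>. \<forall>x\<in>interior T. u i x = a \<bullet> x + e + \<gamma> * full_simplex.bub (vertices T) x"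
      using eCR_local[OF u] by (metis lessThan_iff)
    then obtain a e \<gamma> where loc': "\<forall>i\<in>{..<d}. \<forall>T\<in>\<T>. \<forall>x\<in>interior T.
        u i x = a i T \<bullet> x + e i T + \<gamma> i T * full_simplex.bub (vertices T) x"
      by (simp only: bchoice_iff) blast
    then have loc: "u i x = a i T \<bullet> x + e i T + \<gamma> i T * full_simplex.bub (vertices T) x"
      if "i < d" "T \<in> \<T>" "x \<in> interior T" for i T x
      using that by simp
    define M where "M i = (\<lambda>(T, q). case q of None \<Rightarrow> e i T | Some None \<Rightarrow> \<gamma> i T | Some (Some b) \<Rightarrow> a i T \<bullet> b)" for i
    obtain c where c: "\<exists>i\<in>{..<d}. c i \<noteq> 0" "\<And>z. z \<in> Eq \<Longrightarrow> (\<Sum>i<d. c i * M i z) = 0"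
      using homogeneous_system_nontrivial[OF fin finite_lessThan card, of M] by auto
    have "(\<Sum>i<d. c i * u i x) = 0" if T: "T \<in> \<T>" and x: "x \<in> interior T" for T x
    proof -
      have z1: "(\<Sum>i<d. c i * e i T) = 0" and z2: "(\<Sum>i<d. c i * \<gamma> i T) = 0"
        using c(2)[of "(T, None)"] c(2)[of "(T, Some None)"] T by (auto simp: Eq_def M_def)
      have z3: "(\<Sum>i<d. c i *\<^sub>R a i T) = 0"
      proof (rule euclidean_eqI)
        fix b :: 'a assume b: "b \<in> Basis"
        have "(\<Sum>i<d. c i * (a i T \<bullet> b)) = 0"
          using c(2)[of "(T, Some (Some b))"] T b by (simp add: Eq_def M_def)
        then show "(\<Sum>i<d. c i *\<^sub>R a i T) \<bullet> b = 0 \<bullet> b" by (simp add: inner_sum_left)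
      qed
      have "(\<Sum>i<d. c i * u i x) = (\<Sum>i<d. (c i *\<^sub>R a i T) \<bullet> x + c i * e i T + (c i * \<gamma> i T) * full_simplex.bub (vertices T) x)"
        by (intro sum.cong refl) (simp add: loc[OF _ T x] distrib_left mult.assoc)
      also have "\<dots> = (\<Sum>i<d. c i *\<^sub>R a i T) \<bullet> x + (\<Sum>i<d. c i * e i T)
          + (\<Sum>i<d. c i * \<gamma> i T) * full_simplex.bub (vertices T) x"
        by (simp only: inner_sum_left sum_distrib_right sum.distrib)
      finally show ?thesis by (simp add: z1 z2 z3)
    qed
    then have "AE x in lebesgue_on \<Omega>. (\<Sum>i<d. c i * u i x) = 0"
      using AE_\<Omega>_interior by (auto elim!: eventually_mono)
    then show False using ind c(1) by (auto simp: ae_independent_def)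
  qed
  have "ae_dim \<Omega> (eCR \<Omega> \<T>) \<le> enat (card Eq)"
    unfolding ae_dim_def by (rule Sup_least) (use bound in blast)
  then show ?thesis by (cases "ae_dim \<Omega> (eCR \<Omega> \<T>)") auto
qed

lemma energy_commute: "energy u w = energy w u"
  by (simp add: energy_def grad_inner_def V_inner_def inner_commute mult_ac)

lemma energy_h_commute: "energy_h u w = energy_h w u"
  by (simp add: energy_h_def a_pw_def grad_inner_def V_inner_def inner_commute mult_ac)

lemma energy_sum:
  assumes K: "finite K" and u: "\<And>j. j \<in> K \<Longrightarrow> u j \<in> H10 \<Omega>" and w: "w \<in> H10 \<Omega>"
  shows "energy (\<lambda>x. \<Sum>j\<in>K. c j * u j x) w = (\<Sum>j\<in>K. c j * energy (u j) w)"
proof -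
  have v: "(\<lambda>x. \<Sum>j\<in>K. c j * u j x) \<in> H10 \<Omega>" by (rule H10_sum[OF open_\<Omega> bounded_\<Omega> K u])
  have "grad_inner \<Omega> (\<lambda>x. \<Sum>j\<in>K. c j * u j x) w = (\<Sum>j\<in>K. c j * grad_inner \<Omega> (u j) w)"
    unfolding grad_inner_def
    by (rule integral_inner_sum[OF K H10_L2(2)[OF u] H10_L2(2)[OF w] H10_L2(2)[OF v]
          weak_grad_sum_AE[OF open_\<Omega> bounded_\<Omega> K H10_weak_grad[OF u]]])
  moreover have "V_inner \<Omega> V (\<lambda>x. \<Sum>j\<in>K. c j * u j x) w = (\<Sum>j\<in>K. c j * V_inner \<Omega> V (u j) w)"
    using L2_inner_sum_left[where c = c, OF K H10_L2(1)[OF u] L2_potential[OF H10_L2(1)[OF w]]]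
    by (simp add: L2_inner_def V_inner_def mult_ac)
  ultimately show ?thesis by (simp add: energy_def sum.distrib distrib_left)
qed

lemma mean_sum:
  assumes T: "T \<in> \<T>" and K: "finite K" and u: "\<And>j. j \<in> K \<Longrightarrow> L2 \<Omega> (u j)"
  shows "mean (interior T) (\<lambda>x. \<Sum>j\<in>K. c j * u j x) = (\<Sum>j\<in>K. c j * mean (interior T) (u j))"
proof -
  have "(LINT x|lebesgue_on (interior T). (\<Sum>j\<in>K. c j * u j x)) = (\<Sum>j\<in>K. c j * (LINT x|lebesgue_on (interior T). u j x))"
    using L2_integrable[OF interior_lmeasurable[OF T] L2_interior[OF u T]]
    by (subst Bochner_Integration.integral_sum) auto
  then show ?thesis by (simp add: mean_def sum_divide_distrib)
qed

lemma mean_cong_AE: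
  assumes T: "T \<in> \<T>" and "L2 \<Omega> f" "L2 \<Omega> g" and ae: "AE x in lebesgue_on (interior T). f x = g x"
  shows "mean (interior T) f = mean (interior T) g"
proof -
  have "(LINT x|lebesgue_on (interior T). f x) = (LINT x|lebesgue_on (interior T). g x)"
    by (rule integral_cong_AE[OF _ _ ae]) (use L2_interior[OF assms(2) T] L2_interior[OF assms(3) T] in \<open>auto simp: L2_def\<close>)
  then show ?thesis by (simp add: mean_def)
qed

lemma AE_interior_from_\<Omega>:
  assumes "AE x in lebesgue_on \<Omega>. R x" "T \<in> \<T>" shows "AE x in lebesgue_on (interior T). R x"
proof -
  have "AE x in lebesgue. x \<in> \<Omega> \<longrightarrow> R x" using assms(1) \<Omega>_sets by (simp add: AE_restrict_space_iff)
  then have "AE x in lebesgue. x \<in> interior T \<longrightarrow> R x"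
    by eventually_elim (use interior_subset_\<Omega>[OF assms(2)] in blast)
  then show ?thesis by (simp add: AE_restrict_space_iff)
qed

text \<open>The expansion of \<open>w\<close> is assumed almost everywhere, as dependence in
  \<open>eCR\<close> provides it; uniqueness of weak gradients and equality of means carry it over
  to the form.\<close>

lemma energy_h_sum:
  assumes K: "finite K" and u: "\<And>j. j \<in> K \<Longrightarrow> u j \<in> eCR \<Omega> \<T>" and w: "w \<in> eCR \<Omega> \<T>" and z: "z \<in> eCR \<Omega> \<T>"
    and ae: "AE x in lebesgue_on \<Omega>. w x = (\<Sum>j\<in>K. c j * u j x)"
  shows "energy_h w z = (\<Sum>j\<in>K. c j * energy_h (u j) z)"
proof -
  have loc: "(LINT x|lebesgue_on (interior T). wg T w x \<bullet> wg T z x) + pot T * volume T * mean (interior T) w * mean (interior T) z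
      = (\<Sum>j\<in>K. c j * ((LINT x|lebesgue_on (interior T). wg T (u j) x \<bullet> wg T z x) + pot T * volume T * mean (interior T) (u j) * mean (interior T) z))"
    if T: "T \<in> \<T>" for T
  proof -
    note U = open_interior[of T] bounded_interior[OF T]
    note aeT = AE_interior_from_\<Omega>[OF ae T]
    have L: "L2 (interior T) (wg T y)" if "y \<in> eCR \<Omega> \<T>" for y
      using eCR_weak_grad[OF that T] by (simp add: is_weak_gradient_def)
    have "is_weak_gradient (interior T) (\<lambda>x. \<Sum>j\<in>K. c j * u j x) (\<lambda>x. \<Sum>j\<in>K. c j *\<^sub>R wg T (u j) x)"
      by (rule is_weak_gradient_sum[OF U K eCR_weak_grad[OF u T]])
    note ae1 = is_weak_gradient_unique[OF U eCR_weak_grad[OF w T] this aeT]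
    have "(LINT x|lebesgue_on (interior T). wg T w x \<bullet> wg T z x) = (\<Sum>j\<in>K. c j * (LINT x|lebesgue_on (interior T). wg T (u j) x \<bullet> wg T z x))"
      by (rule integral_inner_sum[where G = "\<lambda>j. wg T (u j)", OF K L[OF u] L[OF z] L[OF w] ae1])
    moreover have "mean (interior T) w = (\<Sum>j\<in>K. c j * mean (interior T) (u j))"
    proof -
      have "mean (interior T) w = mean (interior T) (\<lambda>x. \<Sum>j\<in>K. c j * u j x)"
        by (rule mean_cong_AE[OF T eCR_L2[OF w] L2_lincomb[OF K eCR_L2[OF u]] aeT])
      also have "\<dots> = (\<Sum>j\<in>K. c j * mean (interior T) (u j))" by (rule mean_sum[OF T K eCR_L2[OF u]])
      finally show ?thesis .
    qed
    ultimately show ?thesis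
      by (simp add: sum.distrib distrib_left sum_distrib_left sum_distrib_right mult_ac)
  qed
  have "energy_h w z = (\<Sum>T\<in>\<T>. \<Sum>j\<in>K. c j * ((LINT x|lebesgue_on (interior T). wg T (u j) x \<bullet> wg T z x) + pot T * volume T * mean (interior T) (u j) * mean (interior T) z))"
    unfolding energy_h_split[OF w z] by (intro sum.cong refl loc)
  also have "\<dots> = (\<Sum>j\<in>K. c j * energy_h (u j) z)"
    by (subst sum.swap) (simp add: energy_h_split[OF u z] sum_distrib_left)
  finally show ?thesis .
qed

text \<open>By the orthogonality of the interpolation, the discrete form can be evaluated at the function
  itself, which is linear; the linearity of the interpolation operator is not needed.\<close>

definition energy_test :: "('a \<Rightarrow> real) \<Rightarrow> ('a \<Rightarrow> real) \<Rightarrow> real" where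
  "energy_test z v = (\<Sum>T\<in>\<T>. (LINT x|lebesgue_on (interior T). weak_grad \<Omega> v x \<bullet> wg T z x)
      + pot T * volume T * mean (interior T) v * mean (interior T) z)"

lemma energy_test_eq:
  assumes z: "z \<in> eCR \<Omega> \<T>" and v: "v \<in> H10 \<Omega>" shows "energy_test z v = energy_h (II v) z"
  unfolding energy_test_def energy_h_split[OF I_eCR_in_eCR z]
proof (intro sum.cong refl)
  fix T assume T: "T \<in> \<T>"
  have L: "L2 (interior T) (weak_grad \<Omega> v)" "L2 (interior T) (wg T (II v))" "L2 (interior T) (wg T z)"
    using L2_subset[OF H10_L2(2)[OF v] interior_subset_\<Omega>[OF T] _ \<Omega>_sets] eCR_weak_grad[OF I_eCR_in_eCR T] eCR_weak_grad[OF z T]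
    by (auto simp: is_weak_gradient_def)
  have "(LINT x|lebesgue_on (interior T). weak_grad \<Omega> v x \<bullet> wg T z x) - (LINT x|lebesgue_on (interior T). wg T (II v) x \<bullet> wg T z x)
     = (LINT x|lebesgue_on (interior T). (weak_grad \<Omega> v x - wg T (II v) x) \<bullet> wg T z x)"
    using L2_integrable_inner[OF L(1,3)] L2_integrable_inner[OF L(2,3)] by (simp add: inner_diff_left)
  also have "\<dots> = 0" by (rule interpolation_local(3)[OF v T z])
  finally show "(LINT x|lebesgue_on (interior T). weak_grad \<Omega> v x \<bullet> wg T z x) + pot T * volume T * mean (interior T) v * mean (interior T) z
      = (LINT x|lebesgue_on (interior T). wg T (II v) x \<bullet> wg T z x) + pot T * volume T * mean (interior T) (II v) * mean (interior T) z"
    by (simp add: interpolation_estimates(1)[OF v T])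
qed

lemma energy_test_sum:
  assumes z: "z \<in> eCR \<Omega> \<T>" and K: "finite K" and u: "\<And>j. j \<in> K \<Longrightarrow> u j \<in> H10 \<Omega>"
  shows "energy_test z (\<lambda>x. \<Sum>j\<in>K. c j * u j x) = (\<Sum>j\<in>K. c j * energy_test z (u j))"
proof -
  have v: "(\<lambda>x. \<Sum>j\<in>K. c j * u j x) \<in> H10 \<Omega>" by (rule H10_sum[OF open_\<Omega> bounded_\<Omega> K u])
  have "energy_test z (\<lambda>x. \<Sum>j\<in>K. c j * u j x) = (\<Sum>T\<in>\<T>. \<Sum>j\<in>K. c j * ((LINT x|lebesgue_on (interior T). weak_grad \<Omega> (u j) x \<bullet> wg T z x)
      + pot T * volume T * mean (interior T) (u j) * mean (interior T) z))"
    unfolding energy_test_def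
  proof (intro sum.cong refl)
    fix T assume T: "T \<in> \<T>"
    have L: "L2 (interior T) (weak_grad \<Omega> y)" if "y \<in> H10 \<Omega>" for y
      using L2_subset[OF H10_L2(2)[OF that] interior_subset_\<Omega>[OF T] _ \<Omega>_sets] by simp
    have Lz: "L2 (interior T) (wg T z)" using eCR_weak_grad[OF z T] by (simp add: is_weak_gradient_def)
    have "(LINT x|lebesgue_on (interior T). weak_grad \<Omega> (\<lambda>x. \<Sum>j\<in>K. c j * u j x) x \<bullet> wg T z x)
       = (\<Sum>j\<in>K. c j * (LINT x|lebesgue_on (interior T). weak_grad \<Omega> (u j) x \<bullet> wg T z x))"
      by (rule integral_inner_sum[OF K L[OF u] Lz L[OF v]
            AE_interior_from_\<Omega>[OF weak_grad_sum_AE[OF open_\<Omega> bounded_\<Omega> K H10_weak_grad[OF u]] T]])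
    moreover have "mean (interior T) (\<lambda>x. \<Sum>j\<in>K. c j * u j x) = (\<Sum>j\<in>K. c j * mean (interior T) (u j))"
      by (rule mean_sum[OF T K H10_L2(1)[OF u]])
    ultimately show "(LINT x|lebesgue_on (interior T). weak_grad \<Omega> (\<lambda>x. \<Sum>j\<in>K. c j * u j x) x \<bullet> wg T z x)
          + pot T * volume T * mean (interior T) (\<lambda>x. \<Sum>j\<in>K. c j * u j x) * mean (interior T) z
       = (\<Sum>j\<in>K. c j * ((LINT x|lebesgue_on (interior T). weak_grad \<Omega> (u j) x \<bullet> wg T z x)
      + pot T * volume T * mean (interior T) (u j) * mean (interior T) z))"
      by (simp add: sum.distrib distrib_left sum_distrib_left sum_distrib_right mult_ac)
  qed
  also have "\<dots> = (\<Sum>j\<in>K. c j * energy_test z (u j))"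
    by (subst sum.swap) (simp add: energy_test_def sum_distrib_left)
  finally show ?thesis .
qed

section \<open>Comparison of the exact and the discrete eigenvalues\<close>

lemma exact_eigenspaceD:
  assumes "u \<in> exact_eigenspace \<Omega> V \<mu>"
  shows "u \<in> H10 \<Omega>" "w \<in> H10 \<Omega> \<Longrightarrow> energy u w = \<mu> * L2_inner \<Omega> u w"
  using assms by (auto simp: exact_eigenspace_def energy_def)

lemma mCR_eigenspaceD:
  assumes "u \<in> mCR_eigenspace \<Omega> \<T> V \<mu>"
  shows "u \<in> eCR \<Omega> \<T>" "w \<in> eCR \<Omega> \<T> \<Longrightarrow> energy_h u w = \<mu> * L2_inner \<Omega> u w"
  using assms by (auto simp: mCR_eigenspace_def energy_h_def)

lemma GLB_le_eigenvalue:
  assumes exact: "exact_eigenvalues \<Omega> V lam" and mCR: "mCR_eigenvalues \<Omega> \<T> V lam_mCR" and k: "k \<ge> 1"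
  shows "GLB \<epsilon>' \<epsilon>'' (lam_mCR k) \<le> lam k"
proof -
  obtain u where u': "\<forall>j\<in>{1..}. u j \<in> exact_eigenspace \<Omega> V (lam j)"
    and u_ind': "\<forall>K c \<mu>. finite K \<longrightarrow> K \<subseteq> {1..} \<longrightarrow> (\<forall>j\<in>K. lam j = \<mu>) \<longrightarrow>
       (AE x in lebesgue_on \<Omega>. (\<Sum>j\<in>K. c j * u j x) = 0) \<longrightarrow> (\<forall>j\<in>K. c j = 0)"
    using eigenfunctions_exist[OF exact[unfolded exact_eigenvalues_def]] by blast
  have u: "u j \<in> exact_eigenspace \<Omega> V (lam j)" if "j \<in> {1..}" for j using u' that by blast
  have u_ind: "\<forall>j\<in>K. c j = 0" if "K \<subseteq> {1..k}" "\<And>j. j \<in> K \<Longrightarrow> lam j = \<mu>"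
    "AE x in lebesgue_on \<Omega>. (\<Sum>j\<in>K. c j * u j x) = 0" for K c \<mu>
  proof -
    have "finite K" "K \<subseteq> {1..}" using that(1) finite_subset by auto
    then show ?thesis using u_ind'[rule_format, of K \<mu> c] that by blast
  qed
  have lam_mono: "lam i \<le> lam k" if "1 \<le> i" "i \<le> k" for i
    using exact that mono_onD[of "{1..}" lam i k] by (simp add: exact_eigenvalues_def eigenvalue_enumeration_def)
  have lam_pos: "lam k > 0" using exact k by (simp add: exact_eigenvalues_def eigenvalue_enumeration_def)
  obtain N where N: "ae_dim \<Omega> (eCR \<Omega> \<T>) = enat N" using ae_dim_eCR_finite by auto
  obtain l where l: "eigenvalue_enumeration \<Omega> (mCR_eigenspace \<Omega> \<T> V) {1..N} l"
    and lam_mCR: "lam_mCR k = (if k \<le> N then ereal (l k) else \<infinity>)"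
  proof -
    have "{i. 1 \<le> i \<and> enat i \<le> enat N} = {1..N}" by auto
    then show ?thesis using mCR k that unfolding mCR_eigenvalues_def N by auto
  qed
  obtain \<phi> where \<phi>': "\<forall>j\<in>{1..N}. \<phi> j \<in> mCR_eigenspace \<Omega> \<T> V (l j)"
    and \<phi>_ind': "\<forall>K c \<mu>. finite K \<longrightarrow> K \<subseteq> {1..N} \<longrightarrow> (\<forall>j\<in>K. l j = \<mu>) \<longrightarrow>
       (AE x in lebesgue_on \<Omega>. (\<Sum>j\<in>K. c j * \<phi> j x) = 0) \<longrightarrow> (\<forall>j\<in>K. c j = 0)"
    using eigenfunctions_exist[OF l] by blast
  have \<phi>: "\<phi> j \<in> mCR_eigenspace \<Omega> \<T> V (l j)" if "j \<in> {1..N}" for j using \<phi>' that by blast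
  have \<phi>_ind: "\<forall>j\<in>K. c j = 0" if "K \<subseteq> {1..N}" "\<And>j. j \<in> K \<Longrightarrow> l j = \<mu>"
    "AE x in lebesgue_on \<Omega>. (\<Sum>j\<in>K. c j * \<phi> j x) = 0" for K c \<mu>
  proof -
    have "finite K" using that(1) finite_subset by auto
    then show ?thesis using \<phi>_ind'[rule_format, of K \<mu> c] that by blast
  qed
  have l_pos: "l j > 0" if "j \<in> {1..N}" for j using l that by (simp add: eigenvalue_enumeration_def)
  have l_mono: "l i \<le> l j" if "i \<in> {1..N}" "j \<in> {1..N}" "i \<le> j" for i j
    using l that mono_onD[of "{1..N}" l i j] by (simp add: eigenvalue_enumeration_def)
  have \<phi>e: "\<phi> j \<in> eCR \<Omega> \<T>" and \<phi>L: "L2 \<Omega> (\<phi> j)" if "j \<in> {1..N}" for j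
    using mCR_eigenspaceD(1)[OF \<phi>[OF that]] eCR_L2 by auto
  have uH: "u j \<in> H10 \<Omega>" and uL: "L2 \<Omega> (u j)" if "j \<in> {1..k}" for j
    using exact_eigenspaceD(1)[OF u, of j] H10_L2(1)[of "u j"] that by auto
  have u_orth: "L2_inner \<Omega> (u i) (u j) = 0" if "i \<in> {1..k}" "j \<in> {1..k}" "lam i \<noteq> lam j" for i j
    using exact_eigenspaceD(2)[OF u uH, of i j] exact_eigenspaceD(2)[OF u uH, of j i] that
      energy_commute[of "u i" "u j"] L2_inner_commute[of \<Omega> "u i" "u j"] by auto
  have \<phi>_orth: "L2_inner \<Omega> (\<phi> i) (\<phi> j) = 0" if "i \<in> {1..N}" "j \<in> {1..N}" "l i \<noteq> l j" for i j
    using mCR_eigenspaceD(2)[OF \<phi> \<phi>e, of i j] mCR_eigenspaceD(2)[OF \<phi> \<phi>e, of j i] that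
      energy_h_commute[of "\<phi> i" "\<phi> j"] L2_inner_commute[of \<Omega> "\<phi> i" "\<phi> j"] by auto
  \<comment> \<open>At most k - 1 conditions are imposed on k coefficients; when k - 1 exceeds
    \<open>N\<close>, there are only \<open>N\<close> discrete eigenfunctions.\<close>
  have "card {1..min (k - 1) N} < card {1..k}" using k by simp
  from homogeneous_system_nontrivial[OF finite_atLeastAtMost finite_atLeastAtMost this, of "\<lambda>i j. energy_test (\<phi> j) (u i)"]
  obtain c where c0: "\<exists>i\<in>{1..k}. c i \<noteq> 0"
    and c: "\<forall>j\<in>{1..min (k - 1) N}. (\<Sum>i\<in>{1..k}. c i * energy_test (\<phi> j) (u i)) = 0"
    by blast
  define v where "v = (\<lambda>x. \<Sum>j\<in>{1..k}. c j * u j x)"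
  have v: "v \<in> H10 \<Omega>" unfolding v_def by (rule H10_sum[OF open_\<Omega> bounded_\<Omega> finite_atLeastAtMost uH])
  have vL: "L2 \<Omega> v" by (rule H10_L2(1)[OF v])
  define w where "w = II v"
  have w: "w \<in> eCR \<Omega> \<T>" unfolding w_def by (rule I_eCR_in_eCR)
  have wL: "L2 \<Omega> w" by (rule eCR_L2[OF w])
  \<comment> \<open>Some coefficient is nonzero, but independence across eigenvalues is not part of
    the enumeration; it follows from orthogonality.\<close>
  have v_pos: "L2_inner \<Omega> v v > 0"
  proof (rule ccontr)
    assume "\<not> L2_inner \<Omega> v v > 0"
    then have "L2_inner \<Omega> v v = 0" using L2_inner_nonneg[of \<Omega> v] by simp
    then have ae: "AE x in lebesgue_on \<Omega>. (\<Sum>j\<in>{1..k}. c j * u j x) = 0"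
      using L2_inner_eq_0_AE[OF vL] by (simp add: v_def)
    have "c i = 0" if "i \<in> {1..k}" for i
      by (rule orthogonal_groups_independent[OF finite_atLeastAtMost uL u_orth u_ind ae that])
    then show False using c0 by blast
  qed
  have uv: "L2_inner \<Omega> (u j) v = (\<Sum>i\<in>{1..k}. c i * L2_inner \<Omega> (u i) (u j))" if "j \<in> {1..k}" for j
    unfolding L2_inner_commute[of \<Omega> "u j" v] unfolding v_def
    by (rule L2_inner_sum_left[OF finite_atLeastAtMost uL uL[OF that]])
  have upper: "energy v v \<le> lam k * L2_inner \<Omega> v v"
  proof -
    have "energy v v = (\<Sum>j\<in>{1..k}. c j * energy (u j) v)"
      by (subst (1) v_def) (rule energy_sum[OF finite_atLeastAtMost uH v])
    also have "\<dots> = (\<Sum>j\<in>{1..k}. c j * lam j * L2_inner \<Omega> (u j) v)"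
      using exact_eigenspaceD(2)[OF u v] by (intro sum.cong) auto
    finally have 1: "energy v v = (\<Sum>j\<in>{1..k}. c j * lam j * L2_inner \<Omega> (u j) v)" .
    have 2: "L2_inner \<Omega> v v = (\<Sum>j\<in>{1..k}. c j * L2_inner \<Omega> (u j) v)"
      by (subst (1) v_def) (rule L2_inner_sum_left[OF finite_atLeastAtMost uL vL])
    \<comment> \<open>The eigenvalues are negated because \<open>lam k\<close> bounds the others
      from above. No index has \<open>- lam j < - lam k\<close>, so the last premise is
      vacuous.\<close>
    have "0 \<le> (\<Sum>j\<in>{1..k}. c j * (- lam j - - lam k) * (\<Sum>i\<in>{1..k}. c i * L2_inner \<Omega> (u i) (u j)))"
    proof (rule spectral_sum_nonneg[OF finite_atLeastAtMost])
      show "L2_inner \<Omega> (u i) (u j) = 0" if "i \<in> {1..k}" "j \<in> {1..k}" "- lam i \<noteq> - lam j" for i j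
        using u_orth that by simp
      show "0 \<le> (\<Sum>j\<in>K. c j * (\<Sum>i\<in>K. c i * L2_inner \<Omega> (u i) (u j)))" if "K \<subseteq> {1..k}" for K
        using gram_nonneg[OF finite_subset[OF that finite_atLeastAtMost], of \<Omega> u c] uL that
        by (simp add: L2_inner_nonneg subset_iff)
      show "(\<Sum>i\<in>{1..k}. c i * L2_inner \<Omega> (u i) (u j)) = 0" if "j \<in> {1..k}" "- lam j < - lam k" for j
        using lam_mono[of j] that by simp
    qed
    also have "\<dots> = (\<Sum>j\<in>{1..k}. lam k * (c j * L2_inner \<Omega> (u j) v) - c j * lam j * L2_inner \<Omega> (u j) v)"
      by (intro sum.cong refl) (simp add: uv algebra_simps)
    also have "\<dots> = lam k * L2_inner \<Omega> v v - energy v v"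
      unfolding 1 2 by (simp add: sum_subtractf sum_distrib_left)
    finally show ?thesis by simp
  qed
  \<comment> \<open>The coefficients were chosen for orthogonality in energy; the discrete
    eigenvalue equation turns this into L2 orthogonality because \<open>l j\<close> is
    positive.\<close>
  have \<phi>w0: "L2_inner \<Omega> (\<phi> j) w = 0" if j: "j \<in> {1..N}" "j < k" for j
  proof -
    have "j \<in> {1..min (k - 1) N}" using j by auto
    from bspec[OF c this] have "energy_test (\<phi> j) v = 0"
      unfolding v_def by (subst energy_test_sum[OF \<phi>e[OF j(1)] finite_atLeastAtMost uH]) auto
    then have "energy_h (\<phi> j) w = 0"
      using energy_test_eq[OF \<phi>e[OF j(1)] v] by (simp add: w_def energy_h_commute)
    then show ?thesis using mCR_eigenspaceD(2)[OF \<phi>[OF j(1)] w] l_pos[OF j(1)] by simp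
  qed
  obtain d where d: "AE x in lebesgue_on \<Omega>. w x = (\<Sum>j\<in>{1..N}. d j * \<phi> j x)"
  proof -
    \<comment> \<open>One function more than the dimension. Families in
      \<open>ae_independent\<close> start at index 0, hence the shift of the eigenfunctions, which
      are numbered from 1; \<open>w\<close> sits at index \<open>N\<close>.\<close>
    define f where "f i = (if i < N then \<phi> (Suc i) else w)" for i
    have "f i \<in> eCR \<Omega> \<T>" if "i < Suc N" for i using \<phi>e w by (auto simp: f_def)
    then have "\<not> ae_independent \<Omega> (Suc N) f"
      using ae_independent_le_dim[of "Suc N" f "eCR \<Omega> \<T>" \<Omega>] N by auto
    then obtain e i0 where e: "AE x in lebesgue_on \<Omega>. (\<Sum>i<Suc N. e i * f i x) = 0" and i0: "i0 < Suc N" "e i0 \<noteq> 0"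
      by (auto simp: ae_independent_def)
    have sum: "(\<Sum>i<Suc N. e i * f i x) = (\<Sum>j\<in>{1..N}. e (j - 1) * \<phi> j x) + e N * w x" for x
    proof -
      have "(\<Sum>i<N. e i * f i x) = (\<Sum>i<N. e i * \<phi> (Suc i) x)" by (simp add: f_def)
      also have "\<dots> = (\<Sum>j\<in>{1..N}. e (j - 1) * \<phi> j x)"
        using sum.atLeast1_atMost_eq[of "\<lambda>j. e (j - 1) * \<phi> j x" N] by simp
      finally show ?thesis by (simp add: f_def)
    qed
    \<comment> \<open>Otherwise the relation would involve the discrete eigenfunctions alone, which
      are independent.\<close>
    have eN: "e N \<noteq> 0"
    proof
      assume "e N = 0"
      then have ae: "AE x in lebesgue_on \<Omega>. (\<Sum>j\<in>{1..N}. e (j - 1) * \<phi> j x) = 0" using e unfolding sum by simp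
      have "e (j - 1) = 0" if "j \<in> {1..N}" for j
        by (rule orthogonal_groups_independent[OF finite_atLeastAtMost \<phi>L \<phi>_orth \<phi>_ind ae that])
      from this[of "Suc i0"] show False using i0 \<open>e N = 0\<close> by (cases "i0 = N") auto
    qed
    show ?thesis
    proof (rule that)
      show "AE x in lebesgue_on \<Omega>. w x = (\<Sum>j\<in>{1..N}. (- e (j - 1) / e N) * \<phi> j x)"
        using e
      proof eventually_elim
        case (elim x)
        then have "w x = - (\<Sum>j\<in>{1..N}. e (j - 1) * \<phi> j x) / e N"
          unfolding sum using eN by (simp add: field_simps)
        then show ?case by (simp add: sum_divide_distrib sum_negf)
      qed
    qed
  qed
  have sL: "L2 \<Omega> (\<lambda>x. \<Sum>j\<in>{1..N}. d j * \<phi> j x)" by (rule L2_lincomb[OF finite_atLeastAtMost \<phi>L])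
  have \<phi>w: "L2_inner \<Omega> (\<phi> j) w = (\<Sum>i\<in>{1..N}. d i * L2_inner \<Omega> (\<phi> i) (\<phi> j))" if j: "j \<in> {1..N}" for j
    unfolding L2_inner_commute[of \<Omega> "\<phi> j" w] L2_inner_cong_AE[OF wL sL \<phi>L[OF j] d]
    by (rule L2_inner_sum_left[OF finite_atLeastAtMost \<phi>L \<phi>L[OF j]])
  have ww: "L2_inner \<Omega> w w = (\<Sum>j\<in>{1..N}. d j * L2_inner \<Omega> (\<phi> j) w)"
    unfolding L2_inner_cong_AE[OF wL sL wL d] by (rule L2_inner_sum_left[OF finite_atLeastAtMost \<phi>L wL])
  show ?thesis
  proof (cases "k \<le> N")
    case True
    then have kN: "k \<in> {1..N}" using k by simp
    have "energy_h w w = (\<Sum>j\<in>{1..N}. d j * energy_h (\<phi> j) w)"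
      by (rule energy_h_sum[OF finite_atLeastAtMost \<phi>e w w d])
    also have "\<dots> = (\<Sum>j\<in>{1..N}. d j * l j * L2_inner \<Omega> (\<phi> j) w)"
      using mCR_eigenspaceD(2)[OF \<phi> w] by (intro sum.cong) auto
    finally have ew: "energy_h w w = (\<Sum>j\<in>{1..N}. d j * l j * L2_inner \<Omega> (\<phi> j) w)" .
    have "0 \<le> (\<Sum>j\<in>{1..N}. d j * (l j - l k) * (\<Sum>i\<in>{1..N}. d i * L2_inner \<Omega> (\<phi> i) (\<phi> j)))"
    proof (rule spectral_sum_nonneg[OF finite_atLeastAtMost \<phi>_orth])
      show "0 \<le> (\<Sum>j\<in>K. d j * (\<Sum>i\<in>K. d i * L2_inner \<Omega> (\<phi> i) (\<phi> j)))" if "K \<subseteq> {1..N}" for K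
        using gram_nonneg[OF finite_subset[OF that finite_atLeastAtMost], of \<Omega> \<phi> d] \<phi>L that
        by (simp add: L2_inner_nonneg subset_iff)
      show "(\<Sum>i\<in>{1..N}. d i * L2_inner \<Omega> (\<phi> i) (\<phi> j)) = 0" if j: "j \<in> {1..N}" "l j < l k" for j
      proof -
        \<comment> \<open>An eigenvalue strictly below \<open>l k\<close> belongs to a position
          before \<open>k\<close>, where \<open>w\<close> is orthogonal to the eigenfunction by the
          choice of the coefficients.\<close>
        have "j < k" using l_mono[OF kN j(1)] j(2) by (meson not_le)
        then show ?thesis using \<phi>w0[OF j(1)] \<phi>w[OF j(1)] by simp
      qed
    qed
    also have "\<dots> = (\<Sum>j\<in>{1..N}. d j * l j * L2_inner \<Omega> (\<phi> j) w - l k * (d j * L2_inner \<Omega> (\<phi> j) w))"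
      by (intro sum.cong refl) (simp add: \<phi>w algebra_simps)
    also have "\<dots> = energy_h w w - l k * L2_inner \<Omega> w w"
      unfolding ew ww by (simp add: sum_subtractf sum_distrib_left)
    finally have "l k * L2_inner \<Omega> (II v) (II v) \<le> energy_h (II v) (II v)" by (simp add: w_def)
    from energy_lower_bound[OF v l_pos[OF kN] this]
    have main: "l k * L2_inner \<Omega> v v \<le> (1 + \<epsilon>' * \<epsilon>'' * (l k)\<^sup>2 / (1 + \<epsilon>'' * l k)) * energy v v" .
    define X where "X = 1 + \<epsilon>' * \<epsilon>'' * (l k)\<^sup>2 / (1 + \<epsilon>'' * l k)"
    have X: "X > 0" unfolding X_def using \<epsilon>_pos l_pos[OF kN]
      by (intro add_pos_pos divide_pos_pos mult_pos_pos) auto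
    have "l k * L2_inner \<Omega> v v \<le> X * (lam k * L2_inner \<Omega> v v)"
      using main upper X unfolding X_def[symmetric] by (meson mult_left_mono less_imp_le order_trans)
    then have "l k * L2_inner \<Omega> v v \<le> (X * lam k) * L2_inner \<Omega> v v" by (simp only: mult.assoc)
    then have "l k \<le> X * lam k" using v_pos by (simp only: mult_le_cancel_right_pos)
    then have "l k / X \<le> lam k" using X by (simp add: field_simps)
    then show ?thesis using True by (simp add: GLB_def lam_mCR GLB_real_def X_def)
  next
    case False
    \<comment> \<open>All discrete eigenfunctions are among the first k - 1, so \<open>w\<close> is
      orthogonal to every term of its own expansion.\<close>
    have "L2_inner \<Omega> w w = 0" unfolding ww using \<phi>w0 False by (intro sum.neutral) auto
    then have "AE x in lebesgue_on \<Omega>. II v x = 0" using L2_inner_eq_0_AE[OF wL] by (simp add: w_def)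
    from energy_lower_bound_limit[OF v this] have "L2_inner \<Omega> v v \<le> \<epsilon>' * energy v v" .
    also have "\<dots> \<le> \<epsilon>' * (lam k * L2_inner \<Omega> v v)" using upper \<epsilon>_pos by (intro mult_left_mono) auto
    finally have "1 * L2_inner \<Omega> v v \<le> (\<epsilon>' * lam k) * L2_inner \<Omega> v v" by (simp add: mult.assoc)
    then have "1 \<le> \<epsilon>' * lam k" using v_pos by (simp only: mult_le_cancel_right_pos)
    then have "1 / \<epsilon>' \<le> lam k" using \<epsilon>_pos by (simp add: field_simps)
    moreover have "Lim at_top (GLB_real \<epsilon>' \<epsilon>'') = 1 / \<epsilon>'"
      by (rule tendsto_Lim[OF _ GLB_real_tendsto]) (use \<epsilon>_pos in auto)
    ultimately show ?thesis using False by (simp add: GLB_def lam_mCR)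
  qed
qed

end

theorem theorem3p8:
  fixes \<Omega> :: "'a::euclidean_space set"
    and \<T> :: "'a set set"
    and V :: "'a \<Rightarrow> real"
    and \<kappa> C_P \<epsilon>' \<epsilon>'' :: real
    and lam :: "nat \<Rightarrow> real"
    and lam_mCR :: "nat \<Rightarrow> ereal"
    and k :: nat
  assumes "DIM('a) \<ge> 2"
    and "polyhedral_Lipschitz_domain \<Omega>"
    and "regular_triangulation \<Omega> \<T>"
    and "L_infinity \<Omega> V" and "essinf \<Omega> V = 0"
    and "V \<in> P0 \<T>"
    and "eCR_interpolation_constant \<Omega> \<T> \<kappa>"
    and "Poincare_constant \<T> C_P"
    and "\<epsilon>' = L_infinity_norm \<Omega> (\<lambda>x. C_P\<^sup>2 * (mesh_size \<T> x)\<^sup>2)"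
    and "\<epsilon>'' = L_infinity_norm \<Omega> (\<lambda>x. \<kappa>\<^sup>2 * (mesh_size \<T> x)\<^sup>2)"
    and "exact_eigenvalues \<Omega> V lam"
    and "mCR_eigenvalues \<Omega> \<T> V lam_mCR"
    and "k \<ge> 1"
  shows "GLB \<epsilon>' \<epsilon>'' (lam_mCR k) \<le> lam k"
proof -
  interpret discretization \<Omega> \<T> V \<kappa> C_P \<epsilon>' \<epsilon>''
    by unfold_locales (rule assms)+
  show ?thesis by (rule GLB_le_eigenvalue[OF assms(11-13)])
qed

end
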